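(* Let $V$ be a spectrally negative Lévy process which is not the opposite of a subordinator, with Laplace exponent $\Psi_V$, let $V^{\uparrow}$ be $V$ conditioned to stay positive (starting from $0$), and let $I(V^{\uparrow}) := \int_0^{+\infty} e^{-V^{\uparrow}(t)}\,dt$. Assume that there are a positive constant $C$ and $\alpha\in]1,2]$ such that $\Psi_V(\lambda)\sim_{\lambda\to+\infty} C\lambda^{\alpha}$. Then $$\log\left(\mathbb{P}\left(I(V^{\uparrow})\leq x\right)\right) \underset{x\to 0}{\sim} -\frac{\alpha-1}{(Cx)^{\frac{1}{\alpha-1}}}.$$
   Context: The notation $f\sim g$ means that $f/g\to 1$. A spectrally negative Lévy process is a real-valued càdlàg Lévy process $V$ with $V(0)=0$ and no positive jumps. Its Laplace exponent $\Psi_V$ is given by $\mathbb{E}[e^{\lambda V(t)}] = e^{t\Psi_V(\lambda)}$ for $t,\lambda \geq 0$. If $V$ drifts to $-\infty$ (i.e. $V(t)\to-\infty$ a.s.), $\kappa := \inf\{\lambda>0 : \Psi_V(\lambda)=0\}$; otherwise $\kappa := 0$. Write $V_x := x+V$. Scale function: $W:[0,+\infty[\to[0,+\infty[$ is the continuous increasing function with $\int_0^{+\infty} e^{-\lambda x}W(x)\,dx = 1/\Psi_V(\lambda)$ for all $\lambda>\kappa$. $V$ conditioned to stay positive: for $x>0$, $V^{\uparrow}_x$ is the Markov process started from $x$, with values in $]0,+\infty[$ and infinite lifetime, whose transition semigroup is $p^{\uparrow}_t(x,dy) := \frac{W(y)}{W(x)}\,\mathbb{P}\left(V_x(t)\in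 dy,\ \inf_{[0,t]}V_x>0\right)$. $V^{\uparrow}=V^{\uparrow}_0$ is the process started from $0$ obtained as the limit in distribution of $V^{\uparrow}_x$ as $x\to 0+$; it is a Feller process whose transition laws restricted to $]0,+\infty[$ are given by $p^{\uparrow}_t$. *)

theory Defs
  imports "HOL-Probability.Probability" "HOL-Library.Landau_Symbols"
begin

text \<open>
  Processes are functions \<open>X t \<omega>\<close> of a real time \<open>t\<close> and a sample point \<open>\<omega>\<close>; only
  times \<open>t \<ge> 0\<close> are ever constrained. Path properties are required for every sample point.
\<close>

definition cadlag :: "(real \<Rightarrow> real) \<Rightarrow> bool" where
  "cadlag f \<longleftrightarrow>
     (\<forall>t\<ge>0. (f \<longlongrightarrow> f t) (at_right t)) \<and> (\<forall>t>0. \<exists>l. (f \<longlongrightarrow> l) (at_left t))"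

definition levy_process :: "'a measure \<Rightarrow> (real \<Rightarrow> 'a \<Rightarrow> real) \<Rightarrow> bool" where
  "levy_process M V \<longleftrightarrow>
     prob_space M \<and>
     (\<forall>t\<ge>0. V t \<in> borel_measurable M) \<and>
     (\<forall>\<omega>\<in>space M. V 0 \<omega> = 0 \<and> cadlag (\<lambda>t. V t \<omega>)) \<and>
     (\<forall>(t :: nat \<Rightarrow> real) n. mono t \<and> t 0 \<ge> 0 \<longrightarrow>
        prob_space.indep_vars M (\<lambda>_. borel) (\<lambda>i \<omega>. V (t (Suc i)) \<omega> - V (t i) \<omega>) {..<n}) \<and>
     (\<forall>s\<ge>0. \<forall>t\<ge>0. distr M borel (\<lambda>\<omega>. V (s + t) \<omega> - V s \<omega>) = distr M borel (V t))"

definition no_positive_jumps :: "(real \<Rightarrow> real) \<Rightarrow> bool" where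
  "no_positive_jumps f \<longleftrightarrow> (\<forall>t>0. \<forall>l. (f \<longlongrightarrow> l) (at_left t) \<longrightarrow> f t \<le> l)"

definition spectrally_negative_levy :: "'a measure \<Rightarrow> (real \<Rightarrow> 'a \<Rightarrow> real) \<Rightarrow> bool" where
  "spectrally_negative_levy M V \<longleftrightarrow>
     levy_process M V \<and> (\<forall>\<omega>\<in>space M. no_positive_jumps (\<lambda>t. V t \<omega>))"

definition subordinator :: "'a measure \<Rightarrow> (real \<Rightarrow> 'a \<Rightarrow> real) \<Rightarrow> bool" where
  "subordinator M X \<longleftrightarrow> levy_process M X \<and> (AE \<omega> in M. mono_on {0..} (\<lambda>t. X t \<omega>))"

text \<open>
  The Bochner integral of a non-integrable function is \<open>0\<close>, so the identity below also forces
  \<open>exp (\<lambda> V(t))\<close> to be integrable. Values of \<open>\<Psi>\<close> at negative arguments are irrelevant.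
\<close>

definition laplace_exponent :: "'a measure \<Rightarrow> (real \<Rightarrow> 'a \<Rightarrow> real) \<Rightarrow> (real \<Rightarrow> real) \<Rightarrow> bool" where
  "laplace_exponent M V \<Psi> \<longleftrightarrow>
     (\<forall>t\<ge>0. \<forall>l\<ge>0. (\<integral>\<omega>. exp (l * V t \<omega>) \<partial>M) = exp (t * \<Psi> l))"

definition drifts_to_minus_infinity :: "'a measure \<Rightarrow> (real \<Rightarrow> 'a \<Rightarrow> real) \<Rightarrow> bool" where
  "drifts_to_minus_infinity M V \<longleftrightarrow> (AE \<omega> in M. filterlim (\<lambda>t. V t \<omega>) at_bot at_top)"

definition kappa :: "'a measure \<Rightarrow> (real \<Rightarrow> 'a \<Rightarrow> real) \<Rightarrow> (real \<Rightarrow> real) \<Rightarrow> real" where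
  "kappa M V \<Psi> = (if drifts_to_minus_infinity M V then Inf {l. l > 0 \<and> \<Psi> l = 0} else 0)"

definition scale_function ::
    "'a measure \<Rightarrow> (real \<Rightarrow> 'a \<Rightarrow> real) \<Rightarrow> (real \<Rightarrow> real) \<Rightarrow> (real \<Rightarrow> real) \<Rightarrow> bool" where
  "scale_function M V \<Psi> W \<longleftrightarrow>
     continuous_on {0..} W \<and> mono_on {0..} W \<and> (\<forall>x\<ge>0. W x \<ge> 0) \<and>
     (\<forall>l > kappa M V \<Psi>.
        set_integrable lborel {0..} (\<lambda>x. exp (- l * x) * W x) \<and>
        (LINT x:{0..}|lborel. exp (- l * x) * W x) = 1 / \<Psi> l)"

text \<open>
  \<open>up_kernel M V W t x\<close> is, for \<open>x > 0\<close>, the transition law \<open>p\<^sup>\<up>\<^sub>t(x, dy)\<close> of \<open>V\<close> conditioned to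
  stay positive, viewed as a measure on the whole line. The inner measure, the law of \<open>x + V t\<close>
  on the event that \<open>x + V\<close> has positive infimum over \<open>[0, t]\<close>, is concentrated on the positive
  half-line. The indicator therefore changes nothing except that the unspecified
  values of \<open>W\<close> at negative arguments do not enter.
\<close>

definition up_kernel ::
    "'a measure \<Rightarrow> (real \<Rightarrow> 'a \<Rightarrow> real) \<Rightarrow> (real \<Rightarrow> real) \<Rightarrow> real \<Rightarrow> real \<Rightarrow> real measure" where
  "up_kernel M V W t x =
     density
       (distr (restrict_space M {\<omega> \<in> space M. (INF s\<in>{0..t}. x + V s \<omega>) > 0}) borel
          (\<lambda>\<omega>. x + V t \<omega>))
       (\<lambda>y. ennreal (W y / W x) * indicator {0<..} y)"

text \<open>Only the space and the measurable sets of this measure matter: it is a sub-\<open>\<sigma>\<close>-algebra.\<close>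

definition natural_filtration :: "'a measure \<Rightarrow> (real \<Rightarrow> 'a \<Rightarrow> real) \<Rightarrow> real \<Rightarrow> 'a measure" where
  "natural_filtration N X s =
     sigma (space N) {X r -` A \<inter> space N | r A. 0 \<le> r \<and> r \<le> s \<and> A \<in> sets borel}"

text \<open>
  Markov property with respect to the natural filtration, for a process with values in \<open>E\<close>
  (and infinite lifetime): \<open>P(X(s+t) \<in> A | F\<^sub>s) = P\<^sub>t(X(s), A)\<close> almost surely.
\<close>

definition markov_process ::
    "'a measure \<Rightarrow> real set \<Rightarrow> (real \<Rightarrow> real \<Rightarrow> real measure) \<Rightarrow> (real \<Rightarrow> 'a \<Rightarrow> real) \<Rightarrow> bool" where
  "markov_process N E P X \<longleftrightarrow>
     prob_space N \<and>
     (\<forall>t\<ge>0. X t \<in> measurable N (restrict_space borel E)) \<and>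
     (\<forall>s\<ge>0. \<forall>t\<ge>0. \<forall>A\<in>sets borel. A \<subseteq> E \<longrightarrow>
        (AE \<omega> in N. real_cond_exp N (natural_filtration N X s)
                      (indicator (X (s + t) -` A \<inter> space N)) \<omega> = measure (P t (X s \<omega>)) A))"

definition C0_halfline :: "(real \<Rightarrow> real) set" where
  "C0_halfline = {f. continuous_on {0..} f \<and> (f \<longlongrightarrow> 0) at_top}"

definition feller_semigroup :: "(real \<Rightarrow> real \<Rightarrow> real measure) \<Rightarrow> bool" where
  "feller_semigroup Q \<longleftrightarrow>
     (\<forall>t\<ge>0. Q t \<in> measurable (restrict_space borel {0..}) (prob_algebra (restrict_space borel {0..}))) \<and>
     (\<forall>x\<ge>0. Q 0 x = return (restrict_space borel {0..}) x) \<and>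
     (\<forall>s\<ge>0. \<forall>t\<ge>0. \<forall>x\<ge>0. Q (s + t) x = Q s x \<bind> Q t) \<and>
     (\<forall>f\<in>C0_halfline.
        (\<forall>t\<ge>0. (\<lambda>x. \<integral>y. f y \<partial>Q t x) \<in> C0_halfline) \<and>
        uniform_limit {0..} (\<lambda>t x. \<integral>y. f y \<partial>Q t x) f (at_right 0))"

definition feller_process ::
    "'a measure \<Rightarrow> (real \<Rightarrow> real \<Rightarrow> real measure) \<Rightarrow> (real \<Rightarrow> 'a \<Rightarrow> real) \<Rightarrow> bool" where
  "feller_process N Q U \<longleftrightarrow>
     feller_semigroup Q \<and> markov_process N {0..} Q U \<and> (\<forall>\<omega>\<in>space N. cadlag (\<lambda>t. U t \<omega>))"

text \<open>\<open>X\<close> is a version of \<open>V\<^sup>\<up>\<^sub>x\<close>, for a starting point \<open>x > 0\<close>.\<close>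

definition conditioned_positive_from ::
    "'a measure \<Rightarrow> (real \<Rightarrow> 'a \<Rightarrow> real) \<Rightarrow> (real \<Rightarrow> real) \<Rightarrow> real \<Rightarrow>
     'b measure \<Rightarrow> (real \<Rightarrow> 'b \<Rightarrow> real) \<Rightarrow> bool" where
  "conditioned_positive_from M V W x N X \<longleftrightarrow>
     markov_process N {0<..} (up_kernel M V W) X \<and> (AE \<omega> in N. X 0 \<omega> = x)"

text \<open>
  Convergence in distribution, as \<open>x \<rightarrow> 0+\<close>, of a family of processes in the sense of
  finite-dimensional distributions: weak convergence of \<open>(X\<^sub>x(t))\<^sub>t\<^sub>\<in>\<^sub>J\<close> to \<open>(U(t))\<^sub>t\<^sub>\<in>\<^sub>J\<close> for each
  finite set \<open>J\<close> of times, tested against bounded continuous functions on \<open>\<real>\<^sup>J\<close>.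
\<close>

definition fdd_limit_at_0 ::
    "(real \<Rightarrow> 'b measure) \<Rightarrow> (real \<Rightarrow> real \<Rightarrow> 'b \<Rightarrow> real) \<Rightarrow>
     'c measure \<Rightarrow> (real \<Rightarrow> 'c \<Rightarrow> real) \<Rightarrow> bool" where
  "fdd_limit_at_0 N X N0 U \<longleftrightarrow>
     (\<forall>J f. finite J \<and> J \<subseteq> {0..} \<and>
        continuous_map (product_topology (\<lambda>_. euclideanreal) J) euclideanreal f \<and>
        bounded (f ` (\<Pi>\<^sub>E t\<in>J. UNIV)) \<longrightarrow>
        ((\<lambda>x. \<integral>\<omega>. f (\<lambda>t\<in>J. X x t \<omega>) \<partial>N x) \<longlongrightarrow> (\<integral>\<omega>. f (\<lambda>t\<in>J. U t \<omega>) \<partial>N0)) (at_right 0))"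

text \<open>
  \<open>U\<close> is a version of \<open>V\<^sup>\<up> = V\<^sup>\<up>\<^sub>0\<close>. The family \<open>X\<close> (on the probability spaces \<open>N x\<close>) consists of
  versions of the processes \<open>V\<^sup>\<up>\<^sub>x\<close>, \<open>x > 0\<close>.
\<close>

definition conditioned_positive ::
    "'a measure \<Rightarrow> (real \<Rightarrow> 'a \<Rightarrow> real) \<Rightarrow> (real \<Rightarrow> real) \<Rightarrow>
     (real \<Rightarrow> 'b measure) \<Rightarrow> (real \<Rightarrow> real \<Rightarrow> 'b \<Rightarrow> real) \<Rightarrow>
     'c measure \<Rightarrow> (real \<Rightarrow> 'c \<Rightarrow> real) \<Rightarrow> bool" where
  "conditioned_positive M V W N X N0 U \<longleftrightarrow>
     (\<forall>x>0. conditioned_positive_from M V W x (N x) (X x)) \<and>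
     fdd_limit_at_0 N X N0 U \<and>
     (AE \<omega> in N0. U 0 \<omega> = 0) \<and>
     (\<exists>Q. feller_process N0 Q U \<and>
          (\<forall>t\<ge>0. \<forall>x>0. \<forall>A\<in>sets borel. A \<subseteq> {0<..} \<longrightarrow>
             emeasure (Q t x) A = emeasure (up_kernel M V W t x) A))"

definition exp_functional :: "(real \<Rightarrow> 'c \<Rightarrow> real) \<Rightarrow> 'c \<Rightarrow> ennreal" where
  "exp_functional U \<omega> = (\<integral>\<^sup>+t\<in>{0..}. ennreal (exp (- U t \<omega>)) \<partial>lborel)"

end

theory Submission
  imports Defs "HOL-Complex_Analysis.Cauchy_Integral_Formula"
begin

text \<open>
  Let \<open>W\<close> be the scale function and let \<open>ww = (\<Sum>n. lam^n * W\<^sub>n)\<close> with \<open>W\<^sub>0 = W\<close> and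
  \<open>W\<^sub>n\<^sub>+\<^sub>1 = W \<star> (exp (- \<cdot>) * W\<^sub>n)\<close>. A Dynkin formula for \<open>V\<close> killed below \<open>0\<close> shows that \<open>g = ww / W\<close> is
  annihilated by \<open>A - lam * exp (- x)\<close>, where \<open>A\<close> generates \<open>V\<close> conditioned to stay positive, and \<open>g 0 = 1\<close>.
  Feynman-Kac then gives \<open>E (exp (- lam * (\<integral>\<^sub>0\<^sup>t exp (- U s) ds)) * g (U t)) = 1\<close>; letting \<open>t\<close> tend to infinity,
  \<open>E (exp (- lam * I))\<close> equals \<open>1 / g \<infinity>\<close> up to bounded factors. As \<open>W\<close> grows at most and at least exponentially,
  \<open>g \<infinity>\<close> is comparable to \<open>\<Sum>n. lam^n / (\<Prod>j<n. \<Psi> (l + 1 + j))\<close> for suitable \<open>l\<close>, whose logarithm is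
  asymptotic to \<open>\<alpha> * (lam / C) powr (1 / \<alpha>)\<close> whatever \<open>l\<close> is. An exponential tilting argument turns this into the
  small-value asymptotics of \<open>I\<close>.
\<close>

section \<open>Growth of a generalized exponential series\<close>

text \<open>Apart from the definition of \<open>W\<close>, one fact drives the proof: the kernels of
  the conditioned process have mass one, so \<open>W\<close> is invariant for \<open>V\<close>
  killed below 0. Invariance over a unit of time, together with monotonicity, yields exponential
  bounds on \<open>W\<close> from both sides, with rates \<open>k\<close> and \<open>K\<close> that
  may differ. They bracket \<open>g\<close> far out between multiples of the series at
  \<open>K\<close> and at \<open>k\<close>, and both series have the same logarithmic growth. The
  rate \<open>k\<close> must satisfy \<open>k + 1 > \<kappa>\<close>, since the first factor of its
  series is \<open>\<Psi> (k + 1)\<close>; when \<open>\<kappa> \<ge> 1\<close>, such a rate with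
  \<open>\<Psi> k < 0\<close> comes from the study of the sign of \<open>\<Psi>\<close> under drift
  to minus infinity. The obstacle in Dynkin's formula is that independence of increments concerns
  discrete times, whereas killing is by an infimum over an interval. The formula is therefore first
  proved without killing, by uniqueness of Laplace transforms, and then carried to grids, to dyadic
  times and to the infimum. The Feller property gives access to the starting point 0, where no
  density of the kernel is known.\<close>

lemma prod_le_const_prod:
  fixes a b :: "nat \<Rightarrow> real"
  assumes "\<And>k. a k > 0" "\<And>k. b k > 0" "eventually (\<lambda>k. a k \<le> b k) sequentially"
  obtains c where "c > 0" "\<And>n. (\<Prod>k<n. a k) \<le> c * (\<Prod>k<n. b k)"
proof -
  obtain k0 where k0: "\<And>k. k \<ge> k0 \<Longrightarrow> a k \<le> b k"
    using assms(3) by (auto simp: eventually_sequentially)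
  \<comment> \<open>With factors at least 1 the partial products increase, so the product over the
    exceptional indices below \<open>k0\<close> bounds all of them.\<close>
  define r where "r k = max 1 (a k / b k)" for k
  have r1: "r k \<ge> 1" for k by (simp add: r_def)
  have eqn: "(\<Prod>k<n. a k) = (\<Prod>k<n. a k / b k) * (\<Prod>k<n. b k)" for n
  proof -
    have "(\<Prod>k<n. a k) = (\<Prod>k<n. (a k / b k) * b k)"
      by (intro prod.cong) (use assms(2) in \<open>simp_all add: less_imp_neq[symmetric]\<close>)
    then show ?thesis by (simp only: prod.distrib)
  qed
  have bd: "(\<Prod>k<n. a k / b k) \<le> (\<Prod>k<k0. r k)" for n
  proof -
    have "(\<Prod>k<n. a k / b k) \<le> (\<Prod>k<n. if k < k0 then r k else 1)"
      using assms(1,2) k0 by (intro prod_mono) (auto simp: r_def less_imp_le not_less)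
    also have "\<dots> \<le> (\<Prod>k<max n k0. if k < k0 then r k else 1)"
      using r1 by (intro prod_mono2) (auto intro: order_trans[OF zero_le_one])
    also have "\<dots> = (\<Prod>k<k0. r k)"
      by (intro prod.mono_neutral_cong_right) auto
    finally show ?thesis .
  qed
  have "(\<Prod>k<k0. r k) > 0" using r1 by (intro prod_pos) (auto intro: less_le_trans[OF zero_less_one])
  moreover have "(\<Prod>k<n. a k) \<le> (\<Prod>k<k0. r k) * (\<Prod>k<n. b k)" for n
    unfolding eqn using assms(2) by (intro mult_right_mono bd prod_nonneg) (auto simp: less_imp_le)
  ultimately show ?thesis using that by blast
qed

lemma prod_powr_fact:
  "(\<Prod>k<n. D * real (Suc k) powr \<alpha>) = D ^ n * fact n powr \<alpha>"
proof (induction n)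
  case (Suc n)
  have "(\<Prod>k<Suc n. D * real (Suc k) powr \<alpha>) = D ^ n * fact n powr \<alpha> * (D * real (Suc n) powr \<alpha>)"
    using Suc by simp
  also have "\<dots> = D ^ Suc n * (fact n * real (Suc n)) powr \<alpha>"
    by (subst powr_mult) (auto simp: mult_ac)
  finally show ?case by (simp add: mult.commute)
qed simp

text \<open>Each term of the exponential series is at most its sum \<open>exp z\<close>, so raising
  it to the power \<alpha> costs at most a factor \<open>exp z powr (\<alpha> - 1)\<close>.\<close>

lemma exp_powr_sums:
  fixes z \<alpha> :: real
  assumes "z \<ge> 0" "\<alpha> \<ge> 1"
  shows "summable (\<lambda>n. (z ^ n / fact n) powr \<alpha>)"
    and "(\<Sum>n. (z ^ n / fact n) powr \<alpha>) \<le> exp (\<alpha> * z)"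
proof -
  have s: "(\<lambda>n. z ^ n / fact n) sums exp z"
    using exp_converges[of z] by (simp add: divide_inverse mult.commute)
  have le: "z ^ n / fact n \<le> exp z" for n
  proof -
    have "(\<Sum>k\<in>{n}. z ^ k / fact k) \<le> (\<Sum>k. z ^ k / fact k)"
      using assms s by (intro sum_le_suminf) (auto simp: sums_iff)
    then show ?thesis using s by (simp add: sums_iff)
  qed
  have bd: "(z ^ n / fact n) powr \<alpha> \<le> z ^ n / fact n * exp z powr (\<alpha> - 1)" for n
  proof -
    have "(z ^ n / fact n) powr \<alpha> = (z ^ n / fact n) powr 1 * (z ^ n / fact n) powr (\<alpha> - 1)"
      by (subst powr_add [symmetric]) simp
    also have "\<dots> \<le> z ^ n / fact n * exp z powr (\<alpha> - 1)"
      using assms by (intro mult_mono powr_mono2 le) auto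
    finally show ?thesis .
  qed
  have s2: "(\<lambda>n. z ^ n / fact n * exp z powr (\<alpha> - 1)) sums (exp z * exp z powr (\<alpha> - 1))"
    using s by (rule sums_mult2)
  show sm: "summable (\<lambda>n. (z ^ n / fact n) powr \<alpha>)"
  proof (rule summable_comparison_test'[of _ 0])
    show "summable (\<lambda>n. z ^ n / fact n * exp z powr (\<alpha> - 1))" using s2 by (rule sums_summable)
  qed (use bd in simp)
  have "(\<Sum>n. (z ^ n / fact n) powr \<alpha>) \<le> exp z * exp z powr (\<alpha> - 1)"
    using suminf_le[OF bd sm] s2 by (simp add: sums_iff)
  also have "\<dots> = exp (\<alpha> * z)"
  proof -
    have "exp z powr (\<alpha> - 1) = exp ((\<alpha> - 1) * z)" by (simp add: powr_def)
    then have "exp z * exp z powr (\<alpha> - 1) = exp (z + (\<alpha> - 1) * z)" by (simp only: exp_add)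
    then show ?thesis by (simp add: left_diff_distrib)
  qed
  finally show "(\<Sum>n. (z ^ n / fact n) powr \<alpha>) \<le> exp (\<alpha> * z)" .
qed

text \<open>If all terms were smaller, the exponential series at \<open>(1 - \<delta>) * z\<close>
  would lie strictly below a geometric series whose sum is exactly
  \<open>exp ((1 - \<delta>) * z)\<close>.\<close>

lemma exp_max_term:
  fixes z \<delta> :: real
  assumes "z \<ge> 0" "0 < \<delta>" "\<delta> < 1"
  obtains n where "z ^ n / fact n \<ge> \<delta> * exp ((1 - \<delta>) * z)"
proof -
  have "\<exists>n. z ^ n / fact n \<ge> \<delta> * exp ((1 - \<delta>) * z)"
  proof (rule ccontr)
    assume "\<not> ?thesis"
    then have lt: "z ^ n / fact n < \<delta> * exp ((1 - \<delta>) * z)" for n by (auto simp: not_le)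
    have s: "(\<lambda>n. ((1 - \<delta>) * z) ^ n / fact n) sums exp ((1 - \<delta>) * z)"
      using exp_converges[of "(1 - \<delta>) * z"] by (simp add: divide_inverse mult.commute)
    have g: "(\<lambda>n. \<delta> * exp ((1 - \<delta>) * z) * (1 - \<delta>) ^ n) sums (\<delta> * exp ((1 - \<delta>) * z) * (1 / (1 - (1 - \<delta>))))"
      using assms by (intro sums_mult geometric_sums) auto
    have le: "((1 - \<delta>) * z) ^ n / fact n < \<delta> * exp ((1 - \<delta>) * z) * (1 - \<delta>) ^ n" for n
    proof -
      have "((1 - \<delta>) * z) ^ n / fact n = (1 - \<delta>) ^ n * (z ^ n / fact n)" by (simp add: power_mult_distrib)
      also have "\<dots> < (1 - \<delta>) ^ n * (\<delta> * exp ((1 - \<delta>) * z))"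
        using assms by (intro mult_strict_left_mono lt) auto
      finally show ?thesis by (simp add: mult_ac)
    qed
    have "0 < (\<Sum>n. \<delta> * exp ((1 - \<delta>) * z) * (1 - \<delta>) ^ n - ((1 - \<delta>) * z) ^ n / fact n)"
      using le s g by (intro suminf_pos summable_diff) (auto simp: sums_iff)
    also have "\<dots> = \<delta> * exp ((1 - \<delta>) * z) * (1 / (1 - (1 - \<delta>))) - exp ((1 - \<delta>) * z)"
      using sums_diff[OF g s] by (simp add: sums_iff)
    finally show False using assms by simp
  qed
  then show ?thesis using that by blast
qed

text \<open>With \<open>a k = real (Suc k)\<close> this is the exponential function, with
  \<open>a k = real (Suc k) powr \<alpha>\<close> the function of Le Roy. It plays the role of an
  exponential function attached to the sequence \<open>a\<close>.\<close>

definition fseries :: "(nat \<Rightarrow> real) \<Rightarrow> real \<Rightarrow> real" where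
  "fseries a x = (\<Sum>n. x ^ n / (\<Prod>k<n. a k))"

lemma powr_dilate_at_top:
  fixes C \<alpha> :: real
  assumes C: "C > 0" and al: "\<alpha> \<ge> 1"
  shows "filterlim (\<lambda>x. (x / C) powr (1 / \<alpha>)) at_top at_top"
proof (rule filterlim_at_top_ge[of _ _ 0, THEN iffD2], intro allI impI)
  fix Z :: real assume Z: "Z \<ge> 0"
  show "eventually (\<lambda>x. Z \<le> (x / C) powr (1 / \<alpha>)) at_top"
    using eventually_ge_at_top[of "C * Z powr \<alpha>"]
  proof eventually_elim
    case (elim x)
    then have "Z powr \<alpha> \<le> x / C" using C by (simp add: field_simps)
    then have "(Z powr \<alpha>) powr (1 / \<alpha>) \<le> (x / C) powr (1 / \<alpha>)" using al by (intro powr_mono2) auto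
    then show ?case using al Z by (simp add: powr_powr)
  qed
qed


lemma powr_pow_swap:
  fixes x :: real assumes "x > 0" "\<alpha> > 0" "D > 0"
  shows "((x / D) powr (1 / \<alpha>)) ^ n / fact n \<ge> 0"
    "(((x / D) powr (1 / \<alpha>)) ^ n / fact n) powr \<alpha> = x ^ n / (D ^ n * fact n powr \<alpha>)"
proof -
  have p: "(((x / D) powr (1 / \<alpha>)) ^ n) powr \<alpha> = (x / D) ^ n"
    using assms by (simp add: powr_realpow[symmetric] powr_powr mult.commute)
  show "(((x / D) powr (1 / \<alpha>)) ^ n / fact n) powr \<alpha> = x ^ n / (D ^ n * fact n powr \<alpha>)"
    by (subst powr_divide) (auto simp: p power_divide)
qed auto

text \<open>Comparing \<open>\<Prod>k<n. a k\<close> with \<open>D^n * fact n powr \<alpha>\<close> turns the series into \<open>\<Sum>n. b n powr \<alpha>\<close> with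
  \<open>b n = z^n / fact n\<close>. It is at most \<open>(\<Sum>n. b n) powr \<alpha>\<close>, because \<open>\<alpha> \<ge> 1\<close>, and at least its largest term.\<close>
lemma
  fixes a :: "nat \<Rightarrow> real"
  assumes pos: "\<And>k. a k > 0" and C: "C > 0" and al: "\<alpha> \<ge> 1"
    and lim: "(\<lambda>k. a k / real (Suc k) powr \<alpha>) \<longlonglongrightarrow> C"
  shows summable_fseries: "x > 0 \<Longrightarrow> summable (\<lambda>n. x ^ n / (\<Prod>k<n. a k))"
    and fseries_upper: "\<epsilon> > 0 \<Longrightarrow>
      eventually (\<lambda>x. fseries a x \<le> exp (\<alpha> * (1 + \<epsilon>) * (x / C) powr (1 / \<alpha>))) at_top"
    and fseries_lower: "\<epsilon> > 0 \<Longrightarrow>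
      eventually (\<lambda>x. fseries a x \<ge> exp (\<alpha> * (1 - \<epsilon>) * (x / C) powr (1 / \<alpha>))) at_top"
proof -
  have ap: "(\<Prod>k<n. a k) > 0" for n using pos by (intro prod_pos) auto
  have up: "\<exists>c>0. \<forall>x>0. \<forall>n. x ^ n / (\<Prod>k<n. a k) \<le> c * (((x / D) powr (1 / \<alpha>)) ^ n / fact n) powr \<alpha>"
    if D: "0 < D" "D < C" for D
  proof -
    have "eventually (\<lambda>k. D < a k / real (Suc k) powr \<alpha>) sequentially"
      using lim D by (auto simp: order_tendsto_iff)
    then have "eventually (\<lambda>k. D * real (Suc k) powr \<alpha> \<le> a k) sequentially"
      by eventually_elim (auto simp: field_simps)
    then obtain c where c: "c > 0" "\<And>n. (\<Prod>k<n. D * real (Suc k) powr \<alpha>) \<le> c * (\<Prod>k<n. a k)"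
      using D pos by (elim prod_le_const_prod[rotated 2]) auto
    have "x ^ n / (\<Prod>k<n. a k) \<le> c * (((x / D) powr (1 / \<alpha>)) ^ n / fact n) powr \<alpha>" if "x > 0" for x n
    proof -
      have "D ^ n * fact n powr \<alpha> \<le> c * (\<Prod>k<n. a k)"
        using c(2)[of n] by (simp only: prod_powr_fact)
      then have "1 / (\<Prod>k<n. a k) \<le> c / (D ^ n * fact n powr \<alpha>)"
        using ap[of n] D by (simp add: field_simps)
      then have "x ^ n * (1 / (\<Prod>k<n. a k)) \<le> x ^ n * (c / (D ^ n * fact n powr \<alpha>))"
        using that by (intro mult_left_mono) auto
      then show ?thesis using that al D by (simp add: powr_pow_swap mult_ac)
    qed
    with c(1) show ?thesis by blast
  qed
  show sm: "summable (\<lambda>n. x ^ n / (\<Prod>k<n. a k))" if x: "x > 0" for x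
  proof -
    obtain c where c: "c > 0" "\<And>n. x ^ n / (\<Prod>k<n. a k) \<le> c * (((x / (C/2)) powr (1 / \<alpha>)) ^ n / fact n) powr \<alpha>"
      using up[of "C/2"] x C by auto
    have "summable (\<lambda>n. c * (((x / (C/2)) powr (1 / \<alpha>)) ^ n / fact n) powr \<alpha>)"
      using al by (intro summable_mult exp_powr_sums) auto
    then show ?thesis
    proof (rule summable_comparison_test'[of _ 0])
      fix n
      have "x ^ n / (\<Prod>k<n. a k) \<ge> 0" using x ap[of n] by simp
      then show "norm (x ^ n / (\<Prod>k<n. a k)) \<le> c * (((x / (C/2)) powr (1 / \<alpha>)) ^ n / fact n) powr \<alpha>"
        using c(2)[of n] by simp
    qed
  qed
  note tz = powr_dilate_at_top[OF C al]
  have dil: "(x / D) powr (1 / \<alpha>) = (C / D) powr (1 / \<alpha>) * (x / C) powr (1 / \<alpha>)" if "D > 0" "x > 0" for x D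
    using that C by (subst powr_mult [symmetric]) (auto simp: field_simps)
  show "eventually (\<lambda>x. fseries a x \<le> exp (\<alpha> * (1 + \<epsilon>) * (x / C) powr (1 / \<alpha>))) at_top" if e: "\<epsilon> > 0" for \<epsilon>
  proof -
    \<comment> \<open>Chosen so that \<open>(C / D) powr (1 / \<alpha>) = 1 + \<epsilon>/2\<close>;
      the other half of \<epsilon> absorbs the constant \<open>ln c\<close>.\<close>
    define D where "D = C / (1 + \<epsilon>/2) powr \<alpha>"
    have D0: "D > 0" using C e by (auto simp: D_def)
    have DC: "D < C"
    proof -
      have "1 < (1 + \<epsilon>/2) powr \<alpha>" using e al by (intro gr_one_powr) auto
      then have "C < C * (1 + \<epsilon>/2) powr \<alpha>" using C by simp
      then show ?thesis using e by (simp add: D_def divide_less_eq)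
    qed
    have D1: "(C / D) powr (1 / \<alpha>) = 1 + \<epsilon>/2" using C e al by (simp add: D_def powr_powr)
    obtain c where c: "c > 0" "\<And>x n. x > 0 \<Longrightarrow> x ^ n / (\<Prod>k<n. a k) \<le> c * (((x / D) powr (1 / \<alpha>)) ^ n / fact n) powr \<alpha>"
      using up[OF D0 DC] by blast
    have "eventually (\<lambda>x. (x / C) powr (1 / \<alpha>) \<ge> ln c / (\<alpha> * (\<epsilon>/2))) at_top"
      using tz by (auto simp: filterlim_at_top)
    moreover have "eventually (\<lambda>x::real. x > 0) at_top" by (rule eventually_gt_at_top)
    ultimately show ?thesis
    proof eventually_elim
      case (elim x)
      define y where "y = (x / C) powr (1 / \<alpha>)"
      have ss: "summable (\<lambda>n. (((x / D) powr (1 / \<alpha>)) ^ n / fact n) powr \<alpha>)"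
        "(\<Sum>n. (((x / D) powr (1 / \<alpha>)) ^ n / fact n) powr \<alpha>) \<le> exp (\<alpha> * (x / D) powr (1 / \<alpha>))"
        using al by (intro exp_powr_sums; simp)+
      have "fseries a x \<le> (\<Sum>n. c * (((x / D) powr (1 / \<alpha>)) ^ n / fact n) powr \<alpha>)"
        unfolding fseries_def using elim by (intro suminf_le c sm summable_mult ss) auto
      also have "\<dots> = c * (\<Sum>n. (((x / D) powr (1 / \<alpha>)) ^ n / fact n) powr \<alpha>)"
        by (rule suminf_mult[OF ss(1)])
      also have "\<dots> \<le> c * exp (\<alpha> * (x / D) powr (1 / \<alpha>))" using c ss(2) by (intro mult_left_mono) auto
      also have "\<dots> = exp (ln c + \<alpha> * ((1 + \<epsilon>/2) * y))"
        using c(1) D0 elim by (simp add: exp_add dil[of D x] D1 y_def)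
      also have "\<dots> \<le> exp (\<alpha> * (1 + \<epsilon>) * y)"
      proof -
        have "ln c \<le> \<alpha> * (\<epsilon>/2) * y" using elim(1) al e by (simp add: y_def field_simps)
        then show ?thesis by (simp add: algebra_simps)
      qed
      finally show ?case by (simp add: y_def)
    qed
  qed
  show "eventually (\<lambda>x. fseries a x \<ge> exp (\<alpha> * (1 - \<epsilon>) * (x / C) powr (1 / \<alpha>))) at_top" if e0: "\<epsilon> > 0" for \<epsilon>
  proof -
    \<comment> \<open>The lower bound weakens as \<epsilon> grows, so it suffices to treat a value
      below 1.\<close>
    define e where "e = min \<epsilon> (1/2)"
    have e: "e > 0" "e \<le> \<epsilon>" "e < 1" using e0 by (auto simp: e_def)
    \<comment> \<open>One third of \<open>e\<close> is lost in passing from \<open>C\<close> to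
      \<open>D\<close>, one in \<open>exp_max_term\<close>, and the last one absorbs
      \<open>ln c - \<alpha> * ln \<delta>\<close>.\<close>
    define \<delta> where "\<delta> = e/3"
    have d: "\<delta> > 0" "\<delta> < 1" using e by (auto simp: \<delta>_def)
    define D where "D = C / (1 - \<delta>) powr \<alpha>"
    have D0: "D > 0" using C d by (auto simp: D_def)
    have DC: "C < D"
    proof -
      have "(1 - \<delta>) powr \<alpha> < 1" using powr_less_mono2[of \<alpha> "1 - \<delta>" 1] d al by simp
      then have "C * (1 - \<delta>) powr \<alpha> < C" using C by simp
      then show ?thesis using d by (simp add: D_def less_divide_eq)
    qed
    have D1: "(C / D) powr (1 / \<alpha>) = 1 - \<delta>" using C d al by (simp add: D_def powr_powr)
    have "eventually (\<lambda>k. a k / real (Suc k) powr \<alpha> < D) sequentially"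
      using lim DC by (auto simp: order_tendsto_iff)
    then have "eventually (\<lambda>k. a k \<le> D * real (Suc k) powr \<alpha>) sequentially"
      by eventually_elim (auto simp: field_simps)
    then obtain c where c: "c > 0" "\<And>n. (\<Prod>k<n. a k) \<le> c * (\<Prod>k<n. D * real (Suc k) powr \<alpha>)"
      using D0 pos by (elim prod_le_const_prod[rotated 2]) auto
    have "eventually (\<lambda>x. (x / C) powr (1 / \<alpha>) \<ge> (ln c - \<alpha> * ln \<delta>) / (\<alpha> * \<delta>)) at_top"
      using tz by (auto simp: filterlim_at_top)
    moreover have "eventually (\<lambda>x::real. x > 0) at_top" by (rule eventually_gt_at_top)
    ultimately show ?thesis
    proof eventually_elim
      case (elim x)
      define y where "y = (x / C) powr (1 / \<alpha>)"
      define z where "z = (x / D) powr (1 / \<alpha>)"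
      have z: "z = (1 - \<delta>) * y" using dil[OF D0 elim(2)] by (simp add: z_def y_def D1)
      have y0: "y \<ge> 0" by (simp add: y_def)
      obtain n where n: "z ^ n / fact n \<ge> \<delta> * exp ((1 - \<delta>) * z)"
        using exp_max_term[of z \<delta>] d by (auto simp: z_def)
      have "exp (\<alpha> * (1 - \<epsilon>) * y) \<le> exp (\<alpha> * (1 - e) * y)"
        using al e y0 by (auto intro!: mult_right_mono)
      also have "\<dots> \<le> exp (\<alpha> * ln \<delta> - ln c + \<alpha> * ((1 - \<delta>) * z))"
      proof -
        have "ln c - \<alpha> * ln \<delta> \<le> \<alpha> * \<delta> * y" using elim(1) al d by (simp add: y_def field_simps)
        moreover have "e = 3 * \<delta>" by (simp add: \<delta>_def)
        then have "\<alpha> * ((1 - \<delta>) * z) = \<alpha> * (1 - e) * y + \<alpha> * \<delta> * y + \<alpha> * \<delta> * \<delta> * y"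
          unfolding z by (simp add: algebra_simps)
        moreover have "\<alpha> * \<delta> * \<delta> * y \<ge> 0" using al d y0 by auto
        ultimately show ?thesis by simp
      qed
      also have "\<dots> = (\<delta> * exp ((1 - \<delta>) * z)) powr \<alpha> / c"
      proof -
        have "(\<delta> * exp ((1 - \<delta>) * z)) powr \<alpha> = exp (\<alpha> * (ln \<delta> + (1 - \<delta>) * z))"
          using d by (simp add: powr_def ln_mult)
        also have "\<dots> / c = exp (\<alpha> * (ln \<delta> + (1 - \<delta>) * z) - ln c)"
          using c by (simp add: exp_diff)
        finally show ?thesis by (simp add: algebra_simps)
      qed
      also have "\<dots> \<le> (z ^ n / fact n) powr \<alpha> / c"
        using n d al c by (intro divide_right_mono powr_mono2) auto
      also have "\<dots> = x ^ n / (c * (D ^ n * fact n powr \<alpha>))"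
        using elim al D0 by (simp add: powr_pow_swap z_def field_simps)
      also have "\<dots> \<le> x ^ n / (\<Prod>k<n. a k)"
        using c(2)[of n] ap[of n] elim c(1) D0 by (intro divide_left_mono) (auto simp: prod_powr_fact simp del: of_nat_Suc)
      also have "\<dots> \<le> fseries a x"
        unfolding fseries_def using sum_le_suminf[OF sm[OF elim(2)], of "{n}"] elim ap
        by (auto simp: less_imp_le)
      finally show ?case by (simp add: y_def)
    qed
  qed
qed

section \<open>Small values from the Laplace transform\<close>

text \<open>\<open>enn2real\<close> sends infinity to 0, which would give the integrand the value 1
  there; the correct value 0 is put in by hand.\<close>

definition laplace_transform_at :: "'a measure \<Rightarrow> ('a \<Rightarrow> ennreal) \<Rightarrow> real \<Rightarrow> real" where
  "laplace_transform_at M I l = (\<integral>\<omega>. (if I \<omega> = \<infinity> then 0 else exp (- l * enn2real (I \<omega>))) \<partial>M)"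

text \<open>Obtained from \<open>exp u \<ge> 1 + u\<close> and a bound on the logarithm. In the
  tilting argument the terms of first order in \<delta> cancel, so the error has to be explicit to
  second order.\<close>

lemma powr_inverse_one_minus:
  fixes \<delta> \<alpha> :: real
  assumes "0 \<le> \<delta>" "\<delta> \<le> 1/2" "\<alpha> > 0"
  shows "\<alpha> * (1 - \<delta>) powr (1/\<alpha>) \<ge> \<alpha> - \<delta> - 2 * \<delta>\<^sup>2"
proof -
  have "- \<delta> - 2 * \<delta>\<^sup>2 \<le> ln (1 - \<delta>)" using assms by (intro ln_one_minus_pos_lower_bound) auto
  also have "\<dots> = \<alpha> * (1/\<alpha> * ln (1 - \<delta>))" using assms by simp
  also have "\<dots> \<le> \<alpha> * (exp (1/\<alpha> * ln (1 - \<delta>)) - 1)"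
    using assms exp_ge_add_one_self[of "1/\<alpha> * ln (1 - \<delta>)"] by (intro mult_left_mono) linarith+
  finally show ?thesis using assms by (simp add: powr_def algebra_simps)
qed

lemma powr_inverse_one_plus:
  fixes \<delta> \<alpha> :: real
  assumes "0 \<le> \<delta>" "\<delta> \<le> 1" "\<alpha> > 0"
  shows "\<alpha> * (1 + \<delta>) powr (1/\<alpha>) \<ge> \<alpha> + \<delta> - \<delta>\<^sup>2"
proof -
  have "\<delta> - \<delta>\<^sup>2 \<le> ln (1 + \<delta>)" using assms by (intro ln_one_plus_pos_lower_bound) auto
  also have "\<dots> = \<alpha> * (1/\<alpha> * ln (1 + \<delta>))" using assms by simp
  also have "\<dots> \<le> \<alpha> * (exp (1/\<alpha> * ln (1 + \<delta>)) - 1)"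
    using assms exp_ge_add_one_self[of "1/\<alpha> * ln (1 + \<delta>)"] by (intro mult_left_mono) linarith+
  finally show ?thesis using assms by (simp add: powr_def algebra_simps)
qed

text \<open>The assumptions \<open>up\<close> and \<open>lo\<close> say that the logarithm of the
  Laplace transform is asymptotic to \<open>- \<alpha> * (l / C) powr (1 / \<alpha>)\<close>. What
  follows is an exponential Tauberian theorem in the style of de Bruijn.\<close>

locale small_ball =
  prob_space M for M :: "'a measure" +
  fixes I :: "'a \<Rightarrow> ennreal" and C \<alpha> :: real
  assumes I_meas [measurable]: "I \<in> borel_measurable M"
    and C: "C > 0" and al: "1 < \<alpha>"
    and up: "\<And>\<epsilon>. \<epsilon> > 0 \<Longrightarrow> eventually (\<lambda>l.
       laplace_transform_at M I l \<le> exp (- (\<alpha> * (1 - \<epsilon>) * (l / C) powr (1 / \<alpha>)))) at_top"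
    and lo: "\<And>\<epsilon>. \<epsilon> > 0 \<Longrightarrow> eventually (\<lambda>l.
       laplace_transform_at M I l \<ge> exp (- (\<alpha> * (1 + \<epsilon>) * (l / C) powr (1 / \<alpha>)))) at_top"
begin

definition \<phi> where "\<phi> l \<omega> = (if I \<omega> = \<infinity> then 0 else exp (- l * enn2real (I \<omega>)))"
definition p where "p x = measure M {\<omega> \<in> space M. I \<omega> \<le> ennreal x}"

text \<open>The saddle point of \<open>l \<mapsto> l x - \<alpha> (l / C) powr (1 / \<alpha>)\<close> is \<open>l = y x / x\<close>.\<close>
definition y where "y x = (C * x) powr (- (1 / (\<alpha> - 1)))"

lemma phi_meas [measurable]: "\<phi> l \<in> borel_measurable M"
  unfolding \<phi>_def by measurable

lemma phi_bounds: "0 \<le> \<phi> l \<omega>" "l \<ge> 0 \<Longrightarrow> \<phi> l \<omega> \<le> 1"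
  by (auto simp: \<phi>_def)

lemma phi_integrable: "l \<ge> 0 \<Longrightarrow> integrable M (\<phi> l)"
  by (intro integrable_const_bound[where B = 1]) (auto simp: phi_bounds abs_of_nonneg)

lemma laplace_phi: "laplace_transform_at M I l = (\<integral>\<omega>. \<phi> l \<omega> \<partial>M)"
  by (simp add: laplace_transform_at_def \<phi>_def)

lemma y_pos: "x > 0 \<Longrightarrow> y x > 0"
  using C by (simp add: y_def)

text \<open>When \<open>l\<close> is measured in units \<open>s\<close> of the saddle point, both
  \<open>l * x\<close> and the exponent of the Laplace transform become multiples of
  \<open>y x\<close>, which is then the only scale in the estimates.\<close>

lemma saddle:
  assumes "x > 0" "s \<ge> 0"
  shows "(s * (y x / x) / C) powr (1 / \<alpha>) = s powr (1 / \<alpha>) * y x"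
proof -
  have cx: "C * x > 0" using assms C by simp
  have "y x / (C * x) = y x * (C * x) powr (- 1)" using cx by (simp add: powr_minus divide_inverse)
  also have "\<dots> = (C * x) powr (- (\<alpha> / (\<alpha> - 1)))"
    unfolding y_def powr_add [symmetric] using al by (intro arg_cong2[where f = "(powr)"]) (auto simp: field_simps)
  also have "\<dots> = y x powr \<alpha>" using al by (simp add: y_def powr_powr)
  finally have "s * (y x / x) / C = s * y x powr \<alpha>" using C assms by (simp add: field_simps)
  then show ?thesis using assms al y_pos[of x] by (simp add: powr_mult powr_powr)
qed

lemma y_at_top: "eventually (\<lambda>x. y x \<ge> Z) (at_right 0)"
proof -
  define Z' where "Z' = max Z 1"
  have "eventually (\<lambda>x. x \<in> {0 <..< Z' powr (1 - \<alpha>) / C}) (at_right 0)"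
    using C by (intro eventually_at_right_real) (auto simp: Z'_def)
  then show ?thesis
  proof eventually_elim
    case (elim x)
    then have "C * x \<le> Z' powr (1 - \<alpha>)" using C by (auto simp: field_simps)
    then have "(Z' powr (1 - \<alpha>)) powr (- (1 / (\<alpha> - 1))) \<le> y x"
      unfolding y_def using C elim al by (intro powr_mono2') auto
    moreover have "(1 - \<alpha>) * (- (1 / (\<alpha> - 1))) = 1" using al by (simp add: field_simps)
    ultimately have "Z' \<le> y x" unfolding powr_powr by (simp add: Z'_def)
    then show ?case by (simp add: Z'_def)
  qed
qed

text \<open>Converts estimates for large \<open>l\<close> into estimates for small \<open>x\<close>
  along multiples of the saddle point.\<close>

lemma l_at_top:
  assumes "s > 0" "eventually P (at_top :: real filter)"
  shows "eventually (\<lambda>x. P (s * (y x / x))) (at_right 0)"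
proof -
  obtain Z where Z: "\<And>l. l \<ge> Z \<Longrightarrow> P l" using assms(2) by (auto simp: eventually_at_top_linorder)
  have "eventually (\<lambda>x. x \<in> {0<..<1}) (at_right (0::real))" by (intro eventually_at_right_real) auto
  then show ?thesis using y_at_top[of "max 1 Z / s"]
  proof eventually_elim
    case (elim x)
    have "max 1 Z / s \<le> y x / x"
    proof -
      have "y x \<le> y x / x" using elim y_pos[of x] by (simp add: field_simps)
      then show ?thesis using elim by linarith
    qed
    then have "Z \<le> s * (y x / x)" using assms(1) by (simp add: field_simps)
    then show ?case by (rule Z)
  qed
qed

lemma chernoff:
  assumes "l \<ge> 0" "x > 0" shows "p x \<le> exp (l * x) * laplace_transform_at M I l"
proof -
  have "p x = (\<integral>\<omega>. indicator {\<omega> \<in> space M. I \<omega> \<le> ennreal x} \<omega> \<partial>M)"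
    by (simp add: p_def)
  also have "\<dots> \<le> (\<integral>\<omega>. exp (l * x) * \<phi> l \<omega> \<partial>M)"
  proof (intro integral_mono integrable_mult_right phi_integrable assms)
    show "integrable M (indicator {\<omega> \<in> space M. I \<omega> \<le> ennreal x} :: _ \<Rightarrow> real)"
      by (intro integrable_real_indicator) (auto simp: emeasure_eq_measure)
    fix \<omega> assume "\<omega> \<in> space M"
    show "indicator {\<omega> \<in> space M. I \<omega> \<le> ennreal x} \<omega> \<le> exp (l * x) * \<phi> l \<omega>"
    proof (cases "I \<omega> \<le> ennreal x")
      case True
      then have "I \<omega> \<noteq> \<infinity>" by (auto simp: top_unique)
      moreover have "enn2real (I \<omega>) \<le> x" using True assms by (intro enn2real_leI) auto
      ultimately show ?thesis using assms
        by (auto simp: \<phi>_def exp_add[symmetric] mult_left_mono indicator_def simp flip: exp_add)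
    qed (auto simp: phi_bounds)
  qed
  finally show ?thesis by (simp add: laplace_phi)
qed

text \<open>This is \<open>chernoff\<close> at the saddle point, where \<open>l * x = y x\<close>
  while the transform contributes about \<open>exp (- \<alpha> * y x)\<close>.\<close>

lemma small_ball_upper:
  assumes "\<epsilon> > 0"
  shows "eventually (\<lambda>x. p x \<le> exp (- ((\<alpha> - 1 - \<epsilon>) * y x))) (at_right 0)"
proof -
  have ev: "eventually (\<lambda>x::real. x > 0) (at_right 0)" by (rule eventually_at_right_less)
  have "eventually (\<lambda>x. laplace_transform_at M I (1 * (y x / x)) \<le>
     exp (- (\<alpha> * (1 - \<epsilon>/\<alpha>) * (1 * (y x / x) / C) powr (1 / \<alpha>)))) (at_right 0)"
    using assms al by (intro l_at_top up) auto
  with ev show ?thesis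
  proof eventually_elim
    case (elim x)
    have "p x \<le> exp (y x / x * x) * laplace_transform_at M I (y x / x)"
      using elim y_pos[of x] by (intro chernoff) auto
    also have "\<dots> \<le> exp (y x / x * x) * exp (- (\<alpha> * (1 - \<epsilon>/\<alpha>) * y x))"
      using elim saddle[of x 1] by (intro mult_left_mono) auto
    also have "\<dots> = exp (- ((\<alpha> - 1 - \<epsilon>) * y x))"
      unfolding exp_add [symmetric] using elim al by (simp add: algebra_simps)
    finally show ?case .
  qed
qed

text \<open>The expectation is split according to whether \<open>I\<close> exceeds
  \<open>(1 + \<eta>) * x\<close>, falls below \<open>(1 - \<eta>) * x\<close>, or lies in between.
  On the two outer parts an exponential Markov inequality shifts the argument of the transform by a
  factor \<open>1 - \<delta>\<close> or \<open>1 + \<delta>\<close>.\<close>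

lemma tilting:
  assumes x: "x > 0" and l: "l > 0" and d: "0 < \<delta>" "\<delta> < 1" and e: "0 < \<eta>" "\<eta> < 1"
  shows "laplace_transform_at M I l \<le> exp (- \<delta> * l * ((1 + \<eta>) * x)) * laplace_transform_at M I ((1 - \<delta>) * l)
     + exp (\<delta> * l * ((1 - \<eta>) * x)) * laplace_transform_at M I ((1 + \<delta>) * l)
     + exp (- l * ((1 - \<eta>) * x)) * p ((1 + \<eta>) * x)"
proof -
  let ?E = "{\<omega> \<in> space M. I \<omega> \<le> ennreal ((1 + \<eta>) * x)}"
  have ii: "integrable M (indicator ?E :: _ \<Rightarrow> real)"
    by (intro integrable_real_indicator) (auto simp: emeasure_eq_measure)
  have "(\<integral>\<omega>. \<phi> l \<omega> \<partial>M) \<le> (\<integral>\<omega>. exp (- \<delta> * l * ((1 + \<eta>) * x)) * \<phi> ((1 - \<delta>) * l) \<omega>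
     + exp (\<delta> * l * ((1 - \<eta>) * x)) * \<phi> ((1 + \<delta>) * l) \<omega> + exp (- l * ((1 - \<eta>) * x)) * indicator ?E \<omega> \<partial>M)"
  proof (intro integral_mono Bochner_Integration.integrable_add integrable_mult_right phi_integrable ii)
    fix \<omega> assume w: "\<omega> \<in> space M"
    show "\<phi> l \<omega> \<le> exp (- \<delta> * l * ((1 + \<eta>) * x)) * \<phi> ((1 - \<delta>) * l) \<omega>
     + exp (\<delta> * l * ((1 - \<eta>) * x)) * \<phi> ((1 + \<delta>) * l) \<omega> + exp (- l * ((1 - \<eta>) * x)) * indicator ?E \<omega>"
      (is "_ \<le> ?a + ?b + ?c")
    proof (cases "I \<omega> = \<infinity>")
      case False
      define J where "J = enn2real (I \<omega>)"
      have IJ: "I \<omega> = ennreal J" using False by (simp add: J_def ennreal_enn2real less_top)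
      have J0: "J \<ge> 0" by (simp add: J_def)
      have nn: "?a \<ge> 0" "?b \<ge> 0" "?c \<ge> 0" by (auto simp: phi_bounds)
      have dl: "\<delta> * l > 0" using d l by simp
      consider "J > (1 + \<eta>) * x" | "J < (1 - \<eta>) * x" | "(1 - \<eta>) * x \<le> J" "J \<le> (1 + \<eta>) * x" by linarith
      then show ?thesis
      proof cases
        case 1
        then have "\<delta> * l * ((1 + \<eta>) * x) \<le> \<delta> * l * J" using dl by (intro mult_left_mono) auto
        then have "\<phi> l \<omega> \<le> ?a"
          using False unfolding \<phi>_def J_def[symmetric] by (simp add: algebra_simps flip: exp_add)
        then show ?thesis using nn by linarith
      next
        case 2
        then have "\<delta> * l * J \<le> \<delta> * l * ((1 - \<eta>) * x)" using dl by (intro mult_left_mono) auto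
        then have "\<phi> l \<omega> \<le> ?b"
          using False unfolding \<phi>_def J_def[symmetric] by (simp add: algebra_simps flip: exp_add)
        then show ?thesis using nn by linarith
      next
        case 3
        then have "\<omega> \<in> ?E" using w by (auto simp: IJ intro!: ennreal_leI)
        moreover have "l * ((1 - \<eta>) * x) \<le> l * J" using 3 l by (intro mult_left_mono) auto
        ultimately have "\<phi> l \<omega> \<le> ?c"
          using False unfolding \<phi>_def J_def[symmetric] by simp
        then show ?thesis using nn by linarith
      qed
    qed (simp add: \<phi>_def)
  qed (use d l in auto)
  also have "\<dots> = exp (- \<delta> * l * ((1 + \<eta>) * x)) * laplace_transform_at M I ((1 - \<delta>) * l)
     + exp (\<delta> * l * ((1 - \<eta>) * x)) * laplace_transform_at M I ((1 + \<delta>) * l)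
     + exp (- l * ((1 - \<eta>) * x)) * p ((1 + \<eta>) * x)"
    unfolding laplace_phi p_def using d l
    by (subst Bochner_Integration.integral_add Bochner_Integration.integral_mult_right_zero |
        intro Bochner_Integration.integrable_add integrable_mult_right phi_integrable ii | simp)+
  finally show ?thesis by (simp add: laplace_phi)
qed

text \<open>Under the law tilted by \<open>exp (- l * I)\<close>, with \<open>l\<close> the saddle
  point, \<open>I\<close> concentrates near \<open>x\<close>: each outer part in
  \<open>tilting\<close> is at most a quarter of the transform \<open>L\<close>, so the middle part
  carries at least half of it.\<close>

lemma small_ball_lower_aux:
  assumes e: "0 < \<eta>" "\<eta> < 1"
  shows "eventually (\<lambda>x. p ((1 + \<eta>) * x) \<ge> exp (- ((\<alpha> - 1 + 2 * \<eta>) * y x))) (at_right 0)"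
proof -
  \<comment> \<open>The shift by \<eta> gains
    \<open>\<delta> * \<eta> = 8 * \<delta>\<^sup>2\<close> in the exponent, while the expansions
    and \<epsilon>, taken with \<open>\<alpha> * \<epsilon> = \<delta>\<^sup>2\<close>, cost at most
    \<open>4 * \<delta>\<^sup>2\<close>. The remaining \<open>4 * \<delta>\<^sup>2\<close> produces
    the factor 1/4.\<close>
  define \<delta> where "\<delta> = \<eta> / 8"
  define \<epsilon> where "\<epsilon> = \<delta>\<^sup>2 / \<alpha>"
  have d: "0 < \<delta>" "\<delta> < 1/8" using e by (auto simp: \<delta>_def)
  have eta: "\<eta> = 8 * \<delta>" by (simp add: \<delta>_def)
  have ep: "\<epsilon> > 0" using d al by (simp add: \<epsilon>_def)
  have eal: "\<alpha> * \<epsilon> = \<delta>\<^sup>2" using al by (simp add: \<epsilon>_def)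
  have "\<delta>\<^sup>2 \<le> \<delta> * 1" unfolding power2_eq_square using d by (intro mult_left_mono) auto
  then have dd: "\<delta>\<^sup>2 \<le> \<delta>" by simp
  have e1: "\<epsilon> \<le> \<delta>\<^sup>2" using al d by (simp add: \<epsilon>_def divide_le_eq)
  have e2: "\<epsilon> < 1" using e1 dd d by linarith
  have ev: "eventually (\<lambda>x::real. x > 0) (at_right 0)" by (rule eventually_at_right_less)
  have a: "eventually (\<lambda>x. laplace_transform_at M I (1 * (y x / x)) \<ge>
     exp (- (\<alpha> * (1 + \<epsilon>) * (1 * (y x / x) / C) powr (1 / \<alpha>)))) (at_right 0)"
    by (intro l_at_top lo ep) auto
  have b: "eventually (\<lambda>x. laplace_transform_at M I ((1 - \<delta>) * (y x / x)) \<le>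
     exp (- (\<alpha> * (1 - \<epsilon>) * ((1 - \<delta>) * (y x / x) / C) powr (1 / \<alpha>)))) (at_right 0)"
    using d by (intro l_at_top up ep) auto
  have c: "eventually (\<lambda>x. laplace_transform_at M I ((1 + \<delta>) * (y x / x)) \<le>
     exp (- (\<alpha> * (1 - \<epsilon>) * ((1 + \<delta>) * (y x / x) / C) powr (1 / \<alpha>)))) (at_right 0)"
    using d by (intro l_at_top up ep) auto
  show ?thesis using ev a b c y_at_top[of "ln 4 / (4 * \<delta>\<^sup>2)"]
  proof eventually_elim
    case (elim x)
    define Y where "Y = y x"
    define L where "L = laplace_transform_at M I (Y / x)"
    have Y: "Y > 0" "4 * \<delta>\<^sup>2 * Y \<ge> ln 4" using elim y_pos[of x] d by (auto simp: Y_def field_simps)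
    have L: "L \<ge> exp (- (\<alpha> * (1 + \<epsilon>) * Y))" using elim saddle[of x 1] by (simp add: L_def Y_def)
    have t1: "exp (- \<delta> * (Y/x) * ((1 + \<eta>) * x)) * laplace_transform_at M I ((1 - \<delta>) * (Y/x)) \<le> L / 4"
    proof -
      have 1: "\<alpha> - \<delta> - 2 * \<delta>\<^sup>2 \<le> \<alpha> * (1 - \<delta>) powr (1/\<alpha>)" using d al by (intro powr_inverse_one_minus) auto
      have "(1 - \<epsilon>) * (\<alpha> - \<delta> - 2 * \<delta>\<^sup>2) \<le> (1 - \<epsilon>) * (\<alpha> * (1 - \<delta>) powr (1/\<alpha>))"
        using e2 by (intro mult_left_mono 1) auto
      moreover have "(1 - \<epsilon>) * (\<alpha> - \<delta> - 2 * \<delta>\<^sup>2) \<ge> \<alpha> - \<delta> - 3 * \<delta>\<^sup>2"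
      proof -
        have "\<epsilon> * (\<delta> + 2 * \<delta>\<^sup>2) \<ge> 0" using ep d by simp
        then show ?thesis using eal by (simp add: algebra_simps)
      qed
      ultimately have "\<delta> * (1 + \<eta>) + \<alpha> * (1 - \<epsilon>) * (1 - \<delta>) powr (1/\<alpha>) \<ge> \<alpha> * (1 + \<epsilon>) + 4 * \<delta>\<^sup>2"
      proof -
        assume "(1 - \<epsilon>) * (\<alpha> - \<delta> - 2 * \<delta>\<^sup>2) \<le> (1 - \<epsilon>) * (\<alpha> * (1 - \<delta>) powr (1/\<alpha>))"
          "(1 - \<epsilon>) * (\<alpha> - \<delta> - 2 * \<delta>\<^sup>2) \<ge> \<alpha> - \<delta> - 3 * \<delta>\<^sup>2"
        moreover have "\<alpha> * (1 + \<epsilon>) = \<alpha> + \<delta>\<^sup>2" using eal by (simp add: distrib_left)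
        moreover have "\<delta> * (1 + \<eta>) = \<delta> + 8 * \<delta>\<^sup>2" by (simp add: eta distrib_left power2_eq_square)
        moreover have "\<alpha> * (1 - \<epsilon>) * (1 - \<delta>) powr (1/\<alpha>) = (1 - \<epsilon>) * (\<alpha> * (1 - \<delta>) powr (1/\<alpha>))" by simp
        ultimately show ?thesis by linarith
      qed
      then have "(\<delta> * (1 + \<eta>) + \<alpha> * (1 - \<epsilon>) * (1 - \<delta>) powr (1/\<alpha>)) * Y \<ge> (\<alpha> * (1 + \<epsilon>) + 4 * \<delta>\<^sup>2) * Y"
        using Y by (intro mult_right_mono) auto
      then have *: "- (\<delta> * (1 + \<eta>) * Y) - \<alpha> * (1 - \<epsilon>) * ((1 - \<delta>) powr (1/\<alpha>) * Y) \<le> - (\<alpha> * (1 + \<epsilon>) * Y) - ln 4"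
        using Y by (simp add: algebra_simps)
      have "exp (- \<delta> * (Y/x) * ((1 + \<eta>) * x)) * laplace_transform_at M I ((1 - \<delta>) * (Y/x))
         \<le> exp (- \<delta> * (Y/x) * ((1 + \<eta>) * x)) * exp (- (\<alpha> * (1 - \<epsilon>) * ((1 - \<delta>) powr (1/\<alpha>) * Y)))"
        using elim saddle[of x "1 - \<delta>"] d by (intro mult_left_mono) (auto simp: Y_def)
      also have "\<dots> = exp (- (\<delta> * (1 + \<eta>) * Y) - \<alpha> * (1 - \<epsilon>) * ((1 - \<delta>) powr (1/\<alpha>) * Y))"
        using elim(1) by (simp add: algebra_simps add_divide_distrib diff_divide_distrib flip: exp_add)
      also have "\<dots> \<le> exp (- (\<alpha> * (1 + \<epsilon>) * Y) - ln 4)" using * by simp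
      also have "\<dots> \<le> L / 4" using L by (simp add: exp_diff)
      finally show ?thesis .
    qed
    have t2: "exp (\<delta> * (Y/x) * ((1 - \<eta>) * x)) * laplace_transform_at M I ((1 + \<delta>) * (Y/x)) \<le> L / 4"
    proof -
      have 1: "\<alpha> + \<delta> - \<delta>\<^sup>2 \<le> \<alpha> * (1 + \<delta>) powr (1/\<alpha>)" using d al by (intro powr_inverse_one_plus) auto
      have "(1 - \<epsilon>) * (\<alpha> + \<delta> - \<delta>\<^sup>2) \<le> (1 - \<epsilon>) * (\<alpha> * (1 + \<delta>) powr (1/\<alpha>))"
        using e2 by (intro mult_left_mono 1) auto
      moreover have "(1 - \<epsilon>) * (\<alpha> + \<delta> - \<delta>\<^sup>2) \<ge> \<alpha> + \<delta> - 3 * \<delta>\<^sup>2"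
      proof -
        have "\<epsilon> * \<delta> \<le> \<delta>\<^sup>2 * 1" using e1 d ep by (intro mult_mono) auto
        moreover have "\<epsilon> * \<delta>\<^sup>2 \<ge> 0" using ep by simp
        ultimately show ?thesis using eal by (simp add: algebra_simps)
      qed
      ultimately have "\<alpha> * (1 - \<epsilon>) * (1 + \<delta>) powr (1/\<alpha>) - \<delta> * (1 - \<eta>) \<ge> \<alpha> * (1 + \<epsilon>) + 4 * \<delta>\<^sup>2"
      proof -
        assume "(1 - \<epsilon>) * (\<alpha> + \<delta> - \<delta>\<^sup>2) \<le> (1 - \<epsilon>) * (\<alpha> * (1 + \<delta>) powr (1/\<alpha>))"
          "(1 - \<epsilon>) * (\<alpha> + \<delta> - \<delta>\<^sup>2) \<ge> \<alpha> + \<delta> - 3 * \<delta>\<^sup>2"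
        moreover have "\<alpha> * (1 + \<epsilon>) = \<alpha> + \<delta>\<^sup>2" using eal by (simp add: distrib_left)
        moreover have "\<delta> * (1 - \<eta>) = \<delta> - 8 * \<delta>\<^sup>2" by (simp add: eta right_diff_distrib power2_eq_square)
        moreover have "\<alpha> * (1 - \<epsilon>) * (1 + \<delta>) powr (1/\<alpha>) = (1 - \<epsilon>) * (\<alpha> * (1 + \<delta>) powr (1/\<alpha>))" by simp
        ultimately show ?thesis by linarith
      qed
      then have "(\<alpha> * (1 - \<epsilon>) * (1 + \<delta>) powr (1/\<alpha>) - \<delta> * (1 - \<eta>)) * Y \<ge> (\<alpha> * (1 + \<epsilon>) + 4 * \<delta>\<^sup>2) * Y"
        using Y by (intro mult_right_mono) auto
      then have *: "\<delta> * (1 - \<eta>) * Y - \<alpha> * (1 - \<epsilon>) * ((1 + \<delta>) powr (1/\<alpha>) * Y) \<le> - (\<alpha> * (1 + \<epsilon>) * Y) - ln 4"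
        using Y by (simp add: algebra_simps)
      have "exp (\<delta> * (Y/x) * ((1 - \<eta>) * x)) * laplace_transform_at M I ((1 + \<delta>) * (Y/x))
         \<le> exp (\<delta> * (Y/x) * ((1 - \<eta>) * x)) * exp (- (\<alpha> * (1 - \<epsilon>) * ((1 + \<delta>) powr (1/\<alpha>) * Y)))"
        using elim saddle[of x "1 + \<delta>"] d by (intro mult_left_mono) (auto simp: Y_def)
      also have "\<dots> = exp (\<delta> * (1 - \<eta>) * Y - \<alpha> * (1 - \<epsilon>) * ((1 + \<delta>) powr (1/\<alpha>) * Y))"
        using elim(1) by (simp add: algebra_simps add_divide_distrib diff_divide_distrib flip: exp_add)
      also have "\<dots> \<le> exp (- (\<alpha> * (1 + \<epsilon>) * Y) - ln 4)" using * by simp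
      also have "\<dots> \<le> L / 4" using L by (simp add: exp_diff)
      finally show ?thesis .
    qed
    have "L \<le> L / 4 + L / 4 + exp (- (Y/x) * ((1 - \<eta>) * x)) * p ((1 + \<eta>) * x)"
      unfolding L_def using t1 t2 e d elim Y tilting[of x "Y/x" \<delta> \<eta>] by (simp add: L_def)
    then have "L / 2 \<le> exp (- ((1 - \<eta>) * Y)) * p ((1 + \<eta>) * x)"
      using elim by (simp add: mult.commute)
    then have "exp ((1 - \<eta>) * Y) * (L / 2) \<le> exp ((1 - \<eta>) * Y) * (exp (- ((1 - \<eta>) * Y)) * p ((1 + \<eta>) * x))"
      by (intro mult_left_mono) auto
    also have "\<dots> = p ((1 + \<eta>) * x)" by (simp flip: mult.assoc exp_add)
    finally have p1: "exp ((1 - \<eta>) * Y) * (L / 2) \<le> p ((1 + \<eta>) * x)" .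
    have "exp (- ((\<alpha> - 1 + 2 * \<eta>) * Y)) \<le> exp ((1 - \<eta>) * Y + (- (\<alpha> * (1 + \<epsilon>) * Y) - ln 4))"
    proof -
      have "5 * \<delta>\<^sup>2 * Y \<le> \<eta> * Y" using dd d Y by (intro mult_right_mono) (auto simp: eta)
      then have "\<delta>\<^sup>2 * Y + ln 4 \<le> \<eta> * Y" using Y(2) by linarith
      moreover have "\<alpha> * (1 + \<epsilon>) * Y = \<alpha> * Y + \<delta>\<^sup>2 * Y"
        using eal by (simp add: distrib_left distrib_right)
      moreover have "(\<alpha> - 1 + 2 * \<eta>) * Y = \<alpha> * Y - Y + 2 * (\<eta> * Y)" "(1 - \<eta>) * Y = Y - \<eta> * Y"
        by (simp_all add: algebra_simps)
      ultimately show ?thesis unfolding exp_le_cancel_iff by linarith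
    qed
    also have "\<dots> \<le> exp ((1 - \<eta>) * Y) * (L / 2)"
    proof -
      have "exp (- (\<alpha> * (1 + \<epsilon>) * Y) - ln 4) \<le> L / 2"
      proof -
        have "L \<ge> 0" using L exp_ge_zero order_trans by blast
        then show ?thesis using L by (simp add: exp_diff)
      qed
      then show ?thesis by (simp add: exp_add)
    qed
    finally show ?case using p1 by (simp add: Y_def)
  qed
qed

lemma small_ball_lower:
  assumes "\<epsilon> > 0"
  shows "eventually (\<lambda>x. p x \<ge> exp (- ((\<alpha> - 1 + \<epsilon>) * y x))) (at_right 0)"
proof -
  \<comment> \<open>Replacing \<open>x\<close> by \<open>x / (1 + \<eta>)\<close> multiplies
    \<open>y x\<close> by the power in \<open>?f\<close>. Since \<open>?f\<close> tends to
    \<open>\<alpha> - 1\<close> as \<eta> tends to 0, a suitable \<eta> exists.\<close>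
  let ?f = "\<lambda>\<eta>. (\<alpha> - 1 + 2 * \<eta>) * (1 + \<eta>) powr (1 / (\<alpha> - 1))"
  have "(?f \<longlongrightarrow> (\<alpha> - 1 + 2 * 0) * (1 + 0) powr (1 / (\<alpha> - 1))) (at_right 0)"
    by (intro tendsto_intros) auto
  then have "eventually (\<lambda>\<eta>. ?f \<eta> < \<alpha> - 1 + \<epsilon>) (at_right 0)"
    using assms by (auto simp: order_tendsto_iff)
  moreover have "eventually (\<lambda>\<eta>. \<eta> \<in> {0<..<1}) (at_right (0::real))" by (intro eventually_at_right_real) auto
  ultimately have "eventually (\<lambda>\<eta>. ?f \<eta> < \<alpha> - 1 + \<epsilon> \<and> \<eta> \<in> {0<..<1}) (at_right 0)"
    by eventually_elim auto
  then have "\<exists>\<eta>. ?f \<eta> < \<alpha> - 1 + \<epsilon> \<and> \<eta> \<in> {0<..<1}"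
    by (rule eventually_happens'[rotated]) (rule trivial_limit_at_right_real)
  then obtain \<eta> where e: "0 < \<eta>" "\<eta> < 1" "?f \<eta> < \<alpha> - 1 + \<epsilon>" by auto
  have "eventually (\<lambda>x. p ((1 + \<eta>) * (x / (1 + \<eta>))) \<ge> exp (- ((\<alpha> - 1 + 2 * \<eta>) * y (x / (1 + \<eta>))))) (at_right 0)"
  proof -
    have "filterlim (\<lambda>x. x / (1 + \<eta>)) (at_right 0) (at_right 0)"
      unfolding filterlim_at using e by (auto intro!: tendsto_eq_intros simp: eventually_at_filter)
    then show ?thesis by (rule eventually_compose_filterlim[OF small_ball_lower_aux[OF e(1,2)]])
  qed
  moreover have "eventually (\<lambda>x::real. x > 0) (at_right 0)" by (rule eventually_at_right_less)
  ultimately show ?thesis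
  proof eventually_elim
    case (elim x)
    have "y (x / (1 + \<eta>)) = (1 + \<eta>) powr (1 / (\<alpha> - 1)) * y x"
      using elim C e by (simp add: y_def powr_divide[of "C * x"] powr_minus field_simps)
    then have "(\<alpha> - 1 + 2 * \<eta>) * y (x / (1 + \<eta>)) = ?f \<eta> * y x" by simp
    also have "\<dots> \<le> (\<alpha> - 1 + \<epsilon>) * y x" using e y_pos[of x] elim by (intro mult_right_mono) auto
    finally have "exp (- ((\<alpha> - 1 + \<epsilon>) * y x)) \<le> exp (- ((\<alpha> - 1 + 2 * \<eta>) * y (x / (1 + \<eta>))))" by simp
    also have "\<dots> \<le> p x" using elim e by simp
    finally show ?case .
  qed
qed

theorem log_small_ball:
  "(\<lambda>x. ln (measure M {\<omega> \<in> space M. I \<omega> \<le> ennreal x}))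
     \<sim>[at_right 0] (\<lambda>x. - ((\<alpha> - 1) / (C * x) powr (1 / (\<alpha> - 1))))"
proof (rule asymp_equivI', rule tendstoI)
  fix e :: real assume e: "e > 0"
  define \<epsilon> where "\<epsilon> = e * (\<alpha> - 1) / 2"
  have ep: "\<epsilon> > 0" using e al by (simp add: \<epsilon>_def)
  have ev: "eventually (\<lambda>x::real. x > 0) (at_right 0)" by (rule eventually_at_right_less)
  show "eventually (\<lambda>x. dist (ln (measure M {\<omega> \<in> space M. I \<omega> \<le> ennreal x}) /
      - ((\<alpha> - 1) / (C * x) powr (1 / (\<alpha> - 1)))) 1 < e) (at_right 0)"
    using ev small_ball_upper[OF ep] small_ball_lower[OF ep]
  proof eventually_elim
    case (elim x)
    have pp: "p x > 0" using elim(3) exp_gt_zero less_le_trans by blast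
    have 1: "ln (p x) \<le> - ((\<alpha> - 1 - \<epsilon>) * y x)" using elim(2) pp by (metis exp_le_cancel_iff exp_ln)
    have 2: "ln (p x) \<ge> - ((\<alpha> - 1 + \<epsilon>) * y x)" using elim(3) pp by (metis exp_le_cancel_iff exp_ln)
    have y0: "y x > 0" using elim y_pos by simp
    have eq: "(\<alpha> - 1) / (C * x) powr (1 / (\<alpha> - 1)) = (\<alpha> - 1) * y x"
      by (simp add: y_def powr_minus divide_inverse)
    have "\<bar>ln (p x) + (\<alpha> - 1) * y x\<bar> \<le> \<epsilon> * y x" using 1 2 by (simp add: algebra_simps abs_le_iff)
    also have "\<dots> < e * ((\<alpha> - 1) * y x)" using y0 e al by (simp add: \<epsilon>_def)
    finally have "\<bar>ln (p x) + (\<alpha> - 1) * y x\<bar> / ((\<alpha> - 1) * y x) < e" using y0 al by (simp add: field_simps)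
    moreover have "ln (p x) / - ((\<alpha> - 1) * y x) - 1 = - ((ln (p x) + (\<alpha> - 1) * y x) / ((\<alpha> - 1) * y x))"
      using y0 al by (simp add: field_simps)
    ultimately show ?case
      unfolding dist_real_def eq p_def[symmetric] using y0 al by (simp add: abs_divide abs_mult)
  qed
qed

end

section \<open>Uniqueness of the bilateral Laplace transform\<close>

lemma integrable_laplace_kernel:
  fixes M :: "real measure"
  assumes [measurable_cong]: "sets M = sets borel"
    and "(\<integral>\<^sup>+x. ennreal (exp (- l * x)) \<partial>M) < \<infinity>"
  shows "integrable M (\<lambda>x. exp (- l * x))"
  by (intro integrableI_bounded) (use assms(2) in auto)

text \<open>The factor \<open>exp ((R - z) * x)\<close> is expanded under the integral. The disc of
  radius \<open>R - l0\<close> around \<open>R\<close> is the largest one inside the half-plane of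
  convergence, and these discs exhaust the half-plane as \<open>R\<close> grows.\<close>

lemma laplace_power_series:
  fixes M :: "real measure" and z :: complex and l0 R :: real
  assumes M [measurable_cong]: "sets M = sets borel"
    and fin: "\<And>l. l > l0 \<Longrightarrow> (\<integral>\<^sup>+x. ennreal (exp (- l * x)) \<partial>M) < \<infinity>"
    and z: "cmod (of_real R - z) < R - l0"
  shows "(\<lambda>k. (of_real R - z) ^ k / fact k * of_real (\<integral>x. x ^ k * exp (- R * x) \<partial>M))
    sums (\<integral>x. exp (- z * of_real x) \<partial>M)"
proof -
  define \<rho> where "\<rho> = cmod (of_real R - z)"
  \<comment> \<open>One exponential for each half-line: together they dominate
    \<open>exp (\<rho> * \<bar>x\<bar>) * exp (- R * x)\<close>, and both rates exceed
    \<open>l0\<close>.\<close>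
  define h where "h x = exp (- (R - \<rho>) * x) + exp (- (R + \<rho>) * x)" for x
  define f :: "nat \<Rightarrow> real \<Rightarrow> complex" where
    "f k x = (of_real R - z) ^ k / fact k * of_real (x ^ k * exp (- R * x))" for k x
  have r: "\<rho> \<ge> 0" "\<rho> < R - l0" using z by (auto simp: \<rho>_def)
  have hi: "integrable M h"
    unfolding h_def using r by (intro Bochner_Integration.integrable_add integrable_laplace_kernel fin M) auto
  have nf: "norm (f k x) = (\<rho> * \<bar>x\<bar>) ^ k / fact k * exp (- R * x)" for k x
    by (simp add: f_def \<rho>_def norm_mult norm_divide norm_power power_mult_distrib)
  have expb: "exp (\<rho> * \<bar>x\<bar>) * exp (- R * x) \<le> h x" for x
    by (cases "x \<ge> 0") (auto simp: h_def algebra_simps simp flip: exp_add)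
  have sm: "(\<lambda>k. (\<rho> * \<bar>x\<bar>) ^ k / fact k * exp (- R * x)) sums (exp (\<rho> * \<bar>x\<bar>) * exp (- R * x))" for x
    using exp_converges[of "\<rho> * \<bar>x\<bar>"] by (intro sums_mult2) (simp add: divide_inverse mult.commute)
  have psum: "(\<Sum>k<n. norm (f k x)) \<le> h x" for n x
  proof -
    have "(\<Sum>k<n. norm (f k x)) \<le> exp (\<rho> * \<bar>x\<bar>) * exp (- R * x)"
      unfolding nf sums_unique[OF sm] using r
      by (intro sum_le_suminf sums_summable[OF sm]) auto
    then show ?thesis using expb[of x] by linarith
  qed
  have fm [measurable]: "f k \<in> borel_measurable M" for k
    unfolding f_def by measurable
  have fi: "integrable M (f k)" for k
  proof (rule Bochner_Integration.integrable_bound[OF hi])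
    show "AE x in M. norm (f k x) \<le> norm (h x)"
    proof (rule AE_I2)
      fix x
      have "norm (f k x) \<le> (\<Sum>k<Suc k. norm (f k x))" by simp (intro sum_nonneg, auto)
      also have "\<dots> \<le> h x" by (rule psum)
      finally show "norm (f k x) \<le> norm (h x)" by simp
    qed
  qed simp
  have "(\<lambda>k. integral\<^sup>L M (f k)) sums (\<integral>x. (\<Sum>k. f k x) \<partial>M)"
  proof (rule sums_integral[OF fi])
    show "AE x in M. summable (\<lambda>i. norm (f i x))"
      unfolding nf using sums_summable[OF sm] by simp
    show "summable (\<lambda>i. \<integral>x. norm (f i x) \<partial>M)"
    proof (rule summableI_nonneg_bounded)
      fix n
      have "(\<Sum>i<n. \<integral>x. norm (f i x) \<partial>M) = (\<integral>x. (\<Sum>i<n. norm (f i x)) \<partial>M)"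
        using fi by (intro Bochner_Integration.integral_sum[symmetric] integrable_norm)
      also have "\<dots> \<le> integral\<^sup>L M h"
        using fi hi psum by (intro integral_mono Bochner_Integration.integrable_sum integrable_norm) auto
      finally show "(\<Sum>i<n. \<integral>x. norm (f i x) \<partial>M) \<le> integral\<^sup>L M h" .
    qed simp
  qed
  moreover have "integral\<^sup>L M (f k) = (of_real R - z) ^ k / fact k * of_real (\<integral>x. x ^ k * exp (- R * x) \<partial>M)" for k
    unfolding f_def by (simp del: of_real_mult)
  moreover have "(\<Sum>k. f k x) = exp (- z * of_real x)" for x
  proof -
    have "(\<lambda>k. ((of_real R - z) * of_real x) ^ k / fact k * of_real (exp (- R * x))) sums
       (exp ((of_real R - z) * of_real x) * of_real (exp (- R * x)))"
      using exp_converges[of "(of_real R - z) * of_real x"]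
      by (intro sums_mult2) (simp add: scaleR_conv_of_real divide_inverse mult.commute)
    moreover have "((of_real R - z) * of_real x) ^ k / fact k * of_real (exp (- R * x)) = f k x" for k
      by (simp add: f_def power_mult_distrib)
    moreover have "exp ((of_real R - z) * of_real x) * of_real (exp (- R * x)) = exp (- z * of_real x)"
      by (simp add: exp_of_real[symmetric] algebra_simps flip: exp_add)
    ultimately show ?thesis by (simp add: sums_iff)
  qed
  ultimately show ?thesis by simp
qed

lemma real_powser_eq_0:
  fixes a :: "nat \<Rightarrow> real"
  assumes "r > 0" and s: "\<And>x. \<bar>x\<bar> < r \<Longrightarrow> (\<lambda>n. a n * x ^ n) sums 0"
  shows "a n = 0"
proof (rule ccontr)
  assume nz: "a n \<noteq> 0"
  have "(\<lambda>n. a n * 0 ^ n) sums a 0" using powser_sums_zero[of a] by simp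
  with s[of 0] assms(1) have "a 0 = 0" by (simp add: sums_unique2)
  with nz have "n > 0" by (cases n) auto
  obtain t where "t > 0" "\<And>z. z \<in> cball 0 t - {0} \<Longrightarrow> (\<lambda>x::real. 0::real) z \<noteq> 0"
    using powser_0_nonzero[OF \<open>r > 0\<close>, of 0 a "\<lambda>x. 0" n] s nz \<open>n > 0\<close> by auto
  from this(2)[of t] this(1) show False by (simp add: dist_norm)
qed

text \<open>The transform at a complex point \<open>z\<close> is the sum of a power series around a large real \<open>R\<close>,
  whose coefficients are determined by the values on the real axis.\<close>
lemma laplace_transform_unique:
  fixes M N :: "real measure"
  assumes M [measurable_cong]: "sets M = sets borel" and N [measurable_cong]: "sets N = sets borel"
    and fin: "\<And>l. l > l0 \<Longrightarrow> (\<integral>\<^sup>+x. ennreal (exp (- l * x)) \<partial>M) < \<infinity>"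
    and eq: "\<And>l. l > l0 \<Longrightarrow> (\<integral>\<^sup>+x. ennreal (exp (- l * x)) \<partial>M) = (\<integral>\<^sup>+x. ennreal (exp (- l * x)) \<partial>N)"
  shows "M = N"
proof -
  have finN: "(\<integral>\<^sup>+x. ennreal (exp (- l * x)) \<partial>N) < \<infinity>" if "l > l0" for l
    using fin[OF that] eq[OF that] by simp
  have eqr: "(\<integral>x. exp (- l * x) \<partial>M) = (\<integral>x. exp (- l * x) \<partial>N)" if "l > l0" for l
    using eq[OF that] by (simp add: integral_eq_nn_integral)
  \<comment> \<open>Up to sign these are the Taylor coefficients at \<open>R\<close> of the two
    transforms, which agree on a real interval around \<open>R\<close>.\<close>
  have mom: "(\<integral>x. x ^ k * exp (- R * x) \<partial>M) = (\<integral>x. x ^ k * exp (- R * x) \<partial>N)" if R: "R > l0" for R k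
  proof -
    define a where "a k = ((\<integral>x. x ^ k * exp (- R * x) \<partial>M) - (\<integral>x. x ^ k * exp (- R * x) \<partial>N)) / fact k" for k
    have "a k = 0"
    proof (rule real_powser_eq_0)
      show "R - l0 > 0" using R by simp
      fix w :: real assume w: "\<bar>w\<bar> < R - l0"
      have w': "cmod (of_real R - of_real (R - w)) < R - l0" using w by simp
      have c: "(\<integral>x. exp (- (of_real (R - w) :: complex) * of_real x) \<partial>Q) = of_real (\<integral>x. exp (- (R - w) * x) \<partial>Q)" for Q
        by (subst integral_complex_of_real[symmetric]) (simp add: exp_of_real[symmetric])
      have "R - w > l0" using w by linarith
      then have "(\<lambda>k. of_real w ^ k / fact k * of_real (\<integral>x. x ^ k * exp (- R * x) \<partial>M)
          - of_real w ^ k / fact k * of_real (\<integral>x. x ^ k * exp (- R * x) \<partial>N))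
        sums (of_real (\<integral>x. exp (- (R - w) * x) \<partial>M) - of_real (\<integral>x. exp (- (R - w) * x) \<partial>M) :: complex)"
        using laplace_power_series[OF M fin w'] laplace_power_series[OF N finN w']
        by (intro sums_diff) (simp_all only: c eqr, simp_all)
      moreover have "of_real w ^ k / fact k * of_real (\<integral>x. x ^ k * exp (- R * x) \<partial>M)
          - of_real w ^ k / fact k * of_real (\<integral>x. x ^ k * exp (- R * x) \<partial>N) = (of_real (a k * w ^ k) :: complex)" for k
        by (simp add: a_def field_simps)
      ultimately have "(\<lambda>k. of_real (a k * w ^ k) :: complex) sums of_real 0" by simp
      then show "(\<lambda>k. a k * w ^ k) sums 0" by (simp only: sums_of_real_iff)
    qed
    then show ?thesis by (simp add: a_def)
  qed
  have cplx: "(\<integral>x. exp (- z * of_real x) \<partial>M) = (\<integral>x. exp (- z * of_real x) \<partial>N)" if z: "Re z > l0" for z :: complex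
  proof -
    define d where "d = Re z - l0"
    \<comment> \<open>Far enough to the right for \<open>z\<close> to lie in the disc around
      \<open>R\<close> that touches the line of abscissa \<open>l0\<close>. With
      \<open>u = R - Re z\<close> one has \<open>u * d = (Im z)\<^sup>2 + d\<close>, as
      \<open>pyth\<close> requires.\<close>
    define R where "R = Re z + (Im z)\<^sup>2 / d + 1"
    have d: "d > 0" using z by (simp add: d_def)
    have "(Im z)\<^sup>2 / d \<ge> 0" using d by simp
    then have R: "R > l0" using z by (simp add: R_def)
    have pyth: "u\<^sup>2 + b\<^sup>2 < (u + d)\<^sup>2" if ud: "u * d = b\<^sup>2 + d" for u b :: real
    proof -
      have "(u + d)\<^sup>2 = u\<^sup>2 + d\<^sup>2 + 2 * (b\<^sup>2 + d)" unfolding power2_sum using ud by simp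
      then show ?thesis using d by (auto intro!: add_nonneg_pos)
    qed
    have "(R - Re z)\<^sup>2 + (Im z)\<^sup>2 < (R - Re z + d)\<^sup>2"
      by (rule pyth) (use d in \<open>simp add: R_def field_simps\<close>)
    moreover have "R - Re z + d > 0" using d \<open>(Im z)\<^sup>2 / d \<ge> 0\<close> unfolding R_def by linarith
    ultimately have "sqrt ((R - Re z)\<^sup>2 + (Im z)\<^sup>2) < R - Re z + d"
      using real_sqrt_less_mono[of _ "(R - Re z + d)\<^sup>2"] by simp
    then have zz: "cmod (of_real R - z) < R - l0" by (simp add: cmod_def d_def)
    show ?thesis
      using laplace_power_series[OF M fin zz] laplace_power_series[OF N finN zz] mom[OF R]
      by (simp add: sums_unique2)
  qed
  \<comment> \<open>Weighting by \<open>exp (- r * x)\<close> and normalising gives probability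
    measures whose characteristic functions are the transforms on the line of abscissa
    \<open>r\<close>; the weight is removed again at the end. The zero measure cannot be normalised
    and is treated apart.\<close>
  define r where "r = l0 + 1"
  define m where "m = (\<integral>\<^sup>+x. ennreal (exp (- r * x)) \<partial>M)"
  have mN: "m = (\<integral>\<^sup>+x. ennreal (exp (- r * x)) \<partial>N)" using eq[of r] by (simp add: m_def r_def)
  have mf: "m < \<infinity>" using fin[of r] by (simp add: m_def r_def)
  show ?thesis
  proof (cases "m = 0")
    case True
    have "Q = null_measure borel" if Q [measurable_cong]: "sets Q = sets borel"
      and "(\<integral>\<^sup>+x. ennreal (exp (- r * x)) \<partial>Q) = 0" for Q
    proof -
      have "AE x in Q. False" using that(2) by (subst (asm) nn_integral_0_iff_AE) auto
      then have "emeasure Q (space Q) = 0"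
        by (simp add: ae_filter_eq_bot_iff[symmetric] trivial_limit_def)
      then have "emeasure Q A = 0" for A using emeasure_space[of Q A] by simp
      then show ?thesis by (intro measure_eqI) (auto simp: Q)
    qed
    then show ?thesis using True M N mN by (metis m_def)
  next
    case False
    define c where "c = enn2real m"
    have c: "m = ennreal c" "c > 0" using False mf by (auto simp: c_def less_top enn2real_positive_iff zero_less_iff_neq_zero)
    define T where "T Q = density Q (\<lambda>x. ennreal (exp (- r * x) / c))" for Q :: "real measure"
    have T: "real_distribution (T Q)" "\<And>t. char (T Q) t = (\<integral>x. exp (- (of_real r - \<i> * of_real t) * of_real x) \<partial>Q) / c"
      "Q = density (T Q) (\<lambda>x. ennreal (c / exp (- r * x)))"
      if Q [measurable_cong]: "sets Q = sets borel" and i: "(\<integral>\<^sup>+x. ennreal (exp (- r * x)) \<partial>Q) = m" for Q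
    proof -
      have "(\<integral>\<^sup>+x. ennreal (exp (- r * x) / c) \<partial>Q) = (\<integral>\<^sup>+x. ennreal (exp (- r * x)) / c \<partial>Q)"
        using c by (intro nn_integral_cong) (simp add: divide_ennreal)
      also have "\<dots> = m / c" using i by (subst nn_integral_divide) auto
      also have "\<dots> = 1" using c by (simp add: divide_ennreal)
      finally have "prob_space (T Q)"
        by (intro prob_spaceI) (simp add: T_def emeasure_density)
      then show "real_distribution (T Q)"
        by (simp add: real_distribution_def real_distribution_axioms_def T_def Q)
      show "char (T Q) t = (\<integral>x. exp (- (of_real r - \<i> * of_real t) * of_real x) \<partial>Q) / c" for t
      proof -
        have "char (T Q) t = (\<integral>x. (exp (- r * x) / c) *\<^sub>R iexp (t * x) \<partial>Q)"
          unfolding char_def T_def using c by (subst integral_density) auto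
        also have "\<dots> = (\<integral>x. exp (- (of_real r - \<i> * of_real t) * of_real x) / c \<partial>Q)"
          by (intro Bochner_Integration.integral_cong)
             (auto simp: scaleR_conv_of_real exp_of_real[symmetric] algebra_simps simp flip: exp_add)
        finally show ?thesis by simp
      qed
      show "Q = density (T Q) (\<lambda>x. ennreal (c / exp (- r * x)))"
        unfolding T_def using c
        by (subst density_density_eq) (auto simp: ennreal_mult[symmetric] density_1)
    qed
    have "T M = T N"
    proof (rule Levy_uniqueness)
      show "real_distribution (T M)" "real_distribution (T N)" using T(1) M N mN m_def by auto
      show "char (T M) = char (T N)"
      proof
        fix t
        show "char (T M) t = char (T N) t"
          using T(2)[OF M, of t] T(2)[OF N, of t] cplx[of "of_real r - \<i> * of_real t"] mN m_def
          by (simp add: r_def)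
      qed
    qed
    then show ?thesis using T(3)[OF M] T(3)[OF N] mN m_def by metis
  qed
qed

corollary laplace_unique_AE:
  fixes f g :: "real \<Rightarrow> ennreal"
  assumes [measurable]: "f \<in> borel_measurable borel" "g \<in> borel_measurable borel"
    and fin: "\<And>l. l > l0 \<Longrightarrow> (\<integral>\<^sup>+x. ennreal (exp (- l * x)) * f x \<partial>lborel) < \<infinity>"
    and eq: "\<And>l. l > l0 \<Longrightarrow> (\<integral>\<^sup>+x. ennreal (exp (- l * x)) * f x \<partial>lborel) = (\<integral>\<^sup>+x. ennreal (exp (- l * x)) * g x \<partial>lborel)"
  shows "AE x in lborel. f x = g x"
proof -
  have "density lborel f = density lborel g"
    by (rule laplace_transform_unique[where ?l0.0 = l0]) (use fin eq in \<open>auto simp: nn_integral_density mult.commute\<close>)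
  then show ?thesis by (intro sigma_finite_measure.density_unique[OF sigma_finite_lborel]) auto
qed

section \<open>Levy processes\<close>

lemma cadlag_tendsto_right: "cadlag f \<Longrightarrow> t \<ge> 0 \<Longrightarrow> (f \<longlongrightarrow> f t) (at_right t)"
  by (auto simp: cadlag_def)

lemma cadlag_shift: "cadlag f \<Longrightarrow> cadlag (\<lambda>t. x + f t)"
  unfolding cadlag_def
proof safe
  fix t :: real assume *: "\<forall>t\<ge>0. (f \<longlongrightarrow> f t) (at_right t)" "\<forall>t>0. \<exists>l. (f \<longlongrightarrow> l) (at_left t)"
  show "((\<lambda>t. x + f t) \<longlongrightarrow> x + f t) (at_right t)" if "t \<ge> 0"
    using * that by (intro tendsto_intros) auto
  show "\<exists>l. ((\<lambda>t. x + f t) \<longlongrightarrow> l) (at_left t)" if t: "t > 0"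
  proof -
    obtain l where "(f \<longlongrightarrow> l) (at_left t)" using * t by auto
    then have "((\<lambda>t. x + f t) \<longlongrightarrow> x + l) (at_left t)" by (intro tendsto_intros)
    then show ?thesis by blast
  qed
qed

lemma tendsto_eventually_bounded:
  fixes f :: "real \<Rightarrow> real"
  assumes "(f \<longlongrightarrow> l) F" shows "eventually (\<lambda>r. \<bar>f r\<bar> \<le> \<bar>l\<bar> + 1) F"
proof -
  have "eventually (\<lambda>r. dist (f r) l < 1) F" using assms by (rule tendstoD) simp
  then show ?thesis by eventually_elim (simp add: dist_real_def)
qed

text \<open>The one-sided limits bound \<open>f\<close> on a neighbourhood of each point, and
  finitely many such neighbourhoods cover the interval.\<close>

lemma cadlag_bounded:
  assumes "cadlag f" shows "\<exists>B. \<forall>s\<in>{0..t}. \<bar>f s\<bar> \<le> B"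
proof -
  have loc: "\<exists>U B. open U \<and> s \<in> U \<and> (\<forall>r\<in>U. r \<ge> 0 \<longrightarrow> \<bar>f r\<bar> \<le> B)" if s: "s \<in> {0..t}" for s
  proof -
    have r: "eventually (\<lambda>r. \<bar>f r\<bar> \<le> \<bar>f s\<bar> + 1) (at_right s)"
      using assms s by (intro tendsto_eventually_bounded cadlag_tendsto_right) auto
    obtain l where l: "eventually (\<lambda>r. r \<ge> 0 \<longrightarrow> \<bar>f r\<bar> \<le> l) (at_left s)"
    proof (cases "s = 0")
      case True
      have "eventually (\<lambda>r. r < (0::real)) (at_left 0)" by (simp add: eventually_at_filter)
      then have "eventually (\<lambda>r. r \<ge> 0 \<longrightarrow> \<bar>f r\<bar> \<le> 0) (at_left s)"
        using True by (auto elim!: eventually_mono)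
      then show ?thesis using that by blast
    next
      case False
      then have "s > 0" using s by simp
      then obtain l where "(f \<longlongrightarrow> l) (at_left s)" using assms unfolding cadlag_def by blast
      from tendsto_eventually_bounded[OF this] show ?thesis
        by (intro that[of "\<bar>l\<bar> + 1"]) (auto elim!: eventually_mono)
    qed
    define B where "B = max (\<bar>f s\<bar> + 1) l"
    have "eventually (\<lambda>r. r \<ge> 0 \<longrightarrow> \<bar>f r\<bar> \<le> B) (at s)"
      unfolding eventually_at_split
      by (intro conjI eventually_mono[OF l] eventually_mono[OF r]) (auto simp: B_def)
    then have "eventually (\<lambda>r. r \<ge> 0 \<longrightarrow> \<bar>f r\<bar> \<le> B) (nhds s)"
      by (simp add: eventually_nhds_conv_at B_def le_max_iff_disj)
    then show ?thesis by (auto simp: eventually_nhds)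
  qed
  then obtain U B where UB: "\<And>s. s \<in> {0..t} \<Longrightarrow> open (U s)" "\<And>s. s \<in> {0..t} \<Longrightarrow> s \<in> U s"
    "\<And>s r. s \<in> {0..t} \<Longrightarrow> r \<in> U s \<Longrightarrow> r \<ge> 0 \<Longrightarrow> \<bar>f r\<bar> \<le> (B s :: real)" by metis
  obtain C where C: "C \<subseteq> {0..t}" "finite C" "{0..t} \<subseteq> (\<Union>c\<in>C. U c)"
    by (rule compactE_image[of "{0..t}" "{0..t}" U]) (use UB in auto)
  have "\<bar>f s\<bar> \<le> (\<Sum>c\<in>C. \<bar>B c\<bar>)" if s: "s \<in> {0..t}" for s
  proof -
    obtain c where c: "c \<in> C" "s \<in> U c" using C s by auto
    then have "\<bar>f s\<bar> \<le> B c" using UB(3)[of c s] C s by auto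
    also have "\<dots> \<le> \<bar>B c\<bar>" by simp
    also have "\<dots> \<le> (\<Sum>c\<in>C. \<bar>B c\<bar>)" using c C by (intro member_le_sum) auto
    finally show ?thesis .
  qed
  then show ?thesis by blast
qed

text \<open>A value below \<open>c\<close> at \<open>r\<close> would persist immediately to the
  right of \<open>r\<close>. This is why \<open>r < t\<close> is required: at the right end of the
  interval no such room is left.\<close>

lemma cadlag_ge_of_dense:
  assumes f: "cadlag f" and r: "0 \<le> r" "r < t"
    and dense: "\<And>a b. 0 \<le> a \<Longrightarrow> a < b \<Longrightarrow> b \<le> t \<Longrightarrow> \<exists>q. a < q \<and> q < b \<and> f q \<ge> c"
  shows "f r \<ge> c"
proof (rule ccontr)
  assume "\<not> f r \<ge> c"
  then have "eventually (\<lambda>s. f s < c) (at_right r)"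
    using order_tendstoD(2)[OF cadlag_tendsto_right[OF f r(1)]] by auto
  then obtain b where b: "b > r" "\<And>s. r < s \<Longrightarrow> s < b \<Longrightarrow> f s < c"
    by (auto simp: eventually_at_right_field)
  obtain q where "r < q" "q < min b t" "f q \<ge> c"
    using dense[of r "min b t"] r b by auto
  then show False using b(2)[of q] by auto
qed

lemma dyadic_between:
  fixes a b h :: real
  assumes "0 \<le> a" "a < b" "h > 0"
  obtains j k where "a < real k * (h / 2 ^ j)" "real k * (h / 2 ^ j) < b"
proof -
  obtain j where j: "h / (b - a) < 2 ^ j" using real_arch_pow[of 2 "h / (b - a)"] by auto
  define d where "d = h / 2 ^ j"
  have d: "d > 0" "d < b - a" using j assms by (auto simp: d_def field_simps)
  define k where "k = nat (\<lfloor>a / d\<rfloor> + 1)"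
  have nn: "\<lfloor>a / d\<rfloor> \<ge> 0" using assms d by simp
  have rk: "real k = of_int \<lfloor>a / d\<rfloor> + 1" using nn by (simp add: k_def)
  have "a / d < real k" "real k \<le> a / d + 1" unfolding rk by linarith+
  then have "a < real k * d" "real k * d \<le> a + d" using d by (auto simp: field_simps)
  then show ?thesis using d by (intro that[of k j]) (auto simp: d_def)
qed

text \<open>Positivity of an uncountable infimum becomes a countable condition, hence a measurable
  one. The uniform margin \<open>1 / Suc m\<close> is what survives the passage from dyadic times to
  all times.\<close>

lemma INF_pos_iff_dyadic:
  assumes f: "cadlag f" and t: "t \<ge> 0"
  shows "(INF s\<in>{0..t}. f s) > 0 \<longleftrightarrow>
    (\<exists>m::nat. \<forall>j k. real k * (t / 2 ^ j) \<le> t \<longrightarrow> f (real k * (t / 2 ^ j)) \<ge> 1 / real (Suc m))"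
proof
  obtain B where B: "\<forall>s\<in>{0..t}. \<bar>f s\<bar> \<le> B" using cadlag_bounded[OF f] by blast
  then have bdd: "bdd_below (f ` {0..t})"
    by (intro bdd_belowI2[of _ "- B"]) (use abs_le_D2 in fastforce)
  assume pos: "(INF s\<in>{0..t}. f s) > 0"
  then obtain m where m: "1 / real (Suc m) < (INF s\<in>{0..t}. f s)"
    by (meson nat_approx_posE)
  have "f s \<ge> 1 / real (Suc m)" if "s \<in> {0..t}" for s
    using cINF_lower[OF bdd that] m by linarith
  then show "\<exists>m::nat. \<forall>j k. real k * (t / 2 ^ j) \<le> t \<longrightarrow> f (real k * (t / 2 ^ j)) \<ge> 1 / real (Suc m)"
    using t by (intro exI[of _ m]) auto
next
  assume "\<exists>m::nat. \<forall>j k. real k * (t / 2 ^ j) \<le> t \<longrightarrow> f (real k * (t / 2 ^ j)) \<ge> 1 / real (Suc m)"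
  then obtain m where m: "\<And>j k. real k * (t / 2 ^ j) \<le> t \<Longrightarrow> f (real k * (t / 2 ^ j)) \<ge> 1 / real (Suc m)" by blast
  have "f s \<ge> 1 / real (Suc m)" if s: "s \<in> {0..t}" for s
  proof (cases "s = t")
    \<comment> \<open>The endpoint, out of reach of approximation from the right, is itself the
      dyadic time with \<open>k = 1\<close> and \<open>j = 0\<close>.\<close>
    case True then show ?thesis using m[of 1 0] by simp
  next
    case False
    show ?thesis
    proof (rule cadlag_ge_of_dense[OF f])
      show "0 \<le> s" "s < t" using s False by auto
      fix a b :: real assume ab: "0 \<le> a" "a < b" "b \<le> t"
      obtain j k where "a < real k * (t / 2 ^ j)" "real k * (t / 2 ^ j) < b"
        by (rule dyadic_between[of a b t]) (use ab in \<open>auto intro: that\<close>)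
      then show "\<exists>q>a. q < b \<and> 1 / real (Suc m) \<le> f q" using m[of k j] ab by auto
    qed
  qed
  then have "1 / real (Suc m) \<le> (INF s\<in>{0..t}. f s)" using t by (intro cINF_greatest) auto
  then show "(INF s\<in>{0..t}. f s) > 0" by (rule less_le_trans[rotated]) simp
qed

text \<open>The process is the pointwise limit of processes that are constant in time on grid cells.
  Truncation by \<open>max 0\<close> extends it to negative times, so that the whole Borel line can
  serve as time axis.\<close>

lemma measurable_right_continuous:
  fixes X :: "real \<Rightarrow> 'a \<Rightarrow> real"
  assumes [measurable]: "\<And>t. t \<ge> 0 \<Longrightarrow> X t \<in> borel_measurable M"
    and right: "\<And>t \<omega>. t \<ge> 0 \<Longrightarrow> \<omega> \<in> space M \<Longrightarrow> ((\<lambda>s. X s \<omega>) \<longlongrightarrow> X t \<omega>) (at_right t)"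
  shows "(\<lambda>(s, \<omega>). X (max 0 s) \<omega>) \<in> borel_measurable (borel \<Otimes>\<^sub>M M)"
proof -
  \<comment> \<open>The added 1 puts the grid point strictly to the right of \<open>max 0 s\<close>,
    so the limit along \<open>at_right\<close> applies even when \<open>s\<close> is on the
    grid.\<close>
  define q where "q n s = real (nat \<lfloor>real (Suc n) * max 0 s\<rfloor> + 1) / real (Suc n)" for n and s :: real
  have qb: "max 0 s < q n s" "q n s \<le> max 0 s + 1 / real (Suc n)" for n s
  proof -
    define m N where "m = max 0 s" and "N = real (Suc n)"
    have N: "N > 0" and m: "m \<ge> 0" by (auto simp: N_def m_def)
    have "real (nat \<lfloor>N * m\<rfloor> + 1) = of_int \<lfloor>N * m\<rfloor> + 1" using N m by simp
    then have q: "q n s = (of_int \<lfloor>N * m\<rfloor> + 1) / N" by (simp add: q_def m_def N_def)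
    have "N * m < of_int \<lfloor>N * m\<rfloor> + 1" "of_int \<lfloor>N * m\<rfloor> + 1 \<le> N * m + 1" by linarith+
    then have "m < q n s" "q n s \<le> m + 1 / N" unfolding q using N by (simp_all add: field_simps)
    then show "max 0 s < q n s" "q n s \<le> max 0 s + 1 / real (Suc n)" by (simp_all add: m_def N_def)
  qed
  show ?thesis
  proof (rule borel_measurable_LIMSEQ_real[where u = "\<lambda>n (s, \<omega>). X (q n s) \<omega>"])
    fix n
    have "(\<lambda>p. (\<lambda>k p. X (real (k + 1) / real (Suc n)) (snd p)) (nat \<lfloor>real (Suc n) * max 0 (fst p)\<rfloor>) p)
      \<in> borel_measurable (borel \<Otimes>\<^sub>M M)"
      by (rule measurable_compose_countable) measurable
    then show "(\<lambda>(s, \<omega>). X (q n s) \<omega>) \<in> borel_measurable (borel \<Otimes>\<^sub>M M)"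
      by (simp add: q_def split_beta')
  next
    fix p :: "real \<times> 'a" assume p: "p \<in> space (borel \<Otimes>\<^sub>M M)"
    obtain s \<omega> where [simp]: "p = (s, \<omega>)" by (cases p)
    have "filterlim (\<lambda>n. q n s) (at_right (max 0 s)) sequentially"
      unfolding filterlim_at
    proof
      show "eventually (\<lambda>n. q n s \<in> {max 0 s<..} \<and> q n s \<noteq> max 0 s) sequentially"
        using qb(1)[of s] by (intro always_eventually allI) (simp add: less_imp_neq[symmetric])
      have "(\<lambda>n. max 0 s + 1 / real (Suc n)) \<longlonglongrightarrow> max 0 s + 0"
        by (intro tendsto_intros LIMSEQ_inverse_real_of_nat[unfolded inverse_eq_divide])
      moreover have "max 0 s \<le> q n s" for n using qb(1)[of s n] by (rule less_imp_le)
      ultimately show "(\<lambda>n. q n s) \<longlonglongrightarrow> max 0 s"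
        using qb(2) by (intro tendsto_sandwich[of "\<lambda>_. max 0 s" "\<lambda>n. q n s" _ "\<lambda>n. max 0 s + 1 / real (Suc n)"]
          always_eventually allI) (auto simp del: of_nat_Suc)
    qed
    then show "(\<lambda>n. (case p of (s, \<omega>) \<Rightarrow> X (q n s) \<omega>)) \<longlonglongrightarrow> (case p of (s, \<omega>) \<Rightarrow> X (max 0 s) \<omega>)"
      using right[of "max 0 s" \<omega>] p by (auto simp: space_pair_measure intro: filterlim_compose)
  qed
qed

lemma (in prob_space) nn_integral_indep_var:
  assumes ind: "indep_var S A T Y" and f [measurable]: "f \<in> borel_measurable (S \<Otimes>\<^sub>M T)"
  shows "(\<integral>\<^sup>+\<omega>. f (A \<omega>, Y \<omega>) \<partial>M) = (\<integral>\<^sup>+\<omega>. \<integral>\<^sup>+\<omega>'. f (A \<omega>, Y \<omega>') \<partial>M \<partial>M)"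
proof -
  have rv [measurable]: "A \<in> measurable M S" "Y \<in> measurable M T"
    and d: "distr M S A \<Otimes>\<^sub>M distr M T Y = distr M (S \<Otimes>\<^sub>M T) (\<lambda>x. (A x, Y x))"
    using ind by (auto simp: indep_var_distribution_eq)
  interpret Y: prob_space "distr M T Y" by (rule prob_space_distr) simp
  have "(\<integral>\<^sup>+\<omega>. f (A \<omega>, Y \<omega>) \<partial>M) = (\<integral>\<^sup>+p. f p \<partial>(distr M S A \<Otimes>\<^sub>M distr M T Y))"
    unfolding d by (subst nn_integral_distr) auto
  also have "\<dots> = (\<integral>\<^sup>+a. \<integral>\<^sup>+y. f (a, y) \<partial>distr M T Y \<partial>distr M S A)"
    by (rule Y.nn_integral_fst[symmetric]) simp
  also have "\<dots> = (\<integral>\<^sup>+\<omega>. \<integral>\<^sup>+y. f (A \<omega>, y) \<partial>distr M T Y \<partial>M)"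
    by (rule nn_integral_distr) auto
  also have "\<dots> = (\<integral>\<^sup>+\<omega>. \<integral>\<^sup>+\<omega>'. f (A \<omega>, Y \<omega>') \<partial>M \<partial>M)"
  proof (intro nn_integral_cong)
    fix \<omega> assume "\<omega> \<in> space M"
    then have "A \<omega> \<in> space S" using rv(1) by (rule measurable_space[rotated])
    then have "(\<lambda>y. f (A \<omega>, y)) \<in> borel_measurable T" by measurable
    then show "(\<integral>\<^sup>+y. f (A \<omega>, y) \<partial>distr M T Y) = (\<integral>\<^sup>+\<omega>'. f (A \<omega>, Y \<omega>') \<partial>M)"
      by (intro nn_integral_distr) auto
  qed
  finally show ?thesis .
qed

section \<open>Transition operators of a Levy process and the Markov property on a grid\<close>

locale levy = prob_space M for M :: "'a measure" +
  fixes V :: "real \<Rightarrow> 'a \<Rightarrow> real" and \<Psi> :: "real \<Rightarrow> real"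
  assumes levy: "levy_process M V" and laplace: "laplace_exponent M V \<Psi>"
begin

lemma V_meas [measurable]: "t \<ge> 0 \<Longrightarrow> V t \<in> borel_measurable M"
  using levy by (auto simp: levy_process_def)

lemma V_0: "\<omega> \<in> space M \<Longrightarrow> V 0 \<omega> = 0"
  using levy by (auto simp: levy_process_def)

lemma V_cadlag: "\<omega> \<in> space M \<Longrightarrow> cadlag (\<lambda>t. V t \<omega>)"
  using levy by (auto simp: levy_process_def)

lemma V_pair_meas: "(\<lambda>(s, \<omega>). V (max 0 s) \<omega>) \<in> borel_measurable (borel \<Otimes>\<^sub>M M)"
  by (intro measurable_right_continuous cadlag_tendsto_right V_cadlag) auto

lemma mgf: "t \<ge> 0 \<Longrightarrow> l \<ge> 0 \<Longrightarrow> (\<integral>\<omega>. exp (l * V t \<omega>) \<partial>M) = exp (t * \<Psi> l)"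
  using laplace by (auto simp: laplace_exponent_def)

lemma mgf_integrable: "t \<ge> 0 \<Longrightarrow> l \<ge> 0 \<Longrightarrow> integrable M (\<lambda>\<omega>. exp (l * V t \<omega>))"
  by (rule ccontr) (use mgf[of t l] not_integrable_integral_eq[of M "\<lambda>\<omega>. exp (l * V t \<omega>)"] in auto)

lemma nn_mgf: "t \<ge> 0 \<Longrightarrow> l \<ge> 0 \<Longrightarrow> (\<integral>\<^sup>+\<omega>. ennreal (exp (l * V t \<omega>)) \<partial>M) = ennreal (exp (t * \<Psi> l))"
  using mgf_integrable[of t l] mgf[of t l] by (simp add: nn_integral_eq_integral)

lemma Psi_0: "\<Psi> 0 = 0"
  using mgf[of 1 0] by (simp add: prob_space)

definition P :: "real \<Rightarrow> (real \<Rightarrow> ennreal) \<Rightarrow> real \<Rightarrow> ennreal" where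
  "P s \<phi> x = (\<integral>\<^sup>+\<omega>. \<phi> (x + V s \<omega>) \<partial>M)"

lemma P_measurable [measurable]:
  assumes s: "s \<ge> 0" and [measurable]: "\<phi> \<in> borel_measurable borel"
  shows "P s \<phi> \<in> borel_measurable borel"
proof -
  note V_meas[OF s, measurable]
  show ?thesis unfolding P_def by measurable
qed

lemma P_pair_measurable:
  assumes [measurable]: "\<phi> \<in> borel_measurable borel"
  shows "(\<lambda>(s, x). P (max 0 s) \<phi> x) \<in> borel_measurable (borel \<Otimes>\<^sub>M borel)"
proof -
  have "(\<lambda>((s, x), \<omega>). (s, \<omega>)) \<in> ((borel \<Otimes>\<^sub>M borel) \<Otimes>\<^sub>M M) \<rightarrow>\<^sub>M (borel \<Otimes>\<^sub>M M)"
    unfolding split_beta' by measurable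
  from measurable_compose[OF this V_pair_meas]
  have [measurable]: "(\<lambda>p. V (max 0 (fst (fst p))) (snd p)) \<in> borel_measurable ((borel \<Otimes>\<^sub>M borel) \<Otimes>\<^sub>M M)"
    by (simp add: split_beta')
  have "(\<lambda>((s, x), \<omega>). \<phi> (x + V (max 0 s) \<omega>)) \<in> borel_measurable ((borel \<Otimes>\<^sub>M borel) \<Otimes>\<^sub>M M)"
    unfolding split_beta' by measurable
  then show ?thesis unfolding P_def split_beta' by (intro borel_measurable_nn_integral) (simp add: split_beta')
qed

text \<open>Independence is given along a monotone sequence of times, so the grid and the extra time
  \<open>k * h + s\<close> are merged into one sequence, which stays constant after index
  \<open>k + 1\<close>.\<close>

lemma increment_indep:
  assumes "h \<ge> 0" "s \<ge> 0"
  shows "indep_var (PiM {..<k} (\<lambda>_. borel)) (\<lambda>\<omega>. \<lambda>i\<in>{..<k}. V (real (Suc i) * h) \<omega> - V (real i * h) \<omega>)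
     (PiM {k} (\<lambda>_. borel)) (\<lambda>\<omega>. \<lambda>i\<in>{k}. V (real k * h + s) \<omega> - V (real k * h) \<omega>)"
proof -
  define t where "t i = (if i \<le> k then real i * h else real k * h + s)" for i
  have "mono t"
  proof (rule monoI)
    fix i j :: nat assume "i \<le> j"
    then show "t i \<le> t j" using assms by (auto simp: t_def mult_right_mono intro: add_increasing2)
  qed
  moreover have "t 0 \<ge> 0" using assms by (simp add: t_def)
  ultimately have "indep_vars (\<lambda>_. borel) (\<lambda>i \<omega>. V (t (Suc i)) \<omega> - V (t i) \<omega>) {..<Suc k}"
    using levy by (auto simp: levy_process_def)
  then have "indep_var (PiM {..<k} (\<lambda>_. borel)) (\<lambda>\<omega>. \<lambda>i\<in>{..<k}. V (t (Suc i)) \<omega> - V (t i) \<omega>)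
      (PiM {k} (\<lambda>_. borel)) (\<lambda>\<omega>. \<lambda>i\<in>{k}. V (t (Suc i)) \<omega> - V (t i) \<omega>)"
    by (rule indep_var_restrict) auto
  moreover have "(\<lambda>\<omega>. \<lambda>i\<in>{..<k}. V (t (Suc i)) \<omega> - V (t i) \<omega>)
      = (\<lambda>\<omega>. \<lambda>i\<in>{..<k}. V (real (Suc i) * h) \<omega> - V (real i * h) \<omega>)"
    by (intro ext) (auto simp: t_def restrict_def)
  moreover have "(\<lambda>\<omega>. \<lambda>i\<in>{k}. V (t (Suc i)) \<omega> - V (t i) \<omega>)
      = (\<lambda>\<omega>. \<lambda>i\<in>{k}. V (real k * h + s) \<omega> - V (real k * h) \<omega>)"
    by (intro ext) (auto simp: t_def restrict_def)
  ultimately show ?thesis by simp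
qed

lemma increment_distr:
  assumes "s \<ge> 0" "t \<ge> 0" "\<phi> \<in> borel_measurable borel"
  shows "(\<integral>\<^sup>+\<omega>. \<phi> (V (t + s) \<omega> - V t \<omega>) \<partial>M) = (\<integral>\<^sup>+\<omega>. \<phi> (V s \<omega>) \<partial>M)"
proof -
  have "distr M borel (\<lambda>\<omega>. V (t + s) \<omega> - V t \<omega>) = distr M borel (V s)"
    using levy assms by (auto simp: levy_process_def)
  then have "(\<integral>\<^sup>+x. \<phi> x \<partial>distr M borel (\<lambda>\<omega>. V (t + s) \<omega> - V t \<omega>)) = (\<integral>\<^sup>+x. \<phi> x \<partial>distr M borel (V s))" by simp
  then show ?thesis using assms by (simp add: nn_integral_distr)
qed

definition stays :: "real set \<Rightarrow> real \<Rightarrow> nat \<Rightarrow> real \<Rightarrow> 'a set" where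
  "stays B h k x = {\<omega> \<in> space M. \<forall>j\<le>k. x + V (real j * h) \<omega> \<in> B}"

lemma stays_sets [measurable]: "B \<in> sets borel \<Longrightarrow> h \<ge> 0 \<Longrightarrow> stays B h k x \<in> sets M"
proof -
  assume [measurable]: "B \<in> sets borel" and h: "h \<ge> 0"
  have [measurable]: "V (real j * h) \<in> borel_measurable M" for j using h by (intro V_meas) simp
  show ?thesis unfolding stays_def by measurable
qed

text \<open>The event and the position at time \<open>k * h\<close> are functions of the increments
  up to that time. The increment over the following \<open>s\<close> is independent of them, and
  integrating it out produces \<open>P s\<close>.\<close>

lemma markov_grid:
  assumes B [measurable]: "B \<in> sets borel" and h: "h \<ge> 0" and s: "s \<ge> 0" and \<phi> [measurable]: "\<phi> \<in> borel_measurable borel"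
  shows "(\<integral>\<^sup>+\<omega>. indicator (stays B h k x) \<omega> * \<phi> (x + V (real k * h + s) \<omega>) \<partial>M)
       = (\<integral>\<^sup>+\<omega>. indicator (stays B h k x) \<omega> * P s \<phi> (x + V (real k * h) \<omega>) \<partial>M)"
proof -
  define A where "A \<omega> = (\<lambda>i\<in>{..<k}. V (real (Suc i) * h) \<omega> - V (real i * h) \<omega>)" for \<omega>
  define Y where "Y \<omega> = (\<lambda>i\<in>{k}. V (real k * h + s) \<omega> - V (real k * h) \<omega>)" for \<omega>
  define E where "E = {a \<in> space (PiM {..<k} (\<lambda>_. borel)). \<forall>j\<le>k. x + (\<Sum>i<j. a i) \<in> B}"
  define f where "f = (\<lambda>(a, y). indicator E a * \<phi> (x + (\<Sum>i<k. a i) + y k))"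
  have [measurable]: "(\<lambda>a. a i) \<in> borel_measurable (PiM {..<k} (\<lambda>_. borel :: real measure))" if "i < k" for i
    using that by (intro measurable_component_singleton) auto
  have sm [measurable]: "(\<lambda>a. (\<Sum>i<j. a i)) \<in> borel_measurable (PiM {..<k} (\<lambda>_. borel :: real measure))" if "j \<le> k" for j
    using that by (intro borel_measurable_sum) auto
  have [measurable]: "E \<in> sets (PiM {..<k} (\<lambda>_. borel))"
  proof -
    have "E = (\<Inter>j\<in>{..k}. {a \<in> space (PiM {..<k} (\<lambda>_. borel)). x + (\<Sum>i<j. a i) \<in> B})"
      by (auto simp: E_def)
    also have "\<dots> \<in> sets (PiM {..<k} (\<lambda>_. borel))"
      by (intro sets.finite_INT) measurable
    finally show ?thesis .
  qed
  have [measurable]: "(\<lambda>a. (\<Sum>i<k. a i)) \<in> borel_measurable (PiM {..<k} (\<lambda>_. borel :: real measure))" by (rule sm) simp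
  have fm [measurable]: "f \<in> borel_measurable (PiM {..<k} (\<lambda>_. borel) \<Otimes>\<^sub>M PiM {k} (\<lambda>_. borel))"
    unfolding f_def by measurable
  have tel: "(\<Sum>i<j. A \<omega> i) = V (real j * h) \<omega>" if "j \<le> k" "\<omega> \<in> space M" for j \<omega>
  proof -
    have "(\<Sum>i<j. A \<omega> i) = (\<Sum>i<j. V (real (Suc i) * h) \<omega> - V (real i * h) \<omega>)"
      using that by (intro sum.cong) (auto simp: A_def)
    also have "\<dots> = V (real j * h) \<omega> - V (real 0 * h) \<omega>" by (rule sum_lessThan_telescope)
    finally show ?thesis using V_0 that by simp
  qed
  have AE: "A \<omega> \<in> E \<longleftrightarrow> \<omega> \<in> stays B h k x" if "\<omega> \<in> space M" for \<omega>
    using that tel by (auto simp: E_def stays_def space_PiM A_def[THEN arg_cong, of "\<lambda>f. f \<in> _"])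
  have ind: "indep_var (PiM {..<k} (\<lambda>_. borel)) A (PiM {k} (\<lambda>_. borel)) Y"
    unfolding A_def Y_def by (rule increment_indep[OF h s])
  have "(\<integral>\<^sup>+\<omega>. indicator (stays B h k x) \<omega> * \<phi> (x + V (real k * h + s) \<omega>) \<partial>M) = (\<integral>\<^sup>+\<omega>. f (A \<omega>, Y \<omega>) \<partial>M)"
    by (intro nn_integral_cong) (simp add: f_def tel AE indicator_def Y_def)
  also have "\<dots> = (\<integral>\<^sup>+\<omega>. \<integral>\<^sup>+\<omega>'. f (A \<omega>, Y \<omega>') \<partial>M \<partial>M)"
    by (rule nn_integral_indep_var[OF ind fm])
  also have "\<dots> = (\<integral>\<^sup>+\<omega>. indicator (stays B h k x) \<omega> * P s \<phi> (x + V (real k * h) \<omega>) \<partial>M)"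
  proof (intro nn_integral_cong)
    fix \<omega> assume w: "\<omega> \<in> space M"
    have "(\<integral>\<^sup>+\<omega>'. f (A \<omega>, Y \<omega>') \<partial>M) = (\<integral>\<^sup>+\<omega>'. (\<lambda>y. indicator (stays B h k x) \<omega> * \<phi> (x + V (real k * h) \<omega> + y)) (V (real k * h + s) \<omega>' - V (real k * h) \<omega>') \<partial>M)"
      using w by (intro nn_integral_cong) (simp add: f_def tel AE indicator_def Y_def)
    also have "\<dots> = (\<integral>\<^sup>+\<omega>'. indicator (stays B h k x) \<omega> * \<phi> (x + V (real k * h) \<omega> + V s \<omega>') \<partial>M)"
      using h s by (intro increment_distr) auto
    also have "\<dots> = indicator (stays B h k x) \<omega> * P s \<phi> (x + V (real k * h) \<omega>)"
      unfolding P_def using s by (intro nn_integral_cmult) measurable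
    finally show "(\<integral>\<^sup>+\<omega>'. f (A \<omega>, Y \<omega>') \<partial>M) = indicator (stays B h k x) \<omega> * P s \<phi> (x + V (real k * h) \<omega>)" .
  qed
  finally show ?thesis .
qed

lemma stays_Suc:
  "\<omega> \<in> space M \<Longrightarrow> (indicator (stays B h (Suc k) x) \<omega> :: ennreal) =
     indicator (stays B h k x) \<omega> * indicator B (x + V (real k * h + h) \<omega>)"
  by (auto simp: stays_def indicator_def le_Suc_eq algebra_simps)

text \<open>\<open>markov_grid\<close> separates the last step from the past; induction on the
  number of steps turns this into a decomposition at the first step, as the renewal equation for the
  supremum requires.\<close>

lemma stays_first_step:
  assumes B [measurable]: "B \<in> sets borel" and h: "h \<ge> 0" and "\<phi> \<in> borel_measurable borel"
  shows "(\<integral>\<^sup>+\<omega>. indicator (stays B h (Suc k) x) \<omega> * \<phi> (x + V (real (Suc k) * h) \<omega>) \<partial>M)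
    = indicator B x * P h (\<lambda>z. \<integral>\<^sup>+\<omega>. indicator (stays B h k z) \<omega> * \<phi> (z + V (real k * h) \<omega>) \<partial>M) x"
  using assms(3)
proof (induction k arbitrary: x \<phi>)
  have step: "(\<integral>\<^sup>+\<omega>. indicator (stays B h (Suc k) x) \<omega> * \<phi> (x + V (real (Suc k) * h) \<omega>) \<partial>M)
    = (\<integral>\<^sup>+\<omega>. indicator (stays B h k x) \<omega> * P h (\<lambda>z. indicator B z * \<phi> z) (x + V (real k * h) \<omega>) \<partial>M)"
    if [measurable]: "\<phi> \<in> borel_measurable borel" for k \<phi> x
  proof -
    have "(\<integral>\<^sup>+\<omega>. indicator (stays B h (Suc k) x) \<omega> * \<phi> (x + V (real (Suc k) * h) \<omega>) \<partial>M)
       = (\<integral>\<^sup>+\<omega>. indicator (stays B h k x) \<omega> * (\<lambda>z. indicator B z * \<phi> z) (x + V (real k * h + h) \<omega>) \<partial>M)"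
      by (intro nn_integral_cong) (simp add: stays_Suc mult.assoc algebra_simps)
    also have "\<dots> = (\<integral>\<^sup>+\<omega>. indicator (stays B h k x) \<omega> * P h (\<lambda>z. indicator B z * \<phi> z) (x + V (real k * h) \<omega>) \<partial>M)"
      by (intro markov_grid h) auto
    finally show ?thesis .
  qed
  have zero: "(\<integral>\<^sup>+\<omega>. indicator (stays B h 0 z) \<omega> * \<psi> (z + V (real 0 * h) \<omega>) \<partial>M) = indicator B z * \<psi> z" for \<psi> z
  proof -
    have "(\<integral>\<^sup>+\<omega>. indicator (stays B h 0 z) \<omega> * \<psi> (z + V (real 0 * h) \<omega>) \<partial>M) = (\<integral>\<^sup>+\<omega>. indicator B z * \<psi> z \<partial>M)"
      by (intro nn_integral_cong) (auto simp: stays_def V_0 indicator_def)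
    then show ?thesis by (simp add: emeasure_space_1)
  qed
  case 0
  show ?case unfolding step[OF 0] zero by (simp only: zero)
next
  case (Suc k)
  note [measurable] = Suc.prems
  have step: "(\<integral>\<^sup>+\<omega>. indicator (stays B h (Suc k) x) \<omega> * \<phi> (x + V (real (Suc k) * h) \<omega>) \<partial>M)
    = (\<integral>\<^sup>+\<omega>. indicator (stays B h k x) \<omega> * P h (\<lambda>z. indicator B z * \<phi> z) (x + V (real k * h) \<omega>) \<partial>M)"
    for k x
  proof -
    have "(\<integral>\<^sup>+\<omega>. indicator (stays B h (Suc k) x) \<omega> * \<phi> (x + V (real (Suc k) * h) \<omega>) \<partial>M)
       = (\<integral>\<^sup>+\<omega>. indicator (stays B h k x) \<omega> * (\<lambda>z. indicator B z * \<phi> z) (x + V (real k * h + h) \<omega>) \<partial>M)"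
      by (intro nn_integral_cong) (simp add: stays_Suc mult.assoc algebra_simps)
    also have "\<dots> = (\<integral>\<^sup>+\<omega>. indicator (stays B h k x) \<omega> * P h (\<lambda>z. indicator B z * \<phi> z) (x + V (real k * h) \<omega>) \<partial>M)"
      by (intro markov_grid h) auto
    finally show ?thesis .
  qed
  show ?case
    unfolding step by (rule Suc.IH) (use h in measurable)
qed

section \<open>Sign of the Laplace exponent under drift to minus infinity\<close>

lemma exp_step_tendsto: "(\<lambda>n. real (Suc n) * (exp (v / real (Suc n)) - 1)) \<longlonglongrightarrow> v"
proof -
  have "((\<lambda>x. exp (v * x)) has_real_derivative v) (at 0)"
    by (auto intro!: derivative_eq_intros)
  then have "((\<lambda>h. (exp (v * h) - 1) / h) \<longlongrightarrow> v) (at 0)" by (simp add: DERIV_def)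
  moreover have "filterlim (\<lambda>n. 1 / real (Suc n)) (at 0) sequentially"
    unfolding filterlim_at using LIMSEQ_inverse_real_of_nat by (simp add: inverse_eq_divide)
  ultimately have "(\<lambda>n. (exp (v * (1 / real (Suc n))) - 1) / (1 / real (Suc n))) \<longlonglongrightarrow> v"
    by (rule filterlim_compose)
  then show ?thesis by (simp add: mult.commute del: of_nat_Suc)
qed

text \<open>Bernoulli's inequality applied to \<open>exp (v / Suc n)\<close>. It makes the
  difference quotients of the exponential at 0 subject to one integrable upper bound.\<close>

lemma exp_step_le: "real (Suc n) * (exp (v / real (Suc n)) - 1) \<le> exp v - 1"
proof -
  have "1 + real (Suc n) * (exp (v / real (Suc n)) - 1) \<le> (1 + (exp (v / real (Suc n)) - 1)) ^ Suc n"
    by (rule Bernoulli_inequality) simp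
  also have "\<dots> = exp v" by (simp add: exp_of_nat_mult[symmetric] del: of_nat_Suc power_Suc)
  finally show ?thesis by simp
qed

text \<open>The mean is the right derivative at 0 of the moment generating function. Fatou's lemma,
  applied to the nonnegative differences \<open>exp (V t) - 1 - f n\<close>, also controls the
  negative part of \<open>V t\<close>.\<close>

lemma mean_nonneg:
  assumes Psi: "\<And>l. l > 0 \<Longrightarrow> \<Psi> l \<ge> 0" and t: "t \<ge> 0"
  shows "integrable M (V t)" and "(\<integral>\<omega>. V t \<omega> \<partial>M) \<ge> 0"
proof -
  note V_meas[OF t, measurable]
  define f where "f n \<omega> = real (Suc n) * (exp (V t \<omega> / real (Suc n)) - 1)" for n \<omega>
  define c where "c = exp (t * \<Psi> 1) - 1"
  have [measurable]: "f n \<in> borel_measurable M" for n unfolding f_def by measurable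
  have ei: "integrable M (\<lambda>\<omega>. exp (V t \<omega>) - 1)" "(\<integral>\<omega>. exp (V t \<omega>) - 1 \<partial>M) = c"
    using mgf_integrable[OF t, of 1] mgf[OF t, of 1] by (auto simp: prob_space c_def)
  have fi: "integrable M (f n)" "(\<integral>\<omega>. f n \<omega> \<partial>M) \<ge> 0" for n
  proof -
    have i: "integrable M (\<lambda>\<omega>. exp (1 / real (Suc n) * V t \<omega>))" by (rule mgf_integrable[OF t]) simp
    then show "integrable M (f n)" unfolding f_def by (intro integrable_mult_right Bochner_Integration.integrable_diff) (auto simp: field_simps)
    have "(\<integral>\<omega>. f n \<omega> \<partial>M) = real (Suc n) * (exp (t * \<Psi> (1 / real (Suc n))) - 1)"
      using i mgf[OF t, of "1 / real (Suc n)"] by (simp add: f_def prob_space)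
    also have "\<dots> \<ge> 0" using t Psi[of "1 / real (Suc n)"] by simp
    finally show "(\<integral>\<omega>. f n \<omega> \<partial>M) \<ge> 0" .
  qed
  have lim: "(\<lambda>n. ennreal (exp (V t \<omega>) - 1 - f n \<omega>)) \<longlonglongrightarrow> ennreal (exp (V t \<omega>) - 1 - V t \<omega>)" for \<omega>
    unfolding f_def by (intro tendsto_ennrealI tendsto_diff tendsto_const exp_step_tendsto)
  have nn: "(\<integral>\<^sup>+\<omega>. ennreal (exp (V t \<omega>) - 1 - V t \<omega>) \<partial>M) \<le> ennreal c"
  proof -
    have "(\<integral>\<^sup>+\<omega>. ennreal (exp (V t \<omega>) - 1 - V t \<omega>) \<partial>M) = (\<integral>\<^sup>+\<omega>. liminf (\<lambda>n. ennreal (exp (V t \<omega>) - 1 - f n \<omega>)) \<partial>M)"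
      using lim_imp_Liminf[OF _ lim] by simp
    also have "\<dots> \<le> liminf (\<lambda>n. \<integral>\<^sup>+\<omega>. ennreal (exp (V t \<omega>) - 1 - f n \<omega>) \<partial>M)"
      by (rule nn_integral_liminf) simp
    also have "\<dots> \<le> liminf (\<lambda>n. ennreal c)"
    proof (intro Liminf_mono always_eventually allI)
      fix n
      have di: "integrable M (\<lambda>\<omega>. exp (V t \<omega>) - 1 - f n \<omega>)"
        by (rule Bochner_Integration.integrable_diff[OF ei(1) fi(1)])
      have "0 \<le> exp (V t \<omega>) - 1 - f n \<omega>" for \<omega>
        using exp_step_le[of n "V t \<omega>"] unfolding f_def by linarith
      then have "(\<integral>\<^sup>+\<omega>. ennreal (exp (V t \<omega>) - 1 - f n \<omega>) \<partial>M) = ennreal (\<integral>\<omega>. exp (V t \<omega>) - 1 - f n \<omega> \<partial>M)"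
        by (intro nn_integral_eq_integral di) auto
      also have "\<dots> \<le> ennreal c"
        using ei(2) fi(2)[of n] unfolding Bochner_Integration.integral_diff[OF ei(1) fi(1)] by (intro ennreal_leI) linarith
      finally show "(\<integral>\<^sup>+\<omega>. ennreal (exp (V t \<omega>) - 1 - f n \<omega>) \<partial>M) \<le> ennreal c" .
    qed
    also have "\<dots> = ennreal c" by (simp add: Liminf_const)
    finally show ?thesis .
  qed
  have pos: "exp (V t \<omega>) - 1 - V t \<omega> \<ge> 0" for \<omega> using exp_ge_add_one_self[of "V t \<omega>"] by linarith
  have gi: "integrable M (\<lambda>\<omega>. exp (V t \<omega>) - 1 - V t \<omega>)"
    using nn pos by (intro integrableI_bounded) (auto simp: less_top[symmetric] top_unique intro: le_less_trans)
  have "integrable M (\<lambda>\<omega>. (exp (V t \<omega>) - 1) - (exp (V t \<omega>) - 1 - V t \<omega>))"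
    by (intro Bochner_Integration.integrable_diff ei gi)
  then show vi: "integrable M (V t)" by simp
  have "(\<integral>\<omega>. exp (V t \<omega>) - 1 - V t \<omega> \<partial>M) \<le> c"
  proof -
    have "ennreal (\<integral>\<omega>. exp (V t \<omega>) - 1 - V t \<omega> \<partial>M) \<le> ennreal c"
      using nn nn_integral_eq_integral[OF gi] pos by simp
    moreover have "c \<ge> 0" using Psi[of 1] t by (simp add: c_def)
    ultimately show ?thesis by simp
  qed
  then show "(\<integral>\<omega>. V t \<omega> \<partial>M) \<ge> 0"
    using ei vi by (simp add: Bochner_Integration.integral_diff[of M "\<lambda>\<omega>. exp (V t \<omega>) - 1"])
qed

text \<open>Law of the supremum of the walk with step \<open>h\<close>; \<open>supcdf h a = 0\<close> for \<open>a < 0\<close>.\<close>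
definition supcdf :: "real \<Rightarrow> real \<Rightarrow> real" where
  "supcdf h a = measure M {\<omega> \<in> space M. \<forall>j. V (real j * h) \<omega> \<le> a}"

lemma supcdf_sets [measurable]:
  assumes h: "h \<ge> 0" shows "{\<omega> \<in> space M. \<forall>j. V (real j * h) \<omega> \<le> a} \<in> sets M"
proof -
  have [measurable]: "V (real j * h) \<in> borel_measurable M" for j using h by (intro V_meas) simp
  show ?thesis by measurable
qed

lemma supcdf_mono: "h \<ge> 0 \<Longrightarrow> a \<le> b \<Longrightarrow> supcdf h a \<le> supcdf h b"
  unfolding supcdf_def by (intro finite_measure_mono supcdf_sets) (auto intro: order_trans)

lemma supcdf_bounds: "0 \<le> supcdf h a" "supcdf h a \<le> 1"
  by (auto simp: supcdf_def)

lemma supcdf_neg: "a < 0 \<Longrightarrow> supcdf h a = 0"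
proof -
  assume "a < 0"
  then have "{\<omega> \<in> space M. \<forall>j. V (real j * h) \<omega> \<le> a} = {}"
    by (auto simp: V_0 intro!: exI[of _ "0::nat"])
  then show ?thesis by (simp only: supcdf_def measure_empty)
qed

lemma supcdf_meas [measurable]: "h \<ge> 0 \<Longrightarrow> supcdf h \<in> borel_measurable borel"
  by (intro borel_measurable_mono monoI supcdf_mono)

text \<open>The supremum of the walk is the maximum of 0 and the first step plus an independent copy
  of the supremum; the 0 is harmless because \<open>a \<ge> 0\<close>. The event is viewed as a walk
  started from \<open>- a\<close> that stays in \<open>{..0}\<close>, which is the form of
  \<open>stays_first_step\<close>.\<close>

lemma supcdf_step:
  assumes h: "h \<ge> 0" and a: "a \<ge> 0"
  shows "ennreal (supcdf h a) = (\<integral>\<^sup>+\<omega>. ennreal (supcdf h (a - V h \<omega>)) \<partial>M)"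
proof -
  note V_meas[OF h, measurable] supcdf_meas[OF h, measurable]
  define r where "r k a = emeasure M (stays {..0} h k (- a))" for k a
  have lim: "(\<lambda>k. r k a) \<longlonglongrightarrow> ennreal (supcdf h a)" for a
  proof -
    have "(\<lambda>k. r k a) \<longlonglongrightarrow> emeasure M (\<Inter>k. stays {..0} h k (- a))"
      unfolding r_def using h by (intro Lim_emeasure_decseq) (auto simp: decseq_def stays_def)
    also have "(\<Inter>k. stays {..0} h k (- a)) = {\<omega> \<in> space M. \<forall>j. V (real j * h) \<omega> \<le> a}"
      by (auto simp: stays_def)
    finally show ?thesis by (simp add: supcdf_def emeasure_eq_measure)
  qed
  have step: "r (Suc k) a = (\<integral>\<^sup>+\<omega>. r k (a - V h \<omega>) \<partial>M)" for k
  proof -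
    have "r (Suc k) a = (\<integral>\<^sup>+\<omega>. indicator (stays {..0} h (Suc k) (-a)) \<omega> * 1 \<partial>M)"
      using h by (simp add: r_def)
    also have "\<dots> = indicator {..0} (-a) * P h (\<lambda>z. \<integral>\<^sup>+\<omega>. indicator (stays {..0} h k z) \<omega> * 1 \<partial>M) (-a)"
      by (rule stays_first_step) (use h in auto)
    finally show ?thesis using a h by (simp add: r_def P_def)
  qed
  have rm: "(\<lambda>\<omega>. r k (a - V h \<omega>)) \<in> borel_measurable M" for k
  proof -
    have "mono (\<lambda>a. measure M (stays {..0} h k (- a)))"
      using h by (intro monoI finite_measure_mono stays_sets) (auto simp: stays_def intro: order_trans)
    then have [measurable]: "(\<lambda>a. measure M (stays {..0} h k (- a))) \<in> borel_measurable borel" by (rule borel_measurable_mono)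
    have "r k = (\<lambda>a. ennreal (measure M (stays {..0} h k (- a))))" by (rule ext) (simp add: r_def emeasure_eq_measure)
    then have [measurable]: "r k \<in> borel_measurable borel" by simp
    show ?thesis by measurable
  qed
  have "(\<lambda>k. \<integral>\<^sup>+\<omega>. r k (a - V h \<omega>) \<partial>M) \<longlonglongrightarrow> (\<integral>\<^sup>+\<omega>. ennreal (supcdf h (a - V h \<omega>)) \<partial>M)"
  proof (rule nn_integral_dominated_convergence[where w = "\<lambda>_. 1"])
    show "\<And>j. AE \<omega> in M. r j (a - V h \<omega>) \<le> 1"
      by (auto simp: r_def emeasure_eq_measure)
    show "AE \<omega> in M. (\<lambda>i. r i (a - V h \<omega>)) \<longlonglongrightarrow> ennreal (supcdf h (a - V h \<omega>))" using lim by simp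
  qed (use rm in \<open>auto simp: emeasure_space_1\<close>)
  moreover have "(\<lambda>k. \<integral>\<^sup>+\<omega>. r k (a - V h \<omega>) \<partial>M) \<longlonglongrightarrow> ennreal (supcdf h a)"
    using LIMSEQ_Suc[OF lim[of a]] by (simp add: step)
  ultimately show ?thesis by (rule LIMSEQ_unique[rotated])
qed

text \<open>The primitive of \<open>supcdf h\<close> that vanishes at 0. It is 1-Lipschitz, so it
  can be integrated along \<open>V h\<close> as soon as \<open>V h\<close> has a mean, and its slope
  tends to 1 under the drift assumption.\<close>

definition supcdf_integral :: "real \<Rightarrow> real \<Rightarrow> real" where
  "supcdf_integral h u = (LINT b|lborel. indicator {..<u} b * supcdf h b)"

lemma supcdf_integral_integrable: "h \<ge> 0 \<Longrightarrow> integrable lborel (\<lambda>b. indicator {..<u} b * supcdf h b)"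
proof -
  assume h: "h \<ge> 0"
  note supcdf_meas[OF h, measurable]
  show ?thesis
    by (rule Bochner_Integration.integrable_bound[where f = "indicator {0..<max 0 u} :: real \<Rightarrow> real"])
       (auto simp: indicator_def supcdf_bounds supcdf_neg abs_of_nonneg not_less intro!: integrable_real_indicator)
qed

lemma supcdf_integral_diff:
  assumes h: "h \<ge> 0" and "u \<le> v"
  shows "supcdf_integral h v - supcdf_integral h u = (LINT b|lborel. indicator {u..<v} b * supcdf h b)"
    and "integrable lborel (\<lambda>b. indicator {u..<v} b * supcdf h b)"
    and "(v - u) * supcdf h u \<le> supcdf_integral h v - supcdf_integral h u" "supcdf_integral h v - supcdf_integral h u \<le> v - u"
proof -
  have eq: "indicator {u..<v} b * supcdf h b = indicator {..<v} b * supcdf h b - indicator {..<u} b * supcdf h b" for b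
    using assms by (auto simp: indicator_def)
  show 1: "integrable lborel (\<lambda>b. indicator {u..<v} b * supcdf h b)"
    unfolding eq by (intro Bochner_Integration.integrable_diff supcdf_integral_integrable h)
  show 2: "supcdf_integral h v - supcdf_integral h u = (LINT b|lborel. indicator {u..<v} b * supcdf h b)"
    unfolding eq supcdf_integral_def by (intro Bochner_Integration.integral_diff[symmetric] supcdf_integral_integrable h)
  have c: "(LINT b|lborel. indicator {u..<v} b * c) = (v - u) * c" "integrable lborel (\<lambda>b. indicator {u..<v} b * c)" for c :: real
    using assms by auto
  show "(v - u) * supcdf h u \<le> supcdf_integral h v - supcdf_integral h u"
    unfolding 2 c(1)[symmetric] by (intro integral_mono 1 c) (auto simp: indicator_def supcdf_mono h)
  have "supcdf_integral h v - supcdf_integral h u \<le> (v - u) * 1"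
    unfolding 2 c(1)[symmetric] by (intro integral_mono 1 c) (auto simp: indicator_def supcdf_bounds)
  then show "supcdf_integral h v - supcdf_integral h u \<le> v - u" by simp
qed

lemma supcdf_integral_nonneg: "supcdf_integral h u \<ge> 0"
  unfolding supcdf_integral_def by (intro integral_nonneg_AE) (auto simp: supcdf_bounds)

lemma supcdf_integral_mono: "h \<ge> 0 \<Longrightarrow> u \<le> v \<Longrightarrow> supcdf_integral h u \<le> supcdf_integral h v"
  using supcdf_integral_diff(3)[of h u v] supcdf_bounds(1)[of h u] by (smt (verit) mult_nonneg_nonneg)

lemma supcdf_integral_meas [measurable]: "h \<ge> 0 \<Longrightarrow> supcdf_integral h \<in> borel_measurable borel"
  by (intro borel_measurable_mono monoI supcdf_integral_mono)

lemma supcdf_integral_neg: "u \<le> 0 \<Longrightarrow> supcdf_integral h u = 0"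
proof -
  assume u: "u \<le> 0"
  have z: "indicator {..<u} b * supcdf h b = 0" for b using u by (auto simp: indicator_def supcdf_neg)
  show ?thesis unfolding supcdf_integral_def z by simp
qed

lemma supcdf_integral_lipschitz: "h \<ge> 0 \<Longrightarrow> \<bar>supcdf_integral h u - supcdf_integral h v\<bar> \<le> \<bar>u - v\<bar>"
  using supcdf_integral_diff(4)[of h u v] supcdf_integral_diff(4)[of h v u] supcdf_integral_mono[of h u v] supcdf_integral_mono[of h v u]
  by (cases "u \<le> v") auto

lemma supcdf_integral_identity:
  assumes h: "h \<ge> 0" and K: "K \<ge> 0"
  shows "ennreal (supcdf_integral h K) = (\<integral>\<^sup>+\<omega>. ennreal (supcdf_integral h (K - V h \<omega>) - supcdf_integral h (- V h \<omega>)) \<partial>M)"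
proof -
  note V_meas[OF h, measurable] supcdf_meas[OF h, measurable]
  interpret PS: pair_sigma_finite M lborel ..
  have N: "ennreal (supcdf_integral h K) = (\<integral>\<^sup>+a. indicator {0..<K} a * ennreal (supcdf h a) \<partial>lborel)"
  proof -
    have "supcdf_integral h K = (LINT b|lborel. indicator {0..<K} b * supcdf h b)"
      using supcdf_integral_diff(1)[OF h K] supcdf_integral_neg[of 0 h] by simp
    also have "ennreal \<dots> = (\<integral>\<^sup>+b. ennreal (indicator {0..<K} b * supcdf h b) \<partial>lborel)"
      using supcdf_integral_diff(2)[OF h K] by (intro nn_integral_eq_integral[symmetric]) (auto simp: supcdf_bounds)
    finally show ?thesis by (simp add: ennreal_mult' ennreal_indicator)
  qed
  also have "\<dots> = (\<integral>\<^sup>+a. (\<integral>\<^sup>+\<omega>. indicator {0..<K} a * ennreal (supcdf h (a - V h \<omega>)) \<partial>M) \<partial>lborel)"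
  proof (intro nn_integral_cong)
    fix a
    show "indicator {0..<K} a * ennreal (supcdf h a) = (\<integral>\<^sup>+\<omega>. indicator {0..<K} a * ennreal (supcdf h (a - V h \<omega>)) \<partial>M)"
      using supcdf_step[OF h, of a] by (auto simp: indicator_def)
  qed
  also have "\<dots> = (\<integral>\<^sup>+\<omega>. (\<integral>\<^sup>+a. indicator {0..<K} a * ennreal (supcdf h (a - V h \<omega>)) \<partial>lborel) \<partial>M)"
    by (intro PS.Fubini') measurable
  also have "\<dots> = (\<integral>\<^sup>+\<omega>. ennreal (supcdf_integral h (K - V h \<omega>) - supcdf_integral h (- V h \<omega>)) \<partial>M)"
  proof (intro nn_integral_cong)
    fix \<omega> assume "\<omega> \<in> space M"
    define v where "v = V h \<omega>"
    have "(\<integral>\<^sup>+a. indicator {0..<K} a * ennreal (supcdf h (a - v)) \<partial>lborel)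
       = (\<integral>\<^sup>+b. indicator {0..<K} (v + 1 * b) * ennreal (supcdf h ((v + 1 * b) - v)) \<partial>lborel)"
      by (subst nn_integral_real_affine[where c = 1 and t = v]) auto
    also have "\<dots> = (\<integral>\<^sup>+b. ennreal (indicator {-v..<K-v} b * supcdf h b) \<partial>lborel)"
      by (intro nn_integral_cong) (auto simp: indicator_def)
    also have "\<dots> = ennreal (LINT b|lborel. indicator {-v..<K-v} b * supcdf h b)"
      using K by (intro nn_integral_eq_integral supcdf_integral_diff h) (auto simp: supcdf_bounds)
    also have "(LINT b|lborel. indicator {-v..<K-v} b * supcdf h b) = supcdf_integral h (K - v) - supcdf_integral h (-v)"
      using K by (intro supcdf_integral_diff(1)[symmetric] h) auto
    finally show "(\<integral>\<^sup>+a. indicator {0..<K} a * ennreal (supcdf h (a - V h \<omega>)) \<partial>lborel)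
        = ennreal (supcdf_integral h (K - V h \<omega>) - supcdf_integral h (- V h \<omega>))" by (simp add: v_def)
  qed
  finally show ?thesis .
qed

text \<open>A path that tends to minus infinity is bounded above: by 0 from some time on, and before
  that time because it is cadlag.\<close>

lemma supcdf_lim:
  assumes drift: "drifts_to_minus_infinity M V" and h: "h > 0"
  shows "(supcdf h \<longlongrightarrow> 1) at_top"
proof -
  let ?A = "\<lambda>m::nat. {\<omega> \<in> space M. \<forall>j. V (real j * h) \<omega> \<le> real m}"
  have s: "?A m \<in> sets M" for m using h by (intro supcdf_sets) auto
  have "(\<lambda>m. supcdf h (real m)) \<longlonglongrightarrow> measure M (\<Union>m. ?A m)"
    unfolding supcdf_def using s by (intro finite_Lim_measure_incseq) (auto simp: incseq_def intro: order_trans)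
  moreover have "measure M (\<Union>m. ?A m) = 1"
  proof (rule prob_eq_1[THEN iffD2])
    show "(\<Union>m. ?A m) \<in> events" using s by auto
    show "AE \<omega> in M. \<omega> \<in> (\<Union>m. ?A m)"
      using drift unfolding drifts_to_minus_infinity_def
    proof (rule AE_mp, intro AE_I2 impI)
      fix \<omega> assume w: "\<omega> \<in> space M" and lim: "filterlim (\<lambda>t. V t \<omega>) at_bot at_top"
      then have "eventually (\<lambda>t. V t \<omega> \<le> 0) at_top" by (auto simp: filterlim_at_bot)
      then obtain T where T: "\<And>t. t \<ge> T \<Longrightarrow> V t \<omega> \<le> 0" by (auto simp: eventually_at_top_linorder)
      obtain B where B: "\<forall>s\<in>{0..T}. \<bar>V s \<omega>\<bar> \<le> B" using cadlag_bounded[OF V_cadlag[OF w]] by blast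
      obtain m :: nat where m: "max B 0 \<le> real m" using real_arch_simple by blast
      have "V (real j * h) \<omega> \<le> real m" for j
      proof (cases "real j * h \<ge> T")
        case True then show ?thesis using T[OF True] by simp
      next
        case False
        then have "\<bar>V (real j * h) \<omega>\<bar> \<le> B" using h B by simp
        then show ?thesis using m by linarith
      qed
      then show "\<omega> \<in> (\<Union>m. ?A m)" using w by blast
    qed
  qed
  ultimately have *: "(\<lambda>m. supcdf h (real m)) \<longlonglongrightarrow> 1" by simp
  show ?thesis
  proof (rule order_tendstoI)
    fix a :: real assume "a > 1"
    then show "eventually (\<lambda>x. supcdf h x < a) at_top"
      by (intro always_eventually allI) (meson supcdf_bounds(2) le_less_trans)
  next
    fix a :: real assume "a < 1"
    then have "eventually (\<lambda>m. a < supcdf h (real m)) sequentially" using order_tendstoD(1)[OF *] by blast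
    then obtain m where m: "a < supcdf h (real m)" by (auto simp: eventually_sequentially)
    show "eventually (\<lambda>x. a < supcdf h x) at_top"
      using eventually_ge_at_top[of "real m"] by eventually_elim (use m supcdf_mono[of h "real m"] h in \<open>auto intro: less_le_trans\<close>)
  qed
qed

lemma supcdf_integral_diff_lim:
  assumes drift: "drifts_to_minus_infinity M V" and h: "h > 0"
  shows "(\<lambda>n. supcdf_integral h (real n) - supcdf_integral h (real n - v)) \<longlonglongrightarrow> v"
proof (cases "v \<ge> 0")
  case True
  have "filterlim (\<lambda>n. real n - v) at_top sequentially"
    using filterlim_tendsto_add_at_top[OF tendsto_const[of "- v"] filterlim_real_sequentially] by simp
  then have l: "(\<lambda>n. v * supcdf h (real n - v)) \<longlonglongrightarrow> v * 1"
    by (intro tendsto_intros filterlim_compose[OF supcdf_lim[OF assms]])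
  show ?thesis
  proof (rule tendsto_sandwich[OF _ _ l[simplified] tendsto_const])
    show "eventually (\<lambda>n. v * supcdf h (real n - v) \<le> supcdf_integral h (real n) - supcdf_integral h (real n - v)) sequentially"
      using supcdf_integral_diff(3)[of h "real n - v" "real n" for n] True h by (intro always_eventually allI) (auto intro: order_trans)
    show "eventually (\<lambda>n. supcdf_integral h (real n) - supcdf_integral h (real n - v) \<le> v) sequentially"
      using supcdf_integral_diff(4)[of h "real n - v" "real n" for n] True h by (intro always_eventually allI) (auto intro: order_trans)
  qed
next
  case False
  have l: "(\<lambda>n. v * supcdf h (real n)) \<longlonglongrightarrow> v * 1"
    by (intro tendsto_intros filterlim_compose[OF supcdf_lim[OF assms]] filterlim_real_sequentially)
  show ?thesis
  proof (rule tendsto_sandwich[OF _ _ tendsto_const l[simplified]])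
    show "eventually (\<lambda>n. v \<le> supcdf_integral h (real n) - supcdf_integral h (real n - v)) sequentially"
    proof (intro always_eventually allI)
      fix n show "v \<le> supcdf_integral h (real n) - supcdf_integral h (real n - v)"
        using supcdf_integral_diff(4)[of h "real n" "real n - v"] False h by simp
    qed
    show "eventually (\<lambda>n. supcdf_integral h (real n) - supcdf_integral h (real n - v) \<le> v * supcdf h (real n)) sequentially"
    proof (intro always_eventually allI)
      fix n show "supcdf_integral h (real n) - supcdf_integral h (real n - v) \<le> v * supcdf h (real n)"
        using supcdf_integral_diff(3)[of h "real n" "real n - v"] False h by simp
    qed
  qed
qed

text \<open>If \<open>\<Psi> \<ge> 0\<close>, then \<open>E V(h) \<ge> 0\<close>. Integrating the renewal identity \<open>supcdf h a = E (supcdf h (a - V h))\<close>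
  over \<open>a\<close> gives \<open>E V(h) + E (supcdf_integral h (- V h)) = 0\<close>, so the second term vanishes. This bounds \<open>V h\<close>
  from below uniformly in \<open>h\<close>, against the drift.\<close>
lemma drift_exponent_negative:
  assumes drift: "drifts_to_minus_infinity M V"
  shows "\<exists>l>0. \<Psi> l < 0"
proof (rule ccontr)
  assume "\<not> ?thesis"
  then have Psi: "\<Psi> l \<ge> 0" if "l > 0" for l using that by (metis not_less)
  have zero: "AE \<omega> in M. supcdf_integral h (- V h \<omega>) = 0" if h: "h > 0" for h
  proof -
    have h0: "h \<ge> 0" using h by simp
    note V_meas[OF h0, measurable] supcdf_integral_meas[OF h0, measurable]
    have vi: "integrable M (V h)" and v0: "(\<integral>\<omega>. V h \<omega> \<partial>M) \<ge> 0" using mean_nonneg[OF Psi h0] by auto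
    have n0: "supcdf_integral h 0 = 0" by (rule supcdf_integral_neg) simp
    have i1: "integrable M (\<lambda>\<omega>. supcdf_integral h (- V h \<omega>))"
    proof (rule Bochner_Integration.integrable_bound[OF vi])
      show "AE \<omega> in M. norm (supcdf_integral h (- V h \<omega>)) \<le> norm (V h \<omega>)"
      proof (rule AE_I2)
        fix \<omega> show "norm (supcdf_integral h (- V h \<omega>)) \<le> norm (V h \<omega>)"
          using supcdf_integral_lipschitz[OF h0, of "- V h \<omega>" 0] n0 by simp
      qed
    qed simp
    have i2: "integrable M (\<lambda>\<omega>. supcdf_integral h (real n) - supcdf_integral h (real n - V h \<omega>))" for n
    proof (rule Bochner_Integration.integrable_bound[OF vi])
      show "AE \<omega> in M. norm (supcdf_integral h (real n) - supcdf_integral h (real n - V h \<omega>)) \<le> norm (V h \<omega>)"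
      proof (rule AE_I2)
        fix \<omega> show "norm (supcdf_integral h (real n) - supcdf_integral h (real n - V h \<omega>)) \<le> norm (V h \<omega>)"
          using supcdf_integral_lipschitz[OF h0, of "real n" "real n - V h \<omega>"] by simp
      qed
    qed simp
    have id: "(\<integral>\<omega>. supcdf_integral h (real n) - supcdf_integral h (real n - V h \<omega>) \<partial>M) = - (\<integral>\<omega>. supcdf_integral h (- V h \<omega>) \<partial>M)" for n
    proof -
      have i3: "integrable M (\<lambda>\<omega>. supcdf_integral h (real n - V h \<omega>))"
        using Bochner_Integration.integrable_diff[OF integrable_const[of "supcdf_integral h (real n)"] i2[of n]] by simp
      have "(\<integral>\<omega>. supcdf_integral h (real n - V h \<omega>) - supcdf_integral h (- V h \<omega>) \<partial>M)
        = enn2real (\<integral>\<^sup>+\<omega>. ennreal (supcdf_integral h (real n - V h \<omega>) - supcdf_integral h (- V h \<omega>)) \<partial>M)"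
        using supcdf_integral_mono[OF h0] by (intro integral_eq_nn_integral) auto
      also have "\<dots> = supcdf_integral h (real n)"
        by (subst supcdf_integral_identity[OF h0, symmetric]) (auto simp: supcdf_integral_nonneg)
      finally show ?thesis using i1 i3 by (simp add: prob_space)
    qed
    have "(\<lambda>n. \<integral>\<omega>. supcdf_integral h (real n) - supcdf_integral h (real n - V h \<omega>) \<partial>M) \<longlonglongrightarrow> (\<integral>\<omega>. V h \<omega> \<partial>M)"
    proof (rule integral_dominated_convergence[where w = "\<lambda>\<omega>. \<bar>V h \<omega>\<bar>"])
      show "AE \<omega> in M. norm (supcdf_integral h (real n) - supcdf_integral h (real n - V h \<omega>)) \<le> \<bar>V h \<omega>\<bar>" for n
        using supcdf_integral_lipschitz[OF h0, of "real n" "real n - V h _"] by simp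
      show "AE \<omega> in M. (\<lambda>n. supcdf_integral h (real n) - supcdf_integral h (real n - V h \<omega>)) \<longlonglongrightarrow> V h \<omega>"
        using supcdf_integral_diff_lim[OF drift h] by simp
    qed (use vi i2 in auto)
    then have "(\<integral>\<omega>. V h \<omega> \<partial>M) = - (\<integral>\<omega>. supcdf_integral h (- V h \<omega>) \<partial>M)"
      unfolding id by (simp add: LIMSEQ_const_iff)
    moreover have "(\<integral>\<omega>. supcdf_integral h (- V h \<omega>) \<partial>M) \<ge> 0" by (intro integral_nonneg_AE) (simp add: supcdf_integral_nonneg)
    ultimately have "(\<integral>\<omega>. supcdf_integral h (- V h \<omega>) \<partial>M) = 0" using v0 by simp
    then show ?thesis using integral_nonneg_eq_0_iff_AE[OF i1] by (simp add: supcdf_integral_nonneg)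
  qed
  obtain a where a: "supcdf 1 a > 0"
  proof -
    have "eventually (\<lambda>a. supcdf 1 a > 0) at_top" using order_tendstoD(1)[OF supcdf_lim[OF drift], of 1 0] by simp
    then obtain a where "supcdf 1 a > 0" by (auto simp: eventually_at_top_linorder)
    then show ?thesis using that by blast
  qed
  have Z: "AE \<omega> in M. \<forall>n. supcdf_integral (real (Suc n)) (- V (real (Suc n)) \<omega>) = 0"
    by (subst AE_all_countable) (auto intro!: zero simp del: of_nat_Suc)
  have D: "AE \<omega> in M. filterlim (\<lambda>t. V t \<omega>) at_bot at_top"
    using drift by (simp add: drifts_to_minus_infinity_def)
  have "AE \<omega> in M. False"
    using Z D AE_space
  proof eventually_elim
    case (elim \<omega>)
    note z = elim(1) and lim = elim(2)
    have le: "- V (real (Suc n)) \<omega> \<le> a" for n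
    proof (rule ccontr)
      assume "\<not> ?thesis"
      then have v: "- V (real (Suc n)) \<omega> > a" by simp
      \<comment> \<open>The walk with step \<open>Suc n\<close> is a subsequence of the walk with
        step 1, so a single level \<open>a\<close> serves all step sizes.\<close>
      have "supcdf 1 a \<le> supcdf (real (Suc n)) a"
        unfolding supcdf_def
      proof (intro finite_measure_mono)
        show "{\<omega> \<in> space M. \<forall>j. V (real j * 1) \<omega> \<le> a} \<subseteq> {\<omega> \<in> space M. \<forall>j. V (real j * real (Suc n)) \<omega> \<le> a}"
        proof safe
          fix \<omega> j assume "\<forall>j. V (real j * 1) \<omega> \<le> a"
          then have "V (real (j * Suc n) * 1) \<omega> \<le> a" by blast
          then show "V (real j * real (Suc n)) \<omega> \<le> a" by (simp only: of_nat_mult mult_1_right)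
        qed
      qed (rule supcdf_sets, simp)
      then have "0 < (- V (real (Suc n)) \<omega> - a) * supcdf (real (Suc n)) a" using a v by (intro mult_pos_pos) auto
      also have "\<dots> \<le> supcdf_integral (real (Suc n)) (- V (real (Suc n)) \<omega>) - supcdf_integral (real (Suc n)) a"
        using v by (intro supcdf_integral_diff) auto
      also have "\<dots> \<le> 0" using z supcdf_integral_nonneg[of "real (Suc n)" a] by auto
      finally show False by simp
    qed
    have "filterlim (\<lambda>n. V (real (Suc n)) \<omega>) at_bot sequentially"
      by (intro filterlim_compose[OF lim] filterlim_compose[OF filterlim_real_sequentially filterlim_Suc])
    then have "eventually (\<lambda>n. V (real (Suc n)) \<omega> \<le> - a - 1) sequentially" by (auto simp: filterlim_at_bot)
    then obtain n where "V (real (Suc n)) \<omega> \<le> - a - 1" by (auto simp: eventually_sequentially)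
    with le[of n] show False by simp
  qed
  then show False by simp
qed

section \<open>Convexity, zeros of the exponent, and a rate within distance 1 of kappa\<close>

definition mgf1 where "mgf1 l = (\<integral>\<omega>. exp (l * V 1 \<omega>) \<partial>M)"

lemma mgf1_eq: "l \<ge> 0 \<Longrightarrow> mgf1 l = exp (\<Psi> l)"
  using mgf[of 1 l] by (simp add: mgf1_def)

text \<open>Convexity of the moment generating function, inherited pointwise from
  \<open>exp\<close>, is weaker than convexity of \<Psi> but already decides the sign of \<Psi>
  between 0 and a positive zero.\<close>

lemma mgf1_convex: "convex_on {0..} mgf1"
proof (rule convex_onI)
  fix t x y :: real assume t: "0 < t" "t < 1" and xy: "x \<in> {0..}" "y \<in> {0..}"
  have c: "convex_on UNIV (exp :: real \<Rightarrow> real)" by (rule exp_convex)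
  have "mgf1 ((1 - t) *\<^sub>R x + t *\<^sub>R y) \<le> (\<integral>\<omega>. (1 - t) * exp (x * V 1 \<omega>) + t * exp (y * V 1 \<omega>) \<partial>M)"
    unfolding mgf1_def
  proof (intro integral_mono Bochner_Integration.integrable_add integrable_mult_right mgf_integrable)
    fix \<omega>
    show "exp (((1 - t) *\<^sub>R x + t *\<^sub>R y) * V 1 \<omega>) \<le> (1 - t) * exp (x * V 1 \<omega>) + t * exp (y * V 1 \<omega>)"
      using convex_onD[OF c, of t "x * V 1 \<omega>" "y * V 1 \<omega>"] t by (simp add: algebra_simps)
  qed (use xy t in auto)
  also have "\<dots> = (1 - t) * mgf1 x + t * mgf1 y"
    unfolding mgf1_def using xy by (subst Bochner_Integration.integral_add) (auto intro!: integrable_mult_right mgf_integrable)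
  finally show "mgf1 ((1 - t) *\<^sub>R x + t *\<^sub>R y) \<le> (1 - t) * mgf1 x + t * mgf1 y" .
qed simp

lemma exponent_nonpos_between:
  assumes "\<Psi> z = 0" "0 \<le> k" "k \<le> z" "z > 0" shows "\<Psi> k \<le> 0"
proof -
  have "mgf1 ((1 - k/z) *\<^sub>R 0 + (k/z) *\<^sub>R z) \<le> (1 - k/z) * mgf1 0 + (k/z) * mgf1 z"
    using assms by (intro convex_onD[OF mgf1_convex]) (auto simp: field_simps)
  then have "exp (\<Psi> k) \<le> 1" using assms by (simp add: mgf1_eq Psi_0)
  then show ?thesis by simp
qed

lemma exponent_zero_exists:
  assumes "\<Psi> a < 0" "a > 0" "eventually (\<lambda>l. \<Psi> l > 0) at_top"
  shows "\<exists>z>0. \<Psi> z = 0"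
proof -
  obtain b where b: "b > a" "\<Psi> b > 0"
    using eventually_conj[OF assms(3) eventually_gt_at_top[of a]] by (auto simp: eventually_at_top_linorder)
  have "continuous_on {0<..} mgf1"
    by (rule convex_on_continuous) (auto intro: convex_on_subset[OF mgf1_convex])
  then have c: "continuous_on {a..b} mgf1" by (rule continuous_on_subset) (use assms in auto)
  have "\<exists>x\<ge>a. x \<le> b \<and> mgf1 x = 1"
    using assms b by (intro IVT'[OF _ _ _ c]) (auto simp: mgf1_eq)
  then obtain x where "x \<ge> a" "mgf1 x = 1" by blast
  then show ?thesis using assms mgf1_eq[of x] by (intro exI[of _ x]) auto
qed

text \<open>Provides the rate of the exponential lower bound on the growth of \<open>W\<close>. The
  bound rests on \<open>\<Psi> k < 0\<close> or, for \<open>k = 0\<close>, on monotonicity;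
  \<open>k + 1 > \<kappa>\<close> makes all factors \<open>\<Psi> (k + 1 + j)\<close> of the series
  positive.\<close>

lemma kappa_bound:
  assumes pos: "eventually (\<lambda>l. \<Psi> l > 0) at_top"
  obtains k where "k \<ge> 0" "k + 1 > kappa M V \<Psi>" "k = 0 \<or> \<Psi> k < 0"
proof (cases "kappa M V \<Psi> < 1")
  case True
  then show ?thesis using that[of 0] by simp
next
  case False
  then have drift: "drifts_to_minus_infinity M V" by (auto simp: kappa_def split: if_splits)
  let ?Z = "{l. l > 0 \<and> \<Psi> l = 0}"
  have kap: "kappa M V \<Psi> = Inf ?Z" using drift by (simp add: kappa_def)
  obtain a where "a > 0" "\<Psi> a < 0" using drift_exponent_negative[OF drift] by blast
  then obtain z where z: "z \<in> ?Z" using exponent_zero_exists pos by blast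
  have bdd: "bdd_below ?Z" by (intro bdd_belowI[of _ 0]) auto
  \<comment> \<open>Anything strictly between 0 and 1 may be subtracted: the result is positive
    because \<open>\<kappa> \<ge> 1\<close> here, and it lies below every positive zero of
    \<Psi>.\<close>
  define k where "k = Inf ?Z - 1/2"
  have k: "k > 0" "k < Inf ?Z" using False by (auto simp: k_def kap)
  have "k < z" using k cInf_lower[OF z bdd] by linarith
  then have "\<Psi> k \<le> 0" using z k by (intro exponent_nonpos_between[of z]) auto
  moreover have "\<Psi> k \<noteq> 0"
  proof
    assume "\<Psi> k = 0"
    then have "k \<in> ?Z" using k by simp
    then show False using cInf_lower[OF _ bdd, of k] k by simp
  qed
  ultimately show ?thesis using that[of k] k by (auto simp: kap k_def)
qed

section \<open>Growth of the scale function\<close>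

definition alive :: "real \<Rightarrow> real \<Rightarrow> 'a set" where
  "alive t x = {\<omega> \<in> space M. (INF s\<in>{0..t}. x + V s \<omega>) > 0}"

lemma alive_iff:
  assumes t: "t \<ge> 0"
  shows "\<omega> \<in> alive t x \<longleftrightarrow> \<omega> \<in> space M \<and>
    (\<exists>m::nat. \<forall>j k. real k * (t / 2 ^ j) \<le> t \<longrightarrow> x + V (real k * (t / 2 ^ j)) \<omega> \<ge> 1 / real (Suc m))"
  unfolding alive_def using INF_pos_iff_dyadic[OF cadlag_shift[OF V_cadlag] t] by blast

lemma alive_sets [measurable]:
  assumes t: "t \<ge> 0" shows "alive t x \<in> sets M"
proof -
  have [measurable]: "V (real k * (t / 2 ^ j)) \<in> borel_measurable M" for j k
    using t by (intro V_meas) simp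
  have "alive t x = {\<omega> \<in> space M. \<exists>m::nat. \<forall>j k. real k * (t / 2 ^ j) \<le> t \<longrightarrow> x + V (real k * (t / 2 ^ j)) \<omega> \<ge> 1 / real (Suc m)}"
    using alive_iff[OF t] by blast
  also have "\<dots> \<in> sets M" by measurable
  finally show ?thesis .
qed

lemma alive_pos:
  assumes "\<omega> \<in> alive t x" "0 \<le> s" "s \<le> t"
  shows "x + V s \<omega> > 0"
proof -
  have w: "\<omega> \<in> space M" using assms by (auto simp: alive_def)
  obtain B where B: "\<forall>s\<in>{0..t}. \<bar>V s \<omega>\<bar> \<le> B" using cadlag_bounded[OF V_cadlag[OF w]] by blast
  have "bdd_below ((\<lambda>s. x + V s \<omega>) ` {0..t})"
  proof (rule bdd_belowI2[of _ "x - B"])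
    fix s assume "s \<in> {0..t}"
    then have "\<bar>V s \<omega>\<bar> \<le> B" using B by blast
    then show "x - B \<le> x + V s \<omega>" by linarith
  qed
  then have "(INF s\<in>{0..t}. x + V s \<omega>) \<le> x + V s \<omega>" by (rule cINF_lower) (use assms in auto)
  then show ?thesis using assms(1) by (auto simp: alive_def)
qed

lemma alive_mono: "t \<ge> 0 \<Longrightarrow> x \<le> y \<Longrightarrow> alive t x \<subseteq> alive t y"
proof
  fix \<omega> assume t: "t \<ge> 0" and xy: "x \<le> y" and "\<omega> \<in> alive t x"
  then obtain m where "\<omega> \<in> space M"
    and m: "\<And>j k. real k * (t / 2 ^ j) \<le> t \<Longrightarrow> x + V (real k * (t / 2 ^ j)) \<omega> \<ge> 1 / real (Suc m)"
    by (auto simp: alive_iff[OF t] simp del: of_nat_Suc)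
  moreover have "1 / real (Suc m) \<le> y + V (real k * (t / 2 ^ j)) \<omega>" if "real k * (t / 2 ^ j) \<le> t" for j k
    using m[OF that] xy by linarith
  ultimately show "\<omega> \<in> alive t y" unfolding alive_iff[OF t] by blast
qed

lemma alive_large:
  assumes w: "\<omega> \<in> space M" and t: "t \<ge> 0"
  obtains m where "\<omega> \<in> alive t (real m)"
proof -
  obtain B where B: "\<forall>s\<in>{0..t}. \<bar>V s \<omega>\<bar> \<le> B" using cadlag_bounded[OF V_cadlag[OF w]] by blast
  obtain m :: nat where m: "B + 1 \<le> real m" using real_arch_simple by blast
  have "real m + V s \<omega> \<ge> 1" if "s \<in> {0..t}" for s
  proof -
    have "\<bar>V s \<omega>\<bar> \<le> B" using B that by blast
    then show ?thesis using m by linarith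
  qed
  then have "\<omega> \<in> alive t (real m)"
    unfolding alive_iff[OF t] using w t by (intro conjI exI[of _ 0]) auto
  then show ?thesis using that by blast
qed

end

section \<open>Laplace transforms and convolutions of nonnegative functions on the line\<close>

definition Lap :: "(real \<Rightarrow> ennreal) \<Rightarrow> real \<Rightarrow> ennreal" where
  "Lap \<phi> l = (\<integral>\<^sup>+x. ennreal (exp (- l * x)) * \<phi> x \<partial>lborel)"

lemma Lap_cmult: "\<phi> \<in> borel_measurable borel \<Longrightarrow> Lap (\<lambda>x. c * \<phi> x) l = c * Lap \<phi> l"
  unfolding Lap_def by (subst nn_integral_cmult[symmetric]) (auto simp: mult_ac)

lemma Lap_suminf: "(\<And>n. \<phi> n \<in> borel_measurable borel) \<Longrightarrow> Lap (\<lambda>x. \<Sum>n. \<phi> n x) l = (\<Sum>n. Lap (\<phi> n) l)"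
  unfolding Lap_def by (subst nn_integral_suminf[symmetric]) auto

lemma ennreal_exp_mult: "ennreal (exp a) * ennreal (exp b) = ennreal (exp (a + b))"
  by (simp add: exp_add ennreal_mult)

lemma Lap_exp: "Lap (\<lambda>x. ennreal (exp (- x)) * \<phi> x) l = Lap \<phi> (l + 1)"
proof -
  have "- l * x + - x = - (l + 1) * x" for x :: real by (simp add: algebra_simps)
  then show ?thesis unfolding Lap_def by (simp only: mult.assoc[symmetric] ennreal_exp_mult)
qed

lemma Lap_translate:
  assumes [measurable]: "\<phi> \<in> borel_measurable borel"
  shows "Lap (\<lambda>x. \<phi> (x - y)) l = ennreal (exp (- l * y)) * Lap \<phi> l"
proof -
  have "Lap (\<lambda>x. \<phi> (x - y)) l = (\<integral>\<^sup>+x. ennreal (exp (- l * (y + 1 * x))) * \<phi> (y + 1 * x - y) \<partial>lborel)"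
    unfolding Lap_def by (subst nn_integral_real_affine[where c = 1 and t = y]) auto
  also have "\<dots> = (\<integral>\<^sup>+x. ennreal (exp (- l * y)) * (ennreal (exp (- l * x)) * \<phi> x) \<partial>lborel)"
  proof -
    have "- l * (y + 1 * x) = - l * y + - l * x" for x by (simp add: algebra_simps)
    then show ?thesis by (simp only: mult.assoc[symmetric] ennreal_exp_mult) simp
  qed
  also have "\<dots> = ennreal (exp (- l * y)) * Lap \<phi> l"
    unfolding Lap_def by (rule nn_integral_cmult) simp
  finally show ?thesis .
qed

definition conv :: "(real \<Rightarrow> ennreal) \<Rightarrow> (real \<Rightarrow> ennreal) \<Rightarrow> real \<Rightarrow> ennreal" where
  "conv \<psi> \<phi> x = (\<integral>\<^sup>+y. \<psi> (x - y) * \<phi> y \<partial>lborel)"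

lemma conv_measurable [measurable]:
  assumes [measurable]: "\<psi> \<in> borel_measurable borel" "\<phi> \<in> borel_measurable borel"
  shows "conv \<psi> \<phi> \<in> borel_measurable borel"
  unfolding conv_def by measurable

lemma Lap_conv:
  assumes [measurable]: "\<psi> \<in> borel_measurable borel" "\<phi> \<in> borel_measurable borel"
  shows "Lap (conv \<psi> \<phi>) l = Lap \<psi> l * Lap \<phi> l"
proof -
  have "Lap (conv \<psi> \<phi>) l = (\<integral>\<^sup>+x. \<integral>\<^sup>+y. ennreal (exp (- l * x)) * (\<psi> (x - y) * \<phi> y) \<partial>lborel \<partial>lborel)"
    unfolding Lap_def conv_def by (subst nn_integral_cmult) auto
  also have "\<dots> = (\<integral>\<^sup>+y. \<integral>\<^sup>+x. ennreal (exp (- l * x)) * (\<psi> (x - y) * \<phi> y) \<partial>lborel \<partial>lborel)"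
    by (rule lborel_pair.Fubini') measurable
  also have "\<dots> = (\<integral>\<^sup>+y. Lap (\<lambda>x. \<psi> (x - y)) l * \<phi> y \<partial>lborel)"
    unfolding Lap_def by (intro nn_integral_cong) (subst nn_integral_multc[symmetric]; simp add: mult.assoc)
  also have "\<dots> = (\<integral>\<^sup>+y. Lap \<psi> l * (ennreal (exp (- l * y)) * \<phi> y) \<partial>lborel)"
    by (intro nn_integral_cong) (simp add: Lap_translate mult_ac)
  also have "\<dots> = Lap \<psi> l * Lap \<phi> l"
    unfolding Lap_def[of \<phi>] by (rule nn_integral_cmult) simp
  finally show ?thesis .
qed

text \<open>\<open>W_pos\<close> and \<open>W_inv\<close> express that the kernels of the
  conditioned process are probability measures. The growth conditions on \<Psi> are what its
  power-like behaviour at infinity supplies.\<close>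

locale scale_levy = levy M V \<Psi> for M :: "'a measure" and V \<Psi> +
  fixes W :: "real \<Rightarrow> real"
  assumes scale: "scale_function M V \<Psi> W"
    and W_pos: "\<And>x. x > 0 \<Longrightarrow> W x > 0"
    and W_inv: "\<And>t x. x > 0 \<Longrightarrow> t \<ge> 0 \<Longrightarrow>
      (\<integral>\<^sup>+\<omega>. indicator (alive t x) \<omega> * ennreal (W (x + V t \<omega>)) \<partial>M) = ennreal (W x)"
    and Psi_eventually_pos: "eventually (\<lambda>l. \<Psi> l > 0) at_top"
    and Psi_superlinear: "((\<lambda>l. l / \<Psi> l) \<longlongrightarrow> 0) at_top"
begin

abbreviation "\<kappa> \<equiv> kappa M V \<Psi>"

lemma W_cont: "continuous_on {0..} W" and W_mono: "0 \<le> x \<Longrightarrow> x \<le> y \<Longrightarrow> W x \<le> W y"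
  and W_nonneg: "x \<ge> 0 \<Longrightarrow> W x \<ge> 0"
  and W_integrable: "l > \<kappa> \<Longrightarrow> set_integrable lborel {0..} (\<lambda>x. exp (- l * x) * W x)"
  and W_laplace: "l > \<kappa> \<Longrightarrow> (LINT x:{0..}|lborel. exp (- l * x) * W x) = 1 / \<Psi> l"
  using scale by (auto simp: scale_function_def mono_on_def)

text \<open>On \<open>{0..1/l}\<close> the kernel \<open>exp (- l * x)\<close> is at least
  \<open>exp (- 1)\<close> and \<open>W\<close> at least \<open>W 0\<close>. So the Laplace identity
  gives \<open>W 0 \<le> exp 1 * (l / \<Psi> l)\<close>, which tends to 0.\<close>

lemma W_0: "W 0 = 0"
proof -
  have "W 0 \<le> 0"
  proof (rule tendsto_lowerbound)
    show "((\<lambda>l. exp 1 * (l / \<Psi> l)) \<longlongrightarrow> 0) at_top"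
      using tendsto_mult[OF tendsto_const[of "exp (1::real)"] Psi_superlinear] by simp
    show "eventually (\<lambda>l. W 0 \<le> exp 1 * (l / \<Psi> l)) at_top"
      using eventually_gt_at_top[of \<kappa>] eventually_gt_at_top[of 0]
    proof eventually_elim
      case (elim l)
      have "(LINT x|lborel. indicator {0..1/l} x * (exp (- 1) * W 0)) \<le> (LINT x|lborel. indicator {0..} x *\<^sub>R (exp (- l * x) * W x))"
      proof (rule integral_mono)
        show "integrable lborel (\<lambda>x. indicator {0..} x *\<^sub>R (exp (- l * x) * W x))"
          using W_integrable[OF elim(1)] by (simp add: set_integrable_def)
        fix x :: real
        show "indicator {0..1/l} x * (exp (- 1) * W 0) \<le> indicator {0..} x *\<^sub>R (exp (- l * x) * W x)"
        proof (cases "x \<in> {0..1/l}")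
          case True
          then have "exp (- 1) * W 0 \<le> exp (- l * x) * W x"
            using elim W_nonneg[of 0] W_mono[of 0 x] by (intro mult_mono) (auto simp: field_simps)
          then show ?thesis using True by simp
        next
          case False
          then show ?thesis using W_nonneg[of x] by (auto simp: indicator_def)
        qed
      qed (use elim in auto)
      then have "1 / l * (exp (- 1) * W 0) \<le> 1 / \<Psi> l"
        using W_laplace[OF elim(1)] elim by (simp add: set_lebesgue_integral_def)
      then have "l * exp 1 * (1 / l * (exp (- 1) * W 0)) \<le> l * exp 1 * (1 / \<Psi> l)"
        using elim by (intro mult_left_mono) auto
      moreover have "l * exp 1 * (1 / l * (exp (- 1) * W 0)) = W 0"
        using elim by (simp add: exp_minus)
      ultimately show ?case by (simp add: mult.commute)
    qed
  qed simp
  then show ?thesis using W_nonneg[of 0] by simp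
qed

text \<open>The values of \<open>W\<close> at negative arguments are unspecified. Extension by zero
  makes one-sided transforms and convolutions into integrals over the whole line.\<close>

definition w :: "real \<Rightarrow> real" where "w x = (if x \<le> 0 then 0 else W x)"

lemma w_pos_eq: "x \<ge> 0 \<Longrightarrow> w x = W x"
  by (auto simp: w_def W_0)

lemma w_max: "w x = W (max 0 x)"
  by (auto simp: w_def W_0 max_def)

lemma w_cont: "continuous_on UNIV w"
proof -
  have "continuous_on UNIV (\<lambda>x. W (max 0 x))"
    by (rule continuous_on_compose2[OF W_cont]) (auto intro!: continuous_intros)
  then show ?thesis by (simp add: w_max[abs_def] cong: continuous_on_cong)
qed

lemma w_mono: "x \<le> y \<Longrightarrow> w x \<le> w y"
  unfolding w_max by (intro W_mono) auto

lemma w_nonneg: "w x \<ge> 0"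
  by (auto simp: w_max intro: W_nonneg)

lemma w_pos: "x > 0 \<Longrightarrow> w x > 0"
  by (auto simp: w_def W_pos)

lemma w_zero: "x \<le> 0 \<Longrightarrow> w x = 0"
  by (auto simp: w_def)

lemma w_meas [measurable]: "w \<in> borel_measurable borel"
  using w_cont by (rule borel_measurable_continuous_onI)

lemma Lap_w_aux:
  assumes "l > \<kappa>"
  shows "Lap (\<lambda>x. ennreal (w x)) l = ennreal (1 / \<Psi> l)" "\<Psi> l > 0"
proof -
  have eq: "indicator {0..} x *\<^sub>R (exp (- l * x) * W x) = exp (- l * x) * w x" for x
    by (auto simp: indicator_def w_def W_0)
  have i: "integrable lborel (\<lambda>x. exp (- l * x) * w x)" "(LINT x|lborel. exp (- l * x) * w x) = 1 / \<Psi> l"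
    using W_integrable[OF assms] W_laplace[OF assms] unfolding set_integrable_def set_lebesgue_integral_def eq by auto
  have "Lap (\<lambda>x. ennreal (w x)) l = (\<integral>\<^sup>+x. ennreal (exp (- l * x) * w x) \<partial>lborel)"
    unfolding Lap_def by (intro nn_integral_cong) (simp add: ennreal_mult w_nonneg)
  also have "\<dots> = ennreal (1 / \<Psi> l)"
    using i by (subst nn_integral_eq_integral) (auto simp: w_nonneg)
  finally show L: "Lap (\<lambda>x. ennreal (w x)) l = ennreal (1 / \<Psi> l)" .
  show "\<Psi> l > 0"
  proof (rule ccontr)
    assume "\<not> \<Psi> l > 0"
    \<comment> \<open>This includes \<open>\<Psi> l = 0\<close>, because \<open>1 / 0 = 0\<close>.
      The transform would then vanish although \<open>w\<close> is positive on
      \<open>{0<..<1}\<close>.\<close>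
    then have "1 / \<Psi> l \<le> 0" by (simp add: divide_nonpos_nonpos not_less)
    then have "Lap (\<lambda>x. ennreal (w x)) l = 0" using L by (simp add: ennreal_neg)
    then have "AE x in lborel. ennreal (exp (- l * x)) * ennreal (w x) = 0"
      unfolding Lap_def by (subst (asm) nn_integral_0_iff_AE) auto
    then have "AE x in lborel. x \<notin> {0<..<1::real}"
    proof eventually_elim
      case (elim x)
      then have "w x \<le> 0" by (auto simp: ennreal_eq_0_iff)
      then show ?case using w_pos[of x] by auto
    qed
    then have "{0<..<1::real} \<in> null_sets lborel"
      by (subst AE_iff_null_sets) auto
    then show False by (simp add: null_sets_def)
  qed
qed

lemmas Lap_w = Lap_w_aux(1) and Psi_pos = Lap_w_aux(2)

text \<open>Otherwise \<open>V 1 \<le> 0\<close> almost surely and \<open>mgf1 l \<le> 1\<close> for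
  all \<open>l \<ge> 0\<close>, against the positivity of \<Psi> at large arguments.\<close>

lemma escape_event:
  obtains d m where "d > 0" "measure M ({\<omega> \<in> space M. V 1 \<omega> \<ge> d} \<inter> alive 1 (real m)) > 0"
proof -
  note V_meas[of 1, simplified, measurable] alive_sets[of 1, simplified, measurable]
  let ?A = "\<lambda>m::nat. {\<omega> \<in> space M. V 1 \<omega> \<ge> 1 / real (Suc m)} \<inter> alive 1 (real m)"
  have "\<exists>m. measure M (?A m) > 0"
  proof (rule ccontr)
    assume "\<not> ?thesis"
    then have "measure M (?A m) = 0" for m by (meson measure_le_0_iff not_less)
    then have "?A m \<in> null_sets M" for m by (auto simp: null_sets_def emeasure_eq_measure)
    then have N: "(\<Union>m. ?A m) \<in> null_sets M" by (intro null_sets_UN)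
    have "AE \<omega> in M. V 1 \<omega> \<le> 0"
    proof (rule AE_I'[OF N], safe)
      fix \<omega> assume w: "\<omega> \<in> space M" "\<not> V 1 \<omega> \<le> 0"
      obtain m where m: "\<omega> \<in> alive 1 (real m)" using alive_large[OF w(1), of 1] by auto
      obtain n where n: "1 / real (Suc n) < V 1 \<omega>" using w(2) by (meson nat_approx_posE not_le)
      have "1 / real (Suc (max m n)) \<le> 1 / real (Suc n)" by (intro divide_left_mono) auto
      then have "\<omega> \<in> ?A (max m n)" using m n w alive_mono[of 1 "real m" "real (max m n)"] by auto
      then show "\<omega> \<in> (\<Union>m. ?A m)" by blast
    qed
    then have "mgf1 l \<le> 1" if "l \<ge> 0" for l
    proof -
      have "mgf1 l \<le> (\<integral>\<omega>. 1 \<partial>M)" unfolding mgf1_def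
        using \<open>AE \<omega> in M. V 1 \<omega> \<le> 0\<close> that
        by (intro integral_mono_AE mgf_integrable integrable_const) (auto simp: mult_nonneg_nonpos elim!: eventually_mono)
      then show ?thesis by (simp add: prob_space)
    qed
    moreover obtain l where "l \<ge> 0" "\<Psi> l > 0"
      using eventually_conj[OF Psi_eventually_pos eventually_ge_at_top[of 0]] by (auto simp: eventually_at_top_linorder)
    ultimately show False using mgf1_eq[of l] by force
  qed
  then show ?thesis using that[of "1 / real (Suc _)"] by (auto simp del: of_nat_Suc)
qed

text \<open>With positive probability the process climbs by \<open>d\<close> before it is killed, so \<open>W (x + d)\<close> is at most
  a constant times \<open>W x\<close> by invariance of \<open>W\<close>.\<close>
lemma W_growth_upper:
  obtains x0 C K where "x0 > 0" "C \<ge> 1" "K \<ge> 0"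
    "\<And>x y. x \<ge> x0 \<Longrightarrow> y \<ge> 0 \<Longrightarrow> W (x + y) \<le> C * exp (K * y) * W x"
proof -
  obtain d m where d: "d > 0" and pm: "measure M ({\<omega> \<in> space M. V 1 \<omega> \<ge> d} \<inter> alive 1 (real m)) > 0"
    by (rule escape_event)
  define A where "A = {\<omega> \<in> space M. V 1 \<omega> \<ge> d} \<inter> alive 1 (real m)"
  define p where "p = measure M A"
  note V_meas[of 1, simplified, measurable] alive_sets[of 1, simplified, measurable]
  have Am [measurable]: "A \<in> sets M" unfolding A_def by measurable
  have p: "0 < p" "p \<le> 1" using pm by (auto simp: p_def A_def)
  define x0 where "x0 = max 1 (real m)"
  have one: "W (x + d) \<le> W x / p" if x: "x \<ge> x0" for x
  proof -
    have x': "x > 0" "x \<ge> real m" using x by (auto simp: x0_def)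
    have "ennreal (p * W (x + d)) = (\<integral>\<^sup>+\<omega>. indicator A \<omega> * ennreal (W (x + d)) \<partial>M)"
      using x' d by (subst nn_integral_multc) (auto simp: p_def emeasure_eq_measure ennreal_mult W_nonneg)
    also have "\<dots> \<le> (\<integral>\<^sup>+\<omega>. indicator (alive 1 x) \<omega> * ennreal (W (x + V 1 \<omega>)) \<partial>M)"
    proof (intro nn_integral_mono)
      fix \<omega>
      show "indicator A \<omega> * ennreal (W (x + d)) \<le> indicator (alive 1 x) \<omega> * ennreal (W (x + V 1 \<omega>))"
      proof (cases "\<omega> \<in> A")
        case True
        then have "\<omega> \<in> alive 1 x" using alive_mono[of 1 "real m" x] x' by (auto simp: A_def)
        moreover have "W (x + d) \<le> W (x + V 1 \<omega>)" using True x' d by (intro W_mono) (auto simp: A_def)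
        ultimately show ?thesis using True by (simp add: ennreal_leI)
      qed simp
    qed
    also have "\<dots> = ennreal (W x)" using x' by (intro W_inv) auto
    finally have "p * W (x + d) \<le> W x" using W_nonneg[of x] x' by simp
    then show ?thesis using p by (simp add: field_simps)
  qed
  have it: "W (x + real n * d) \<le> W x * (1 / p) ^ n" if x: "x \<ge> x0" for x n
  proof (induction n)
    case (Suc n)
    have "W (x + real (Suc n) * d) = W ((x + real n * d) + d)" by (simp add: algebra_simps)
    also have "\<dots> \<le> W (x + real n * d) / p" using x d by (intro one) (auto intro: add_increasing2)
    also have "\<dots> \<le> (W x * (1 / p) ^ n) / p" using Suc p by (intro divide_right_mono) auto
    finally show ?case by simp
  qed simp
  \<comment> \<open>With this rate \<open>(1 / p) powr (y / d)\<close> equals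
    \<open>exp (K * y)\<close>; rounding \<open>y / d\<close> up to an integer costs at most one
    more factor \<open>1 / p\<close>, which becomes the constant \<open>C\<close>.\<close>
  define K where "K = - ln p / d"
  show ?thesis
  proof (rule that)
    show "x0 > 0" by (simp add: x0_def)
    show "1 / p \<ge> 1" using p by simp
    show "K \<ge> 0" using p d by (simp add: K_def divide_nonpos_pos)
    fix x y :: real assume x: "x \<ge> x0" and y: "y \<ge> 0"
    define n where "n = nat \<lceil>y / d\<rceil>"
    have n: "y / d \<le> real n" "real n \<le> y / d + 1"
    proof -
      have "y / d \<ge> 0" using y d by simp
      then have "0 \<le> \<lceil>y / d\<rceil>" by linarith
      then have "real n = of_int \<lceil>y / d\<rceil>" by (simp add: n_def)
      then show "y / d \<le> real n" "real n \<le> y / d + 1" by linarith+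
    qed
    have x': "x > 0" using x by (simp add: x0_def)
    have "(1 / p) ^ n = exp (real n * (- ln p))"
      using p by (simp add: exp_of_nat_mult exp_minus power_one_over inverse_eq_divide power_divide)
    also have "\<dots> \<le> exp ((y / d + 1) * (- ln p))"
      using n p by (intro exp_mono mult_right_mono) auto
    also have "\<dots> = 1 / p * exp (K * y)" using p by (simp add: K_def distrib_right exp_add exp_diff exp_minus divide_inverse)
    finally have e: "(1 / p) ^ n \<le> 1 / p * exp (K * y)" .
    have "W (x + y) \<le> W (x + real n * d)" using n d x' y by (intro W_mono) (auto simp: field_simps)
    also have "\<dots> \<le> W x * (1 / p) ^ n" by (rule it[OF x])
    also have "\<dots> \<le> W x * (1 / p * exp (K * y))"
      using W_nonneg[of x] x' by (intro mult_left_mono e) auto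
    finally show "W (x + y) \<le> 1 / p * exp (K * y) * W x"
      by (simp add: mult_ac)
  qed
qed

text \<open>Applying the invariance of \<open>W\<close> on \<open>[0, 1]\<close> bounds the supremum \<open>m\<close> of
  \<open>W z / W x * exp (k * (x - z))\<close> over \<open>z < x\<close> by \<open>m * exp (\<Psi> k)\<close> plus a constant.\<close>
lemma W_growth_lower_aux:
  assumes k: "k > 0" "\<Psi> k < 0"
    and up: "x0 > 0" "C \<ge> 1" "K \<ge> 0" "\<And>x y. x \<ge> x0 \<Longrightarrow> y \<ge> 0 \<Longrightarrow> W (x + y) \<le> C * exp (K * y) * W x"
    and x: "x \<ge> x0" and z: "0 < z" "z < x"
  shows "W z \<le> C * exp (\<Psi> (K + k)) / (1 - exp (\<Psi> k)) * exp (- k * (x - z)) * W x"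
proof -
  note V_meas[of 1, simplified, measurable] alive_sets[of 1, simplified, measurable]
  \<comment> \<open>The supremum of \<open>r\<close> is finite, being at most
    \<open>exp (k * x)\<close>; this is what later allows the self-referring inequality for
    \<open>m\<close> to be solved.\<close>
  define r where "r z = W z / W x * exp (k * (x - z))" for z
  define m where "m = (SUP z\<in>{0<..<x}. r z)"
  have Wx: "W x > 0" using x up by (intro W_pos) auto
  have bdd: "bdd_above (r ` {0<..<x})"
  proof (rule bdd_aboveI2)
    fix z assume z: "z \<in> {0<..<x}"
    show "r z \<le> 1 * exp (k * x)" unfolding r_def
      using z k Wx W_mono[of z x] W_nonneg[of z] by (intro mult_mono) (auto simp: field_simps)
  qed
  have rm: "r z \<le> m" if "z \<in> {0<..<x}" for z unfolding m_def by (rule cSUP_upper[OF that bdd])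
  have m0: "m \<ge> 0" using rm[of "x/2"] W_nonneg[of "x/2"] Wx x up by (smt (verit) r_def divide_nonneg_pos exp_ge_zero greaterThanLessThan_iff mult_nonneg_nonneg half_gt_zero field_sum_of_halves)
  have Wm: "W z \<le> m * exp (- k * (x - z)) * W x" if "z \<in> {0<..<x}" for z
  proof -
    have "W z = r z * exp (- k * (x - z)) * W x" using Wx by (simp add: r_def exp_minus)
    also have "\<dots> \<le> m * exp (- k * (x - z)) * W x" using rm[OF that] Wx by (intro mult_right_mono) auto
    finally show ?thesis .
  qed
  have step: "r z \<le> m * exp (\<Psi> k) + C * exp (\<Psi> (K + k))" if z: "z \<in> {0<..<x}" for z
  proof -
    define v where "v = exp (- k * (x - z))"
    have "ennreal (W z) = (\<integral>\<^sup>+\<omega>. indicator (alive 1 z) \<omega> * ennreal (W (z + V 1 \<omega>)) \<partial>M)"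
      using z by (intro W_inv[symmetric]) auto
    also have "\<dots> \<le> (\<integral>\<^sup>+\<omega>. ennreal (m * v * W x) * ennreal (exp (k * V 1 \<omega>)) + ennreal (C * v * W x) * ennreal (exp ((K + k) * V 1 \<omega>)) \<partial>M)"
    proof (intro nn_integral_mono)
      fix \<omega>
      show "indicator (alive 1 z) \<omega> * ennreal (W (z + V 1 \<omega>))
        \<le> ennreal (m * v * W x) * ennreal (exp (k * V 1 \<omega>)) + ennreal (C * v * W x) * ennreal (exp ((K + k) * V 1 \<omega>))"
      proof (cases "\<omega> \<in> alive 1 z")
        case True
        then have pos: "z + V 1 \<omega> > 0" by (rule alive_pos) auto
        \<comment> \<open>If the path is below \<open>x\<close> at time 1, the definition of
          \<open>m\<close> applies; above \<open>x\<close> the upper growth bound does. In both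
          cases the factor \<open>v = exp (- k * (x - z))\<close> can be extracted.\<close>
        have "W (z + V 1 \<omega>) \<le> m * v * W x * exp (k * V 1 \<omega>) + C * v * W x * exp ((K + k) * V 1 \<omega>)"
        proof (cases "z + V 1 \<omega> < x")
          case True
          then have "W (z + V 1 \<omega>) \<le> m * exp (- k * (x - (z + V 1 \<omega>))) * W x" using pos by (intro Wm) auto
          also have "exp (- k * (x - (z + V 1 \<omega>))) = v * exp (k * V 1 \<omega>)"
            by (simp add: v_def algebra_simps flip: exp_add)
          finally have "W (z + V 1 \<omega>) \<le> m * v * W x * exp (k * V 1 \<omega>)" by (simp add: mult_ac)
          moreover have "C * v * W x * exp ((K + k) * V 1 \<omega>) \<ge> 0" using up Wx by (simp add: v_def)
          ultimately show ?thesis by linarith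
        next
          case False
          then have "W (x + (z + V 1 \<omega> - x)) \<le> C * exp (K * (z + V 1 \<omega> - x)) * W x" using x by (intro up) auto
          then have "W (z + V 1 \<omega>) \<le> C * exp (K * (z + V 1 \<omega> - x)) * W x" by simp
          also have "\<dots> \<le> C * (v * exp ((K + k) * V 1 \<omega>)) * W x"
          proof -
            have "K * z + k * z \<le> k * z + K * x" using z up by (simp add: mult_left_mono)
            moreover have "0 \<le> k * (z + V 1 \<omega> - x)" using False k by simp
            ultimately have "K * (z + V 1 \<omega> - x) \<le> - k * (x - z) + (K + k) * V 1 \<omega>"
              using False k up z by (simp add: algebra_simps)
            then have "exp (K * (z + V 1 \<omega> - x)) \<le> v * exp ((K + k) * V 1 \<omega>)"
              unfolding v_def exp_add[symmetric] by simp
            then show ?thesis using up Wx by (intro mult_right_mono mult_left_mono) auto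
          qed
          finally have "W (z + V 1 \<omega>) \<le> C * v * W x * exp ((K + k) * V 1 \<omega>)" by (simp add: mult_ac)
          moreover have "m * v * W x * exp (k * V 1 \<omega>) \<ge> 0" using m0 Wx by (simp add: v_def)
          ultimately show ?thesis by linarith
        qed
        then have "ennreal (W (z + V 1 \<omega>)) \<le> ennreal (m * v * W x * exp (k * V 1 \<omega>) + C * v * W x * exp ((K + k) * V 1 \<omega>))"
          by (rule ennreal_leI)
        also have "\<dots> = ennreal (m * v * W x) * ennreal (exp (k * V 1 \<omega>)) + ennreal (C * v * W x) * ennreal (exp ((K + k) * V 1 \<omega>))"
          using m0 Wx up by (simp add: ennreal_plus ennreal_mult v_def)
        finally show ?thesis using True by simp
      qed simp
    qed
    also have "\<dots> = ennreal (m * v * W x) * ennreal (exp (\<Psi> k)) + ennreal (C * v * W x) * ennreal (exp (\<Psi> (K + k)))"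
      using nn_mgf[of 1 k] nn_mgf[of 1 "K + k"] k up by (simp add: nn_integral_add nn_integral_cmult)
    also have "\<dots> = ennreal ((m * exp (\<Psi> k) + C * exp (\<Psi> (K + k))) * v * W x)"
    proof -
      define a b where "a = m * v * W x" and "b = C * v * W x"
      have "a \<ge> 0" "b \<ge> 0" using m0 Wx up by (auto simp: a_def b_def v_def)
      then have "ennreal a * ennreal (exp (\<Psi> k)) + ennreal b * ennreal (exp (\<Psi> (K + k)))
         = ennreal (a * exp (\<Psi> k) + b * exp (\<Psi> (K + k)))"
        by (simp add: ennreal_mult ennreal_plus)
      also have "a * exp (\<Psi> k) + b * exp (\<Psi> (K + k)) = (m * exp (\<Psi> k) + C * exp (\<Psi> (K + k))) * v * W x"
        by (simp add: a_def b_def algebra_simps)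
      finally show ?thesis by (simp add: a_def b_def)
    qed
    finally have "W z \<le> (m * exp (\<Psi> k) + C * exp (\<Psi> (K + k))) * v * W x"
      using m0 Wx up by (subst (asm) ennreal_le_iff) (auto simp: v_def)
    then have "W z / W x \<le> (m * exp (\<Psi> k) + C * exp (\<Psi> (K + k))) * v" using Wx by (simp add: divide_le_eq)
    then have "r z \<le> (m * exp (\<Psi> k) + C * exp (\<Psi> (K + k))) * v * exp (k * (x - z))"
      unfolding r_def by (intro mult_right_mono) auto
    also have "\<dots> = m * exp (\<Psi> k) + C * exp (\<Psi> (K + k))"
      unfolding v_def mult.assoc exp_add[symmetric] by simp
    finally show ?thesis .
  qed
  have "m \<le> m * exp (\<Psi> k) + C * exp (\<Psi> (K + k))"
    unfolding m_def by (rule cSUP_least) (use step x up in \<open>auto simp: m_def\<close>)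
  \<comment> \<open>Here \<open>\<Psi> k < 0\<close> enters: the factor
    \<open>1 - exp (\<Psi> k)\<close> is positive.\<close>
  then have "m * (1 - exp (\<Psi> k)) \<le> C * exp (\<Psi> (K + k))" by (simp add: algebra_simps)
  then have "m \<le> C * exp (\<Psi> (K + k)) / (1 - exp (\<Psi> k))" using k by (simp add: le_divide_eq)
  then have "m * exp (- k * (x - z)) * W x \<le> C * exp (\<Psi> (K + k)) / (1 - exp (\<Psi> k)) * exp (- k * (x - z)) * W x"
    using Wx by (intro mult_right_mono) auto
  then show ?thesis using Wm[of z] z by simp
qed

text \<open>Makes the lower growth bound uniform in \<open>x\<close>. For \<open>k = 0\<close> it is
  monotonicity. Otherwise, if \<open>x < x0\<close> and \<open>x - y > 0\<close>, then
  \<open>y < x0\<close> and the constant \<open>exp (k * x0)\<close> compensates the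
  exponential.\<close>

lemma w_ratio_bound:
  obtains k c where "k \<ge> 0" "k + 1 > \<kappa>" "c \<ge> 1" "\<And>x y. y \<ge> 0 \<Longrightarrow> w (x - y) \<le> c * exp (- k * y) * w x"
proof -
  obtain k where k: "k \<ge> 0" "k + 1 > \<kappa>" "k = 0 \<or> \<Psi> k < 0"
    using kappa_bound[OF Psi_eventually_pos] by blast
  show ?thesis
  proof (cases "k = 0")
    case True
    then show ?thesis using k by (intro that[of 0 1]) (auto intro: w_mono)
  next
    case False
    then have k': "k > 0" "\<Psi> k < 0" using k by auto
    obtain x0 C K where up: "x0 > 0" "C \<ge> 1" "K \<ge> 0" "\<And>x y. x \<ge> x0 \<Longrightarrow> y \<ge> 0 \<Longrightarrow> W (x + y) \<le> C * exp (K * y) * W x"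
      using W_growth_upper by blast
    define c where "c = max (exp (k * x0)) (C * exp (\<Psi> (K + k)) / (1 - exp (\<Psi> k)))"
    have c1: "c \<ge> 1"
    proof -
      have "1 \<le> exp (k * x0)" using k' up by simp
      also have "\<dots> \<le> c" by (simp add: c_def)
      finally show ?thesis .
    qed
    have "w (x - y) \<le> c * exp (- k * y) * w x" if y: "y \<ge> 0" for x y
    proof -
      consider "x - y \<le> 0" | "x - y > 0" "x < x0" | "x - y > 0" "x \<ge> x0" "y = 0" | "x - y > 0" "x \<ge> x0" "y > 0" using y by linarith
      then show ?thesis
      proof cases
        case 1
        then show ?thesis using c1 w_nonneg[of x] by (simp add: w_zero)
      next
        case 2
        have "1 \<le> exp (k * x0) * exp (- k * y)" unfolding exp_add[symmetric] using 2 y k' by simp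
        also have "\<dots> \<le> c * exp (- k * y)" by (intro mult_right_mono) (auto simp: c_def)
        finally have "1 * w x \<le> c * exp (- k * y) * w x" by (intro mult_right_mono w_nonneg)
        then show ?thesis using w_mono[of "x - y" x] y by simp
      next
        case 3
        have "1 * w x \<le> c * w x" using c1 by (intro mult_right_mono w_nonneg)
        then show ?thesis using 3 by simp
      next
        case 4
        then have "W (x - y) \<le> C * exp (\<Psi> (K + k)) / (1 - exp (\<Psi> k)) * exp (- k * (x - (x - y))) * W x"
          by (intro W_growth_lower_aux[OF k' up]) auto
        also have "\<dots> \<le> c * exp (- k * y) * W x"
          using W_nonneg[of x] 4 y by (intro mult_mono mult_right_mono) (auto simp: c_def le_max_iff_disj)
        finally show ?thesis using 4 by (simp add: w_def)
      qed
    qed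
    then show ?thesis using that[of k c] k c1 by blast
  qed
qed

end

section \<open>The omega-scale function\<close>

text \<open>\<open>ratio\<close>, with rate \<open>k\<close>, bounds the convolutions defining
  \<open>ww\<close> from above by multiples of \<open>w\<close>; \<open>growth\<close>, with rate
  \<open>K\<close>, bounds them from below far out. \<open>summ\<close> keeps the resulting series
  finite.\<close>

locale omega_scale = scale_levy M V \<Psi> W for M :: "'a measure" and V \<Psi> W +
  fixes lam k c x0 C K :: real
  assumes lam: "lam > 0"
    and k: "k \<ge> 0" "k + 1 > \<kappa>"
    and c: "c \<ge> 1"
    and ratio: "\<And>x y. y \<ge> 0 \<Longrightarrow> w (x - y) \<le> c * exp (- k * y) * w x"
    and growth_const: "x0 > 0" "C \<ge> 1" "K \<ge> 0"
    and growth: "\<And>x y. x \<ge> x0 \<Longrightarrow> y \<ge> 0 \<Longrightarrow> W (x + y) \<le> C * exp (K * y) * W x"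
    and summ: "\<And>l. l \<ge> 0 \<Longrightarrow> l + 1 > \<kappa> \<Longrightarrow> summable (\<lambda>n. lam ^ n / (\<Prod>j<n. \<Psi> (l + 1 + real j)))"
begin

abbreviation we :: "real \<Rightarrow> ennreal" where "we \<equiv> \<lambda>x. ennreal (w x)"

text \<open>The \<open>\<omega>\<close>-scale function for killing at rate \<open>lam * exp (- x)\<close> solves \<open>ww = w + w \<star> (lam * exp (- \<cdot>) * ww)\<close>.
  Here \<open>wn n\<close> is its coefficient of \<open>lam ^ n\<close>, \<open>f\<close> is \<open>lam * exp (- \<cdot>) * ww\<close> and \<open>F\<close> is \<open>w \<star> f\<close>.\<close>
primrec wn :: "nat \<Rightarrow> real \<Rightarrow> ennreal" where
  "wn 0 = we"
| "wn (Suc n) = conv we (\<lambda>y. ennreal (exp (- y)) * wn n y)"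

lemma wn_meas [measurable]: "wn n \<in> borel_measurable borel"
  by (induction n) auto

lemma wn_neg: "x \<le> 0 \<Longrightarrow> wn n x = 0"
proof (induction n arbitrary: x)
  case (Suc n)
  have z: "ennreal (w (x - y)) * (ennreal (exp (- y)) * wn n y) = 0" for y
    using Suc by (cases "y \<le> 0") (auto simp: w_zero)
  show ?case unfolding wn.simps conv_def z by simp
qed (simp add: w_zero)

text \<open>Multiplication by \<open>exp (- y)\<close> shifts the argument of the transform by 1 and
  convolution with \<open>w\<close> multiplies it by \<open>1 / \<Psi> l\<close>; iterating gives
  the product.\<close>

lemma Lap_wn: "l > \<kappa> \<Longrightarrow> Lap (wn n) l = ennreal (\<Prod>j\<le>n. 1 / \<Psi> (l + real j))"
proof (induction n arbitrary: l)
  case 0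
  then show ?case by (simp add: Lap_w)
next
  case (Suc n)
  have p: "\<Psi> (l + real j) > 0" for j using Suc.prems by (intro Psi_pos) auto
  have "Lap (wn (Suc n)) l = Lap we l * Lap (wn n) (l + 1)"
    by (simp add: Lap_conv Lap_exp)
  also have "\<dots> = ennreal (1 / \<Psi> l) * ennreal (\<Prod>j\<le>n. 1 / \<Psi> (l + 1 + real j))"
    using Suc by (simp add: Lap_w)
  also have "\<dots> = ennreal ((1 / \<Psi> l) * (\<Prod>j\<le>n. 1 / \<Psi> (l + 1 + real j)))"
    using p[of 0] by (intro ennreal_mult'[symmetric]) simp
  also have "(1 / \<Psi> l) * (\<Prod>j\<le>n. 1 / \<Psi> (l + 1 + real j)) = (\<Prod>j\<le>Suc n. 1 / \<Psi> (l + real j))"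
    by (subst prod.atMost_Suc_shift) (simp add: add_ac)
  finally show ?case .
qed

definition f :: "real \<Rightarrow> ennreal" where
  "f y = (\<Sum>n. ennreal (lam ^ Suc n) * (ennreal (exp (- y)) * wn n y))"

definition F :: "real \<Rightarrow> ennreal" where "F = conv we f"

definition S :: "real \<Rightarrow> real" where "S l = fseries (\<lambda>j. \<Psi> (l + 1 + real j)) lam"

lemma f_meas [measurable]: "f \<in> borel_measurable borel"
  unfolding f_def by measurable

lemma F_meas [measurable]: "F \<in> borel_measurable borel"
  unfolding F_def by measurable

lemma f_neg: "y \<le> 0 \<Longrightarrow> f y = 0"
  by (simp add: f_def wn_neg)

lemma F_series: "F x = (\<Sum>n. ennreal (lam ^ Suc n) * wn (Suc n) x)"
proof -
  have "F x = (\<integral>\<^sup>+y. (\<Sum>n. ennreal (lam ^ Suc n) * (we (x - y) * (ennreal (exp (- y)) * wn n y))) \<partial>lborel)"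
    unfolding F_def conv_def f_def by (intro nn_integral_cong) (subst ennreal_suminf_cmult[symmetric]; simp add: mult_ac)
  also have "\<dots> = (\<Sum>n. \<integral>\<^sup>+y. ennreal (lam ^ Suc n) * (we (x - y) * (ennreal (exp (- y)) * wn n y)) \<partial>lborel)"
    by (rule nn_integral_suminf) measurable
  also have "\<dots> = (\<Sum>n. ennreal (lam ^ Suc n) * wn (Suc n) x)"
    by (intro suminf_cong) (subst nn_integral_cmult; simp add: conv_def)
  finally show ?thesis .
qed

text \<open>The series of \<open>F\<close> is that of \<open>ww\<close> without its zeroth term
  \<open>w\<close>. Together with \<open>F = conv we f\<close> this closes the renewal equation of
  the \<omega>-scale function.\<close>

lemma f_eq: "f y = ennreal lam * ennreal (exp (- y)) * (we y + F y)"
proof -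
  have s: "(\<lambda>n. ennreal (lam ^ Suc n) * wn (Suc n) y) sums F y"
    unfolding F_series by (intro summable_sums) simp
  have "(\<lambda>n. ennreal (lam ^ n) * wn n y) sums (F y + ennreal (lam ^ 0) * wn 0 y)"
    using sums_Suc[OF s] by simp
  then have "(\<Sum>n. ennreal (lam ^ n) * wn n y) = we y + F y" by (simp add: sums_iff add.commute)
  then have "ennreal lam * ennreal (exp (- y)) * (we y + F y) = (\<Sum>n. ennreal lam * ennreal (exp (- y)) * (ennreal (lam ^ n) * wn n y))"
    by (simp add: ennreal_suminf_cmult)
  also have "\<dots> = f y"
    unfolding f_def using lam by (intro suminf_cong) (simp add: ennreal_mult mult_ac)
  finally show ?thesis by simp
qed

text \<open>The 1 on the left is the term of index 0 of the series \<open>S l\<close>; the other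
  terms come from \<open>Lap_wn\<close> at \<open>l + 1\<close>, the shift being due to the factor
  \<open>exp (- y)\<close> in \<open>f\<close>.\<close>

lemma Lap_f:
  assumes l: "l \<ge> 0" "l + 1 > \<kappa>"
  shows "1 + Lap f l = ennreal (S l)"
proof -
  have p: "\<Psi> (l + 1 + real j) > 0" for j using l by (intro Psi_pos) auto
  define b where "b n = lam ^ n / (\<Prod>j<n. \<Psi> (l + 1 + real j))" for n
  have b: "b n \<ge> 0" for n unfolding b_def
    by (intro divide_nonneg_nonneg zero_le_power prod_nonneg ballI less_imp_le[OF p] less_imp_le[OF lam])
  have sb: "summable b" unfolding b_def by (rule summ[OF l])
  have "Lap f l = (\<Sum>n. ennreal (lam ^ Suc n) * Lap (wn n) (l + 1))"
    unfolding f_def by (subst Lap_suminf) (auto simp: Lap_cmult Lap_exp)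
  also have "\<dots> = (\<Sum>n. ennreal (b (Suc n)))"
  proof (intro suminf_cong)
    fix n
    have "ennreal (lam ^ Suc n) * Lap (wn n) (l + 1) = ennreal (lam ^ Suc n * (\<Prod>j\<le>n. 1 / \<Psi> (l + 1 + real j)))"
      using lam l by (simp add: Lap_wn ennreal_mult')
    also have "lam ^ Suc n * (\<Prod>j\<le>n. 1 / \<Psi> (l + 1 + real j)) = b (Suc n)"
      by (simp add: b_def prod_dividef lessThan_Suc_atMost)
    finally show "ennreal (lam ^ Suc n) * Lap (wn n) (l + 1) = ennreal (b (Suc n))" .
  qed
  also have "\<dots> = ennreal (\<Sum>n. b (Suc n))"
    using b sb by (intro suminf_ennreal2) (auto simp: summable_Suc_iff)
  finally have L: "Lap f l = ennreal (\<Sum>n. b (Suc n))" .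
  have "S l = (\<Sum>n. b (Suc n)) + b 0"
  proof -
    have "S l = suminf b" by (simp add: S_def fseries_def b_def[abs_def])
    moreover have "b 0 = 1" by (simp add: b_def)
    ultimately show ?thesis using suminf_split_head[OF sb] by simp
  qed
  then have "ennreal (S l) = ennreal (\<Sum>n. b (Suc n)) + ennreal (b 0)"
    using b sb by (simp add: ennreal_plus suminf_nonneg summable_Suc_iff)
  then show ?thesis by (simp add: L b_def add.commute)
qed

lemma S_ge_1: "l \<ge> 0 \<Longrightarrow> l + 1 > \<kappa> \<Longrightarrow> S l \<ge> 1"
proof -
  assume "l \<ge> 0" "l + 1 > \<kappa>"
  then have "ennreal (S l) = 1 + Lap f l" using Lap_f by simp
  then have "ennreal 1 \<le> ennreal (S l)" by simp
  then show ?thesis using ennreal_le_iff2[of 1 "S l"] by linarith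
qed

definition G where "G = c * S k"

lemma G_ge_1: "G \<ge> 1"
  using S_ge_1[OF k] c by (simp add: G_def mult_ge1_I)

text \<open>Inserting \<open>ratio\<close> into the convolution pulls \<open>w x\<close> out and
  leaves the Laplace transform of \<open>f\<close> at \<open>k\<close>, so the series
  \<open>S k\<close> appears as the constant.\<close>

lemma F_upper: "we x + F x \<le> ennreal (G * w x)"
proof -
  have "F x \<le> (\<integral>\<^sup>+y. ennreal (c * w x) * (ennreal (exp (- k * y)) * f y) \<partial>lborel)"
    unfolding F_def conv_def
  proof (intro nn_integral_mono)
    fix y
    show "we (x - y) * f y \<le> ennreal (c * w x) * (ennreal (exp (- k * y)) * f y)"
    proof (cases "y \<le> 0")
      case False
      then have "we (x - y) \<le> ennreal (c * exp (- k * y) * w x)" using ratio by (intro ennreal_leI) auto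
      then have "we (x - y) * f y \<le> ennreal (c * exp (- k * y) * w x) * f y" by (rule mult_right_mono) simp
      also have "ennreal (c * exp (- k * y) * w x) = ennreal (c * w x) * ennreal (exp (- k * y))"
        using c w_nonneg[of x] by (simp add: ennreal_mult[symmetric] mult_ac)
      finally show ?thesis by (simp add: mult.assoc)
    qed (simp add: f_neg)
  qed
  also have "\<dots> = ennreal (c * w x) * Lap f k"
    unfolding Lap_def by (rule nn_integral_cmult) simp
  finally have "we x + F x \<le> ennreal (c * w x) + ennreal (c * w x) * Lap f k"
    using c w_nonneg[of x] mult_right_mono[of 1 c "w x"] by (intro add_mono ennreal_leI) auto
  also have "\<dots> = ennreal (c * w x) * (1 + Lap f k)" by (simp add: distrib_left)
  also have "\<dots> = ennreal (G * w x)"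
    using c w_nonneg[of x] S_ge_1[OF k] by (simp add: Lap_f[OF k] G_def ennreal_mult[symmetric] mult_ac)
  finally show ?thesis .
qed

lemma F_finite: "F x < \<infinity>"
proof -
  have "F x \<le> we x + F x" by simp
  also have "\<dots> < \<infinity>" by (rule le_less_trans[OF F_upper]) simp
  finally show ?thesis .
qed

definition Fr where "Fr x = enn2real (F x)"
definition ww where "ww x = w x + Fr x"
definition fr where "fr y = lam * exp (- y) * ww y"

lemma F_Fr: "F x = ennreal (Fr x)"
  using F_finite[of x] by (simp add: Fr_def less_top)

lemma Fr_nonneg: "Fr x \<ge> 0" by (simp add: Fr_def)

lemma ww_ge: "w x \<le> ww x" by (simp add: ww_def Fr_nonneg)

lemma ww_nonneg: "ww x \<ge> 0" using ww_ge[of x] w_nonneg[of x] by linarith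

lemma ww_le: "ww x \<le> G * w x"
proof -
  have "ennreal (ww x) \<le> ennreal (G * w x)"
    using F_upper[of x] by (simp add: ww_def F_Fr Fr_nonneg w_nonneg ennreal_plus)
  then show ?thesis using G_ge_1 w_nonneg[of x] by (subst (asm) ennreal_le_iff) auto
qed

lemma fr_nonneg: "fr y \<ge> 0" using lam ww_nonneg by (simp add: fr_def)

lemma f_fr: "f y = ennreal (fr y)"
  using lam w_nonneg[of y] Fr_nonneg[of y]
  by (simp add: f_eq fr_def ww_def F_Fr ennreal_mult ennreal_plus)

lemma ww_neg: "x \<le> 0 \<Longrightarrow> ww x = 0"
  using ww_le[of x] ww_nonneg[of x] by (simp add: w_zero)

lemma fr_neg: "x \<le> 0 \<Longrightarrow> fr x = 0" by (simp add: fr_def ww_neg)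

lemma fr_le: "fr y \<le> lam * ww y"
proof (cases "y \<le> 0")
  case False
  then have "exp (- y) * ww y \<le> 1 * ww y" by (intro mult_right_mono ww_nonneg) auto
  then show ?thesis using lam by (simp add: fr_def mult.assoc)
qed (simp add: fr_neg ww_neg)

lemma Fr_mono: "x \<le> y \<Longrightarrow> Fr x \<le> Fr y"
proof -
  assume "x \<le> y"
  then have "F x \<le> F y" unfolding F_def conv_def
    by (intro nn_integral_mono mult_right_mono ennreal_leI w_mono) auto
  then show ?thesis by (simp add: F_Fr Fr_nonneg)
qed

lemma ww_mono: "x \<le> y \<Longrightarrow> ww x \<le> ww y"
  unfolding ww_def by (intro add_mono Fr_mono w_mono)

lemma w_isCont: "isCont w x"
  using w_cont by (simp add: continuous_on_eq_continuous_at)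

text \<open>Serves to show that \<open>F x / w x\<close> vanishes as \<open>x\<close> tends to 0,
  that is, \<open>g\<close> has limit 1. The integrand lives on an interval of length
  \<open>max 0 x\<close>, where both factors are controlled by \<open>w x\<close>.\<close>

lemma F_bound_local: "F x \<le> ennreal (w x * (max 0 x * (lam * G * w x)))"
proof -
  have "F x \<le> (\<integral>\<^sup>+y. ennreal (w x * (lam * G * w x)) * indicator {0..max 0 x} y \<partial>lborel)"
    unfolding F_def conv_def
  proof (intro nn_integral_mono)
    fix y
    show "we (x - y) * f y \<le> ennreal (w x * (lam * G * w x)) * indicator {0..max 0 x} y"
    proof (cases "y \<in> {0..max 0 x}")
      case True
      have "w (x - y) * fr y \<le> w x * (lam * G * w x)"
      proof (cases "x - y \<le> 0")
        case False
        have "fr y \<le> lam * (G * w y)" using fr_le[of y] ww_le[of y] lam by (meson mult_left_mono order_trans less_imp_le)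
        also have "\<dots> \<le> lam * (G * w x)" using False lam G_ge_1 by (intro mult_left_mono w_mono) auto
        finally show ?thesis using True by (intro mult_mono w_mono fr_nonneg) (auto simp: w_nonneg mult_ac)
      qed (use lam G_ge_1 w_nonneg[of x] in \<open>simp add: w_zero\<close>)
      then show ?thesis using True by (simp add: f_fr ennreal_mult[symmetric] w_nonneg fr_nonneg ennreal_leI)
    next
      case False
      then show ?thesis by (auto simp: f_neg w_zero not_le)
    qed
  qed
  also have "\<dots> = ennreal (w x * (lam * G * w x)) * ennreal (max 0 x)"
    by (subst nn_integral_cmult_indicator) auto
  also have "\<dots> = ennreal (w x * (lam * G * w x) * max 0 x)"
    using lam G_ge_1 w_nonneg[of x] by (intro ennreal_mult[symmetric]) auto
  finally show ?thesis by (simp add: mult_ac)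
qed

lemma Fr_sequentially:
  assumes x: "x \<longlonglongrightarrow> x'" shows "(\<lambda>n. Fr (x n)) \<longlonglongrightarrow> Fr x'"
proof -
  obtain R where R: "\<And>n. \<bar>x n\<bar> \<le> R" "\<bar>x'\<bar> \<le> R"
  proof -
    obtain R0 where "\<And>n. \<bar>x n\<bar> \<le> R0" using Bseq_def convergent_imp_Bseq x convergent_def by (metis real_norm_def)
    then show ?thesis by (intro that[of "max R0 \<bar>x'\<bar>"]) (auto simp: le_max_iff_disj)
  qed
  have R0: "R \<ge> 0" using R(2) by linarith
  define B where "B = w R * (lam * G * w R)"
  have B0: "B \<ge> 0" using lam G_ge_1 w_nonneg[of R] by (simp add: B_def)
  have bd: "ennreal (w (z - y) * fr y) \<le> ennreal B * indicator {0..R} y" if z: "z \<le> R" for z y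
  proof (cases "y \<in> {0..R}")
    case True
    have "fr y \<le> lam * (G * w y)" using fr_le[of y] ww_le[of y] lam by (meson mult_left_mono order_trans less_imp_le)
    also have "\<dots> \<le> lam * (G * w R)" using True lam G_ge_1 by (intro mult_left_mono w_mono) auto
    finally have "w (z - y) * fr y \<le> w R * (lam * (G * w R))"
      using True z by (intro mult_mono w_mono fr_nonneg) (auto simp: w_nonneg)
    then show ?thesis using True by (simp add: B_def mult.assoc ennreal_leI)
  next
    case False
    then show ?thesis using z by (auto simp: fr_neg w_zero not_le)
  qed
  have "(\<lambda>n. \<integral>\<^sup>+y. ennreal (w (x n - y) * fr y) \<partial>lborel) \<longlonglongrightarrow> (\<integral>\<^sup>+y. ennreal (w (x' - y) * fr y) \<partial>lborel)"
  proof (rule nn_integral_dominated_convergence[where w = "\<lambda>y. ennreal B * indicator {0..R} y"])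
    have [measurable]: "fr \<in> borel_measurable borel"
    proof -
      have "fr = (\<lambda>y. enn2real (f y))" by (simp add: f_fr fr_nonneg fun_eq_iff)
      then show ?thesis by simp
    qed
    show "\<And>n. (\<lambda>y. ennreal (w (x n - y) * fr y)) \<in> borel_measurable lborel" by measurable
    show "(\<lambda>y. ennreal (w (x' - y) * fr y)) \<in> borel_measurable lborel" by measurable
    show "AE y in lborel. ennreal (w (x n - y) * fr y) \<le> ennreal B * indicator {0..R} y" for n
      by (intro AE_I2 bd) (use R(1)[of n] in linarith)
    show "AE y in lborel. (\<lambda>n. ennreal (w (x n - y) * fr y)) \<longlonglongrightarrow> ennreal (w (x' - y) * fr y)"
    proof (intro AE_I2 tendsto_ennrealI tendsto_mult tendsto_const)
      show "(\<lambda>n. w (x n - y)) \<longlonglongrightarrow> w (x' - y)" for y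
        by (rule isCont_tendsto_compose[OF w_isCont]) (intro tendsto_diff x tendsto_const)
    qed
    show "(\<integral>\<^sup>+y. ennreal B * indicator {0..R} y \<partial>lborel) < \<infinity>"
      using R0 by (subst nn_integral_cmult_indicator) (auto simp: ennreal_mult_less_top)
  qed simp
  moreover have "(\<integral>\<^sup>+y. ennreal (w (z - y) * fr y) \<partial>lborel) = ennreal (Fr z)" for z
    unfolding F_Fr[symmetric] F_def conv_def by (intro nn_integral_cong) (simp add: f_fr ennreal_mult w_nonneg fr_nonneg)
  ultimately have "(\<lambda>n. ennreal (Fr (x n))) \<longlonglongrightarrow> ennreal (Fr x')" by simp
  then show ?thesis by (rule tendsto_ennrealD) (auto simp: Fr_nonneg)
qed

lemma Fr_isCont: "isCont Fr x"
  by (simp add: continuous_at_sequentially comp_def Fr_sequentially)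

lemma ww_isCont: "isCont ww x"
  unfolding ww_def[abs_def] by (intro continuous_intros w_isCont Fr_isCont)

lemma fr_isCont: "isCont fr x"
  unfolding fr_def[abs_def] by (intro continuous_intros ww_isCont)

lemma Fr_meas [measurable]: "Fr \<in> borel_measurable borel"
  unfolding Fr_def[abs_def] by measurable

lemma ww_meas [measurable]: "ww \<in> borel_measurable borel"
  unfolding ww_def[abs_def] by measurable

text \<open>The conditioned process is the h-transform of the killed one by \<open>W\<close>, so a
  function is carried from the killed process to the conditioned one by division by
  \<open>w\<close>.\<close>

definition g where "g x = ww x / w x"

lemma g_bounds: "x > 0 \<Longrightarrow> 1 \<le> g x" "x > 0 \<Longrightarrow> g x \<le> G"
  using ww_ge[of x] ww_le[of x] w_pos[of x] by (auto simp: g_def divide_le_eq le_divide_eq)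

lemma g_isCont: "x > 0 \<Longrightarrow> isCont g x"
  unfolding g_def[abs_def] by (intro continuous_intros ww_isCont w_isCont) (auto dest: w_pos)

lemma g_at_0: "(g \<longlongrightarrow> 1) (at_right 0)"
proof (rule tendsto_sandwich[where f = "\<lambda>_. 1" and h = "\<lambda>x. 1 + max 0 x * (lam * G * w x)"])
  have ev: "eventually (\<lambda>x::real. x > 0) (at_right 0)" by (rule eventually_at_right_less)
  show "eventually (\<lambda>x. 1 \<le> g x) (at_right 0)" using ev by eventually_elim (rule g_bounds)
  show "eventually (\<lambda>x. g x \<le> 1 + max 0 x * (lam * G * w x)) (at_right 0)"
    using ev
  proof eventually_elim
    case (elim x)
    have "Fr x \<le> w x * (max 0 x * (lam * G * w x))"
      using F_bound_local[of x] elim lam G_ge_1 w_nonneg[of x] unfolding F_Fr by (subst (asm) ennreal_le_iff) auto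
    then have "ww x \<le> w x * (1 + max 0 x * (lam * G * w x))" by (simp add: ww_def distrib_left)
    then show ?case using w_pos[OF elim] by (simp add: g_def divide_le_eq mult.commute)
  qed
  have "((\<lambda>x. 1 + max 0 x * (lam * G * w x)) \<longlongrightarrow> 1 + max 0 0 * (lam * G * w 0)) (at_right 0)"
    by (intro tendsto_intros tendsto_mono[OF _ w_isCont[unfolded isCont_def]]) (auto simp: at_le)
  then show "((\<lambda>x. 1 + max 0 x * (lam * G * w x)) \<longlongrightarrow> 1) (at_right 0)" by simp
qed simp

text \<open>\<open>growth\<close> bounds \<open>w (x - y) / w x\<close> from below by
  \<open>exp (- K * y) / C\<close>, but only while \<open>x - y \<ge> x0\<close>. The transform of
  \<open>f\<close> at \<open>K\<close> is therefore truncated at \<open>y \<le> n\<close>, and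
  monotone convergence in \<open>n\<close> recovers it.\<close>

lemma g_eventually_ge:
  assumes "K + 1 > \<kappa>" and \<theta>: "\<theta> < 1 + (S K - 1) / C"
  shows "eventually (\<lambda>x. g x \<ge> \<theta>) at_top"
proof -
  have K0: "K \<ge> 0" using growth_const by simp
  define h where "h n = (\<integral>\<^sup>+y. ennreal (exp (- K * y)) * f y * indicator {..real n} y \<partial>lborel)" for n
  have hlim: "(\<lambda>n. h n) \<longlonglongrightarrow> Lap f K"
  proof -
    have "(\<lambda>n. h n) \<longlonglongrightarrow> (\<integral>\<^sup>+y. ennreal (exp (- K * y)) * f y \<partial>lborel)"
      unfolding h_def
    proof (rule nn_integral_LIMSEQ)
      show "incseq (\<lambda>n y. ennreal (exp (- K * y)) * f y * indicator {..real n} y)"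
        by (auto simp: incseq_def le_fun_def indicator_def)
      fix y
      obtain N :: nat where N: "y \<le> real N" using real_arch_simple by blast
      have "eventually (\<lambda>n. ennreal (exp (- K * y)) * f y * indicator {..real n} y = ennreal (exp (- K * y)) * f y) sequentially"
        using eventually_ge_at_top[of N] by eventually_elim (use N in auto)
      then show "(\<lambda>n. ennreal (exp (- K * y)) * f y * indicator {..real n} y) \<longlonglongrightarrow> ennreal (exp (- K * y)) * f y"
        by (rule tendsto_eventually)
    qed measurable
    then show ?thesis by (simp add: Lap_def)
  qed
  have LK: "Lap f K = ennreal (S K - 1)"
  proof -
    have "1 + Lap f K = 1 + ennreal (S K - 1)"
      using Lap_f[OF K0 assms(1)] S_ge_1[OF K0 assms(1)] by (simp add: ennreal_plus[symmetric] flip: ennreal_1)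
    then show ?thesis by simp
  qed
  have low: "g x \<ge> 1 + enn2real (h n) / C" if x: "x \<ge> real n + x0" for x n
  proof -
    have xp: "x > 0" using x growth_const by simp
    have hf: "h n < \<infinity>"
    proof -
      have "h n \<le> Lap f K" unfolding h_def Lap_def by (intro nn_integral_mono) (auto simp: indicator_def)
      then show ?thesis by (simp add: LK le_less_trans)
    qed
    have "ennreal (w x / C) * h n = (\<integral>\<^sup>+y. ennreal (w x / C) * (ennreal (exp (- K * y)) * f y * indicator {..real n} y) \<partial>lborel)"
      unfolding h_def by (rule nn_integral_cmult[symmetric]) measurable
    also have "\<dots> \<le> F x" unfolding F_def conv_def
    proof (intro nn_integral_mono)
      fix y
      show "ennreal (w x / C) * (ennreal (exp (- K * y)) * f y * indicator {..real n} y) \<le> we (x - y) * f y"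
      proof (cases "0 < y \<and> y \<le> real n")
        case True
        have "W (x - y + y) \<le> C * exp (K * y) * W (x - y)" using True x growth_const by (intro growth) auto
        then have "w x \<le> C * exp (K * y) * w (x - y)" using True x growth_const xp by (simp add: w_pos_eq)
        then have "w x / C * exp (- K * y) \<le> w (x - y)"
          using growth_const by (simp add: field_simps exp_minus)
        then have "ennreal (w x / C) * ennreal (exp (- K * y)) \<le> we (x - y)"
          using growth_const w_nonneg[of x] by (simp add: ennreal_mult[symmetric] ennreal_leI)
        then have "ennreal (w x / C) * ennreal (exp (- K * y)) * f y \<le> we (x - y) * f y" by (rule mult_right_mono) simp
        then show ?thesis using True by (simp add: mult.assoc)
      next
        case False
        then show ?thesis by (cases "y \<le> 0") (auto simp: f_neg)
      qed
    qed
    finally have "ennreal (w x / C * enn2real (h n)) \<le> ennreal (Fr x)"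
      using hf growth_const w_nonneg[of x] by (subst ennreal_mult') (simp_all add: F_Fr)
    then have "w x / C * enn2real (h n) \<le> Fr x" by (simp add: Fr_nonneg)
    then show ?thesis using w_pos[OF xp] by (simp add: g_def ww_def field_simps)
  qed
  have "(\<lambda>n. 1 + enn2real (h n) / C) \<longlonglongrightarrow> 1 + (S K - 1) / C"
    using growth_const S_ge_1[OF K0 assms(1)] hlim unfolding LK
    by (intro tendsto_intros tendsto_enn2real) auto
  then have "eventually (\<lambda>n. \<theta> < 1 + enn2real (h n) / C) sequentially" using \<theta> by (auto simp: order_tendsto_iff)
  then obtain n where n: "\<theta> < 1 + enn2real (h n) / C" by (auto simp: eventually_sequentially)
  show ?thesis
    using eventually_ge_at_top[of "real n + x0"]
    by eventually_elim (use low n in \<open>meson less_imp_le order_trans less_le_trans\<close>)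
qed

end

section \<open>Dynkin formula for the killed process\<close>

text \<open>The first conclusion supplies the joint measurability in time and path of the integrands
  that arise as limits over grids and starting points.\<close>

lemma nn_integral_LIMSEQ_dominated:
  fixes v :: "nat \<Rightarrow> 'b \<Rightarrow> ennreal"
  assumes v: "\<And>n. v n \<in> borel_measurable N" and u: "u \<in> borel_measurable N"
    and le: "\<And>n p. p \<in> space N \<Longrightarrow> v n p \<le> u p" and fin: "(\<integral>\<^sup>+p. u p \<partial>N) < \<infinity>"
    and lim: "\<And>p. p \<in> space N \<Longrightarrow> (\<lambda>n. v n p) \<longlonglongrightarrow> v0 p"
  shows "v0 \<in> borel_measurable N" "(\<lambda>n. \<integral>\<^sup>+p. v n p \<partial>N) \<longlonglongrightarrow> (\<integral>\<^sup>+p. v0 p \<partial>N)"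
proof -
  show m: "v0 \<in> borel_measurable N"
    using lim v by (rule borel_measurable_LIMSEQ_order)
  show "(\<lambda>n. \<integral>\<^sup>+p. v n p \<partial>N) \<longlonglongrightarrow> (\<integral>\<^sup>+p. v0 p \<partial>N)"
    by (rule nn_integral_dominated_convergence[where w = u]) (use v u m le fin lim in auto)
qed

text \<open>A nondecreasing function that is infinite at \<open>x\<close> is infinite on
  \<open>{x..x+1}\<close>, a set of positive measure. Finiteness at every point thus comes from
  finiteness of one transform.\<close>

lemma Lap_finite_mono:
  fixes H :: "real \<Rightarrow> ennreal"
  assumes mono: "\<And>x y. x \<le> y \<Longrightarrow> H x \<le> H y" and [measurable]: "H \<in> borel_measurable borel" and fin: "Lap H l < \<infinity>"
  shows "H x < \<infinity>"
proof (rule ccontr)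
  assume "\<not> ?thesis"
  then have "H x = \<infinity>" by (simp add: not_less top_unique)
  then have top: "H y = \<infinity>" if "x \<le> y" for y using mono[OF that] by (simp add: top_unique)
  have "AE y in lborel. ennreal (exp (- l * y)) * H y \<noteq> \<infinity>"
    using fin unfolding Lap_def by (intro nn_integral_PInf_AE) auto
  then have "AE y in lborel. y \<notin> {x..x+1}"
    by eventually_elim (auto simp: top ennreal_mult_eq_top_iff ennreal_eq_0_iff)
  then have "{x..x+1} \<in> null_sets lborel" by (subst AE_iff_null_sets) auto
  then show False by (simp add: null_sets_def)
qed

lemma sequential_eq_of_AE:
  fixes H1 H2 :: "real \<Rightarrow> ennreal"
  assumes ae: "AE x in lborel. H1 x = H2 x"
    and c1: "\<And>X x. X \<longlonglongrightarrow> x \<Longrightarrow> (\<lambda>n. H1 (X n)) \<longlonglongrightarrow> H1 x"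
    and c2: "\<And>X x. X \<longlonglongrightarrow> x \<Longrightarrow> (\<lambda>n. H2 (X n)) \<longlonglongrightarrow> H2 x"
  shows "H1 x = H2 x"
proof -
  have "\<exists>y. x \<le> y \<and> y \<le> x + 1 / real (Suc n) \<and> H1 y = H2 y" for n
  proof (rule ccontr)
    assume "\<not> ?thesis"
    then have "AE y in lborel. y \<notin> {x..x + 1 / real (Suc n)}"
      using ae by (elim eventually_mono) auto
    then have "{x..x + 1 / real (Suc n)} \<in> null_sets lborel" by (subst AE_iff_null_sets) auto
    then show False by (simp add: null_sets_def del: of_nat_Suc)
  qed
  then obtain X where X: "\<And>n. x \<le> X n" "\<And>n. X n \<le> x + 1 / real (Suc n)" "\<And>n. H1 (X n) = H2 (X n)" by metis
  have "(\<lambda>n. x + 1 / real (Suc n)) \<longlonglongrightarrow> x + 0"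
    by (intro tendsto_intros LIMSEQ_inverse_real_of_nat[unfolded inverse_eq_divide])
  then have "X \<longlonglongrightarrow> x"
    using X(1,2) by (intro tendsto_sandwich[of "\<lambda>_. x" X _ "\<lambda>n. x + 1 / real (Suc n)"] always_eventually allI) auto
  then show ?thesis using c1[of X x] c2[of X x] X(3) by (auto intro: LIMSEQ_unique)
qed

section \<open>The free semigroup under the Laplace transform, and approximations of the killing
  event\<close>

context levy
begin

lemma V_prod_meas [measurable]: "(\<lambda>p. V (max 0 (fst p)) (snd p)) \<in> borel_measurable (lborel \<Otimes>\<^sub>M M)"
proof -
  have "sets (lborel \<Otimes>\<^sub>M M) = sets (borel \<Otimes>\<^sub>M M)" by (intro sets_pair_measure_cong) auto
  from measurable_cong_sets[OF this refl] V_pair_meas show ?thesis by (simp add: split_beta')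
qed

lemma Lap_P:
  assumes t: "t \<ge> 0" and l: "l \<ge> 0" and [measurable]: "\<phi> \<in> borel_measurable borel"
  shows "Lap (P t \<phi>) l = ennreal (exp (t * \<Psi> l)) * Lap \<phi> l"
proof -
  note V_meas[OF t, measurable]
  interpret PS: pair_sigma_finite lborel M ..
  have "Lap (P t \<phi>) l = (\<integral>\<^sup>+x. \<integral>\<^sup>+\<omega>. ennreal (exp (- l * x)) * \<phi> (x + V t \<omega>) \<partial>M \<partial>lborel)"
    unfolding Lap_def P_def by (subst nn_integral_cmult) auto
  also have "\<dots> = (\<integral>\<^sup>+\<omega>. \<integral>\<^sup>+x. ennreal (exp (- l * x)) * \<phi> (x + V t \<omega>) \<partial>lborel \<partial>M)"
    by (rule PS.Fubini'[symmetric]) measurable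
  also have "\<dots> = (\<integral>\<^sup>+\<omega>. ennreal (exp (l * V t \<omega>)) * Lap \<phi> l \<partial>M)"
  proof (intro nn_integral_cong)
    fix \<omega>
    show "(\<integral>\<^sup>+x. ennreal (exp (- l * x)) * \<phi> (x + V t \<omega>) \<partial>lborel) = ennreal (exp (l * V t \<omega>)) * Lap \<phi> l"
      using Lap_translate[of \<phi> "- V t \<omega>" l] by (simp add: Lap_def)
  qed
  also have "\<dots> = ennreal (exp (t * \<Psi> l)) * Lap \<phi> l"
    using nn_mgf[OF t l] by (subst nn_integral_multc) auto
  finally show ?thesis .
qed

definition Pint :: "real \<Rightarrow> (real \<Rightarrow> ennreal) \<Rightarrow> real \<Rightarrow> ennreal" where
  "Pint t \<phi> x = (\<integral>\<^sup>+s. indicator {0..<t} s * P (max 0 s) \<phi> x \<partial>lborel)"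

lemma P_pair_meas2 [measurable]:
  assumes "\<phi> \<in> borel_measurable borel"
  shows "(\<lambda>p. P (max 0 (snd p)) \<phi> (fst p)) \<in> borel_measurable (borel \<Otimes>\<^sub>M borel)"
proof -
  have "(\<lambda>p. (snd p, fst p)) \<in> (borel \<Otimes>\<^sub>M borel :: (real \<times> real) measure) \<rightarrow>\<^sub>M borel \<Otimes>\<^sub>M borel" by measurable
  from measurable_compose[OF this P_pair_measurable[OF assms]] show ?thesis by (simp add: split_beta')
qed

lemma Pint_meas [measurable]:
  assumes [measurable]: "\<phi> \<in> borel_measurable borel" shows "Pint t \<phi> \<in> borel_measurable borel"
proof -
  have "(\<lambda>p. indicator {0..<t} (snd p) * P (max 0 (snd p)) \<phi> (fst p)) \<in> borel_measurable (borel \<Otimes>\<^sub>M lborel)"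
  proof -
    have "sets (borel \<Otimes>\<^sub>M lborel) = sets (borel \<Otimes>\<^sub>M borel)" by (intro sets_pair_measure_cong) auto
    note e = measurable_cong_sets[OF this refl]
    have "(\<lambda>p. indicator {0..<t} (snd p) * P (max 0 (snd p)) \<phi> (fst p)) \<in> borel_measurable (borel \<Otimes>\<^sub>M borel)"
      by measurable
    then show ?thesis by (simp only: e)
  qed
  then show ?thesis unfolding Pint_def[abs_def]
    by (intro lborel.borel_measurable_nn_integral) (simp add: split_beta')
qed

lemma nn_integral_exp_interval:
  assumes "a > 0" "t \<ge> 0"
  shows "(\<integral>\<^sup>+s. indicator {0..<t} s * ennreal (exp (max 0 s * a)) \<partial>lborel) = ennreal ((exp (t * a) - 1) / a)"
proof -
  have "(\<integral>\<^sup>+s. indicator {0..<t} s * ennreal (exp (max 0 s * a)) \<partial>lborel)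
    = (\<integral>\<^sup>+s. ennreal (exp (s * a)) * indicator {0..t} s \<partial>lborel)"
  proof (rule nn_integral_cong_AE)
    show "AE s in lborel. indicator {0..<t} s * ennreal (exp (max 0 s * a)) = ennreal (exp (s * a)) * indicator {0..t} s"
      using AE_lborel_singleton[of t] by eventually_elim (auto simp: indicator_def)
  qed
  also have "\<dots> = ennreal (exp (t * a) / a - exp (0 * a) / a)"
    using assms by (intro nn_integral_FTC_Icc) (auto intro!: derivative_eq_intros)
  finally show ?thesis by (simp add: diff_divide_distrib)
qed

lemma Lap_Pint:
  assumes t: "t \<ge> 0" and l: "l \<ge> 0" "\<Psi> l > 0" and [measurable]: "\<phi> \<in> borel_measurable borel"
  shows "Lap (Pint t \<phi>) l = ennreal ((exp (t * \<Psi> l) - 1) / \<Psi> l) * Lap \<phi> l"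
proof -
  have [measurable]: "(\<lambda>p. P (max 0 (fst p)) \<phi> (snd p)) \<in> borel_measurable (lborel \<Otimes>\<^sub>M lborel)"
  proof -
    have "sets (lborel \<Otimes>\<^sub>M lborel :: (real \<times> real) measure) = sets (borel \<Otimes>\<^sub>M borel)" by (intro sets_pair_measure_cong) auto
    from measurable_cong_sets[OF this refl] show ?thesis using P_pair_measurable[of \<phi>] by (simp add: split_beta')
  qed
  have m: "(\<lambda>(s, x). ennreal (exp (- l * x)) * (indicator {0..<t} s * P (max 0 s) \<phi> x)) \<in> borel_measurable (lborel \<Otimes>\<^sub>M lborel)"
    unfolding split_beta' by measurable
  have [measurable]: "(\<lambda>s. P (max 0 s) \<phi> x) \<in> borel_measurable borel" for x
    using measurable_compose[OF _ P_pair_meas2[of \<phi>], of "\<lambda>s. (x, s)" borel] by simp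
  have "Lap (Pint t \<phi>) l = (\<integral>\<^sup>+x. \<integral>\<^sup>+s. ennreal (exp (- l * x)) * (indicator {0..<t} s * P (max 0 s) \<phi> x) \<partial>lborel \<partial>lborel)"
    unfolding Lap_def Pint_def by (subst nn_integral_cmult) auto
  also have "\<dots> = (\<integral>\<^sup>+s. \<integral>\<^sup>+x. ennreal (exp (- l * x)) * (indicator {0..<t} s * P (max 0 s) \<phi> x) \<partial>lborel \<partial>lborel)"
    by (rule lborel_pair.Fubini'[OF m])
  also have "\<dots> = (\<integral>\<^sup>+s. indicator {0..<t} s * Lap (P (max 0 s) \<phi>) l \<partial>lborel)"
    unfolding Lap_def by (intro nn_integral_cong) (subst nn_integral_cmult[symmetric]; simp add: mult_ac)
  also have "\<dots> = (\<integral>\<^sup>+s. indicator {0..<t} s * ennreal (exp (max 0 s * \<Psi> l)) * Lap \<phi> l \<partial>lborel)"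
    by (intro nn_integral_cong) (simp add: Lap_P l mult.assoc)
  also have "\<dots> = (\<integral>\<^sup>+s. indicator {0..<t} s * ennreal (exp (max 0 s * \<Psi> l)) \<partial>lborel) * Lap \<phi> l"
    by (rule nn_integral_multc) measurable
  finally show ?thesis using nn_integral_exp_interval[OF l(2) t] by simp
qed

lemma Pint_prod:
  assumes [measurable]: "\<phi> \<in> borel_measurable borel"
  shows "Pint t \<phi> x = (\<integral>\<^sup>+p. indicator {0..<t} (fst p) * \<phi> (x + V (max 0 (fst p)) (snd p)) \<partial>(lborel \<Otimes>\<^sub>M M))"
proof -
  have m: "(\<lambda>p. indicator {0..<t} (fst p) * \<phi> (x + V (max 0 (fst p)) (snd p))) \<in> borel_measurable (lborel \<Otimes>\<^sub>M M)"
    by measurable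
  have "(\<integral>\<^sup>+p. indicator {0..<t} (fst p) * \<phi> (x + V (max 0 (fst p)) (snd p)) \<partial>(lborel \<Otimes>\<^sub>M M))
     = (\<integral>\<^sup>+s. \<integral>\<^sup>+\<omega>. indicator {0..<t} s * \<phi> (x + V (max 0 s) \<omega>) \<partial>M \<partial>lborel)"
    using nn_integral_fst[OF m] by simp
  also have "\<dots> = Pint t \<phi> x"
    unfolding Pint_def P_def
    by (intro nn_integral_cong nn_integral_cmult) measurable
  finally show ?thesis by simp
qed

definition grid_alive :: "real \<Rightarrow> real \<Rightarrow> real \<Rightarrow> 'a set" where
  "grid_alive \<delta> x s = {\<omega> \<in> space M. \<forall>i. real i * \<delta> \<le> s \<longrightarrow> x + V (real i * \<delta>) \<omega> > 0}"

text \<open>The grid is scaled by the horizon \<open>h\<close> and not by \<open>s\<close>, so one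
  grid serves all intermediate times. Positivity is required at each dyadic time separately, without
  the common margin that \<open>alive\<close> contains.\<close>

definition dyadic_alive :: "real \<Rightarrow> real \<Rightarrow> real \<Rightarrow> 'a set" where
  "dyadic_alive h x s = (\<Inter>j. grid_alive (h / 2 ^ j) x s)"

lemma grid_alive_prod_meas [measurable]:
  assumes d: "\<delta> \<ge> 0"
  shows "(\<lambda>p. indicator (grid_alive \<delta> x (fst p)) (snd p) :: ennreal) \<in> borel_measurable (lborel \<Otimes>\<^sub>M M)"
proof -
  have [measurable]: "V (real i * \<delta>) \<in> borel_measurable M" for i using d by (intro V_meas) simp
  have "{p \<in> space (lborel \<Otimes>\<^sub>M M). \<forall>i. real i * \<delta> \<le> fst p \<longrightarrow> x + V (real i * \<delta>) (snd p) > 0} \<in> sets (lborel \<Otimes>\<^sub>M M)"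
    by measurable
  then have "(\<lambda>p. indicator {p \<in> space (lborel \<Otimes>\<^sub>M M). \<forall>i. real i * \<delta> \<le> fst p \<longrightarrow> x + V (real i * \<delta>) (snd p) > 0} p :: ennreal)
    \<in> borel_measurable (lborel \<Otimes>\<^sub>M M)" by measurable
  then show ?thesis
    by (rule measurable_cong[THEN iffD1, rotated]) (auto simp: indicator_def grid_alive_def space_pair_measure)
qed

lemma grid_alive_sets [measurable]:
  assumes d: "\<delta> \<ge> 0" shows "grid_alive \<delta> x s \<in> sets M"
proof -
  have [measurable]: "V (real i * \<delta>) \<in> borel_measurable M" for i using d by (intro V_meas) simp
  show ?thesis unfolding grid_alive_def by measurable
qed

lemma grid_alive_decseq: "decseq (\<lambda>j. grid_alive (h / 2 ^ j) x s)"
proof (rule decseq_SucI)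
  fix j
  show "grid_alive (h / 2 ^ Suc j) x s \<subseteq> grid_alive (h / 2 ^ j) x s"
  proof
    fix \<omega> assume w: "\<omega> \<in> grid_alive (h / 2 ^ Suc j) x s"
    have "x + V (real i * (h / 2 ^ j)) \<omega> > 0" if i: "real i * (h / 2 ^ j) \<le> s" for i
    proof -
      have e: "real (2 * i) * (h / 2 ^ Suc j) = real i * (h / 2 ^ j)" by simp
      have "real (2 * i) * (h / 2 ^ Suc j) \<le> s \<longrightarrow> x + V (real (2 * i) * (h / 2 ^ Suc j)) \<omega> > 0"
        using w unfolding grid_alive_def by blast
      then show ?thesis using i unfolding e by simp
    qed
    then show "\<omega> \<in> grid_alive (h / 2 ^ j) x s" using w by (auto simp: grid_alive_def)
  qed
qed

lemma grid_alive_eq_stays: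
  assumes "\<delta> > 0" "real n * \<delta> \<le> s" "s < real (Suc n) * \<delta>"
  shows "grid_alive \<delta> x s = stays {0<..} \<delta> n x"
proof -
  have "real i * \<delta> \<le> s \<longleftrightarrow> i \<le> n" for i
  proof
    assume "real i * \<delta> \<le> s"
    then have "real i * \<delta> < real (Suc n) * \<delta>" using assms by linarith
    then show "i \<le> n" using assms by simp
  next
    assume "i \<le> n"
    then have "real i * \<delta> \<le> real n * \<delta>" using assms by (intro mult_right_mono) auto
    then show "real i * \<delta> \<le> s" using assms by linarith
  qed
  then show ?thesis by (auto simp: grid_alive_def stays_def)
qed

lemma indicator_decseq_eventually:
  assumes "decseq A" shows "eventually (\<lambda>j. indicator (A j) \<omega> = (indicator (\<Inter>j. A j) \<omega> :: ennreal)) sequentially"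
proof (cases "\<omega> \<in> (\<Inter>j. A j)")
  case False
  then obtain J where J: "\<omega> \<notin> A J" by blast
  have "\<omega> \<notin> A j" if "j \<ge> J" for j using assms that J by (auto simp: decseq_def)
  then show ?thesis using False by (intro eventually_mono[OF eventually_ge_at_top[of J]]) auto
qed simp

lemma alive_gap:
  assumes "\<omega> \<in> alive s x" "s \<ge> 0"
  obtains e where "e > 0" "\<And>r. 0 \<le> r \<Longrightarrow> r \<le> s \<Longrightarrow> x + V r \<omega> \<ge> e"
proof -
  have w: "\<omega> \<in> space M" using assms by (auto simp: alive_def)
  obtain B where B: "\<forall>r\<in>{0..s}. \<bar>V r \<omega>\<bar> \<le> B" using cadlag_bounded[OF V_cadlag[OF w]] by blast
  have "bdd_below ((\<lambda>r. x + V r \<omega>) ` {0..s})"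
  proof (rule bdd_belowI2[of _ "x - B"])
    fix r assume "r \<in> {0..s}"
    then have "\<bar>V r \<omega>\<bar> \<le> B" using B by blast
    then show "x - B \<le> x + V r \<omega>" by linarith
  qed
  then have "(INF r\<in>{0..s}. x + V r \<omega>) \<le> x + V r \<omega>" if "0 \<le> r" "r \<le> s" for r
    by (rule cINF_lower) (use that in auto)
  then show ?thesis using assms(1) by (intro that[of "INF r\<in>{0..s}. x + V r \<omega>"]) (auto simp: alive_def)
qed

text \<open>If the path from \<open>x\<close> has positive infimum, so have the paths from
  \<open>X m\<close> close to \<open>x\<close>. Conversely, positivity from \<open>X m\<close> at
  the dyadic times leaves the path from \<open>x\<close> the margin \<open>x - X m\<close>. The time
  \<open>s\<close> may fail to be dyadic; there the vanishing of \<phi> on the negative half-line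
  takes over.\<close>

lemma alive_limit:
  fixes \<phi> :: "real \<Rightarrow> real"
  assumes h: "h > 0" and s: "0 \<le> s" "s \<le> h" and w: "\<omega> \<in> space M"
    and X: "X \<longlonglongrightarrow> x" "\<And>m. X m < x"
    and \<phi>: "\<And>z. isCont \<phi> z" "\<And>z. z \<le> 0 \<Longrightarrow> \<phi> z = 0"
  shows "(\<lambda>m. indicator (dyadic_alive h (X m) s) \<omega> * ennreal (\<phi> (X m + V s \<omega>)))
     \<longlonglongrightarrow> indicator (alive s x) \<omega> * ennreal (\<phi> (x + V s \<omega>))"
proof (cases "\<omega> \<in> alive s x")
  case True
  obtain e where e: "e > 0" "\<And>r. 0 \<le> r \<Longrightarrow> r \<le> s \<Longrightarrow> x + V r \<omega> \<ge> e" using alive_gap[OF True s(1)] by blast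
  have "eventually (\<lambda>m. x - e < X m) sequentially" using X(1) e(1) by (auto simp: order_tendsto_iff)
  then have ev: "eventually (\<lambda>m. ennreal (\<phi> (X m + V s \<omega>)) = indicator (dyadic_alive h (X m) s) \<omega> * ennreal (\<phi> (X m + V s \<omega>))) sequentially"
  proof eventually_elim
    case (elim m)
    have "X m + V r \<omega> > 0" if "0 \<le> r" "r \<le> s" for r using e(2)[OF that] elim by linarith
    then have "\<omega> \<in> dyadic_alive h (X m) s" using w h by (auto simp: dyadic_alive_def grid_alive_def)
    then show ?case by simp
  qed
  have "(\<lambda>m. ennreal (\<phi> (X m + V s \<omega>))) \<longlonglongrightarrow> ennreal (\<phi> (x + V s \<omega>))"
    by (intro tendsto_ennrealI isCont_tendsto_compose[OF \<phi>(1)] tendsto_intros X)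
  then have "(\<lambda>m. indicator (dyadic_alive h (X m) s) \<omega> * ennreal (\<phi> (X m + V s \<omega>))) \<longlonglongrightarrow> ennreal (\<phi> (x + V s \<omega>))"
    by (rule Lim_transform_eventually[OF _ ev])
  then show ?thesis using True by simp
next
  case False
  have z: "indicator (dyadic_alive h (X m) s) \<omega> * ennreal (\<phi> (X m + V s \<omega>)) = 0" for m
  proof (rule ccontr)
    assume nz: "\<not> ?thesis"
    then have D: "\<omega> \<in> dyadic_alive h (X m) s" by (auto simp: indicator_def split: if_splits)
    have P: "X m + V s \<omega> > 0"
    proof (rule ccontr)
      assume "\<not> X m + V s \<omega> > 0"
      then have "\<phi> (X m + V s \<omega>) = 0" by (intro \<phi>) simp
      then show False using nz by simp
    qed
    define e where "e = x - X m"
    have e: "e > 0" using X by (simp add: e_def)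
    have ge: "x + V r \<omega> \<ge> e" if r: "r \<in> {0..s}" for r
    proof (cases "r = s")
      case True then show ?thesis using P by (simp add: e_def)
    next
      case False
      show ?thesis
      proof (rule cadlag_ge_of_dense[OF cadlag_shift[OF V_cadlag[OF w]], where t = s])
        show "0 \<le> r" "r < s" using r False by auto
        fix a b :: real assume ab: "0 \<le> a" "a < b" "b \<le> s"
        obtain j i where q: "a < real i * (h / 2 ^ j)" "real i * (h / 2 ^ j) < b"
          by (rule dyadic_between[OF ab(1,2) h]) (auto intro: that)
        then have "X m + V (real i * (h / 2 ^ j)) \<omega> > 0" using D ab by (auto simp: dyadic_alive_def grid_alive_def)
        then show "\<exists>q>a. q < b \<and> e \<le> x + V q \<omega>" using q by (intro exI[of _ "real i * (h / 2 ^ j)"]) (auto simp: e_def)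
      qed
    qed
    have "e \<le> (INF r\<in>{0..s}. x + V r \<omega>)" using s ge by (intro cINF_greatest) auto
    then show False using False e w by (auto simp: alive_def)
  qed
  show ?thesis using False unfolding z by simp
qed

definition killed :: "real \<Rightarrow> (real \<Rightarrow> ennreal) \<Rightarrow> real \<Rightarrow> ennreal" where
  "killed t \<phi> x = (\<integral>\<^sup>+\<omega>. indicator (alive t x) \<omega> * \<phi> (x + V t \<omega>) \<partial>M)"

end

section \<open>The Dynkin formula for the omega-scale function\<close>

context omega_scale
begin

abbreviation "wwe \<equiv> \<lambda>x. ennreal (ww x)"

text \<open>\<open>wwe\<close> dominates \<open>F\<close> and, up to the factor \<open>lam\<close>,
  also \<open>f\<close>. It is monotone with finite transform, and so provides the dominating
  functions in all limits of this part.\<close>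

lemma Lap_wwe: "l > \<kappa> \<Longrightarrow> Lap wwe l < \<infinity>"
proof -
  assume l: "l > \<kappa>"
  have "Lap wwe l \<le> Lap (\<lambda>x. ennreal G * we x) l" unfolding Lap_def
    using G_ge_1 ww_le by (intro nn_integral_mono mult_left_mono) (auto simp: ennreal_mult[symmetric] w_nonneg ennreal_leI)
  also have "\<dots> = ennreal G * ennreal (1 / \<Psi> l)" using l by (simp add: Lap_cmult Lap_w)
  also have "\<dots> < \<infinity>" by (simp add: ennreal_mult_less_top)
  finally show ?thesis .
qed

lemma f_le_wwe: "f x \<le> ennreal lam * wwe x"
  using lam fr_le[of x] by (simp add: f_fr ennreal_mult[symmetric] ww_nonneg ennreal_leI)

lemma F_le_wwe: "F x \<le> wwe x"
  by (simp add: F_Fr ww_def w_nonneg ennreal_leI)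

lemma Lap_f_finite: "l > \<kappa> \<Longrightarrow> Lap f l < \<infinity>"
proof -
  assume l: "l > \<kappa>"
  have "Lap f l \<le> Lap (\<lambda>x. ennreal lam * wwe x) l" unfolding Lap_def
    using f_le_wwe by (intro nn_integral_mono mult_left_mono) auto
  also have "\<dots> = ennreal lam * Lap wwe l" by (simp add: Lap_cmult)
  also have "\<dots> < \<infinity>" using Lap_wwe[OF l] by (simp add: ennreal_mult_less_top)
  finally show ?thesis .
qed

lemma P_wwe_finite:
  assumes t: "t \<ge> 0" shows "P t wwe x < \<infinity>"
proof (rule Lap_finite_mono)
  show "P t wwe x \<le> P t wwe y" if "x \<le> y" for x y
    unfolding P_def by (intro nn_integral_mono ennreal_leI ww_mono) (use that in auto)
  show "P t wwe \<in> borel_measurable borel" using t by measurable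
  show "Lap (P t wwe) (max \<kappa> 0 + 1) < \<infinity>"
    using t Lap_wwe[of "max \<kappa> 0 + 1"] by (subst Lap_P) (auto simp: ennreal_mult_less_top)
qed

lemma Pint_wwe_finite:
  assumes t: "t \<ge> 0" shows "Pint t wwe x < \<infinity>"
proof (rule Lap_finite_mono)
  show "Pint t wwe x \<le> Pint t wwe y" if "x \<le> y" for x y
    unfolding Pint_def P_def by (intro nn_integral_mono mult_left_mono ennreal_leI ww_mono) (use that in auto)
  show "Pint t wwe \<in> borel_measurable borel" by measurable
  show "Lap (Pint t wwe) (max \<kappa> 0 + 1) < \<infinity>"
    using t Lap_wwe[of "max \<kappa> 0 + 1"] Psi_pos[of "max \<kappa> 0 + 1"] by (subst Lap_Pint) (auto simp: ennreal_mult_less_top)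
qed

lemma P_F_sequentially:
  assumes t: "t \<ge> 0" and X: "X \<longlonglongrightarrow> x"
  shows "(\<lambda>n. P t F (X n)) \<longlonglongrightarrow> P t F x"
proof -
  note V_meas[OF t, measurable]
  obtain b where b: "\<And>n. X n \<le> b"
    using convergent_imp_Bseq[OF convergentI[OF X]] by (auto simp: Bseq_def abs_le_iff)
  show ?thesis unfolding P_def
  proof (rule nn_integral_LIMSEQ_dominated(2)[where u = "\<lambda>\<omega>. wwe (b + V t \<omega>)"])
    show "F (X n + V t \<omega>) \<le> wwe (b + V t \<omega>)" for n \<omega>
      using F_le_wwe[of "X n + V t \<omega>"] b[of n] by (elim order_trans) (auto intro!: ennreal_leI ww_mono)
    show "(\<integral>\<^sup>+\<omega>. wwe (b + V t \<omega>) \<partial>M) < \<infinity>" using P_wwe_finite[OF t, of b] by (simp add: P_def)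
    show "(\<lambda>n. F (X n + V t \<omega>)) \<longlonglongrightarrow> F (x + V t \<omega>)" for \<omega>
      unfolding F_Fr by (intro tendsto_ennrealI isCont_tendsto_compose[OF Fr_isCont] tendsto_intros X)
  qed measurable
qed

lemma Pint_f_sequentially:
  assumes t: "t \<ge> 0" and X: "X \<longlonglongrightarrow> x"
  shows "(\<lambda>n. Pint t f (X n)) \<longlonglongrightarrow> Pint t f x"
proof -
  obtain b where b: "\<And>n. X n \<le> b"
    using convergent_imp_Bseq[OF convergentI[OF X]] by (auto simp: Bseq_def abs_le_iff)
  show ?thesis unfolding Pint_prod[OF f_meas]
  proof (rule nn_integral_LIMSEQ_dominated(2)[where u = "\<lambda>p. ennreal lam * (indicator {0..<t} (fst p) * wwe (b + V (max 0 (fst p)) (snd p)))"])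
    show "indicator {0..<t} (fst p) * f (X n + V (max 0 (fst p)) (snd p))
      \<le> ennreal lam * (indicator {0..<t} (fst p) * wwe (b + V (max 0 (fst p)) (snd p)))" for n p
    proof -
      have "f (X n + V (max 0 (fst p)) (snd p)) \<le> ennreal lam * wwe (X n + V (max 0 (fst p)) (snd p))" by (rule f_le_wwe)
      also have "\<dots> \<le> ennreal lam * wwe (b + V (max 0 (fst p)) (snd p))"
        using b[of n] by (intro mult_left_mono ennreal_leI ww_mono) auto
      finally show ?thesis by (cases "fst p \<in> {0..<t}") simp_all
    qed
    have "(\<integral>\<^sup>+p. ennreal lam * (indicator {0..<t} (fst p) * wwe (b + V (max 0 (fst p)) (snd p))) \<partial>(lborel \<Otimes>\<^sub>M M)) = ennreal lam * Pint t wwe b"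
      by (subst Pint_prod) (auto intro!: nn_integral_cmult)
    also have "\<dots> < \<infinity>" using Pint_wwe_finite[OF t, of b] by (simp add: ennreal_mult_less_top)
    finally show "(\<integral>\<^sup>+p. ennreal lam * (indicator {0..<t} (fst p) * wwe (b + V (max 0 (fst p)) (snd p))) \<partial>(lborel \<Otimes>\<^sub>M M)) < \<infinity>" .
    show "(\<lambda>n. indicator {0..<t} (fst p) * f (X n + V (max 0 (fst p)) (snd p))) \<longlonglongrightarrow> indicator {0..<t} (fst p) * f (x + V (max 0 (fst p)) (snd p))" for p
    proof -
      have "(\<lambda>n. f (X n + V (max 0 (fst p)) (snd p))) \<longlonglongrightarrow> f (x + V (max 0 (fst p)) (snd p))"
        unfolding f_fr by (intro tendsto_ennrealI isCont_tendsto_compose[OF fr_isCont] tendsto_intros X)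
      then show ?thesis by (cases "fst p \<in> {0..<t}") auto
    qed
  qed measurable
qed

text \<open>Both sides have the same Laplace transform, since \<open>Lap F = Lap f / \<Psi>\<close>.\<close>
lemma full_line_identity:
  assumes t: "t \<ge> 0"
  shows "P t F x = F x + Pint t f x"
proof (rule sequential_eq_of_AE)
  note V_meas[OF t, measurable]
  show "AE x in lborel. P t F x = F x + Pint t f x"
  proof (rule laplace_unique_AE[where ?l0.0 = "max \<kappa> 0"])
    show "P t F \<in> borel_measurable borel" "(\<lambda>x. F x + Pint t f x) \<in> borel_measurable borel" using t by measurable
    fix l assume l: "l > max \<kappa> 0"
    have Psi: "\<Psi> l > 0" using l by (intro Psi_pos) auto
    have LF: "Lap F l = ennreal (1 / \<Psi> l) * Lap f l" using l by (simp add: F_def Lap_conv Lap_w)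
    have L1: "Lap (P t F) l = ennreal (exp (t * \<Psi> l)) * Lap F l" using t l by (intro Lap_P) auto
    show "(\<integral>\<^sup>+x. ennreal (exp (- l * x)) * P t F x \<partial>lborel) < \<infinity>"
      using L1 LF Lap_f_finite[of l] l by (simp add: Lap_def[of "P t F"] ennreal_mult_less_top)
    have "Lap (\<lambda>x. F x + Pint t f x) l = Lap F l + Lap (Pint t f) l"
      unfolding Lap_def by (subst nn_integral_add[symmetric]) (auto simp: distrib_left)
    also have "\<dots> = ennreal (1 / \<Psi> l) * Lap f l + ennreal ((exp (t * \<Psi> l) - 1) / \<Psi> l) * Lap f l"
      using t l Psi by (simp add: LF Lap_Pint)
    also have "\<dots> = (ennreal (1 / \<Psi> l) + ennreal ((exp (t * \<Psi> l) - 1) / \<Psi> l)) * Lap f l" by (simp add: distrib_right)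
    also have "ennreal (1 / \<Psi> l) + ennreal ((exp (t * \<Psi> l) - 1) / \<Psi> l) = ennreal (exp (t * \<Psi> l) * (1 / \<Psi> l))"
      using Psi t divide_right_mono[of 1 "exp (t * \<Psi> l)" "\<Psi> l"] by (subst ennreal_plus[symmetric]) (auto simp: diff_divide_distrib)
    also have "\<dots> * Lap f l = Lap (P t F) l"
    proof -
      have "ennreal (exp (t * \<Psi> l) * (1 / \<Psi> l)) = ennreal (exp (t * \<Psi> l)) * ennreal (1 / \<Psi> l)"
        by (rule ennreal_mult) (use Psi in auto)
      then show ?thesis by (simp only: L1 LF mult.assoc)
    qed
    finally show "(\<integral>\<^sup>+x. ennreal (exp (- l * x)) * P t F x \<partial>lborel) = (\<integral>\<^sup>+x. ennreal (exp (- l * x)) * (F x + Pint t f x) \<partial>lborel)"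
      by (simp add: Lap_def)
  qed
  show "(\<lambda>n. P t F (X n)) \<longlonglongrightarrow> P t F x" if "X \<longlonglongrightarrow> x" for X x by (rule P_F_sequentially[OF t that])
  show "(\<lambda>n. F (X n) + Pint t f (X n)) \<longlonglongrightarrow> F x + Pint t f x" if X: "X \<longlonglongrightarrow> x" for X x
  proof (intro tendsto_add Pint_f_sequentially[OF t X])
    show "(\<lambda>n. F (X n)) \<longlonglongrightarrow> F x"
      unfolding F_Fr by (intro tendsto_ennrealI isCont_tendsto_compose[OF Fr_isCont] X)
  qed
qed

lemma F_neg: "x \<le> 0 \<Longrightarrow> F x = 0"
  using F_le_wwe[of x] by (simp add: ww_neg)

text \<open>The Markov property concatenates the full-line identity over consecutive grid steps; positivity at the
  last grid time costs nothing, since \<open>F\<close> vanishes on the negative half-line.\<close>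
lemma grid_identity:
  assumes d: "\<delta> > 0" and x: "x > 0"
  shows "(\<integral>\<^sup>+\<omega>. indicator (stays {0<..} \<delta> n x) \<omega> * F (x + V (real n * \<delta>) \<omega>) \<partial>M)
    = F x + (\<integral>\<^sup>+s. indicator {0..<real n * \<delta>} s * (\<integral>\<^sup>+\<omega>. indicator (grid_alive \<delta> x s) \<omega> * f (x + V (max 0 s) \<omega>) \<partial>M) \<partial>lborel)"
proof (induction n)
  case 0
  have "(\<integral>\<^sup>+\<omega>. indicator (stays {0<..} \<delta> 0 x) \<omega> * F (x + V (real 0 * \<delta>) \<omega>) \<partial>M) = (\<integral>\<^sup>+\<omega>. F x \<partial>M)"
    using x by (intro nn_integral_cong) (auto simp: stays_def V_0)
  then show ?case by (simp add: emeasure_space_1)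
next
  case (Suc n)
  have d0: "\<delta> \<ge> 0" using d by simp
  have nd: "real n * \<delta> \<ge> 0" using d by simp
  note stays_sets[OF _ d0, measurable] V_meas[OF nd, measurable]
  let ?st = "stays {0<..} \<delta> n x"
  have [measurable]: "?st \<in> sets M" by measurable
  have Pm: "(\<lambda>(\<omega>, s). indicator ?st \<omega> * (indicator {0..<\<delta>} s * P (max 0 s) f (x + V (real n * \<delta>) \<omega>))) \<in> borel_measurable (M \<Otimes>\<^sub>M lborel)"
  proof -
    have "(\<lambda>p. (x + V (real n * \<delta>) (fst p), snd p)) \<in> (M \<Otimes>\<^sub>M lborel) \<rightarrow>\<^sub>M borel \<Otimes>\<^sub>M borel" by measurable
    from measurable_compose[OF this P_pair_meas2[OF f_meas]]
    have [measurable]: "(\<lambda>p. P (max 0 (snd p)) f (x + V (real n * \<delta>) (fst p))) \<in> borel_measurable (M \<Otimes>\<^sub>M lborel)" by simp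
    show ?thesis unfolding split_beta' by measurable
  qed
  interpret PS: pair_sigma_finite M lborel ..
  have [measurable]: "(\<lambda>s. P (max 0 s) f z) \<in> borel_measurable borel" for z
    using measurable_compose[OF _ P_pair_meas2[OF f_meas], of "\<lambda>s. (z, s)" borel] by simp
  have fm: "(\<lambda>(s, \<omega>). indicator A \<omega> * f (x + V (max 0 s) \<omega>)) \<in> borel_measurable (lborel \<Otimes>\<^sub>M M)" if [measurable]: "A \<in> sets M" for A
    unfolding split_beta' by measurable
  have fm': "(\<lambda>s. \<integral>\<^sup>+\<omega>. indicator ?st \<omega> * f (x + V (max 0 s) \<omega>) \<partial>M) \<in> borel_measurable lborel"
    by (intro borel_measurable_nn_integral fm) measurable
  have "(\<integral>\<^sup>+\<omega>. indicator (stays {0<..} \<delta> (Suc n) x) \<omega> * F (x + V (real (Suc n) * \<delta>) \<omega>) \<partial>M)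
    = (\<integral>\<^sup>+\<omega>. indicator ?st \<omega> * F (x + V (real n * \<delta> + \<delta>) \<omega>) \<partial>M)"
  proof (intro nn_integral_cong)
    fix \<omega> assume w: "\<omega> \<in> space M"
    have e: "real (Suc n) * \<delta> = real n * \<delta> + \<delta>" by (simp add: algebra_simps)
    show "indicator (stays {0<..} \<delta> (Suc n) x) \<omega> * F (x + V (real (Suc n) * \<delta>) \<omega>) = indicator ?st \<omega> * F (x + V (real n * \<delta> + \<delta>) \<omega>)"
      unfolding stays_Suc[OF w] e using F_neg by (auto simp: indicator_def not_less)
  qed
  also have "\<dots> = (\<integral>\<^sup>+\<omega>. indicator ?st \<omega> * P \<delta> F (x + V (real n * \<delta>) \<omega>) \<partial>M)"
    by (rule markov_grid) (use d0 in auto)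
  also have "\<dots> = (\<integral>\<^sup>+\<omega>. indicator ?st \<omega> * F (x + V (real n * \<delta>) \<omega>) + indicator ?st \<omega> * Pint \<delta> f (x + V (real n * \<delta>) \<omega>) \<partial>M)"
    by (intro nn_integral_cong) (simp add: full_line_identity[OF d0] distrib_left)
  also have "\<dots> = (\<integral>\<^sup>+\<omega>. indicator ?st \<omega> * F (x + V (real n * \<delta>) \<omega>) \<partial>M) + (\<integral>\<^sup>+\<omega>. indicator ?st \<omega> * Pint \<delta> f (x + V (real n * \<delta>) \<omega>) \<partial>M)"
    by (rule nn_integral_add) measurable
  also have "(\<integral>\<^sup>+\<omega>. indicator ?st \<omega> * Pint \<delta> f (x + V (real n * \<delta>) \<omega>) \<partial>M)
    = (\<integral>\<^sup>+\<omega>. \<integral>\<^sup>+s. indicator ?st \<omega> * (indicator {0..<\<delta>} s * P (max 0 s) f (x + V (real n * \<delta>) \<omega>)) \<partial>lborel \<partial>M)"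
    unfolding Pint_def by (intro nn_integral_cong nn_integral_cmult[symmetric]) measurable
  also have "\<dots> = (\<integral>\<^sup>+s. \<integral>\<^sup>+\<omega>. indicator ?st \<omega> * (indicator {0..<\<delta>} s * P (max 0 s) f (x + V (real n * \<delta>) \<omega>)) \<partial>M \<partial>lborel)"
    by (rule PS.Fubini'[symmetric, OF Pm])
  also have "\<dots> = (\<integral>\<^sup>+s. indicator {real n * \<delta>..<real (Suc n) * \<delta>} (real n * \<delta> + 1 * s) *
      (\<integral>\<^sup>+\<omega>. indicator ?st \<omega> * f (x + V (max 0 (real n * \<delta> + 1 * s)) \<omega>) \<partial>M) \<partial>lborel)"
  proof (intro nn_integral_cong)
    fix s
    show "(\<integral>\<^sup>+\<omega>. indicator ?st \<omega> * (indicator {0..<\<delta>} s * P (max 0 s) f (x + V (real n * \<delta>) \<omega>)) \<partial>M)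
      = indicator {real n * \<delta>..<real (Suc n) * \<delta>} (real n * \<delta> + 1 * s) * (\<integral>\<^sup>+\<omega>. indicator ?st \<omega> * f (x + V (max 0 (real n * \<delta> + 1 * s)) \<omega>) \<partial>M)"
    proof (cases "s \<in> {0..<\<delta>}")
      case True
      then have "(\<integral>\<^sup>+\<omega>. indicator ?st \<omega> * f (x + V (real n * \<delta> + s) \<omega>) \<partial>M) = (\<integral>\<^sup>+\<omega>. indicator ?st \<omega> * P s f (x + V (real n * \<delta>) \<omega>) \<partial>M)"
        by (intro markov_grid) (use d0 in auto)
      moreover have "max 0 (real n * \<delta> + s) = real n * \<delta> + s" "max 0 s = s" using True nd by auto
      ultimately show ?thesis using True by (simp add: distrib_right)
    next
      case False
      then show ?thesis by (auto simp: indicator_def distrib_right)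
    qed
  qed
  also have "\<dots> = (\<integral>\<^sup>+s. indicator {real n * \<delta>..<real (Suc n) * \<delta>} s * (\<integral>\<^sup>+\<omega>. indicator ?st \<omega> * f (x + V (max 0 s) \<omega>) \<partial>M) \<partial>lborel)"
    using fm' by (subst nn_integral_real_affine[where c = 1 and t = "real n * \<delta>"]) auto
  also have "\<dots> = (\<integral>\<^sup>+s. indicator {real n * \<delta>..<real (Suc n) * \<delta>} s * (\<integral>\<^sup>+\<omega>. indicator (grid_alive \<delta> x s) \<omega> * f (x + V (max 0 s) \<omega>) \<partial>M) \<partial>lborel)"
  proof (intro nn_integral_cong)
    fix s
    show "indicator {real n * \<delta>..<real (Suc n) * \<delta>} s * (\<integral>\<^sup>+\<omega>. indicator ?st \<omega> * f (x + V (max 0 s) \<omega>) \<partial>M)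
      = indicator {real n * \<delta>..<real (Suc n) * \<delta>} s * (\<integral>\<^sup>+\<omega>. indicator (grid_alive \<delta> x s) \<omega> * f (x + V (max 0 s) \<omega>) \<partial>M)"
      using grid_alive_eq_stays[OF d, of n s x] by (cases "s \<in> {real n * \<delta>..<real (Suc n) * \<delta>}") auto
  qed
  finally have "(\<integral>\<^sup>+\<omega>. indicator (stays {0<..} \<delta> (Suc n) x) \<omega> * F (x + V (real (Suc n) * \<delta>) \<omega>) \<partial>M)
    = F x + ((\<integral>\<^sup>+s. indicator {0..<real n * \<delta>} s * (\<integral>\<^sup>+\<omega>. indicator (grid_alive \<delta> x s) \<omega> * f (x + V (max 0 s) \<omega>) \<partial>M) \<partial>lborel)
     + (\<integral>\<^sup>+s. indicator {real n * \<delta>..<real (Suc n) * \<delta>} s * (\<integral>\<^sup>+\<omega>. indicator (grid_alive \<delta> x s) \<omega> * f (x + V (max 0 s) \<omega>) \<partial>M) \<partial>lborel))"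
    unfolding Suc.IH by (simp add: add.assoc)
  also have "\<dots> = F x + (\<integral>\<^sup>+s. indicator {0..<real (Suc n) * \<delta>} s * (\<integral>\<^sup>+\<omega>. indicator (grid_alive \<delta> x s) \<omega> * f (x + V (max 0 s) \<omega>) \<partial>M) \<partial>lborel)"
  proof -
    have "(\<lambda>(s, \<omega>). indicator (grid_alive \<delta> x s) \<omega> * f (x + V (max 0 s) \<omega>)) \<in> borel_measurable (lborel \<Otimes>\<^sub>M M)"
      unfolding split_beta' using grid_alive_prod_meas[OF d0] by measurable
    then have [measurable]: "(\<lambda>s. \<integral>\<^sup>+\<omega>. indicator (grid_alive \<delta> x s) \<omega> * f (x + V (max 0 s) \<omega>) \<partial>M) \<in> borel_measurable lborel"
      by (rule borel_measurable_nn_integral)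
    have "indicator {0..<real (Suc n) * \<delta>} s = (indicator {0..<real n * \<delta>} s + indicator {real n * \<delta>..<real (Suc n) * \<delta>} s :: ennreal)" for s
      using nd d0 by (auto simp: indicator_def distrib_right intro: order_trans[OF nd])
    then show ?thesis by (subst nn_integral_add[symmetric]) (auto simp: distrib_right)
  qed
  finally show ?case .
qed

text \<open>\<open>grid_identity\<close> with \<open>2 ^ j\<close> steps of length
  \<open>h / 2 ^ j\<close>, passed to the limit on both sides. The grid events decrease, so their
  indicators are eventually constant at each point.\<close>

lemma killed_identity_dyadic_alive:
  assumes h: "h > 0" and x: "x > 0"
  shows "(\<integral>\<^sup>+\<omega>. indicator (dyadic_alive h x h) \<omega> * F (x + V h \<omega>) \<partial>M)
    = F x + (\<integral>\<^sup>+p. indicator {0..<h} (fst p) * (indicator (dyadic_alive h x (fst p)) (snd p) * f (x + V (max 0 (fst p)) (snd p))) \<partial>(lborel \<Otimes>\<^sub>M M))"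
    and "(\<lambda>\<omega>. indicator (dyadic_alive h x h) \<omega> * F (x + V h \<omega>)) \<in> borel_measurable M"
    and "(\<lambda>p. indicator {0..<h} (fst p) * (indicator (dyadic_alive h x (fst p)) (snd p) * f (x + V (max 0 (fst p)) (snd p)))) \<in> borel_measurable (lborel \<Otimes>\<^sub>M M)"
proof -
  have h0: "h \<ge> 0" using h by simp
  have dj: "h / 2 ^ j > 0" "h / 2 ^ j \<ge> 0" for j :: nat using h by auto
  note V_meas[OF h0, measurable] grid_alive_sets[OF dj(2), measurable] grid_alive_prod_meas[OF dj(2), measurable]
  define L where "L j = (\<integral>\<^sup>+\<omega>. indicator (grid_alive (h / 2 ^ j) x h) \<omega> * F (x + V h \<omega>) \<partial>M)" for j :: nat
  define R where "R j = (\<integral>\<^sup>+p. indicator {0..<h} (fst p) * (indicator (grid_alive (h / 2 ^ j) x (fst p)) (snd p) * f (x + V (max 0 (fst p)) (snd p))) \<partial>(lborel \<Otimes>\<^sub>M M))" for j :: nat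
  have eq: "L j = F x + R j" for j
  proof -
    have n: "real (2 ^ j) * (h / 2 ^ j) = h" by simp
    have s: "stays {0<..} (h / 2 ^ j) (2 ^ j) x = grid_alive (h / 2 ^ j) x h"
      by (rule grid_alive_eq_stays[symmetric, OF dj(1)]) (use h in \<open>auto simp: field_simps\<close>)
    have m: "(\<lambda>p. indicator {0..<h} (fst p) * (indicator (grid_alive (h / 2 ^ j) x (fst p)) (snd p) * f (x + V (max 0 (fst p)) (snd p)))) \<in> borel_measurable (lborel \<Otimes>\<^sub>M M)"
      by measurable
    have "R j = (\<integral>\<^sup>+s. \<integral>\<^sup>+\<omega>. indicator {0..<h} s * (indicator (grid_alive (h / 2 ^ j) x s) \<omega> * f (x + V (max 0 s) \<omega>)) \<partial>M \<partial>lborel)"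
      unfolding R_def using nn_integral_fst[OF m] by simp
    also have "\<dots> = (\<integral>\<^sup>+s. indicator {0..<h} s * (\<integral>\<^sup>+\<omega>. indicator (grid_alive (h / 2 ^ j) x s) \<omega> * f (x + V (max 0 s) \<omega>) \<partial>M) \<partial>lborel)"
    proof (intro nn_integral_cong nn_integral_cmult)
      fix s :: real
      have [measurable]: "V (max 0 s) \<in> borel_measurable M" by (rule V_meas) simp
      show "(\<lambda>\<omega>. indicator (grid_alive (h / 2 ^ j) x s) \<omega> * f (x + V (max 0 s) \<omega>)) \<in> borel_measurable M" by measurable
    qed
    finally show ?thesis using grid_identity[OF dj(1) x, of j "2 ^ j"] unfolding n s L_def by simp
  qed
  have ev: "eventually (\<lambda>j. indicator (grid_alive (h / 2 ^ j) x s) \<omega> = (indicator (dyadic_alive h x s) \<omega> :: ennreal)) sequentially" for s \<omega>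
    unfolding dyadic_alive_def by (rule indicator_decseq_eventually[OF grid_alive_decseq])
  have Llim: "(\<lambda>\<omega>. indicator (dyadic_alive h x h) \<omega> * F (x + V h \<omega>)) \<in> borel_measurable M"
     "L \<longlonglongrightarrow> (\<integral>\<^sup>+\<omega>. indicator (dyadic_alive h x h) \<omega> * F (x + V h \<omega>) \<partial>M)"
  proof -
    have v: "\<And>j. (\<lambda>\<omega>. indicator (grid_alive (h / 2 ^ j) x h) \<omega> * F (x + V h \<omega>)) \<in> borel_measurable M" by measurable
    have u: "(\<lambda>\<omega>. wwe (x + V h \<omega>)) \<in> borel_measurable M" by measurable
    have le: "indicator (grid_alive (h / 2 ^ j) x h) \<omega> * F (x + V h \<omega>) \<le> wwe (x + V h \<omega>)" for j \<omega>
      using F_le_wwe[of "x + V h \<omega>"] by (auto simp: indicator_def)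
    have fin: "(\<integral>\<^sup>+\<omega>. wwe (x + V h \<omega>) \<partial>M) < \<infinity>" using P_wwe_finite[OF h0, of x] by (simp add: P_def)
    have lim: "(\<lambda>j. indicator (grid_alive (h / 2 ^ j) x h) \<omega> * F (x + V h \<omega>)) \<longlonglongrightarrow> indicator (dyadic_alive h x h) \<omega> * F (x + V h \<omega>)" for \<omega>
      by (rule tendsto_eventually) (use ev[of h \<omega>] in \<open>auto elim!: eventually_mono\<close>)
    show "(\<lambda>\<omega>. indicator (dyadic_alive h x h) \<omega> * F (x + V h \<omega>)) \<in> borel_measurable M"
     "L \<longlonglongrightarrow> (\<integral>\<^sup>+\<omega>. indicator (dyadic_alive h x h) \<omega> * F (x + V h \<omega>) \<partial>M)"
      unfolding L_def by (rule nn_integral_LIMSEQ_dominated(1)[OF v u le fin lim], assumption?)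
        (rule nn_integral_LIMSEQ_dominated(2)[OF v u le fin lim], assumption?)
  qed
  have Rlim: "(\<lambda>p. indicator {0..<h} (fst p) * (indicator (dyadic_alive h x (fst p)) (snd p) * f (x + V (max 0 (fst p)) (snd p)))) \<in> borel_measurable (lborel \<Otimes>\<^sub>M M)"
     "R \<longlonglongrightarrow> (\<integral>\<^sup>+p. indicator {0..<h} (fst p) * (indicator (dyadic_alive h x (fst p)) (snd p) * f (x + V (max 0 (fst p)) (snd p))) \<partial>(lborel \<Otimes>\<^sub>M M))"
  proof -
    have v: "\<And>j. (\<lambda>p. indicator {0..<h} (fst p) * (indicator (grid_alive (h / 2 ^ j) x (fst p)) (snd p) * f (x + V (max 0 (fst p)) (snd p)))) \<in> borel_measurable (lborel \<Otimes>\<^sub>M M)"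
      by measurable
    have u: "(\<lambda>p. ennreal lam * (indicator {0..<h} (fst p) * wwe (x + V (max 0 (fst p)) (snd p)))) \<in> borel_measurable (lborel \<Otimes>\<^sub>M M)" by measurable
    have le: "indicator {0..<h} (fst p) * (indicator (grid_alive (h / 2 ^ j) x (fst p)) (snd p) * f (x + V (max 0 (fst p)) (snd p)))
      \<le> ennreal lam * (indicator {0..<h} (fst p) * wwe (x + V (max 0 (fst p)) (snd p)))" for j p
      using f_le_wwe[of "x + V (max 0 (fst p)) (snd p)"] by (auto simp: indicator_def)
    have "(\<integral>\<^sup>+p. ennreal lam * (indicator {0..<h} (fst p) * wwe (x + V (max 0 (fst p)) (snd p))) \<partial>(lborel \<Otimes>\<^sub>M M)) = ennreal lam * Pint h wwe x"
      by (subst Pint_prod) (auto intro!: nn_integral_cmult)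
    also have "\<dots> < \<infinity>" using Pint_wwe_finite[OF h0, of x] by (simp add: ennreal_mult_less_top)
    finally have fin: "(\<integral>\<^sup>+p. ennreal lam * (indicator {0..<h} (fst p) * wwe (x + V (max 0 (fst p)) (snd p))) \<partial>(lborel \<Otimes>\<^sub>M M)) < \<infinity>" .
    have lim: "(\<lambda>j. indicator {0..<h} (fst p) * (indicator (grid_alive (h / 2 ^ j) x (fst p)) (snd p) * f (x + V (max 0 (fst p)) (snd p))))
      \<longlonglongrightarrow> indicator {0..<h} (fst p) * (indicator (dyadic_alive h x (fst p)) (snd p) * f (x + V (max 0 (fst p)) (snd p)))" for p
      by (rule tendsto_eventually) (use ev[of "fst p" "snd p"] in \<open>auto elim!: eventually_mono\<close>)
    show "(\<lambda>p. indicator {0..<h} (fst p) * (indicator (dyadic_alive h x (fst p)) (snd p) * f (x + V (max 0 (fst p)) (snd p)))) \<in> borel_measurable (lborel \<Otimes>\<^sub>M M)"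
     "R \<longlonglongrightarrow> (\<integral>\<^sup>+p. indicator {0..<h} (fst p) * (indicator (dyadic_alive h x (fst p)) (snd p) * f (x + V (max 0 (fst p)) (snd p))) \<partial>(lborel \<Otimes>\<^sub>M M))"
      unfolding R_def by (rule nn_integral_LIMSEQ_dominated(1)[OF v u le fin lim], assumption?)
        (rule nn_integral_LIMSEQ_dominated(2)[OF v u le fin lim], assumption?)
  qed
  have "(\<lambda>j. F x + R j) \<longlonglongrightarrow> F x + (\<integral>\<^sup>+p. indicator {0..<h} (fst p) * (indicator (dyadic_alive h x (fst p)) (snd p) * f (x + V (max 0 (fst p)) (snd p))) \<partial>(lborel \<Otimes>\<^sub>M M))"
    by (intro tendsto_add tendsto_const Rlim)
  then show "(\<integral>\<^sup>+\<omega>. indicator (dyadic_alive h x h) \<omega> * F (x + V h \<omega>) \<partial>M)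
    = F x + (\<integral>\<^sup>+p. indicator {0..<h} (fst p) * (indicator (dyadic_alive h x (fst p)) (snd p) * f (x + V (max 0 (fst p)) (snd p))) \<partial>(lborel \<Otimes>\<^sub>M M))"
    using Llim(2) unfolding eq[abs_def] by (intro LIMSEQ_unique) auto
  show "(\<lambda>\<omega>. indicator (dyadic_alive h x h) \<omega> * F (x + V h \<omega>)) \<in> borel_measurable M" by (rule Llim)
  show "(\<lambda>p. indicator {0..<h} (fst p) * (indicator (dyadic_alive h x (fst p)) (snd p) * f (x + V (max 0 (fst p)) (snd p)))) \<in> borel_measurable (lborel \<Otimes>\<^sub>M M)"
    by (rule Rlim)
qed

text \<open>\<open>dyadic_alive\<close> and \<open>alive\<close> differ only when the infimum is zero; letting the starting point tend
  to \<open>x\<close> from below removes the difference.\<close>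
lemma killed_identity_F:
  assumes h: "h > 0" and x: "x > 0"
  shows "killed h F x = F x + (\<integral>\<^sup>+s. indicator {0..<h} s * killed s f x \<partial>lborel)"
proof -
  have h0: "h \<ge> 0" using h by simp
  note V_meas[OF h0, measurable]
  \<comment> \<open>Starting points increasing to \<open>x\<close> from strictly below; the 2 keeps
    already the first of them, \<open>x / 2\<close>, positive.\<close>
  define X where "X m = x - x / real (m + 2)" for m :: nat
  have "(\<lambda>m. x - x * (1 / real (m + 2))) \<longlonglongrightarrow> x - x * 0"
  proof (intro tendsto_intros)
    show "(\<lambda>m. 1 / real (m + 2)) \<longlonglongrightarrow> 0"
      using LIMSEQ_ignore_initial_segment[OF lim_1_over_n, of 2] by simp
  qed
  then have Xlim: "X \<longlonglongrightarrow> x" by (simp add: X_def[abs_def])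
  have X: "X m < x" "X m > 0" for m using x by (auto simp: X_def field_simps intro!: add_pos_nonneg)
  have Llim: "(\<lambda>m. \<integral>\<^sup>+\<omega>. indicator (dyadic_alive h (X m) h) \<omega> * F (X m + V h \<omega>) \<partial>M) \<longlonglongrightarrow> killed h F x"
    unfolding killed_def
  proof (rule nn_integral_LIMSEQ_dominated(2)[where u = "\<lambda>\<omega>. wwe (x + V h \<omega>)"])
    show "(\<lambda>\<omega>. indicator (dyadic_alive h (X m) h) \<omega> * F (X m + V h \<omega>)) \<in> borel_measurable M" for m
      by (rule killed_identity_dyadic_alive(2)[OF h X(2)])
    show "(\<lambda>\<omega>. wwe (x + V h \<omega>)) \<in> borel_measurable M" by measurable
    show "indicator (dyadic_alive h (X m) h) \<omega> * F (X m + V h \<omega>) \<le> wwe (x + V h \<omega>)" for m \<omega>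
    proof -
      have "F (X m + V h \<omega>) \<le> wwe (X m + V h \<omega>)" by (rule F_le_wwe)
      also have "\<dots> \<le> wwe (x + V h \<omega>)" using X(1)[of m] by (intro ennreal_leI ww_mono) auto
      finally show ?thesis by (auto simp: indicator_def)
    qed
    show "(\<integral>\<^sup>+\<omega>. wwe (x + V h \<omega>) \<partial>M) < \<infinity>" using P_wwe_finite[OF h0, of x] by (simp add: P_def)
    fix \<omega> assume w: "\<omega> \<in> space M"
    show "(\<lambda>m. indicator (dyadic_alive h (X m) h) \<omega> * F (X m + V h \<omega>)) \<longlonglongrightarrow> indicator (alive h x) \<omega> * F (x + V h \<omega>)"
      unfolding F_Fr
    proof (rule alive_limit[OF h h0 order_refl w Xlim X(1) Fr_isCont])
      show "Fr z = 0" if "z \<le> 0" for z using F_neg[OF that] by (simp add: Fr_def)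
    qed
  qed
  let ?u = "\<lambda>p. indicator {0..<h} (fst p) * (indicator (alive (fst p) x) (snd p) * f (x + V (max 0 (fst p)) (snd p)))"
  have R: "?u \<in> borel_measurable (lborel \<Otimes>\<^sub>M M)"
     "(\<lambda>m. \<integral>\<^sup>+p. indicator {0..<h} (fst p) * (indicator (dyadic_alive h (X m) (fst p)) (snd p) * f (X m + V (max 0 (fst p)) (snd p))) \<partial>(lborel \<Otimes>\<^sub>M M))
      \<longlonglongrightarrow> (\<integral>\<^sup>+p. ?u p \<partial>(lborel \<Otimes>\<^sub>M M))"
  proof -
    have v: "(\<lambda>p. indicator {0..<h} (fst p) * (indicator (dyadic_alive h (X m) (fst p)) (snd p) * f (X m + V (max 0 (fst p)) (snd p)))) \<in> borel_measurable (lborel \<Otimes>\<^sub>M M)" for m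
      by (rule killed_identity_dyadic_alive(3)[OF h X(2)])
    have u: "(\<lambda>p. ennreal lam * (indicator {0..<h} (fst p) * wwe (x + V (max 0 (fst p)) (snd p)))) \<in> borel_measurable (lborel \<Otimes>\<^sub>M M)" by measurable
    have le: "indicator {0..<h} (fst p) * (indicator (dyadic_alive h (X m) (fst p)) (snd p) * f (X m + V (max 0 (fst p)) (snd p)))
      \<le> ennreal lam * (indicator {0..<h} (fst p) * wwe (x + V (max 0 (fst p)) (snd p)))" for m p
    proof -
      have "f (X m + V (max 0 (fst p)) (snd p)) \<le> ennreal lam * wwe (X m + V (max 0 (fst p)) (snd p))" by (rule f_le_wwe)
      also have "\<dots> \<le> ennreal lam * wwe (x + V (max 0 (fst p)) (snd p))"
        using X(1)[of m] by (intro mult_left_mono ennreal_leI ww_mono) auto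
      finally show ?thesis by (auto simp: indicator_def)
    qed
    have "(\<integral>\<^sup>+p. ennreal lam * (indicator {0..<h} (fst p) * wwe (x + V (max 0 (fst p)) (snd p))) \<partial>(lborel \<Otimes>\<^sub>M M)) = ennreal lam * Pint h wwe x"
      by (subst Pint_prod) (auto intro!: nn_integral_cmult)
    also have "\<dots> < \<infinity>" using Pint_wwe_finite[OF h0, of x] by (simp add: ennreal_mult_less_top)
    finally have fin: "(\<integral>\<^sup>+p. ennreal lam * (indicator {0..<h} (fst p) * wwe (x + V (max 0 (fst p)) (snd p))) \<partial>(lborel \<Otimes>\<^sub>M M)) < \<infinity>" .
    have lim: "(\<lambda>m. indicator {0..<h} (fst p) * (indicator (dyadic_alive h (X m) (fst p)) (snd p) * f (X m + V (max 0 (fst p)) (snd p)))) \<longlonglongrightarrow> ?u p"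
      if p: "p \<in> space (lborel \<Otimes>\<^sub>M M)" for p
    proof (cases "fst p \<in> {0..<h}")
      case True
      have w: "snd p \<in> space M" using p by (auto simp: space_pair_measure)
      have "(\<lambda>m. indicator (dyadic_alive h (X m) (fst p)) (snd p) * f (X m + V (fst p) (snd p))) \<longlonglongrightarrow> indicator (alive (fst p) x) (snd p) * f (x + V (fst p) (snd p))"
        unfolding f_fr by (rule alive_limit[OF h _ _ w Xlim X(1) fr_isCont fr_neg]) (use True in auto)
      then show ?thesis using True by simp
    qed simp
    show "?u \<in> borel_measurable (lborel \<Otimes>\<^sub>M M)"
     "(\<lambda>m. \<integral>\<^sup>+p. indicator {0..<h} (fst p) * (indicator (dyadic_alive h (X m) (fst p)) (snd p) * f (X m + V (max 0 (fst p)) (snd p))) \<partial>(lborel \<Otimes>\<^sub>M M))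
      \<longlonglongrightarrow> (\<integral>\<^sup>+p. ?u p \<partial>(lborel \<Otimes>\<^sub>M M))"
      by (rule nn_integral_LIMSEQ_dominated(1)[OF v u le fin lim], assumption?)
        (rule nn_integral_LIMSEQ_dominated(2)[OF v u le fin lim], assumption?)
  qed
  have "(\<lambda>m. F (X m)) \<longlonglongrightarrow> F x"
    unfolding F_Fr by (intro tendsto_ennrealI isCont_tendsto_compose[OF Fr_isCont] Xlim)
  from tendsto_add[OF this R(2)] Llim have "killed h F x = F x + (\<integral>\<^sup>+p. ?u p \<partial>(lborel \<Otimes>\<^sub>M M))"
    unfolding killed_identity_dyadic_alive(1)[OF h X(2)] by (rule LIMSEQ_unique[rotated])
  also have "(\<integral>\<^sup>+p. ?u p \<partial>(lborel \<Otimes>\<^sub>M M)) = (\<integral>\<^sup>+s. \<integral>\<^sup>+\<omega>. ?u (s, \<omega>) \<partial>M \<partial>lborel)"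
    by (rule nn_integral_fst[OF R(1), symmetric])
  also have "\<dots> = (\<integral>\<^sup>+s. indicator {0..<h} s * killed s f x \<partial>lborel)"
  proof (intro nn_integral_cong)
    fix s :: real
    show "(\<integral>\<^sup>+\<omega>. ?u (s, \<omega>) \<partial>M) = indicator {0..<h} s * killed s f x"
      by (cases "s \<in> {0..<h}") (auto simp: killed_def)
  qed
  finally show ?thesis .
qed

text \<open>The generator of the killed process annihilates \<open>w\<close>, by invariance of
  \<open>W\<close>, and sends \<open>F\<close> to \<open>f\<close>; adding the two parts gives
  Dynkin's formula for \<open>ww = w + F\<close>.\<close>

lemma killed_identity:
  assumes h: "h > 0" and x: "x > 0"
  shows "killed h wwe x = wwe x + (\<integral>\<^sup>+s. indicator {0..<h} s * killed s f x \<partial>lborel)"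
proof -
  have h0: "h \<ge> 0" using h by simp
  note V_meas[OF h0, measurable] alive_sets[OF h0, measurable]
  have wwe: "wwe z = we z + F z" for z by (simp add: ww_def F_Fr w_nonneg Fr_nonneg ennreal_plus)
  have "killed h wwe x = (\<integral>\<^sup>+\<omega>. indicator (alive h x) \<omega> * we (x + V h \<omega>) + indicator (alive h x) \<omega> * F (x + V h \<omega>) \<partial>M)"
    unfolding killed_def wwe by (simp add: distrib_left)
  also have "\<dots> = (\<integral>\<^sup>+\<omega>. indicator (alive h x) \<omega> * we (x + V h \<omega>) \<partial>M) + killed h F x"
    unfolding killed_def by (rule nn_integral_add) measurable
  also have "(\<integral>\<^sup>+\<omega>. indicator (alive h x) \<omega> * we (x + V h \<omega>) \<partial>M) = (\<integral>\<^sup>+\<omega>. indicator (alive h x) \<omega> * ennreal (W (x + V h \<omega>)) \<partial>M)"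
  proof (intro nn_integral_cong)
    fix \<omega>
    show "indicator (alive h x) \<omega> * we (x + V h \<omega>) = indicator (alive h x) \<omega> * ennreal (W (x + V h \<omega>))"
      using alive_pos[of \<omega> h x h] h0 by (cases "\<omega> \<in> alive h x") (auto simp: w_def)
  qed
  also have "\<dots> = we x" using W_inv[OF x h0] x by (simp add: w_def)
  finally show ?thesis unfolding wwe killed_identity_F[OF h x] by (simp add: add.assoc)
qed

end

section \<open>Feynman-Kac formula\<close>

lemma subalgebra_natural_filtration:
  assumes "\<And>r. 0 \<le> r \<Longrightarrow> X r \<in> borel_measurable N"
  shows "subalgebra N (natural_filtration N X s)"
  unfolding subalgebra_def natural_filtration_def
proof
  let ?G = "{X r -` A \<inter> space N | r A. 0 \<le> r \<and> r \<le> s \<and> A \<in> sets borel}"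
  have G: "?G \<subseteq> sets N" using assms by (auto intro: measurable_sets)
  then have "?G \<subseteq> Pow (space N)" by (auto dest: sets.sets_into_space)
  then show "space (sigma (space N) ?G) = space N" "sets (sigma (space N) ?G) \<subseteq> sets N"
    using G by (simp_all add: sets.sigma_sets_subset)
qed

lemma measurable_natural_filtration:
  assumes "\<And>r. 0 \<le> r \<Longrightarrow> X r \<in> borel_measurable N" "0 \<le> r" "r \<le> s"
  shows "X r \<in> borel_measurable (natural_filtration N X s)"
proof (rule measurableI)
  let ?G = "{X r -` A \<inter> space N | r A. 0 \<le> r \<and> r \<le> s \<and> A \<in> sets borel}"
  have sp: "space (natural_filtration N X s) = space N"
    using subalgebra_natural_filtration[OF assms(1), where s = s] by (simp add: subalgebra_def)
  have "?G \<subseteq> Pow (space N)" by auto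
  then have sets: "sets (natural_filtration N X s) = sigma_sets (space N) ?G"
    unfolding natural_filtration_def by (rule sets_measure_of)
  fix A :: "real set" assume "A \<in> sets borel"
  then show "X r -` A \<inter> space (natural_filtration N X s) \<in> sets (natural_filtration N X s)"
    unfolding sp sets using assms(2,3) by (intro sigma_sets.Basic) blast
qed simp

abbreviation halfline :: "real measure" where "halfline \<equiv> restrict_space borel {0..}"

lemma borel_halfline: "\<phi> \<in> borel_measurable borel \<Longrightarrow> \<phi> \<in> borel_measurable halfline"
  by (rule measurable_restrict_space1)

lemma cont_halfline: "continuous_on {0..} f \<Longrightarrow> f \<in> borel_measurable halfline" for f :: "real \<Rightarrow> real"
  by (rule borel_measurable_continuous_on_restrict)

lemma sum_indicator_grid:
  fixes c :: "nat \<Rightarrow> real" and s :: real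
  assumes h: "h > 0"
  shows "(\<Sum>k<n. indicator {real k * h..<real (Suc k) * h} s * c k) = indicator {0..<real n * h} s * c (nat \<lfloor>s / h\<rfloor>)"
proof (induction n)
  case (Suc n)
  have "indicator {0..<real (Suc n) * h} s * c (nat \<lfloor>s / h\<rfloor>) = indicator {0..<real n * h} s * c (nat \<lfloor>s / h\<rfloor>)
      + indicator {real n * h..<real (Suc n) * h} s * c n"
  proof (cases "s \<in> {real n * h..<real (Suc n) * h}")
    case True
    have "real n \<le> s / h" "s / h < real n + 1" using True h by (auto simp: field_simps)
    then have "\<lfloor>s / h\<rfloor> = int n" by linarith
    moreover have "0 \<le> s" using True h by (auto intro: order_trans[rotated])
    ultimately show ?thesis using True by (simp add: indicator_def)
  next
    case False
    have "0 \<le> real n * h" "real n * h \<le> real (Suc n) * h" using h by auto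
    then show ?thesis using False by (auto simp: indicator_def)
  qed
  then show ?case by (simp only: sum.lessThan_Suc Suc.IH)
qed simp

text \<open>The sum is the integral of a step function whose value at \<open>s\<close> is
  \<open>u\<close> at a grid point strictly after \<open>s\<close>. Right-continuity makes it
  converge pointwise, and dominated convergence does the rest.\<close>

lemma riemann_right_limit:
  fixes u :: "real \<Rightarrow> real"
  assumes t: "t > 0" and m: "(\<lambda>s. u (max 0 s)) \<in> borel_measurable borel" and b: "\<And>s. \<bar>u s\<bar> \<le> 1"
    and right: "\<And>s. s \<ge> 0 \<Longrightarrow> (u \<longlongrightarrow> u s) (at_right s)"
  shows "(\<lambda>n. \<Sum>k<Suc n. (t / real (Suc n)) * u (real (Suc k) * (t / real (Suc n)))) \<longlonglongrightarrow>
     (LINT s|lborel. indicator {0..<t} s * u (max 0 s))"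
proof -
  define h where "h n = t / real (Suc n)" for n
  have h: "h n > 0" for n using t by (simp add: h_def)
  have nh: "real (Suc n) * h n = t" for n by (simp add: h_def)
  have sum: "(\<Sum>k<Suc n. h n * u (real (Suc k) * h n)) = (LINT s|lborel. indicator {0..<t} s * u (real (Suc (nat \<lfloor>s / h n\<rfloor>)) * h n))" for n
  proof -
    have "(LINT s|lborel. indicator {0..<t} s * u (real (Suc (nat \<lfloor>s / h n\<rfloor>)) * h n))
      = (LINT s|lborel. (\<Sum>k<Suc n. indicator {real k * h n..<real (Suc k) * h n} s * u (real (Suc k) * h n)))"
      unfolding sum_indicator_grid[OF h[of n], where n = "Suc n" and c = "\<lambda>k. u (real (Suc k) * h n)"] nh ..
    also have "\<dots> = (\<Sum>k<Suc n. LINT s|lborel. indicator {real k * h n..<real (Suc k) * h n} s * u (real (Suc k) * h n))"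
      using h[of n] by (intro Bochner_Integration.integral_sum) (auto simp: mult_right_mono)
    also have "\<dots> = (\<Sum>k<Suc n. h n * u (real (Suc k) * h n))"
    proof (intro sum.cong refl)
      fix k
      have "real k * h n \<le> real (Suc k) * h n" using h[of n] by (simp add: mult_right_mono)
      then show "(LINT s|lborel. indicator {real k * h n..<real (Suc k) * h n} s * u (real (Suc k) * h n)) = h n * u (real (Suc k) * h n)"
        by (simp add: algebra_simps)
    qed
    finally show ?thesis by simp
  qed
  have "(\<lambda>n. LINT s|lborel. indicator {0..<t} s * u (real (Suc (nat \<lfloor>s / h n\<rfloor>)) * h n)) \<longlonglongrightarrow> (LINT s|lborel. indicator {0..<t} s * u (max 0 s))"
  proof (rule integral_dominated_convergence[where w = "indicator {0..<t}"])
    show "(\<lambda>s. indicator {0..<t} s * u (max 0 s)) \<in> borel_measurable lborel" using m by measurable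
    show "(\<lambda>s. indicator {0..<t} s * u (real (Suc (nat \<lfloor>s / h n\<rfloor>)) * h n)) \<in> borel_measurable lborel" for n
      unfolding sum_indicator_grid[OF h[of n], where n = "Suc n" and c = "\<lambda>k. u (real (Suc k) * h n)", unfolded nh, symmetric] by measurable
    show "integrable lborel (indicator {0..<t} :: real \<Rightarrow> real)" using t by (intro integrable_real_indicator) auto
    show "AE s in lborel. norm (indicator {0..<t} s * u (real (Suc (nat \<lfloor>s / h n\<rfloor>)) * h n)) \<le> indicator {0..<t} s" for n
      using b by (auto simp: indicator_def)
    show "AE s in lborel. (\<lambda>n. indicator {0..<t} s * u (real (Suc (nat \<lfloor>s / h n\<rfloor>)) * h n)) \<longlonglongrightarrow> indicator {0..<t} s * u (max 0 s)"
    proof (rule AE_I2)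
      fix s
      show "(\<lambda>n. indicator {0..<t} s * u (real (Suc (nat \<lfloor>s / h n\<rfloor>)) * h n)) \<longlonglongrightarrow> indicator {0..<t} s * u (max 0 s)"
      proof (cases "s \<in> {0..<t}")
        case True
        then have s: "s \<ge> 0" by simp
        define \<rho> where "\<rho> n = real (Suc (nat \<lfloor>s / h n\<rfloor>)) * h n" for n
        have r: "s < \<rho> n" "\<rho> n \<le> s + h n" for n
        proof -
          have "s / h n \<ge> 0" using s h[of n] by simp
          then have e: "real (Suc (nat \<lfloor>s / h n\<rfloor>)) = of_int \<lfloor>s / h n\<rfloor> + 1" by simp
          have "s / h n < of_int \<lfloor>s / h n\<rfloor> + 1" "of_int \<lfloor>s / h n\<rfloor> + 1 \<le> s / h n + 1" by linarith+
          then show "s < \<rho> n" "\<rho> n \<le> s + h n" unfolding \<rho>_def e using h[of n] by (auto simp: field_simps)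
        qed
        have "(\<lambda>n. s + t * (1 / real (Suc n))) \<longlonglongrightarrow> s + t * 0"
          by (intro tendsto_intros LIMSEQ_inverse_real_of_nat[unfolded inverse_eq_divide])
        then have "(\<lambda>n. s + h n) \<longlonglongrightarrow> s" by (simp add: h_def[abs_def])
        then have "\<rho> \<longlonglongrightarrow> s"
          by (rule tendsto_sandwich[OF _ _ tendsto_const, rotated 2]) (use r in \<open>auto intro!: always_eventually less_imp_le\<close>)
        then have "filterlim \<rho> (at_right s) sequentially"
          unfolding filterlim_at using r(1) by (auto intro!: always_eventually simp: less_imp_neq[symmetric])
        from filterlim_compose[OF right[OF s] this] show ?thesis using True by (simp add: \<rho>_def)
      qed simp
    qed
  qed
  then show ?thesis unfolding sum[symmetric] by (simp add: h_def)
qed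

section \<open>A Feller process started from 0 and a bounded continuous test function\<close>

locale feller_bounded = prob_space N0 for N0 :: "'c measure" +
  fixes Q :: "real \<Rightarrow> real \<Rightarrow> real measure" and U :: "real \<Rightarrow> 'c \<Rightarrow> real" and lam G :: real and gg :: "real \<Rightarrow> real"
  assumes feller: "feller_process N0 Q U" and start: "AE \<omega> in N0. U 0 \<omega> = 0" and lam: "lam > 0"
    and gg: "\<And>x. x \<ge> 0 \<Longrightarrow> 1 \<le> gg x" "\<And>x. x \<ge> 0 \<Longrightarrow> gg x \<le> G" and gg_cont: "continuous_on {0..} gg" and gg_0: "gg 0 = 1"
begin

lemma Q_feller: "feller_semigroup Q" and U_markov: "markov_process N0 {0..} Q U" and U_cadlag: "\<omega> \<in> space N0 \<Longrightarrow> cadlag (\<lambda>t. U t \<omega>)"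
  using feller by (auto simp: feller_process_def)

lemma Q_meas: "t \<ge> 0 \<Longrightarrow> Q t \<in> halfline \<rightarrow>\<^sub>M prob_algebra halfline"
  using Q_feller by (auto simp: feller_semigroup_def)

lemma Q_meas_sub: "t \<ge> 0 \<Longrightarrow> Q t \<in> halfline \<rightarrow>\<^sub>M subprob_algebra halfline"
  by (intro measurable_prob_algebraD Q_meas)

lemma Q_prob: assumes "t \<ge> 0" "x \<ge> 0" shows "prob_space (Q t x)" "sets (Q t x) = sets halfline" "space (Q t x) = {0..}"
proof -
  have "Q t x \<in> space (prob_algebra halfline)"
    using measurable_space[OF Q_meas[OF assms(1)], of x] assms(2) by (simp add: space_restrict_space)
  then show "prob_space (Q t x)" and s: "sets (Q t x) = sets halfline" by (auto simp: space_prob_algebra)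
  show "space (Q t x) = {0..}" using sets_eq_imp_space_eq[OF s] by (simp add: space_restrict_space)
qed

lemma U_halfline: "t \<ge> 0 \<Longrightarrow> U t \<in> N0 \<rightarrow>\<^sub>M halfline"
  using U_markov by (auto simp: markov_process_def)

lemma U_meas [measurable]: "t \<ge> 0 \<Longrightarrow> U t \<in> borel_measurable N0"
  using U_halfline[of t] by (auto simp: measurable_restrict_space2_iff)

lemma U_nonneg: "t \<ge> 0 \<Longrightarrow> \<omega> \<in> space N0 \<Longrightarrow> U t \<omega> \<ge> 0"
  using measurable_space[OF U_halfline, of t \<omega>] by (simp add: space_restrict_space)

text \<open>Extends the Markov property from events to nonnegative functions by induction over
  \<phi>. The weight \<open>Z\<close>, measurable with respect to the past, will be the discount
  accumulated up to time \<open>s\<close>.\<close>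

lemma markov_nn:
  assumes s: "s \<ge> 0" and t: "t \<ge> 0" and Z: "Z \<in> borel_measurable (natural_filtration N0 U s)"
    and Z01: "\<And>\<omega>. 0 \<le> Z \<omega>" "\<And>\<omega>. Z \<omega> \<le> 1" and \<phi>: "\<phi> \<in> borel_measurable halfline"
  shows "(\<integral>\<^sup>+\<omega>. ennreal (Z \<omega>) * \<phi> (U (s + t) \<omega>) \<partial>N0) = (\<integral>\<^sup>+\<omega>. ennreal (Z \<omega>) * (\<integral>\<^sup>+y. \<phi> y \<partial>Q t (U s \<omega>)) \<partial>N0)"
proof -
  have sub: "subalgebra N0 (natural_filtration N0 U s)" by (rule subalgebra_natural_filtration) (rule U_meas)
  interpret FS: finite_measure_subalgebra N0 "natural_filtration N0 U s"
    by unfold_locales (rule sub)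
  have Zm [measurable]: "Z \<in> borel_measurable N0" by (rule measurable_from_subalg[OF sub Z])
  have st: "s + t \<ge> 0" using s t by simp
  note U_halfline[OF st, measurable] U_halfline[OF s, measurable] Q_meas_sub[OF t, measurable]
  have inner [measurable]: "(\<lambda>\<omega>. \<integral>\<^sup>+y. \<psi> y \<partial>Q t (U s \<omega>)) \<in> borel_measurable N0" if [measurable]: "\<psi> \<in> borel_measurable halfline" for \<psi>
  proof -
    have "Q t \<circ> U s \<in> N0 \<rightarrow>\<^sub>M subprob_algebra halfline" by (rule measurable_comp[OF U_halfline[OF s] Q_meas_sub[OF t]])
    from measurable_compose[OF this nn_integral_measurable_subprob_algebra[OF that]] show ?thesis by (simp add: comp_def)
  qed
  have Qs: "sets (Q t (U s \<omega>)) = sets halfline" if "\<omega> \<in> space N0" for \<omega>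
    using Q_prob(2)[OF t U_nonneg[OF s that]] .
  have Qm: "borel_measurable (Q t (U s \<omega>)) = (borel_measurable halfline :: (real \<Rightarrow> ennreal) set)" if "\<omega> \<in> space N0" for \<omega>
    by (rule measurable_cong_sets[OF Qs[OF that] refl])
  have USP: "U (s + t) \<omega> \<in> space halfline" if "\<omega> \<in> space N0" for \<omega> using U_nonneg[OF st that] by (simp add: space_restrict_space)
  show ?thesis using \<phi>
  proof induct
    case (cong f g)
    have 1: "(\<integral>\<^sup>+\<omega>. ennreal (Z \<omega>) * f (U (s + t) \<omega>) \<partial>N0) = (\<integral>\<^sup>+\<omega>. ennreal (Z \<omega>) * g (U (s + t) \<omega>) \<partial>N0)"
      by (intro nn_integral_cong) (simp add: cong(3)[OF USP])
    have 2: "(\<integral>\<^sup>+\<omega>. ennreal (Z \<omega>) * (\<integral>\<^sup>+y. f y \<partial>Q t (U s \<omega>)) \<partial>N0) = (\<integral>\<^sup>+\<omega>. ennreal (Z \<omega>) * (\<integral>\<^sup>+y. g y \<partial>Q t (U s \<omega>)) \<partial>N0)"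
    proof (rule nn_integral_cong)
      fix \<omega> assume w: "\<omega> \<in> space N0"
      have "(\<integral>\<^sup>+y. f y \<partial>Q t (U s \<omega>)) = (\<integral>\<^sup>+y. g y \<partial>Q t (U s \<omega>))"
        by (rule nn_integral_cong) (use cong(3) sets_eq_imp_space_eq[OF Qs[OF w]] in auto)
      then show "ennreal (Z \<omega>) * (\<integral>\<^sup>+y. f y \<partial>Q t (U s \<omega>)) = ennreal (Z \<omega>) * (\<integral>\<^sup>+y. g y \<partial>Q t (U s \<omega>))" by simp
    qed
    show ?case unfolding 1 2 by (rule cong(4))
  next
    case (set A)
    have A: "A \<in> sets borel" "A \<subseteq> {0..}" using set by (auto simp: sets_restrict_space)
    let ?I = "indicator (U (s + t) -` A \<inter> space N0) :: 'c \<Rightarrow> real"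
    have Im [measurable]: "?I \<in> borel_measurable N0"
      by (intro borel_measurable_indicator measurable_sets[OF U_halfline[OF st] set])
    have ce: "AE \<omega> in N0. real_cond_exp N0 (natural_filtration N0 U s) ?I \<omega> = measure (Q t (U s \<omega>)) A"
      using U_markov s t A by (auto simp: markov_process_def)
    have i1: "integrable N0 (\<lambda>\<omega>. Z \<omega> * ?I \<omega>)"
    proof (rule integrable_const_bound[where B = 1])
      show "(\<lambda>\<omega>. Z \<omega> * ?I \<omega>) \<in> borel_measurable N0" by (intro borel_measurable_times Zm Im)
      show "AE \<omega> in N0. norm (Z \<omega> * ?I \<omega>) \<le> 1" using Z01 by (auto simp: indicator_def)
    qed
    have i2: "integrable N0 (\<lambda>\<omega>. Z \<omega> * real_cond_exp N0 (natural_filtration N0 U s) ?I \<omega>)"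
      "(\<integral>\<omega>. Z \<omega> * real_cond_exp N0 (natural_filtration N0 U s) ?I \<omega> \<partial>N0) = (\<integral>\<omega>. Z \<omega> * ?I \<omega> \<partial>N0)"
      using FS.real_cond_exp_intg[OF i1 Z Im] by auto
    have "(\<integral>\<^sup>+\<omega>. ennreal (Z \<omega>) * indicator A (U (s + t) \<omega>) \<partial>N0) = (\<integral>\<^sup>+\<omega>. ennreal (Z \<omega> * ?I \<omega>) \<partial>N0)"
      by (intro nn_integral_cong) (simp add: indicator_def)
    also have "\<dots> = ennreal (\<integral>\<omega>. Z \<omega> * ?I \<omega> \<partial>N0)"
      by (rule nn_integral_eq_integral[OF i1]) (use Z01 in auto)
    also have "\<dots> = ennreal (\<integral>\<omega>. Z \<omega> * real_cond_exp N0 (natural_filtration N0 U s) ?I \<omega> \<partial>N0)" by (simp add: i2)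
    also have "\<dots> = (\<integral>\<^sup>+\<omega>. ennreal (Z \<omega> * real_cond_exp N0 (natural_filtration N0 U s) ?I \<omega>) \<partial>N0)"
      by (rule nn_integral_eq_integral[OF i2(1), symmetric]) (use ce Z01 in \<open>auto elim!: eventually_mono\<close>)
    also have "\<dots> = (\<integral>\<^sup>+\<omega>. ennreal (Z \<omega>) * (\<integral>\<^sup>+y. indicator A y \<partial>Q t (U s \<omega>)) \<partial>N0)"
    proof (rule nn_integral_cong_AE)
      show "AE \<omega> in N0. ennreal (Z \<omega> * real_cond_exp N0 (natural_filtration N0 U s) ?I \<omega>) = ennreal (Z \<omega>) * (\<integral>\<^sup>+y. indicator A y \<partial>Q t (U s \<omega>))"
        using ce AE_space
      proof eventually_elim
        case (elim \<omega>)
        interpret q: prob_space "Q t (U s \<omega>)" by (rule Q_prob(1)[OF t U_nonneg[OF s elim(2)]])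
        have "(\<integral>\<^sup>+y. indicator A y \<partial>Q t (U s \<omega>)) = ennreal (measure (Q t (U s \<omega>)) A)"
          using set Qs[OF elim(2)] by (simp add: q.emeasure_eq_measure)
        then show ?case using elim(1) Z01 by (simp add: ennreal_mult)
      qed
    qed
    finally show ?case .
  next
    case (mult u c)
    note [measurable] = mult(2)
    have "(\<integral>\<^sup>+\<omega>. ennreal (Z \<omega>) * (c * u (U (s + t) \<omega>)) \<partial>N0) = c * (\<integral>\<^sup>+\<omega>. ennreal (Z \<omega>) * u (U (s + t) \<omega>) \<partial>N0)"
      by (subst nn_integral_cmult[symmetric]) (auto simp: mult_ac)
    also have "\<dots> = c * (\<integral>\<^sup>+\<omega>. ennreal (Z \<omega>) * (\<integral>\<^sup>+y. u y \<partial>Q t (U s \<omega>)) \<partial>N0)" by (simp only: mult)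
    also have "\<dots> = (\<integral>\<^sup>+\<omega>. c * (ennreal (Z \<omega>) * (\<integral>\<^sup>+y. u y \<partial>Q t (U s \<omega>))) \<partial>N0)"
      by (rule nn_integral_cmult[symmetric]) measurable
    also have "\<dots> = (\<integral>\<^sup>+\<omega>. ennreal (Z \<omega>) * (\<integral>\<^sup>+y. c * u y \<partial>Q t (U s \<omega>)) \<partial>N0)"
      by (intro nn_integral_cong) (subst nn_integral_cmult; simp add: Qm mult mult_ac)
    finally show ?case .
  next
    case (add u v)
    note [measurable] = add(1,4)
    have "(\<integral>\<^sup>+\<omega>. ennreal (Z \<omega>) * (v (U (s + t) \<omega>) + u (U (s + t) \<omega>)) \<partial>N0)
       = (\<integral>\<^sup>+\<omega>. ennreal (Z \<omega>) * v (U (s + t) \<omega>) \<partial>N0) + (\<integral>\<^sup>+\<omega>. ennreal (Z \<omega>) * u (U (s + t) \<omega>) \<partial>N0)"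
      by (subst nn_integral_add[symmetric]) (auto simp: distrib_left)
    also have "\<dots> = (\<integral>\<^sup>+\<omega>. ennreal (Z \<omega>) * (\<integral>\<^sup>+y. v y \<partial>Q t (U s \<omega>)) + ennreal (Z \<omega>) * (\<integral>\<^sup>+y. u y \<partial>Q t (U s \<omega>)) \<partial>N0)"
      unfolding add(3) add(7) by (rule nn_integral_add[symmetric]) measurable
    also have "\<dots> = (\<integral>\<^sup>+\<omega>. ennreal (Z \<omega>) * (\<integral>\<^sup>+y. v y + u y \<partial>Q t (U s \<omega>)) \<partial>N0)"
      by (intro nn_integral_cong) (subst nn_integral_add; simp add: Qm add distrib_left)
    finally show ?case .
  next
    case (seq S)
    note [measurable] = seq(1)
    have inc: "incseq (\<lambda>i \<omega>. ennreal (Z \<omega>) * S i (U (s + t) \<omega>))"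
      using seq(4) by (auto simp: incseq_def le_fun_def intro!: mult_left_mono)
    have inc2: "incseq (\<lambda>i \<omega>. ennreal (Z \<omega>) * (\<integral>\<^sup>+y. S i y \<partial>Q t (U s \<omega>)))"
      using seq(4) by (auto simp: incseq_def le_fun_def intro!: mult_left_mono nn_integral_mono)
    have "(\<integral>\<^sup>+\<omega>. ennreal (Z \<omega>) * (SUP i. S i) (U (s + t) \<omega>) \<partial>N0) = (\<integral>\<^sup>+\<omega>. (SUP i. ennreal (Z \<omega>) * S i (U (s + t) \<omega>)) \<partial>N0)"
      by (simp add: SUP_mult_left_ennreal image_comp)
    also have "\<dots> = (SUP i. \<integral>\<^sup>+\<omega>. ennreal (Z \<omega>) * S i (U (s + t) \<omega>) \<partial>N0)"
      by (rule nn_integral_monotone_convergence_SUP[OF inc]) measurable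
    also have "\<dots> = (SUP i. \<integral>\<^sup>+\<omega>. ennreal (Z \<omega>) * (\<integral>\<^sup>+y. S i y \<partial>Q t (U s \<omega>)) \<partial>N0)" by (simp only: seq(3))
    also have "\<dots> = (\<integral>\<^sup>+\<omega>. (SUP i. ennreal (Z \<omega>) * (\<integral>\<^sup>+y. S i y \<partial>Q t (U s \<omega>))) \<partial>N0)"
      by (rule nn_integral_monotone_convergence_SUP[OF inc2, symmetric]) measurable
    also have "\<dots> = (\<integral>\<^sup>+\<omega>. ennreal (Z \<omega>) * (\<integral>\<^sup>+y. (SUP i. S i) y \<partial>Q t (U s \<omega>)) \<partial>N0)"
    proof (rule nn_integral_cong)
      fix \<omega> assume w: "\<omega> \<in> space N0"
      have "(\<integral>\<^sup>+y. (SUP i. S i y) \<partial>Q t (U s \<omega>)) = (SUP i. \<integral>\<^sup>+y. S i y \<partial>Q t (U s \<omega>))"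
        by (rule nn_integral_monotone_convergence_SUP[OF seq(4)]) (simp add: Qm w seq(1))
      then show "(SUP i. ennreal (Z \<omega>) * (\<integral>\<^sup>+y. S i y \<partial>Q t (U s \<omega>))) = ennreal (Z \<omega>) * (\<integral>\<^sup>+y. (SUP i. S i) y \<partial>Q t (U s \<omega>))"
        by (simp add: SUP_mult_left_ennreal image_comp)
    qed
    finally show ?case .
  qed
qed

lemma G_ge_1: "G \<ge> 1" using gg[of 0] by linarith

lemma Q_integrable:
  fixes \<phi> :: "real \<Rightarrow> real"
  assumes "t \<ge> 0" "x \<ge> 0" and "\<phi> \<in> borel_measurable halfline" and "\<And>y. y \<ge> 0 \<Longrightarrow> \<bar>\<phi> y\<bar> \<le> B"
  shows "integrable (Q t x) \<phi>"
proof -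
  interpret q: prob_space "Q t x" by (rule Q_prob(1)[OF assms(1,2)])
  have "\<phi> \<in> borel_measurable (Q t x)" using assms(3) by (simp only: measurable_cong_sets[OF Q_prob(2)[OF assms(1,2)] refl])
  then show ?thesis using assms(4) Q_prob(3)[OF assms(1,2)]
    by (intro q.integrable_const_bound[where B = B]) (auto intro!: AE_I2)
qed

lemma gg_halfline: "gg \<in> borel_measurable halfline" using gg_cont by (rule cont_halfline)

lemma gg_integrable: "t \<ge> 0 \<Longrightarrow> x \<ge> 0 \<Longrightarrow> integrable (Q t x) gg"
proof (rule Q_integrable[OF _ _ gg_halfline])
  show "\<bar>gg y\<bar> \<le> G" if "y \<ge> 0" for y using gg[OF that] by linarith
qed

text \<open>Unlike \<open>gg\<close>, which is at least 1 everywhere, this product vanishes at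
  infinity. It belongs to the class on which the Feller semigroup converges uniformly as time tends
  to 0.\<close>

definition om where "om y = exp (- y) * gg y"

lemma om_cont: "continuous_on {0..} om"
  unfolding om_def by (intro continuous_intros gg_cont)

lemma om_bounds: "y \<ge> 0 \<Longrightarrow> 0 \<le> om y" "y \<ge> 0 \<Longrightarrow> om y \<le> G"
proof -
  assume y: "y \<ge> 0"
  show "0 \<le> om y" using gg(1)[OF y] by (simp add: om_def)
  have "exp (- y) * gg y \<le> 1 * G" using gg[OF y] y by (intro mult_mono) auto
  then show "om y \<le> G" by (simp add: om_def)
qed

lemma om_C0: "om \<in> C0_halfline"
proof -
  have "(om \<longlongrightarrow> 0) at_top"
  proof (rule tendsto_sandwich[where f = "\<lambda>_. 0" and h = "\<lambda>y. G * exp (- y)"])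
    show "eventually (\<lambda>y. 0 \<le> om y) at_top"
      using eventually_ge_at_top[of 0] by eventually_elim (rule om_bounds)
    show "eventually (\<lambda>y. om y \<le> G * exp (- y)) at_top"
      using eventually_ge_at_top[of 0]
    proof eventually_elim
      case (elim y)
      then show ?case using gg(2)[OF elim] by (simp add: om_def mult.commute)
    qed
    have "((\<lambda>y. G * exp (- y)) \<longlongrightarrow> G * 0) at_top"
      by (intro tendsto_intros filterlim_compose[OF exp_at_bot] filterlim_uminus_at_bot_at_top)
    then show "((\<lambda>y. G * exp (- y)) \<longlongrightarrow> 0) at_top" by simp
  qed simp
  then show ?thesis using om_cont by (simp add: C0_halfline_def)
qed

lemma om_integrable: "t \<ge> 0 \<Longrightarrow> x \<ge> 0 \<Longrightarrow> integrable (Q t x) om"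
proof (rule Q_integrable[OF _ _ cont_halfline[OF om_cont]])
  show "\<bar>om y\<bar> \<le> G" if "y \<ge> 0" for y using om_bounds[OF that] by linarith
qed

lemma om_uniform:
  assumes "\<epsilon> > 0"
  shows "\<exists>h0>0. \<forall>h. 0 < h \<and> h < h0 \<longrightarrow> (\<forall>x\<ge>0. \<bar>(\<integral>y. om y \<partial>Q h x) - om x\<bar> < \<epsilon>)"
proof -
  have "uniform_limit {0..} (\<lambda>t x. \<integral>y. om y \<partial>Q t x) om (at_right 0)"
    using Q_feller om_C0 by (auto simp: feller_semigroup_def)
  then have "eventually (\<lambda>h. \<forall>x\<in>{0..}. dist (\<integral>y. om y \<partial>Q h x) (om x) < \<epsilon>) (at_right 0)"
    using assms by (auto simp: uniform_limit_iff)
  then obtain b where "b > 0" "\<forall>h. 0 < h \<longrightarrow> h < b \<longrightarrow> (\<forall>x\<in>{0..}. dist (\<integral>y. om y \<partial>Q h x) (om x) < \<epsilon>)"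
    by (auto simp: eventually_at_right_field)
  then show ?thesis by (intro exI[of _ b]) (auto simp: dist_real_def)
qed

lemma Q_C0_at_0:
  assumes "\<phi> \<in> C0_halfline" "t \<ge> 0"
  shows "((\<lambda>x. \<integral>y. \<phi> y \<partial>Q t x) \<longlongrightarrow> (\<integral>y. \<phi> y \<partial>Q t 0)) (at_right 0)"
proof -
  have "continuous_on {0..} (\<lambda>x. \<integral>y. \<phi> y \<partial>Q t x)"
    using Q_feller assms by (auto simp: feller_semigroup_def C0_halfline_def)
  then have "((\<lambda>x. \<integral>y. \<phi> y \<partial>Q t x) \<longlongrightarrow> (\<integral>y. \<phi> y \<partial>Q t 0)) (at 0 within {0..})"
    by (auto simp: continuous_on)
  then show ?thesis by (rule tendsto_mono[rotated]) (auto intro: at_le)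
qed

definition cut :: "nat \<Rightarrow> real \<Rightarrow> real" where "cut m y = max 0 (min 1 (real m + 1 - y))"

lemma cut_cont: "continuous_on A (cut m)"
  unfolding cut_def by (intro continuous_intros)

lemma cut_bounds: "0 \<le> cut m y" "cut m y \<le> 1" by (auto simp: cut_def)

lemma cut_C0: "continuous_on {0..} \<phi> \<Longrightarrow> (\<lambda>y. \<phi> y * cut m y) \<in> C0_halfline"
proof -
  assume c: "continuous_on {0..} \<phi>"
  have "eventually (\<lambda>y. \<phi> y * cut m y = 0) at_top"
    using eventually_ge_at_top[of "real m + 1"] by eventually_elim (simp add: cut_def)
  then have "((\<lambda>y. \<phi> y * cut m y) \<longlongrightarrow> 0) at_top" by (rule tendsto_eventually)
  then show ?thesis using c by (simp add: C0_halfline_def continuous_on_mult cut_cont)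
qed

text \<open>Conservativeness upgrades the Feller property to bounded continuous functions.\<close>
lemma Q_gg_at_0:
  assumes t: "t \<ge> 0"
  shows "((\<lambda>x. \<integral>y. gg y \<partial>Q t x) \<longlongrightarrow> (\<integral>y. gg y \<partial>Q t 0)) (at_right 0)"
proof (rule tendstoI)
  fix e :: real assume e: "e > 0"
  have cut1: "(\<lambda>y. 1 * cut m y) \<in> C0_halfline" for m by (rule cut_C0) simp
  have ci: "integrable (Q t x) (cut m)" if "x \<ge> 0" for x m
    by (rule Q_integrable[OF t that cont_halfline[OF cut_cont], of _ 1]) (use cut_bounds in \<open>auto simp: abs_of_nonneg\<close>)
  have gci: "integrable (Q t x) (\<lambda>y. gg y * cut m y)" if "x \<ge> 0" for x m
  proof (rule Q_integrable[OF t that])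
    show "(\<lambda>y. gg y * cut m y) \<in> borel_measurable halfline" by (intro borel_measurable_times gg_halfline cont_halfline cut_cont)
    show "\<bar>gg y * cut m y\<bar> \<le> G * 1" if "y \<ge> 0" for y
      unfolding abs_mult using gg[OF that] cut_bounds[of m y] by (intro mult_mono) auto
  qed
  \<comment> \<open>Because \<open>Q t x\<close> has mass one, the error of the cutoff is controlled
    by the integral of \<open>cut m\<close>, which is itself continuous in \<open>x\<close> by the
    Feller property.\<close>
  have err: "\<bar>(\<integral>y. gg y \<partial>Q t x) - (\<integral>y. gg y * cut m y \<partial>Q t x)\<bar> \<le> G * (1 - (\<integral>y. cut m y \<partial>Q t x))" if x: "x \<ge> 0" for x m
  proof -
    interpret q: prob_space "Q t x" by (rule Q_prob(1)[OF t x])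
    have sp: "y \<ge> 0" if "y \<in> space (Q t x)" for y using that Q_prob(3)[OF t x] by simp
    have "(\<integral>y. gg y \<partial>Q t x) - (\<integral>y. gg y * cut m y \<partial>Q t x) = (\<integral>y. gg y * (1 - cut m y) \<partial>Q t x)"
      using gg_integrable[OF t x] gci[OF x] by (simp add: right_diff_distrib)
    moreover have "0 \<le> (\<integral>y. gg y * (1 - cut m y) \<partial>Q t x)"
      by (intro Bochner_Integration.integral_nonneg mult_nonneg_nonneg) (use sp cut_bounds gg(1) in \<open>auto intro: order_trans[OF zero_le_one]\<close>)
    moreover have "(\<integral>y. gg y * (1 - cut m y) \<partial>Q t x) \<le> (\<integral>y. G * (1 - cut m y) \<partial>Q t x)"
    proof (rule integral_mono)
      show "integrable (Q t x) (\<lambda>y. gg y * (1 - cut m y))" using gg_integrable[OF t x] gci[OF x] by (simp add: right_diff_distrib)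
      show "integrable (Q t x) (\<lambda>y. G * (1 - cut m y))" using ci[OF x] by auto
      show "gg y * (1 - cut m y) \<le> G * (1 - cut m y)" if "y \<in> space (Q t x)" for y
        using gg(2)[OF sp[OF that]] cut_bounds(2)[of m y] by (intro mult_right_mono) auto
    qed
    moreover have "(\<integral>y. G * (1 - cut m y) \<partial>Q t x) = G * (1 - (\<integral>y. cut m y \<partial>Q t x))" using ci[OF x] by (simp add: q.prob_space)
    ultimately show ?thesis by linarith
  qed
  have "(\<lambda>m. \<integral>y. cut m y \<partial>Q t 0) \<longlonglongrightarrow> (\<integral>y. 1 \<partial>Q t 0)"
  proof (rule integral_dominated_convergence[where w = "\<lambda>_. 1"])
    interpret q: prob_space "Q t 0" by (rule Q_prob(1)[OF t]) simp
    show "integrable (Q t 0) (\<lambda>_. 1::real)" by simp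
    show "cut m \<in> borel_measurable (Q t 0)" for m using ci[of 0 m] by auto
    show "AE y in Q t 0. (\<lambda>m. cut m y) \<longlonglongrightarrow> 1"
    proof (rule AE_I2)
      fix y
      obtain m0 :: nat where m0: "y \<le> real m0" using real_arch_simple by blast
      have "eventually (\<lambda>m. cut m y = 1) sequentially"
        using eventually_ge_at_top[of m0] by eventually_elim (use m0 in \<open>auto simp: cut_def min_def max_def\<close>)
      then show "(\<lambda>m. cut m y) \<longlonglongrightarrow> 1" by (rule tendsto_eventually)
    qed
    show "AE y in Q t 0. norm (cut m y) \<le> 1" for m using cut_bounds by (auto simp: abs_of_nonneg)
  qed simp
  moreover have "(\<integral>y. 1 \<partial>Q t 0) = (1::real)" using prob_space.prob_space[OF Q_prob(1)[OF t, of 0]] by simp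
  ultimately have "eventually (\<lambda>m. 1 - e / (8 * G) < (\<integral>y. cut m y \<partial>Q t 0)) sequentially"
    using e G_ge_1 by (auto simp: order_tendsto_iff)
  then obtain m where m: "1 - e / (8 * G) < (\<integral>y. cut m y \<partial>Q t 0)" by (auto simp: eventually_sequentially)
  have "((\<lambda>x. \<integral>y. cut m y \<partial>Q t x) \<longlongrightarrow> (\<integral>y. cut m y \<partial>Q t 0)) (at_right 0)"
    using Q_C0_at_0[OF cut1 t] by simp
  then have e1: "eventually (\<lambda>x. 1 - e / (8 * G) < (\<integral>y. cut m y \<partial>Q t x)) (at_right 0)"
    using m by (auto simp: order_tendsto_iff)
  have e2: "eventually (\<lambda>x. dist (\<integral>y. gg y * cut m y \<partial>Q t x) (\<integral>y. gg y * cut m y \<partial>Q t 0) < e / 4) (at_right 0)"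
    using e by (intro tendstoD[OF Q_C0_at_0[OF cut_C0[OF gg_cont] t]]) auto
  have ev: "eventually (\<lambda>x::real. x > 0) (at_right 0)" by (rule eventually_at_right_less)
  show "eventually (\<lambda>x. dist (\<integral>y. gg y \<partial>Q t x) (\<integral>y. gg y \<partial>Q t 0) < e) (at_right 0)"
    using e1 e2 ev
  proof eventually_elim
    case (elim x)
    have "G * (1 - (\<integral>y. cut m y \<partial>Q t x)) \<le> e / 8" "G * (1 - (\<integral>y. cut m y \<partial>Q t 0)) \<le> e / 8"
      using elim(1) m G_ge_1 by (simp_all add: field_simps)
    then show ?case using err[of x m] err[of 0 m] elim e unfolding dist_real_def by linarith
  qed
qed

lemma U_pair_meas: "(\<lambda>(s, \<omega>). U (max 0 s) \<omega>) \<in> borel_measurable (borel \<Otimes>\<^sub>M N0)"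
  by (intro measurable_right_continuous U_meas cadlag_tendsto_right U_cadlag)

lemma U_section_meas: "\<omega> \<in> space N0 \<Longrightarrow> (\<lambda>s. U (max 0 s) \<omega>) \<in> borel_measurable borel"
proof -
  assume w: "\<omega> \<in> space N0"
  have "(\<lambda>s. (s, \<omega>)) \<in> borel \<rightarrow>\<^sub>M borel \<Otimes>\<^sub>M N0" using w by measurable
  from measurable_compose[OF this U_pair_meas] show ?thesis by simp
qed

lemma U_swap_meas [measurable]: "(\<lambda>p. U (max 0 (snd p)) (fst p)) \<in> borel_measurable (N0 \<Otimes>\<^sub>M lborel)"
proof -
  have "(\<lambda>p. (snd p, fst p)) \<in> (N0 \<Otimes>\<^sub>M lborel) \<rightarrow>\<^sub>M (borel \<Otimes>\<^sub>M N0)" by measurable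
  from measurable_compose[OF this U_pair_meas] show ?thesis by (simp add: split_beta')
qed

abbreviation "Iexp \<equiv> exp_functional U"

lemma Iexp_eq: "Iexp \<omega> = (\<integral>\<^sup>+s. indicator {0..} s * ennreal (exp (- U (max 0 s) \<omega>)) \<partial>lborel)"
  unfolding exp_functional_def by (intro nn_integral_cong) (auto simp: indicator_def)

lemma Iexp_meas [measurable]: "Iexp \<in> borel_measurable N0"
proof -
  have "(\<lambda>(\<omega>, s). indicator {0..} s * ennreal (exp (- U (max 0 s) \<omega>))) \<in> borel_measurable (N0 \<Otimes>\<^sub>M lborel)"
    unfolding split_beta' by measurable
  then show ?thesis unfolding Iexp_eq[abs_def] by (rule lborel.borel_measurable_nn_integral)
qed

end

text \<open>\<open>gen\<close> says, uniformly in the starting point, that the generator maps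
  \<open>gg\<close> to \<open>lam * om\<close>, that is, to
  \<open>lam * exp (- \<cdot>) * gg\<close>. Positive starting points are those where the kernel is
  known; \<open>gen_0\<close> adds 0 by continuity.\<close>

locale feller_fk = feller_bounded N0 Q U lam G gg
  for N0 :: "'c measure" and Q U lam G gg +
  assumes gen: "\<And>\<epsilon>. \<epsilon> > 0 \<Longrightarrow> \<exists>h0>0. \<forall>h. 0 < h \<and> h < h0 \<longrightarrow> (\<forall>x>0.
       \<bar>(\<integral>y. gg y \<partial>Q h x) - gg x - lam * h * om x\<bar> \<le> \<epsilon> * h)"
begin

lemma gen_0:
  assumes "\<epsilon> > 0"
  shows "\<exists>h0>0. \<forall>h. 0 < h \<and> h < h0 \<longrightarrow> (\<forall>x\<ge>0. \<bar>(\<integral>y. gg y \<partial>Q h x) - gg x - lam * h * om x\<bar> \<le> \<epsilon> * h)"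
proof -
  obtain h0 where h0: "h0 > 0" "\<And>h x. 0 < h \<Longrightarrow> h < h0 \<Longrightarrow> x > 0 \<Longrightarrow> \<bar>(\<integral>y. gg y \<partial>Q h x) - gg x - lam * h * om x\<bar> \<le> \<epsilon> * h"
    using gen[OF assms] by blast
  have "\<bar>(\<integral>y. gg y \<partial>Q h 0) - gg 0 - lam * h * om 0\<bar> \<le> \<epsilon> * h" if h: "0 < h" "h < h0" for h
  proof (rule tendsto_upperbound)
    have lim: "(\<phi> \<longlongrightarrow> \<phi> 0) (at_right 0)" if "continuous_on {0..} \<phi>" for \<phi> :: "real \<Rightarrow> real"
    proof -
      have "(\<phi> \<longlongrightarrow> \<phi> 0) (at 0 within {0..})" using that by (auto simp: continuous_on)
      then show ?thesis by (rule tendsto_mono[rotated]) (auto intro: at_le)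
    qed
    show "((\<lambda>x. \<bar>(\<integral>y. gg y \<partial>Q h x) - gg x - lam * h * om x\<bar>) \<longlongrightarrow> \<bar>(\<integral>y. gg y \<partial>Q h 0) - gg 0 - lam * h * om 0\<bar>) (at_right 0)"
      using h by (intro tendsto_intros Q_gg_at_0 lim gg_cont om_cont) auto
    have "eventually (\<lambda>x::real. x > 0) (at_right 0)" by (rule eventually_at_right_less)
    then show "eventually (\<lambda>x. \<bar>(\<integral>y. gg y \<partial>Q h x) - gg x - lam * h * om x\<bar> \<le> \<epsilon> * h) (at_right 0)"
      by eventually_elim (use h0 h in auto)
  qed simp
  then show ?thesis using h0 by (intro exI[of _ h0]) (metis le_less)
qed

text \<open>One step of a time-discrete Feynman-Kac semigroup. By \<open>T_estimate\<close>,
  \<open>gg\<close> is a fixed point of it up to an error of smaller order than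
  \<open>h\<close>.\<close>

definition T where "T h x = (\<integral>y. exp (- (lam * h * exp (- y))) * gg y \<partial>Q h x)"

lemma damp_halfline: "(\<lambda>y. exp (- (lam * h * exp (- y))) * gg y) \<in> borel_measurable halfline"
  by (intro borel_measurable_times gg_halfline borel_halfline) measurable

lemma damp_integrable: "h > 0 \<Longrightarrow> x \<ge> 0 \<Longrightarrow> integrable (Q h x) (\<lambda>y. exp (- (lam * h * exp (- y))) * gg y)"
proof (rule Q_integrable[OF _ _ damp_halfline])
  assume h: "h > 0"
  fix y :: real assume y: "y \<ge> 0"
  have "exp (- (lam * h * exp (- y))) * gg y \<le> 1 * G" using gg[OF y] h lam by (intro mult_mono) auto
  then show "\<bar>exp (- (lam * h * exp (- y))) * gg y\<bar> \<le> G" using gg[OF y] by simp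
qed auto

lemma exp_neg_bounds: "u \<ge> 0 \<Longrightarrow> 1 - u \<le> exp (- u)" "u \<ge> 0 \<Longrightarrow> exp (- u) \<le> 1 - u + u\<^sup>2" for u :: real
proof -
  assume u: "u \<ge> 0"
  show "1 - u \<le> exp (- u)" using exp_ge_add_one_self[of "- u"] by simp
  have "1 \<le> 1 + u ^ 3" using u by simp
  also have "\<dots> = (1 + u) * (1 - u + u\<^sup>2)" by (simp add: algebra_simps power2_eq_square power3_eq_cube)
  finally have "1 / (1 + u) \<le> 1 - u + u\<^sup>2" using u by (simp add: divide_le_eq mult.commute)
  moreover have "exp (- u) \<le> 1 / (1 + u)"
    using exp_ge_add_one_self[of u] u by (simp add: exp_minus inverse_eq_divide divide_left_mono)
  ultimately show "exp (- u) \<le> 1 - u + u\<^sup>2" by linarith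
qed

text \<open>To first order the gain \<open>lam * h * om x\<close> from the generator cancels against
  the loss by discounting. Since \<open>gg \<ge> 1\<close>, the absolute error
  \<open>\<epsilon> * h\<close> is also a relative one, and relative errors can be iterated.\<close>

lemma T_estimate:
  assumes e: "\<epsilon> > 0"
  shows "\<exists>h0>0. \<forall>h. 0 < h \<and> h < h0 \<longrightarrow> (\<forall>x\<ge>0. (1 - \<epsilon> * h) * gg x \<le> T h x \<and> T h x \<le> (1 + \<epsilon> * h) * gg x)"
proof -
  have e3: "\<epsilon> / 3 > 0" "\<epsilon> / (3 * lam) > 0" using e lam by auto
  obtain a where a: "a > 0" "\<And>h x. 0 < h \<Longrightarrow> h < a \<Longrightarrow> x \<ge> 0 \<Longrightarrow> \<bar>(\<integral>y. gg y \<partial>Q h x) - gg x - lam * h * om x\<bar> \<le> \<epsilon> / 3 * h"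
    using gen_0[OF e3(1)] by blast
  obtain b where b: "b > 0" "\<And>h x. 0 < h \<Longrightarrow> h < b \<Longrightarrow> x \<ge> 0 \<Longrightarrow> \<bar>(\<integral>y. om y \<partial>Q h x) - om x\<bar> < \<epsilon> / (3 * lam)"
    using om_uniform[OF e3(2)] by blast
  \<comment> \<open>For \<open>h < d\<close> the quadratic remainder
    \<open>G * (lam * h)\<^sup>2\<close> is at most \<open>\<epsilon> / 3 * h\<close>.\<close>
  define d where "d = \<epsilon> / (3 * G * lam\<^sup>2)"
  have d: "d > 0" using e G_ge_1 lam by (simp add: d_def)
  have "(1 - \<epsilon> * h) * gg x \<le> T h x \<and> T h x \<le> (1 + \<epsilon> * h) * gg x"
    if h: "0 < h" "h < min a (min b d)" and x: "x \<ge> 0" for h x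
  proof -
    have h0: "h \<ge> 0" using h by simp
    interpret q: prob_space "Q h x" by (rule Q_prob(1)[OF h0 x])
    have sp: "y \<ge> 0" if "y \<in> space (Q h x)" for y using that Q_prob(3)[OF h0 x] by simp
    define A where "A = (\<integral>y. gg y \<partial>Q h x) - lam * h * (\<integral>y. om y \<partial>Q h x)"
    have int: "integrable (Q h x) (\<lambda>y. gg y - lam * h * om y)" "(\<integral>y. gg y - lam * h * om y \<partial>Q h x) = A"
      using gg_integrable[OF h0 x] om_integrable[OF h0 x] by (auto simp: A_def)
    have ptl: "gg y - lam * h * om y \<le> exp (- (lam * h * exp (- y))) * gg y"
      and ptu: "exp (- (lam * h * exp (- y))) * gg y \<le> gg y - lam * h * om y + G * (lam * h)\<^sup>2" if y: "y \<ge> 0" for y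
    proof -
      define u where "u = lam * h * exp (- y)"
      have u: "u \<ge> 0" "u \<le> lam * h" using lam h y by (auto simp: u_def mult_le_cancel_left1)
      have g0: "gg y \<ge> 0" using gg(1)[OF y] by simp
      have "(1 - u) * gg y \<le> exp (- u) * gg y" using exp_neg_bounds(1)[OF u(1)] g0 by (rule mult_right_mono)
      then show "gg y - lam * h * om y \<le> exp (- (lam * h * exp (- y))) * gg y"
        by (simp add: u_def om_def algebra_simps)
      have "exp (- u) * gg y \<le> (1 - u + u\<^sup>2) * gg y" using exp_neg_bounds(2)[OF u(1)] g0 by (rule mult_right_mono)
      moreover have "u\<^sup>2 * gg y \<le> (lam * h)\<^sup>2 * G" using u gg[OF y] g0 by (intro mult_mono power_mono) auto
      ultimately show "exp (- (lam * h * exp (- y))) * gg y \<le> gg y - lam * h * om y + G * (lam * h)\<^sup>2"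
        by (simp add: u_def om_def algebra_simps)
    qed
    have T1: "A \<le> T h x" unfolding T_def int(2)[symmetric]
      by (intro integral_mono int damp_integrable h(1) x ptl sp)
    have T2: "T h x \<le> A + G * (lam * h)\<^sup>2"
    proof -
      have "T h x \<le> (\<integral>y. gg y - lam * h * om y + G * (lam * h)\<^sup>2 \<partial>Q h x)" unfolding T_def
        by (intro integral_mono Bochner_Integration.integrable_add int q.integrable_const damp_integrable h(1) x ptu sp)
      also have "\<dots> = A + G * (lam * h)\<^sup>2"
        by (subst Bochner_Integration.integral_add) (auto simp: int q.prob_space)
      finally show ?thesis .
    qed
    have r1: "\<bar>(\<integral>y. gg y \<partial>Q h x) - gg x - lam * h * om x\<bar> \<le> \<epsilon> / 3 * h" using a h x by auto
    have r2: "lam * h * \<bar>(\<integral>y. om y \<partial>Q h x) - om x\<bar> \<le> \<epsilon> / 3 * h"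
    proof -
      have "lam * h * \<bar>(\<integral>y. om y \<partial>Q h x) - om x\<bar> \<le> lam * h * (\<epsilon> / (3 * lam))"
        using b(2)[of h x] h x lam by (intro mult_left_mono) auto
      also have "\<dots> = \<epsilon> / 3 * h" using lam by simp
      finally show ?thesis .
    qed
    have r3: "G * (lam * h)\<^sup>2 \<le> \<epsilon> / 3 * h"
    proof -
      have "G * (lam * h)\<^sup>2 = G * lam\<^sup>2 * h * h" by (simp add: power2_eq_square)
      also have "\<dots> \<le> G * lam\<^sup>2 * h * d" using h G_ge_1 lam by (intro mult_left_mono) auto
      also have "\<dots> = \<epsilon> / 3 * h" using G_ge_1 lam by (simp add: d_def)
      finally show ?thesis .
    qed
    have "\<bar>A - gg x\<bar> \<le> 2 * (\<epsilon> / 3 * h)"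
    proof -
      have "A - gg x = ((\<integral>y. gg y \<partial>Q h x) - gg x - lam * h * om x) - lam * h * ((\<integral>y. om y \<partial>Q h x) - om x)"
        by (simp add: A_def algebra_simps)
      moreover have "\<bar>lam * h * ((\<integral>y. om y \<partial>Q h x) - om x)\<bar> = lam * h * \<bar>(\<integral>y. om y \<partial>Q h x) - om x\<bar>"
        using lam h by (simp add: abs_mult)
      ultimately show ?thesis using r1 r2 by linarith
    qed
    then have "\<bar>T h x - gg x\<bar> \<le> \<epsilon> * h" using T1 T2 r3 by linarith
    moreover have "\<epsilon> * h * 1 \<le> \<epsilon> * h * gg x" using gg(1)[OF x] e h by (intro mult_left_mono) auto
    ultimately show ?thesis by (simp add: algebra_simps abs_le_iff)
  qed
  then show ?thesis using a(1) b(1) d by (intro exI[of _ "min a (min b d)"]) auto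
qed

text \<open>Right endpoints \<open>Suc k\<close> are used so that the last factor depends on the
  position over which \<open>T h\<close> integrates; the others are known one step earlier.\<close>

definition discount where "discount h n \<omega> = (\<Prod>k<n. exp (- (lam * h * exp (- U (real (Suc k) * h) \<omega>))))"

lemma discount_bounds: "0 \<le> discount h n \<omega>" "h > 0 \<Longrightarrow> discount h n \<omega> \<le> 1"
  unfolding discount_def using lam by (auto intro!: prod_nonneg prod_le_1)

lemma discount_meas:
  assumes h: "h > 0" shows "discount h n \<in> borel_measurable (natural_filtration N0 U (real n * h))"
proof -
  have "U (real (Suc k) * h) \<in> borel_measurable (natural_filtration N0 U (real n * h))" if "k < n" for k
  proof (rule measurable_natural_filtration)
    have "real (Suc k) \<le> real n" using that by simp
    then show "real (Suc k) * h \<le> real n * h" using h by (intro mult_right_mono) auto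
  qed (use h in \<open>auto intro: U_meas\<close>)
  then show ?thesis unfolding discount_def
    by (intro borel_measurable_prod borel_measurable_exp[THEN measurable_compose[rotated]] borel_measurable_uminus borel_measurable_times borel_measurable_const) auto
qed

definition E where "E h n = (\<integral>\<^sup>+\<omega>. ennreal (discount h n \<omega>) * ennreal (gg (U (real n * h) \<omega>)) \<partial>N0)"

lemma E_0: "E h 0 = 1"
proof -
  have "E h 0 = (\<integral>\<^sup>+\<omega>. 1 \<partial>N0)" unfolding E_def
    by (rule nn_integral_cong_AE) (use start in \<open>auto simp: discount_def gg_0 elim!: eventually_mono\<close>)
  then show ?thesis by (simp add: emeasure_space_1)
qed

lemma E_Suc:
  assumes h: "h > 0"
  shows "E h (Suc n) = (\<integral>\<^sup>+\<omega>. ennreal (discount h n \<omega>) * ennreal (T h (U (real n * h) \<omega>)) \<partial>N0)"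
proof -
  have h0: "h \<ge> 0" and nh: "real n * h \<ge> 0" using h by auto
  have e: "real (Suc n) * h = real n * h + h" by (simp add: algebra_simps)
  have "E h (Suc n) = (\<integral>\<^sup>+\<omega>. ennreal (discount h n \<omega>) * (\<lambda>y. ennreal (exp (- (lam * h * exp (- y))) * gg y)) (U (real n * h + h) \<omega>) \<partial>N0)"
    unfolding E_def
  proof (intro nn_integral_cong)
    fix \<omega> assume w: "\<omega> \<in> space N0"
    have "gg (U (real n * h + h) \<omega>) \<ge> 0" using gg(1)[OF U_nonneg[OF _ w], of "real n * h + h"] h nh by simp
    moreover have "discount h (Suc n) \<omega> = discount h n \<omega> * exp (- (lam * h * exp (- U (real n * h + h) \<omega>)))"
      unfolding discount_def by (simp only: prod.lessThan_Suc e)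
    ultimately show "ennreal (discount h (Suc n) \<omega>) * ennreal (gg (U (real (Suc n) * h) \<omega>))
      = ennreal (discount h n \<omega>) * (\<lambda>y. ennreal (exp (- (lam * h * exp (- y))) * gg y)) (U (real n * h + h) \<omega>)"
      unfolding e by (simp add: ennreal_mult discount_bounds mult.assoc)
  qed
  also have "\<dots> = (\<integral>\<^sup>+\<omega>. ennreal (discount h n \<omega>) * (\<integral>\<^sup>+y. ennreal (exp (- (lam * h * exp (- y))) * gg y) \<partial>Q h (U (real n * h) \<omega>)) \<partial>N0)"
    by (intro markov_nn nh h0 discount_meas h discount_bounds measurable_compose[OF damp_halfline measurable_ennreal])
  also have "\<dots> = (\<integral>\<^sup>+\<omega>. ennreal (discount h n \<omega>) * ennreal (T h (U (real n * h) \<omega>)) \<partial>N0)"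
  proof (intro nn_integral_cong)
    fix \<omega> assume w: "\<omega> \<in> space N0"
    have x: "U (real n * h) \<omega> \<ge> 0" by (rule U_nonneg[OF nh w])
    have "(\<integral>\<^sup>+y. ennreal (exp (- (lam * h * exp (- y))) * gg y) \<partial>Q h (U (real n * h) \<omega>)) = ennreal (T h (U (real n * h) \<omega>))"
      unfolding T_def
    proof (rule nn_integral_eq_integral[OF damp_integrable[OF h x]], rule AE_I2)
      fix y assume "y \<in> space (Q h (U (real n * h) \<omega>))"
      then have "y \<ge> 0" using Q_prob(3)[OF h0 x] by simp
      then show "0 \<le> exp (- (lam * h * exp (- y))) * gg y" using gg(1)[of y] by simp
    qed
    then show "ennreal (discount h n \<omega>) * (\<integral>\<^sup>+y. ennreal (exp (- (lam * h * exp (- y))) * gg y) \<partial>Q h (U (real n * h) \<omega>))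
      = ennreal (discount h n \<omega>) * ennreal (T h (U (real n * h) \<omega>))" by simp
  qed
  finally show ?thesis .
qed

lemma gg_U_meas: "t \<ge> 0 \<Longrightarrow> (\<lambda>\<omega>. gg (U t \<omega>)) \<in> borel_measurable N0"
  by (rule measurable_compose[OF U_halfline gg_halfline])

lemma discount_meas': "h > 0 \<Longrightarrow> discount h n \<in> borel_measurable N0"
  by (rule measurable_from_subalg[OF subalgebra_natural_filtration discount_meas]) (auto intro: U_meas)

lemma E_bounds:
  assumes h: "h > 0" and e: "0 \<le> \<epsilon>" "\<epsilon> * h \<le> 1"
    and T: "\<And>x. x \<ge> 0 \<Longrightarrow> (1 - \<epsilon> * h) * gg x \<le> T h x" "\<And>x. x \<ge> 0 \<Longrightarrow> T h x \<le> (1 + \<epsilon> * h) * gg x"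
  shows "ennreal ((1 - \<epsilon> * h) ^ n) \<le> E h n" "E h n \<le> ennreal ((1 + \<epsilon> * h) ^ n)"
proof (induction n)
  case 0
  show "ennreal ((1 - \<epsilon> * h) ^ 0) \<le> E h 0" "E h 0 \<le> ennreal ((1 + \<epsilon> * h) ^ 0)" by (simp_all add: E_0)
next
  case (Suc n)
  have nh: "real n * h \<ge> 0" using h by simp
  note gg_U_meas[OF nh, measurable] discount_meas'[OF h, measurable]
  have gp: "gg (U (real n * h) \<omega>) \<ge> 0" if "\<omega> \<in> space N0" for \<omega> using gg(1)[OF U_nonneg[OF nh that]] by simp
  have cE: "ennreal c * E h n = (\<integral>\<^sup>+\<omega>. ennreal (discount h n \<omega>) * ennreal (c * gg (U (real n * h) \<omega>)) \<partial>N0)" if "c \<ge> 0" for c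
  proof -
    have "(\<integral>\<^sup>+\<omega>. ennreal (discount h n \<omega>) * ennreal (c * gg (U (real n * h) \<omega>)) \<partial>N0)
      = (\<integral>\<^sup>+\<omega>. ennreal c * (ennreal (discount h n \<omega>) * ennreal (gg (U (real n * h) \<omega>))) \<partial>N0)"
      by (intro nn_integral_cong) (simp add: ennreal_mult that gp mult.left_commute)
    also have "\<dots> = ennreal c * E h n" unfolding E_def by (rule nn_integral_cmult) measurable
    finally show ?thesis by simp
  qed
  have "ennreal ((1 - \<epsilon> * h) ^ Suc n) = ennreal (1 - \<epsilon> * h) * ennreal ((1 - \<epsilon> * h) ^ n)"
    using e by (simp add: ennreal_mult)
  also have "\<dots> \<le> ennreal (1 - \<epsilon> * h) * E h n" by (intro mult_left_mono Suc) simp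
  also have "\<dots> \<le> E h (Suc n)"
    using e by (subst cE) (auto simp: E_Suc[OF h] intro!: nn_integral_mono mult_left_mono ennreal_leI T U_nonneg nh)
  finally show "ennreal ((1 - \<epsilon> * h) ^ Suc n) \<le> E h (Suc n)" .
  have eh: "0 \<le> \<epsilon> * h" using e h by simp
  have "E h (Suc n) \<le> ennreal (1 + \<epsilon> * h) * E h n"
    using eh by (subst cE) (auto simp: E_Suc[OF h] intro!: nn_integral_mono mult_left_mono ennreal_leI T U_nonneg nh)
  also have "\<dots> \<le> ennreal (1 + \<epsilon> * h) * ennreal ((1 + \<epsilon> * h) ^ n)" by (intro mult_left_mono Suc) simp
  also have "\<dots> = ennreal ((1 + \<epsilon> * h) ^ Suc n)" using eh by (simp add: ennreal_mult)
  finally show "E h (Suc n) \<le> ennreal ((1 + \<epsilon> * h) ^ Suc n)" .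
qed

text \<open>With \<open>n\<close> steps of length \<open>t / n\<close> the relative errors of the
  single steps compound to a factor between \<open>1 - \<epsilon> * t\<close> and
  \<open>exp (\<epsilon> * t)\<close>, and \<epsilon> is arbitrary.\<close>

lemma E_limit:
  assumes t: "t > 0"
  shows "(\<lambda>n. E (t / real (Suc n)) (Suc n)) \<longlonglongrightarrow> 1"
proof -
  have bds: "eventually (\<lambda>n. ennreal (1 - \<epsilon> * t) \<le> E (t / real (Suc n)) (Suc n) \<and> E (t / real (Suc n)) (Suc n) \<le> ennreal (exp (\<epsilon> * t))) sequentially"
    if e: "\<epsilon> > 0" for \<epsilon>
  proof -
    obtain h0 where h0: "h0 > 0" "\<And>h x. 0 < h \<Longrightarrow> h < h0 \<Longrightarrow> x \<ge> 0 \<Longrightarrow> (1 - \<epsilon> * h) * gg x \<le> T h x \<and> T h x \<le> (1 + \<epsilon> * h) * gg x"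
      using T_estimate[OF e] by blast
    have "(\<lambda>n. t * (1 / real (Suc n))) \<longlonglongrightarrow> t * 0"
      by (intro tendsto_intros LIMSEQ_inverse_real_of_nat[unfolded inverse_eq_divide])
    \<comment> \<open>The bound \<open>1 / \<epsilon>\<close> keeps
      \<open>1 - \<epsilon> * h\<close> nonnegative, as needed for iterating the lower
      estimate.\<close>
    then have "eventually (\<lambda>n. t * (1 / real (Suc n)) < min h0 (1 / \<epsilon>)) sequentially"
      by (rule order_tendstoD(2)) (use h0 e in auto)
    then show ?thesis
    proof eventually_elim
      case (elim n)
      define h where "h = t / real (Suc n)"
      have h: "h > 0" "h < h0" "\<epsilon> * h \<le> 1" using elim t e by (auto simp: h_def field_simps)
      have nh: "real (Suc n) * h = t" by (simp add: h_def)
      have b: "ennreal ((1 - \<epsilon> * h) ^ Suc n) \<le> E h (Suc n)" "E h (Suc n) \<le> ennreal ((1 + \<epsilon> * h) ^ Suc n)"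
        using E_bounds[of h \<epsilon> "Suc n"] h h0(2) e by (auto simp: less_imp_le)
      have "1 + real (Suc n) * (- (\<epsilon> * h)) \<le> (1 + - (\<epsilon> * h)) ^ Suc n"
        by (rule Bernoulli_inequality) (use h in simp)
      moreover have "real (Suc n) * (- (\<epsilon> * h)) = - (\<epsilon> * t)" using nh by (metis mult.commute mult.left_commute mult_minus_right)
      ultimately have "1 + - (\<epsilon> * t) \<le> (1 + - (\<epsilon> * h)) ^ Suc n" by (simp only:)
      then have 1: "1 - \<epsilon> * t \<le> (1 - \<epsilon> * h) ^ Suc n" by (simp only: add_uminus_conv_diff)
      have "(1 + \<epsilon> * h) ^ Suc n \<le> exp (\<epsilon> * h) ^ Suc n"
        using e h by (intro power_mono exp_ge_add_one_self) auto
      also have "\<dots> = exp (real (Suc n) * (\<epsilon> * h))" by (rule exp_of_nat_mult[symmetric])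
      also have "real (Suc n) * (\<epsilon> * h) = \<epsilon> * t" using nh by (metis mult.commute mult.left_commute)
      finally have 2: "(1 + \<epsilon> * h) ^ Suc n \<le> exp (\<epsilon> * t)" .
      show ?case unfolding h_def[symmetric] using b ennreal_leI[OF 1] ennreal_leI[OF 2] by (meson order_trans)
    qed
  qed
  show ?thesis
  proof (rule order_tendstoI)
    fix a :: ennreal assume a: "a < 1"
    obtain r where r: "a = ennreal r" "r \<ge> 0" using a by (cases a) auto
    have r1: "r < 1" using a r by (simp add: ennreal_less_iff[OF r(2), of 1, simplified])
    define \<epsilon> where "\<epsilon> = (1 - r) / (2 * t)"
    have e: "\<epsilon> > 0" "1 - \<epsilon> * t > r" using r1 t by (auto simp: \<epsilon>_def field_simps)
    show "eventually (\<lambda>n. a < E (t / real (Suc n)) (Suc n)) sequentially"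
      using bds[OF e(1)]
    proof eventually_elim
      case (elim n)
      have "a < ennreal (1 - \<epsilon> * t)" using e r by (simp add: ennreal_less_iff)
      then show ?case using elim by (auto intro: less_le_trans)
    qed
  next
    fix a :: ennreal assume a: "1 < a"
    show "eventually (\<lambda>n. E (t / real (Suc n)) (Suc n) < a) sequentially"
    proof (cases "a = \<top>")
      case True
      show ?thesis using bds[of 1, simplified] by eventually_elim (auto simp: True intro: le_less_trans)
    next
      case False
      then obtain r where r: "a = ennreal r" "r \<ge> 0" by (cases a) auto
      have r1: "r > 1" using a r by (simp add: ennreal_less_iff[of 1 r, simplified])
      define \<epsilon> where "\<epsilon> = ln r / (2 * t)"
      have e: "\<epsilon> > 0" using r1 t by (simp add: \<epsilon>_def)
      have "exp (\<epsilon> * t) < exp (ln r)" using r1 t by (subst exp_less_cancel_iff) (simp add: \<epsilon>_def)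
      then have er: "exp (\<epsilon> * t) < r" using r1 by simp
      show ?thesis using bds[OF e]
      proof eventually_elim
        case (elim n)
        have "ennreal (exp (\<epsilon> * t)) < a" using er r by (simp add: ennreal_less_iff)
        then show ?case using elim by (auto intro: le_less_trans)
      qed
    qed
  qed
qed

definition clock where "clock t \<omega> = (LINT s|lborel. indicator {0..<t} s * exp (- U (max 0 s) \<omega>))"

lemma discount_limit:
  assumes t: "t > 0" and w: "\<omega> \<in> space N0"
  shows "(\<lambda>n. discount (t / real (Suc n)) (Suc n) \<omega>) \<longlonglongrightarrow> exp (- lam * clock t \<omega>)"
proof -
  define u where "u s = exp (- U (max 0 s) \<omega>)" for s
  have "(\<lambda>n. \<Sum>k<Suc n. (t / real (Suc n)) * u (real (Suc k) * (t / real (Suc n)))) \<longlonglongrightarrow> (LINT s|lborel. indicator {0..<t} s * u (max 0 s))"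
  proof (rule riemann_right_limit[OF t])
    show "(\<lambda>s. u (max 0 s)) \<in> borel_measurable borel"
      using U_section_meas[OF w] unfolding u_def by simp
    show "\<bar>u s\<bar> \<le> 1" for s using U_nonneg[OF _ w, of "max 0 s"] by (simp add: u_def)
    show "(u \<longlongrightarrow> u s) (at_right s)" if s: "s \<ge> 0" for s
    proof -
      have "((\<lambda>r. exp (- U r \<omega>)) \<longlongrightarrow> exp (- U s \<omega>)) (at_right s)"
        by (intro tendsto_intros cadlag_tendsto_right[OF U_cadlag[OF w] s])
      moreover have "eventually (\<lambda>r. exp (- U r \<omega>) = u r) (at_right s)"
        using eventually_at_right_less[of s] by eventually_elim (use s in \<open>simp add: u_def\<close>)
      ultimately have "(u \<longlongrightarrow> exp (- U s \<omega>)) (at_right s)" by (rule Lim_transform_eventually)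
      then show ?thesis using s by (simp add: u_def)
    qed
  qed
  then have "(\<lambda>n. exp (- lam * (\<Sum>k<Suc n. (t / real (Suc n)) * u (real (Suc k) * (t / real (Suc n)))))) \<longlonglongrightarrow> exp (- lam * clock t \<omega>)"
    unfolding clock_def u_def by (intro tendsto_intros) simp
  moreover have "exp (- lam * (\<Sum>k<Suc n. (t / real (Suc n)) * u (real (Suc k) * (t / real (Suc n))))) = discount (t / real (Suc n)) (Suc n) \<omega>" for n
  proof -
    have "u (real (Suc k) * (t / real (Suc n))) = exp (- U (real (Suc k) * (t / real (Suc n))) \<omega>)" for k
      using t by (simp add: u_def)
    then show ?thesis unfolding discount_def
      by (simp only: sum_distrib_left exp_sum[OF finite_lessThan] mult_minus_left mult.assoc sum_negf[symmetric])
  qed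
  ultimately show ?thesis by simp
qed

theorem feynman_kac:
  assumes t: "t > 0"
  shows "(\<integral>\<^sup>+\<omega>. ennreal (exp (- lam * clock t \<omega>) * gg (U t \<omega>)) \<partial>N0) = 1"
    and "(\<lambda>\<omega>. exp (- lam * clock t \<omega>)) \<in> borel_measurable N0"
proof -
  have t0: "t \<ge> 0" using t by simp
  note gg_U_meas[OF t0, measurable]
  have hp: "t / real (Suc n) > 0" for n using t by simp
  note discount_meas'[OF hp, measurable]
  have e: "real (Suc n) * (t / real (Suc n)) = t" for n by simp
  show m [measurable]: "(\<lambda>\<omega>. exp (- lam * clock t \<omega>)) \<in> borel_measurable N0"
    by (rule borel_measurable_LIMSEQ_real[OF discount_limit[OF t]]) measurable
  have "(\<lambda>n. E (t / real (Suc n)) (Suc n)) \<longlonglongrightarrow> (\<integral>\<^sup>+\<omega>. ennreal (exp (- lam * clock t \<omega>) * gg (U t \<omega>)) \<partial>N0)"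
    unfolding E_def e
  proof (rule nn_integral_dominated_convergence[where w = "\<lambda>_. ennreal G"])
    show "AE \<omega> in N0. ennreal (discount (t / real (Suc n)) (Suc n) \<omega>) * ennreal (gg (U t \<omega>)) \<le> ennreal G" for n
    proof (rule AE_I2)
      fix \<omega> assume w: "\<omega> \<in> space N0"
      have "discount (t / real (Suc n)) (Suc n) \<omega> * gg (U t \<omega>) \<le> 1 * G"
        using gg[OF U_nonneg[OF t0 w]] discount_bounds(2)[OF hp] by (intro mult_mono) auto
      then show "ennreal (discount (t / real (Suc n)) (Suc n) \<omega>) * ennreal (gg (U t \<omega>)) \<le> ennreal G"
        using gg(1)[OF U_nonneg[OF t0 w]] by (simp add: ennreal_mult[symmetric] discount_bounds ennreal_leI)
    qed
    show "AE \<omega> in N0. (\<lambda>n. ennreal (discount (t / real (Suc n)) (Suc n) \<omega>) * ennreal (gg (U t \<omega>))) \<longlonglongrightarrow> ennreal (exp (- lam * clock t \<omega>) * gg (U t \<omega>))"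
    proof (rule AE_I2)
      fix \<omega> assume w: "\<omega> \<in> space N0"
      have "(\<lambda>n. ennreal (discount (t / real (Suc n)) (Suc n) \<omega> * gg (U t \<omega>))) \<longlonglongrightarrow> ennreal (exp (- lam * clock t \<omega>) * gg (U t \<omega>))"
        by (intro tendsto_ennrealI tendsto_mult tendsto_const discount_limit t w)
      moreover have "ennreal (discount h n \<omega> * gg (U t \<omega>)) = ennreal (discount h n \<omega>) * ennreal (gg (U t \<omega>))" for h n
        using gg(1)[OF U_nonneg[OF t0 w]] by (intro ennreal_mult discount_bounds) auto
      ultimately show "(\<lambda>n. ennreal (discount (t / real (Suc n)) (Suc n) \<omega>) * ennreal (gg (U t \<omega>))) \<longlonglongrightarrow> ennreal (exp (- lam * clock t \<omega>) * gg (U t \<omega>))"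
        by simp
    qed
    show "(\<integral>\<^sup>+\<omega>. ennreal G \<partial>N0) < \<infinity>" by (simp add: emeasure_space_1)
  qed measurable
  then show "(\<integral>\<^sup>+\<omega>. ennreal (exp (- lam * clock t \<omega>) * gg (U t \<omega>)) \<partial>N0) = 1"
    using E_limit[OF t] by (rule LIMSEQ_unique)
qed

section \<open>From finite time horizons to the full exponential functional\<close>

lemma exp_U_section [measurable]: "\<omega> \<in> space N0 \<Longrightarrow> (\<lambda>s. exp (- U (max 0 s) \<omega>)) \<in> borel_measurable borel"
  using U_section_meas[of \<omega>] by measurable

lemma clock_nn:
  assumes w: "\<omega> \<in> space N0"
  shows "ennreal (clock t \<omega>) = (\<integral>\<^sup>+s. indicator {0..<t} s * ennreal (exp (- U (max 0 s) \<omega>)) \<partial>lborel)" "clock t \<omega> \<ge> 0"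
proof -
  note exp_U_section[OF w, measurable]
  have i: "integrable lborel (\<lambda>s. indicator {0..<t} s * exp (- U (max 0 s) \<omega>))"
  proof (rule Bochner_Integration.integrable_bound[where f = "indicator {0..<max 0 t} :: real \<Rightarrow> real"])
    show "integrable lborel (indicator {0..<max 0 t} :: real \<Rightarrow> real)" by (intro integrable_real_indicator) auto
    show "AE s in lborel. norm (indicator {0..<t} s * exp (- U (max 0 s) \<omega>)) \<le> norm (indicator {0..<max 0 t} s :: real)"
      using U_nonneg[OF _ w] by (auto simp: indicator_def)
  qed measurable
  show "ennreal (clock t \<omega>) = (\<integral>\<^sup>+s. indicator {0..<t} s * ennreal (exp (- U (max 0 s) \<omega>)) \<partial>lborel)"
    unfolding clock_def by (subst nn_integral_eq_integral[OF i, symmetric]) (auto intro!: nn_integral_cong simp: indicator_def)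
  show "clock t \<omega> \<ge> 0" unfolding clock_def by (intro Bochner_Integration.integral_nonneg) auto
qed

lemma clock_le_Iexp: "\<omega> \<in> space N0 \<Longrightarrow> ennreal (clock t \<omega>) \<le> Iexp \<omega>"
  unfolding clock_nn(1) Iexp_eq by (intro nn_integral_mono) (auto simp: indicator_def)

lemma clock_lim:
  assumes w: "\<omega> \<in> space N0"
  shows "(\<lambda>n. ennreal (clock (real n) \<omega>)) \<longlonglongrightarrow> Iexp \<omega>"
  unfolding clock_nn(1)[OF w] Iexp_eq
proof (rule nn_integral_LIMSEQ)
  note exp_U_section[OF w, measurable]
  show "incseq (\<lambda>n s. indicator {0..<real n} s * ennreal (exp (- U (max 0 s) \<omega>)))"
    by (auto simp: incseq_def le_fun_def indicator_def)
  show "(\<lambda>s. indicator {0..<real n} s * ennreal (exp (- U (max 0 s) \<omega>))) \<in> borel_measurable lborel" for n by measurable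
  fix s :: real
  obtain m :: nat where m: "s < real m" using reals_Archimedean2 by blast
  have "eventually (\<lambda>n. indicator {0..<real n} s * ennreal (exp (- U (max 0 s) \<omega>)) = indicator {0..} s * ennreal (exp (- U (max 0 s) \<omega>))) sequentially"
    using eventually_ge_at_top[of m] by eventually_elim (use m in \<open>auto simp: indicator_def\<close>)
  then show "(\<lambda>n. indicator {0..<real n} s * ennreal (exp (- U (max 0 s) \<omega>))) \<longlonglongrightarrow> indicator {0..} s * ennreal (exp (- U (max 0 s) \<omega>))"
    by (rule tendsto_eventually)
qed

definition weight where "weight \<omega> = (if Iexp \<omega> = \<infinity> then 0 else exp (- lam * enn2real (Iexp \<omega>)))"

lemma weight_meas [measurable]: "weight \<in> borel_measurable N0"
  unfolding weight_def[abs_def] by measurable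

lemma weight_bounds: "0 \<le> weight \<omega>" "weight \<omega> \<le> 1"
  using lam by (auto simp: weight_def)

lemma weight_le: "\<omega> \<in> space N0 \<Longrightarrow> weight \<omega> \<le> exp (- lam * clock t \<omega>)"
proof (cases "Iexp \<omega> = \<infinity>")
  case False
  assume w: "\<omega> \<in> space N0"
  have "clock t \<omega> \<le> enn2real (Iexp \<omega>)"
    using enn2real_mono[OF clock_le_Iexp[OF w, of t]] False clock_nn(2)[OF w, of t] by (simp add: less_top)
  then show ?thesis using lam False by (simp add: weight_def)
qed (simp add: weight_def)

lemma weight_lim:
  assumes w: "\<omega> \<in> space N0"
  shows "(\<lambda>n. exp (- lam * clock (real n) \<omega>)) \<longlonglongrightarrow> weight \<omega>"
proof (cases "Iexp \<omega> = \<infinity>")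
  case True
  have "(\<lambda>n. ennreal (clock (real n) \<omega>)) \<longlonglongrightarrow> \<infinity>" using clock_lim[OF w] True by simp
  then have "filterlim (\<lambda>n. clock (real n) \<omega>) at_top sequentially"
    by (simp add: ennreal_tendsto_top_eq_at_top[symmetric])
  then have "filterlim (\<lambda>n. lam * clock (real n) \<omega>) at_top sequentially"
    using lam by (intro filterlim_tendsto_pos_mult_at_top[OF tendsto_const])
  then have "filterlim (\<lambda>n. - (lam * clock (real n) \<omega>)) at_bot sequentially"
    by (simp add: filterlim_uminus_at_bot)
  then have "(\<lambda>n. exp (- (lam * clock (real n) \<omega>))) \<longlonglongrightarrow> 0" by (rule filterlim_compose[OF exp_at_bot])
  then show ?thesis using True by (simp add: weight_def)
next
  case False
  then have "Iexp \<omega> = ennreal (enn2real (Iexp \<omega>))" by (simp add: less_top)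
  then have "(\<lambda>n. ennreal (clock (real n) \<omega>)) \<longlonglongrightarrow> ennreal (enn2real (Iexp \<omega>))" using clock_lim[OF w] by simp
  then have "(\<lambda>n. clock (real n) \<omega>) \<longlonglongrightarrow> enn2real (Iexp \<omega>)"
    by (rule tendsto_ennrealD) (auto simp: clock_nn(2)[OF w])
  then have "(\<lambda>n. exp (- lam * clock (real n) \<omega>)) \<longlonglongrightarrow> exp (- lam * enn2real (Iexp \<omega>))" by (intro tendsto_intros)
  then show ?thesis using False by (simp add: weight_def)
qed

lemma laplace_weight: "laplace_transform_at N0 Iexp lam = (\<integral>\<omega>. weight \<omega> \<partial>N0)"
  by (simp add: laplace_transform_at_def weight_def)

text \<open>Bounding \<open>gg\<close> by \<open>G\<close> in the Feynman-Kac formula gives the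
  estimate at each finite time; dominated convergence carries it to infinity.\<close>

lemma laplace_lower: "laplace_transform_at N0 Iexp lam \<ge> 1 / G"
proof -
  have step: "(\<integral>\<omega>. exp (- lam * clock (real (Suc n)) \<omega>) \<partial>N0) \<ge> 1 / G" for n
  proof -
    have t: "real (Suc n) > 0" by simp
    note feynman_kac(2)[OF t, measurable]
    have i: "integrable N0 (\<lambda>\<omega>. exp (- lam * clock (real (Suc n)) \<omega>))"
    proof (rule integrable_const_bound[where B = 1])
      show "AE \<omega> in N0. norm (exp (- lam * clock (real (Suc n)) \<omega>)) \<le> 1"
      proof (rule AE_I2)
        fix \<omega> assume "\<omega> \<in> space N0"
        then show "norm (exp (- lam * clock (real (Suc n)) \<omega>)) \<le> 1"
          using lam clock_nn(2)[of \<omega> "real (Suc n)"] by simp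
      qed
    qed measurable
    have "1 = (\<integral>\<^sup>+\<omega>. ennreal (exp (- lam * clock (real (Suc n)) \<omega>) * gg (U (real (Suc n)) \<omega>)) \<partial>N0)"
      using feynman_kac(1)[OF t] by simp
    also have "\<dots> \<le> (\<integral>\<^sup>+\<omega>. ennreal (exp (- lam * clock (real (Suc n)) \<omega>) * G) \<partial>N0)"
      by (intro nn_integral_mono ennreal_leI mult_left_mono gg U_nonneg) auto
    also have "\<dots> = ennreal (\<integral>\<omega>. exp (- lam * clock (real (Suc n)) \<omega>) * G \<partial>N0)"
      using i G_ge_1 by (intro nn_integral_eq_integral) auto
    also have "(\<integral>\<omega>. exp (- lam * clock (real (Suc n)) \<omega>) * G \<partial>N0) = (\<integral>\<omega>. exp (- lam * clock (real (Suc n)) \<omega>) \<partial>N0) * G" by simp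
    finally have "ennreal 1 \<le> ennreal ((\<integral>\<omega>. exp (- lam * clock (real (Suc n)) \<omega>) \<partial>N0) * G)" by simp
    then have "1 \<le> (\<integral>\<omega>. exp (- lam * clock (real (Suc n)) \<omega>) \<partial>N0) * G"
      using ennreal_le_iff2[of 1] by (metis not_one_le_zero)
    then show ?thesis using G_ge_1 by (simp add: divide_le_eq)
  qed
  have "(\<lambda>n. \<integral>\<omega>. exp (- lam * clock (real (Suc n)) \<omega>) \<partial>N0) \<longlonglongrightarrow> (\<integral>\<omega>. weight \<omega> \<partial>N0)"
  proof (rule integral_dominated_convergence[where w = "\<lambda>_. 1"])
    show "(\<lambda>\<omega>. exp (- lam * clock (real (Suc n)) \<omega>)) \<in> borel_measurable N0" for n by (rule feynman_kac(2)) simp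
    show "AE \<omega> in N0. (\<lambda>n. exp (- lam * clock (real (Suc n)) \<omega>)) \<longlonglongrightarrow> weight \<omega>"
      by (intro AE_I2 LIMSEQ_Suc weight_lim)
    show "AE \<omega> in N0. norm (exp (- lam * clock (real (Suc n)) \<omega>)) \<le> 1" for n
    proof (rule AE_I2)
      fix \<omega> assume "\<omega> \<in> space N0"
      then show "norm (exp (- lam * clock (real (Suc n)) \<omega>)) \<le> 1"
        using lam clock_nn(2)[of \<omega> "real (Suc n)"] by simp
    qed
  qed (auto intro: weight_meas)
  then have "1 / G \<le> (\<integral>\<omega>. weight \<omega> \<partial>N0)" by (rule LIMSEQ_le_const) (use step in blast)
  then show ?thesis by (simp add: laplace_weight)
qed

text \<open>When the functional is finite, the process spends an asymptotically full proportion of its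
  time above any level; averaging over time therefore avoids a proof that it tends to infinity.\<close>
lemma laplace_upper:
  assumes \<theta>: "\<theta> > 0" and R0: "\<And>y. y \<ge> R \<Longrightarrow> y \<ge> 0 \<Longrightarrow> gg y \<ge> \<theta>"
  shows "\<theta> * laplace_transform_at N0 Iexp lam \<le> 1"
proof -
  interpret PS: pair_sigma_finite N0 lborel ..
  define m where "m T \<omega> = (\<integral>\<^sup>+s. indicator {0<..<T} s * indicator {R..} (U (max 0 s) \<omega>) \<partial>lborel)" for T \<omega>
  define J where "J \<omega> = enn2real (Iexp \<omega>)" for \<omega>
  have one: "(\<integral>\<^sup>+\<omega>. ennreal (\<theta> * weight \<omega>) * indicator {R..} (U t \<omega>) \<partial>N0) \<le> 1" if t: "t > 0" for t
  proof -
    have t0: "t \<ge> 0" using t by simp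
    have "(\<integral>\<^sup>+\<omega>. ennreal (\<theta> * weight \<omega>) * indicator {R..} (U t \<omega>) \<partial>N0) \<le> (\<integral>\<^sup>+\<omega>. ennreal (exp (- lam * clock t \<omega>) * gg (U t \<omega>)) \<partial>N0)"
    proof (intro nn_integral_mono)
      fix \<omega> assume w: "\<omega> \<in> space N0"
      show "ennreal (\<theta> * weight \<omega>) * indicator {R..} (U t \<omega>) \<le> ennreal (exp (- lam * clock t \<omega>) * gg (U t \<omega>))"
      proof (cases "U t \<omega> \<ge> R")
        case True
        have "weight \<omega> * \<theta> \<le> exp (- lam * clock t \<omega>) * gg (U t \<omega>)"
          using \<theta> weight_bounds by (intro mult_mono weight_le w R0 True U_nonneg t0) auto
        then show ?thesis using True by (simp add: ennreal_leI mult.commute)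
      qed simp
    qed
    then show ?thesis using feynman_kac(1)[OF t] by simp
  qed
  have mT: "(\<integral>\<^sup>+\<omega>. ennreal (\<theta> * weight \<omega>) * m T \<omega> \<partial>N0) \<le> ennreal T" if T: "T > 0" for T
  proof -
    have meas: "(\<lambda>(\<omega>, s). ennreal (\<theta> * weight \<omega>) * (indicator {0<..<T} s * indicator {R..} (U (max 0 s) \<omega>))) \<in> borel_measurable (N0 \<Otimes>\<^sub>M lborel)"
      unfolding split_beta' by measurable
    have "(\<integral>\<^sup>+\<omega>. ennreal (\<theta> * weight \<omega>) * m T \<omega> \<partial>N0) = (\<integral>\<^sup>+\<omega>. \<integral>\<^sup>+s. ennreal (\<theta> * weight \<omega>) * (indicator {0<..<T} s * indicator {R..} (U (max 0 s) \<omega>)) \<partial>lborel \<partial>N0)"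
      unfolding m_def
    proof (intro nn_integral_cong nn_integral_cmult[symmetric])
      fix \<omega> assume "\<omega> \<in> space N0"
      note U_section_meas[OF this, measurable]
      show "(\<lambda>s. indicator {0<..<T} s * indicator {R..} (U (max 0 s) \<omega>) :: ennreal) \<in> borel_measurable lborel" by measurable
    qed
    also have "\<dots> = (\<integral>\<^sup>+s. \<integral>\<^sup>+\<omega>. ennreal (\<theta> * weight \<omega>) * (indicator {0<..<T} s * indicator {R..} (U (max 0 s) \<omega>)) \<partial>N0 \<partial>lborel)"
      by (rule PS.Fubini'[OF meas, symmetric])
    also have "\<dots> \<le> (\<integral>\<^sup>+s. indicator {0<..<T} s \<partial>lborel)"
    proof (intro nn_integral_mono)
      fix s :: real
      show "(\<integral>\<^sup>+\<omega>. ennreal (\<theta> * weight \<omega>) * (indicator {0<..<T} s * indicator {R..} (U (max 0 s) \<omega>)) \<partial>N0) \<le> indicator {0<..<T} s"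
        using one[of s] by (cases "s \<in> {0<..<T}") auto
    qed
    also have "\<dots> = ennreal T" using T by simp
    finally show ?thesis .
  qed
  \<comment> \<open>While \<open>U\<close> is below \<open>R\<close> the integrand
    \<open>exp (- U)\<close> exceeds \<open>exp (- R)\<close>, so the total time spent there is at
    most \<open>exp R * J \<omega>\<close>.\<close>
  have occ: "ennreal (T - exp R * J \<omega>) \<le> m T \<omega>" if T: "T > 0" and w: "\<omega> \<in> space N0" and fin: "Iexp \<omega> \<noteq> \<infinity>" for T \<omega>
  proof -
    note U_section_meas[OF w, measurable]
    have "ennreal T = (\<integral>\<^sup>+s. indicator {0<..<T} s \<partial>lborel)" using T by simp
    also have "\<dots> \<le> (\<integral>\<^sup>+s. indicator {0<..<T} s * indicator {R..} (U (max 0 s) \<omega>) + ennreal (exp R) * (indicator {0..} s * ennreal (exp (- U (max 0 s) \<omega>))) \<partial>lborel)"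
    proof (intro nn_integral_mono)
      fix s :: real
      show "(indicator {0<..<T} s :: ennreal) \<le> indicator {0<..<T} s * indicator {R..} (U (max 0 s) \<omega>) + ennreal (exp R) * (indicator {0..} s * ennreal (exp (- U (max 0 s) \<omega>)))"
      proof (cases "s \<in> {0<..<T} \<and> U (max 0 s) \<omega> < R")
        case True
        then have "ennreal 1 \<le> ennreal (exp R * exp (- U (max 0 s) \<omega>))"
          by (intro ennreal_leI) (auto simp flip: exp_add)
        then show ?thesis using True by (auto simp: ennreal_mult intro: add_increasing)
      next
        case False
        then show ?thesis by (auto simp: indicator_def not_less intro: add_increasing2)
      qed
    qed
    also have "\<dots> = m T \<omega> + ennreal (exp R) * Iexp \<omega>"
      unfolding m_def Iexp_eq by (subst nn_integral_add) (auto simp: nn_integral_cmult)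
    also have "ennreal (exp R) * Iexp \<omega> = ennreal (exp R * J \<omega>)"
      using fin by (simp add: J_def ennreal_mult less_top)
    finally have le: "ennreal T \<le> m T \<omega> + ennreal (exp R * J \<omega>)" .
    have "ennreal (T - exp R * J \<omega>) = ennreal T - ennreal (exp R * J \<omega>)"
      by (rule ennreal_minus[symmetric]) (simp add: J_def)
    also have "\<dots> \<le> m T \<omega>" using le by (simp add: ennreal_minus_le_iff add.commute)
    finally show ?thesis .
  qed
  \<comment> \<open>A lower bound, tending to 1, for the proportion of the time up to
    \<open>Suc n\<close> that is spent above \<open>R\<close>.\<close>
  define r where "r n \<omega> = max 0 (1 - exp R * J \<omega> / real (Suc n))" for n \<omega>
  have J0: "J \<omega> \<ge> 0" for \<omega> by (simp add: J_def)
  have Jm [measurable]: "J \<in> borel_measurable N0" unfolding J_def[abs_def] by measurable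
  have r01: "0 \<le> r n \<omega>" "r n \<omega> \<le> 1" for n \<omega> using J0[of \<omega>] by (auto simp: r_def)
  have step: "(\<integral>\<omega>. \<theta> * weight \<omega> * r n \<omega> \<partial>N0) \<le> 1" for n
  proof -
    have T: "real (Suc n) > 0" by simp
    have "ennreal (real (Suc n)) * (\<integral>\<^sup>+\<omega>. ennreal (\<theta> * weight \<omega> * r n \<omega>) \<partial>N0) = (\<integral>\<^sup>+\<omega>. ennreal (real (Suc n)) * ennreal (\<theta> * weight \<omega> * r n \<omega>) \<partial>N0)"
      unfolding r_def by (rule nn_integral_cmult[symmetric]) measurable
    also have "\<dots> \<le> (\<integral>\<^sup>+\<omega>. ennreal (\<theta> * weight \<omega>) * m (real (Suc n)) \<omega> \<partial>N0)"
    proof (intro nn_integral_mono)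
      fix \<omega> assume w: "\<omega> \<in> space N0"
      show "ennreal (real (Suc n)) * ennreal (\<theta> * weight \<omega> * r n \<omega>) \<le> ennreal (\<theta> * weight \<omega>) * m (real (Suc n)) \<omega>"
      proof (cases "Iexp \<omega> = \<infinity>")
        case True then show ?thesis by (simp add: weight_def)
      next
        case False
        have "real (Suc n) * (\<theta> * weight \<omega> * r n \<omega>) = \<theta> * weight \<omega> * (real (Suc n) * r n \<omega>)" by simp
        then have "ennreal (real (Suc n)) * ennreal (\<theta> * weight \<omega> * r n \<omega>) = ennreal (\<theta> * weight \<omega>) * ennreal (real (Suc n) * r n \<omega>)"
          using \<theta> weight_bounds[of \<omega>] r01[of n \<omega>] by (simp add: ennreal_mult[symmetric] del: of_nat_Suc)
        also have "ennreal (real (Suc n) * r n \<omega>) = ennreal (real (Suc n) - exp R * J \<omega>)"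
        proof -
          have "real (Suc n) * r n \<omega> = max 0 (real (Suc n) - exp R * J \<omega>)"
            unfolding r_def max_mult_distrib_left by (simp add: right_diff_distrib del: of_nat_Suc)
          then show ?thesis by (simp add: max_def ennreal_neg del: of_nat_Suc)
        qed
        also have "ennreal (\<theta> * weight \<omega>) * \<dots> \<le> ennreal (\<theta> * weight \<omega>) * m (real (Suc n)) \<omega>"
          by (intro mult_left_mono occ T w False) simp
        finally show ?thesis .
      qed
    qed
    also have "\<dots> \<le> ennreal (real (Suc n))" by (rule mT[OF T])
    finally have le: "ennreal (real (Suc n)) * (\<integral>\<^sup>+\<omega>. ennreal (\<theta> * weight \<omega> * r n \<omega>) \<partial>N0) \<le> ennreal (real (Suc n))" .
    have i: "integrable N0 (\<lambda>\<omega>. \<theta> * weight \<omega> * r n \<omega>)"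
    proof (rule integrable_const_bound[where B = \<theta>])
      show "AE \<omega> in N0. norm (\<theta> * weight \<omega> * r n \<omega>) \<le> \<theta>"
      proof (rule AE_I2)
        fix \<omega>
        have "\<theta> * weight \<omega> * r n \<omega> \<le> \<theta> * 1 * 1" using \<theta> weight_bounds[of \<omega>] r01[of n \<omega>] by (intro mult_mono) auto
        then show "norm (\<theta> * weight \<omega> * r n \<omega>) \<le> \<theta>" using \<theta> weight_bounds[of \<omega>] r01[of n \<omega>] by simp
      qed
      show "(\<lambda>\<omega>. \<theta> * weight \<omega> * r n \<omega>) \<in> borel_measurable N0" unfolding r_def by measurable
    qed
    have nn: "(\<integral>\<^sup>+\<omega>. ennreal (\<theta> * weight \<omega> * r n \<omega>) \<partial>N0) = ennreal (\<integral>\<omega>. \<theta> * weight \<omega> * r n \<omega> \<partial>N0)"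
      using \<theta> weight_bounds r01 by (intro nn_integral_eq_integral[OF i] AE_I2) auto
    have p: "(\<integral>\<omega>. \<theta> * weight \<omega> * r n \<omega> \<partial>N0) \<ge> 0"
      using \<theta> weight_bounds r01 by (intro Bochner_Integration.integral_nonneg) auto
    have "real (Suc n) * (\<integral>\<omega>. \<theta> * weight \<omega> * r n \<omega> \<partial>N0) \<le> real (Suc n)"
      using le p unfolding nn by (simp add: ennreal_mult[symmetric] del: of_nat_Suc)
    then show ?thesis using T by (simp add: mult_le_cancel_left1 del: of_nat_Suc)
  qed
  have "(\<lambda>n. \<integral>\<omega>. \<theta> * weight \<omega> * r n \<omega> \<partial>N0) \<longlonglongrightarrow> (\<integral>\<omega>. \<theta> * weight \<omega> \<partial>N0)"
  proof (rule integral_dominated_convergence[where w = "\<lambda>_. \<theta>"])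
    show "(\<lambda>\<omega>. \<theta> * weight \<omega>) \<in> borel_measurable N0" by measurable
    show "(\<lambda>\<omega>. \<theta> * weight \<omega> * r n \<omega>) \<in> borel_measurable N0" for n unfolding r_def by measurable
    show "integrable N0 (\<lambda>_. \<theta>)" by simp
    show "AE \<omega> in N0. (\<lambda>n. \<theta> * weight \<omega> * r n \<omega>) \<longlonglongrightarrow> \<theta> * weight \<omega>"
    proof (rule AE_I2)
      fix \<omega>
      have "(\<lambda>n. max 0 (1 - exp R * J \<omega> * (1 / real (Suc n)))) \<longlonglongrightarrow> max 0 (1 - exp R * J \<omega> * 0)"
        by (intro tendsto_intros LIMSEQ_inverse_real_of_nat[unfolded inverse_eq_divide])
      then have "(\<lambda>n. \<theta> * weight \<omega> * r n \<omega>) \<longlonglongrightarrow> \<theta> * weight \<omega> * 1"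
        unfolding r_def by (intro tendsto_intros) simp
      then show "(\<lambda>n. \<theta> * weight \<omega> * r n \<omega>) \<longlonglongrightarrow> \<theta> * weight \<omega>" by simp
    qed
    show "AE \<omega> in N0. norm (\<theta> * weight \<omega> * r n \<omega>) \<le> \<theta>" for n
    proof (rule AE_I2)
      fix \<omega>
      have "\<theta> * weight \<omega> * r n \<omega> \<le> \<theta> * 1 * 1" using \<theta> weight_bounds[of \<omega>] r01[of n \<omega>] by (intro mult_mono) auto
      then show "norm (\<theta> * weight \<omega> * r n \<omega>) \<le> \<theta>" using \<theta> weight_bounds[of \<omega>] r01[of n \<omega>] by simp
    qed
  qed
  then have "(\<integral>\<omega>. \<theta> * weight \<omega> \<partial>N0) \<le> 1" by (rule LIMSEQ_le_const2) (use step in blast)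
  then show ?thesis by (simp add: laplace_weight)
qed

end

section \<open>The exponential functional of the conditioned process\<close>

context levy
begin

lemma nn_integral_up_kernel:
  assumes W: "continuous_on {0..} W" and t: "t \<ge> 0" and [measurable]: "\<phi> \<in> borel_measurable borel"
  shows "(\<integral>\<^sup>+y. \<phi> y \<partial>up_kernel M V W t x)
    = (\<integral>\<^sup>+\<omega>. indicator (alive t x) \<omega> * (ennreal (W (x + V t \<omega>) / W x) * \<phi> (x + V t \<omega>)) \<partial>M)"
proof -
  note V_meas[OF t, measurable] alive_sets[OF t, measurable]
  have "continuous_on UNIV (\<lambda>y. W (max 0 y))"
    by (rule continuous_on_compose2[OF W]) (auto intro!: continuous_intros)
  then have Wm [measurable]: "(\<lambda>y. W (max 0 y)) \<in> borel_measurable borel" by (rule borel_measurable_continuous_onI)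
  define \<rho> where "\<rho> y = ennreal (W y / W x) * indicator {0<..} y" for y
  have "\<rho> = (\<lambda>y. ennreal (W (max 0 y) / W x) * indicator {0<..} y)"
    by (auto simp: \<rho>_def fun_eq_iff indicator_def)
  then have [measurable]: "\<rho> \<in> borel_measurable borel" by simp
  let ?R = "restrict_space M (alive t x)"
  have [measurable]: "(\<lambda>\<omega>. x + V t \<omega>) \<in> ?R \<rightarrow>\<^sub>M borel" by (rule measurable_restrict_space1) measurable
  have "up_kernel M V W t x = density (distr ?R borel (\<lambda>\<omega>. x + V t \<omega>)) \<rho>"
    unfolding up_kernel_def alive_def \<rho>_def[abs_def] by (rule refl)
  then have "(\<integral>\<^sup>+y. \<phi> y \<partial>up_kernel M V W t x) = (\<integral>\<^sup>+y. \<rho> y * \<phi> y \<partial>distr ?R borel (\<lambda>\<omega>. x + V t \<omega>))"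
    by (simp add: nn_integral_density)
  also have "\<dots> = (\<integral>\<^sup>+\<omega>. \<rho> (x + V t \<omega>) * \<phi> (x + V t \<omega>) \<partial>?R)"
    by (rule nn_integral_distr) auto
  also have "\<dots> = (\<integral>\<^sup>+\<omega>. \<rho> (x + V t \<omega>) * \<phi> (x + V t \<omega>) * indicator (alive t x) \<omega> \<partial>M)"
    by (rule nn_integral_restrict_space) measurable
  also have "\<dots> = (\<integral>\<^sup>+\<omega>. indicator (alive t x) \<omega> * (ennreal (W (x + V t \<omega>) / W x) * \<phi> (x + V t \<omega>)) \<partial>M)"
  proof (intro nn_integral_cong)
    fix \<omega>
    show "\<rho> (x + V t \<omega>) * \<phi> (x + V t \<omega>) * indicator (alive t x) \<omega>
      = indicator (alive t x) \<omega> * (ennreal (W (x + V t \<omega>) / W x) * \<phi> (x + V t \<omega>))"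
      using alive_pos[of \<omega> t x t] t by (cases "\<omega> \<in> alive t x") (auto simp: \<rho>_def)
  qed
  finally show ?thesis .
qed

text \<open>The Markov property at time 0 is applied to the sure event that the process is positive
  at time \<open>t\<close>: its conditional probability is 1 and also equals the mass of the kernel
  at \<open>X 0 = x\<close>.\<close>

lemma up_kernel_mass:
  assumes X: "conditioned_positive_from M V W x N X" and t: "t \<ge> 0"
  shows "emeasure (up_kernel M V W t x) {0<..} = 1"
proof -
  have U_markov: "markov_process N {0<..} (up_kernel M V W) X" and X0: "AE \<omega> in N. X 0 \<omega> = x"
    using X by (auto simp: conditioned_positive_from_def)
  interpret N: prob_space N using U_markov by (simp add: markov_process_def)
  have Xm: "X r \<in> N \<rightarrow>\<^sub>M restrict_space borel {0<..}" if "r \<ge> 0" for r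
    using U_markov that by (auto simp: markov_process_def)
  then have Xb: "X r \<in> borel_measurable N" if "r \<ge> 0" for r
    using that by (auto simp: measurable_restrict_space2_iff)
  have sub: "subalgebra N (natural_filtration N X 0)" by (rule subalgebra_natural_filtration) (rule Xb)
  interpret FS: finite_measure_subalgebra N "natural_filtration N X 0" by unfold_locales (rule sub)
  have sp: "X t -` {0<..} \<inter> space N = space N"
    using measurable_space[OF Xm[OF t]] by (auto simp: space_restrict_space)
  have "AE \<omega> in N. real_cond_exp N (natural_filtration N X 0) (indicator (space N)) \<omega> = measure (up_kernel M V W t (X 0 \<omega>)) {0<..}"
  proof -
    have "AE \<omega> in N. real_cond_exp N (natural_filtration N X 0) (indicator (X (0 + t) -` {0<..} \<inter> space N)) \<omega>
        = measure (up_kernel M V W t (X 0 \<omega>)) {0<..}"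
      using U_markov t by (auto simp: markov_process_def)
    then show ?thesis by (simp add: sp)
  qed
  moreover have "AE \<omega> in N. real_cond_exp N (natural_filtration N X 0) (indicator (space N)) \<omega> = (indicator (space N) \<omega> :: real)"
  proof (rule FS.real_cond_exp_F_meas)
    have "space N = space (natural_filtration N X 0)" using sub by (simp add: subalgebra_def)
    then show "(indicator (space N) :: _ \<Rightarrow> real) \<in> borel_measurable (natural_filtration N X 0)" by simp
  qed (simp add: N.emeasure_eq_measure)
  ultimately have "AE \<omega> in N. measure (up_kernel M V W t x) {0<..} = 1"
    using X0 AE_space by eventually_elim simp
  then have "measure (up_kernel M V W t x) {0<..} = 1" by simp
  \<comment> \<open>Infinite mass is excluded because \<open>measure\<close> would then return
    0.\<close>
  then show ?thesis by (cases "emeasure (up_kernel M V W t x) {0<..}") (auto simp: measure_def)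
qed

text \<open>If \<open>W x\<close> were 0, the density of the kernel would vanish, as division by
  zero gives 0, contradicting mass one. Multiplying the mass identity by \<open>W x > 0\<close> then
  yields the invariance.\<close>

lemma conditioned_positive_W:
  assumes W: "continuous_on {0..} W" "\<And>x. x \<ge> 0 \<Longrightarrow> W x \<ge> 0"
    and X: "conditioned_positive_from M V W x N X" and x: "x > 0"
  shows "W x > 0"
    and "t \<ge> 0 \<Longrightarrow> (\<integral>\<^sup>+\<omega>. indicator (alive t x) \<omega> * ennreal (W (x + V t \<omega>)) \<partial>M) = ennreal (W x)"
proof -
  have one: "(\<integral>\<^sup>+\<omega>. indicator (alive t x) \<omega> * ennreal (W (x + V t \<omega>) / W x) \<partial>M) = 1" if t: "t \<ge> 0" for t
  proof -
    have "(\<integral>\<^sup>+y. indicator {0<..} y \<partial>up_kernel M V W t x) = emeasure (up_kernel M V W t x) {0<..}"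
      by (rule nn_integral_indicator) (simp add: up_kernel_def)
    then have "1 = (\<integral>\<^sup>+\<omega>. indicator (alive t x) \<omega> * (ennreal (W (x + V t \<omega>) / W x) * indicator {0<..} (x + V t \<omega>)) \<partial>M)"
      using up_kernel_mass[OF X t] nn_integral_up_kernel[OF W(1) t, of "indicator {0<..}" x] by simp
    also have "\<dots> = (\<integral>\<^sup>+\<omega>. indicator (alive t x) \<omega> * ennreal (W (x + V t \<omega>) / W x) \<partial>M)"
    proof (intro nn_integral_cong)
      fix \<omega>
      show "indicator (alive t x) \<omega> * (ennreal (W (x + V t \<omega>) / W x) * indicator {0<..} (x + V t \<omega>))
        = indicator (alive t x) \<omega> * ennreal (W (x + V t \<omega>) / W x)"
        using alive_pos[of \<omega> t x t] t by (cases "\<omega> \<in> alive t x") auto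
    qed
    finally show ?thesis by simp
  qed
  show Wx: "W x > 0"
  proof (rule ccontr)
    assume "\<not> W x > 0"
    then have "W x = 0" using W(2)[of x] x by simp
    then show False using one[of 0] by simp
  qed
  show "(\<integral>\<^sup>+\<omega>. indicator (alive t x) \<omega> * ennreal (W (x + V t \<omega>)) \<partial>M) = ennreal (W x)" if t: "t \<ge> 0"
  proof -
    note V_meas[OF t, measurable] alive_sets[OF t, measurable]
    have "continuous_on UNIV (\<lambda>y. W (max 0 y))"
      by (rule continuous_on_compose2[OF W(1)]) (auto intro!: continuous_intros)
    then have Wm [measurable]: "(\<lambda>y. W (max 0 y)) \<in> borel_measurable borel" by (rule borel_measurable_continuous_onI)
    have "(\<integral>\<^sup>+\<omega>. indicator (alive t x) \<omega> * ennreal (W (x + V t \<omega>)) \<partial>M)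
      = (\<integral>\<^sup>+\<omega>. ennreal (W x) * (indicator (alive t x) \<omega> * ennreal (W (max 0 (x + V t \<omega>)) / W x)) \<partial>M)"
    proof (intro nn_integral_cong)
      fix \<omega>
      show "indicator (alive t x) \<omega> * ennreal (W (x + V t \<omega>)) = ennreal (W x) * (indicator (alive t x) \<omega> * ennreal (W (max 0 (x + V t \<omega>)) / W x))"
        using alive_pos[of \<omega> t x t] t Wx by (cases "\<omega> \<in> alive t x") (auto simp: ennreal_mult[symmetric] W(2))
    qed
    also have "\<dots> = ennreal (W x) * (\<integral>\<^sup>+\<omega>. indicator (alive t x) \<omega> * ennreal (W (max 0 (x + V t \<omega>)) / W x) \<partial>M)"
      by (rule nn_integral_cmult) measurable
    also have "(\<integral>\<^sup>+\<omega>. indicator (alive t x) \<omega> * ennreal (W (max 0 (x + V t \<omega>)) / W x) \<partial>M)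
      = (\<integral>\<^sup>+\<omega>. indicator (alive t x) \<omega> * ennreal (W (x + V t \<omega>) / W x) \<partial>M)"
    proof (intro nn_integral_cong)
      fix \<omega>
      show "indicator (alive t x) \<omega> * ennreal (W (max 0 (x + V t \<omega>)) / W x) = indicator (alive t x) \<omega> * ennreal (W (x + V t \<omega>) / W x)"
        using alive_pos[of \<omega> t x t] t by (cases "\<omega> \<in> alive t x") auto
    qed
    finally show ?thesis using one[OF t] by simp
  qed
qed

end

context omega_scale
begin

text \<open>At 0 the quotient \<open>g\<close> is \<open>0 / 0 = 0\<close>, whereas its limit from
  the right is 1; the value is corrected to make the function continuous on the closed
  half-line.\<close>

definition gg where "gg x = (if x \<le> 0 then 1 else g x)"

lemma gg_0: "gg 0 = 1"
  by (simp add: gg_def)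

lemma gg_bounds: "1 \<le> gg x" "gg x \<le> G"
  using g_bounds[of x] G_ge_1 by (auto simp: gg_def)

lemma gg_cont: "continuous_on {0..} gg"
  unfolding continuous_on_def
proof
  fix x :: real assume x: "x \<in> {0..}"
  show "(gg \<longlongrightarrow> gg x) (at x within {0..})"
  proof (cases "x = 0")
    case True
    have "(gg \<longlongrightarrow> 1) (at_right 0)"
      using g_at_0
    proof (rule Lim_transform_eventually)
      have "eventually (\<lambda>x::real. x > 0) (at_right 0)" by (rule eventually_at_right_less)
      then show "eventually (\<lambda>x. g x = gg x) (at_right 0)" by eventually_elim (simp add: gg_def)
    qed
    moreover have "at (0::real) within {0..} = at_right 0"
    proof -
      have "{0..} - {0} = {0::real<..}" by auto
      then show ?thesis by (simp add: at_within_def)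
    qed
    ultimately show ?thesis using True by (simp add: gg_def)
  next
    case False
    then have xp: "x > 0" using x by simp
    have "isCont gg x"
    proof (rule isCont_cong[THEN iffD2, OF _ g_isCont[OF xp]])
      show "eventually (\<lambda>y. gg y = g y) (nhds x)"
        using eventually_nhds_in_open[of "{0<..}" x] xp by (auto elim!: eventually_mono simp: gg_def)
    qed
    then show ?thesis unfolding isCont_def by (rule tendsto_within_subset) simp
  qed
qed

lemma gg_meas [measurable]: "gg \<in> borel_measurable borel"
proof -
  have "gg = (\<lambda>x. if x \<le> 0 then 1 else ww x / w x)" by (auto simp: gg_def g_def)
  then show ?thesis by simp
qed

text \<open>Divided by \<open>W x\<close>, Dynkin's formula for \<open>ww\<close> under killing
  becomes the generator estimate for \<open>gg\<close> under \<open>Q\<close>, which is the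
  remaining hypothesis of the Feynman-Kac argument.\<close>

lemma exp_functional_laplace_bounds:
  fixes N0 :: "'c measure"
  assumes fp: "feller_process N0 Q U" and start: "AE \<omega> in N0. U 0 \<omega> = 0"
    and kernel: "\<forall>t\<ge>0. \<forall>x>0. \<forall>A\<in>sets borel. A \<subseteq> {0<..} \<longrightarrow>
       emeasure (Q t x) A = emeasure (up_kernel M V W t x) A"
    and K: "K + 1 > \<kappa>"
  shows "exp_functional U \<in> borel_measurable N0"
    and "1 / G \<le> laplace_transform_at N0 (exp_functional U) lam"
    and "laplace_transform_at N0 (exp_functional U) lam \<le> C / S K"
proof -
  have Qup: "emeasure (Q t x) A = emeasure (up_kernel M V W t x) A"
    if "t \<ge> 0" "x > 0" "A \<in> sets borel" "A \<subseteq> {0<..}" for t x A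
    using kernel that by blast
  have N0: "prob_space N0" using fp by (simp add: feller_process_def markov_process_def)
  interpret fb: feller_bounded N0 Q U lam G gg
    using N0 fp start lam gg_bounds gg_cont
    by (intro feller_bounded.intro feller_bounded_axioms.intro) (auto simp: gg_0)
  show "exp_functional U \<in> borel_measurable N0" by (rule fb.Iexp_meas)
  \<comment> \<open>\<open>Q t x\<close> lives on the closed half-line but is prescribed only on
    subsets of the open one. As the kernel already has mass one there, \<open>Q t x\<close> gives no
    mass to 0.\<close>
  have Qnn: "(\<integral>\<^sup>+y. \<phi> y \<partial>Q t x) = (\<integral>\<^sup>+\<omega>. indicator (alive t x) \<omega> * (ennreal (W (x + V t \<omega>) / W x) * \<phi> (x + V t \<omega>)) \<partial>M)"
    if t: "t \<ge> 0" and x: "x > 0" and \<phi> [measurable]: "\<phi> \<in> borel_measurable borel" for t x \<phi>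
  proof -
    have x0: "x \<ge> 0" using x by simp
    interpret q: prob_space "Q t x" by (rule fb.Q_prob(1)[OF t x0])
    have sQ: "sets (Q t x) = sets halfline" by (rule fb.Q_prob(2)[OF t x0])
    have idm: "(\<lambda>y. y) \<in> Q t x \<rightarrow>\<^sub>M borel"
      unfolding measurable_cong_sets[OF sQ refl] by (rule measurable_restrict_space1) simp
    have mass: "emeasure (up_kernel M V W t x) {0<..} = 1"
    proof -
      have "(\<integral>\<^sup>+y. indicator {0<..} y \<partial>up_kernel M V W t x) = emeasure (up_kernel M V W t x) {0<..}"
        by (rule nn_integral_indicator) (simp add: up_kernel_def)
      also have "(\<integral>\<^sup>+y. indicator {0<..} y \<partial>up_kernel M V W t x)
        = (\<integral>\<^sup>+\<omega>. indicator (alive t x) \<omega> * (ennreal (W (x + V t \<omega>) / W x) * indicator {0<..} (x + V t \<omega>)) \<partial>M)"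
        by (rule nn_integral_up_kernel[OF W_cont t]) measurable
      also have "\<dots> = (\<integral>\<^sup>+\<omega>. indicator (alive t x) \<omega> * ennreal (W (x + V t \<omega>)) * ennreal (1 / W x) \<partial>M)"
      proof (intro nn_integral_cong)
        fix \<omega>
        show "indicator (alive t x) \<omega> * (ennreal (W (x + V t \<omega>) / W x) * indicator {0<..} (x + V t \<omega>))
          = indicator (alive t x) \<omega> * ennreal (W (x + V t \<omega>)) * ennreal (1 / W x)"
          using alive_pos[of \<omega> t x t] t W_pos[OF x]
          by (cases "\<omega> \<in> alive t x") (auto simp: ennreal_mult[symmetric] W_nonneg)
      qed
      also have "\<dots> = ennreal (W x) * ennreal (1 / W x)"
      proof -
        note V_meas[OF t, measurable] alive_sets[OF t, measurable]
        have "(\<lambda>\<omega>. indicator (alive t x) \<omega> * ennreal (w (x + V t \<omega>))) \<in> borel_measurable M" by measurable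
        moreover have "indicator (alive t x) \<omega> * ennreal (w (x + V t \<omega>)) = indicator (alive t x) \<omega> * ennreal (W (x + V t \<omega>))" for \<omega>
          using alive_pos[of \<omega> t x t] t by (cases "\<omega> \<in> alive t x") (auto simp: w_def)
        ultimately have "(\<lambda>\<omega>. indicator (alive t x) \<omega> * ennreal (W (x + V t \<omega>))) \<in> borel_measurable M" by simp
        then show ?thesis using W_inv[OF x t] by (simp add: nn_integral_multc)
      qed
      also have "\<dots> = 1" using W_pos[OF x] by (simp add: ennreal_mult[symmetric])
      finally show ?thesis by simp
    qed
    have dist: "distr (Q t x) borel (\<lambda>y. y) = up_kernel M V W t x"
    proof (rule measure_eqI)
      show "sets (distr (Q t x) borel (\<lambda>y. y)) = sets (up_kernel M V W t x)" by (simp add: up_kernel_def)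
      fix A assume "A \<in> sets (distr (Q t x) borel (\<lambda>y. y))"
      then have A: "A \<in> sets borel" by simp
      have p: "{0<..} \<in> sets (Q t x)" unfolding sQ by (auto simp: sets_restrict_space intro!: image_eqI[of _ _ "{0<..}"])
      have "emeasure (Q t x) {0<..} = 1" using Qup[OF t x, of "{0<..}"] mass by simp
      then have ae: "AE y in Q t x. y \<in> {0<..}" by (subst q.AE_in_set_eq_1[OF p]) (simp add: q.emeasure_eq_measure)
      have A1: "A \<inter> {0..} \<in> sets (Q t x)" "A \<inter> {0<..} \<in> sets (Q t x)"
        unfolding sQ using A by (auto simp: sets_restrict_space_iff)
      have "emeasure (distr (Q t x) borel (\<lambda>y. y)) A = emeasure (Q t x) (A \<inter> {0..})"
        using A fb.Q_prob(3)[OF t x0] by (subst emeasure_distr[OF idm]) auto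
      also have "\<dots> = emeasure (Q t x) (A \<inter> {0<..})"
        by (rule emeasure_eq_AE) (use ae A1 in auto)
      also have "\<dots> = emeasure (up_kernel M V W t x) (A \<inter> {0<..})" using A by (intro Qup t x) auto
      also have "\<dots> = emeasure (up_kernel M V W t x) A"
      proof -
        have up: "emeasure (up_kernel M V W t x) B = (\<integral>\<^sup>+y. indicator B y \<partial>up_kernel M V W t x)" if "B \<in> sets borel" for B
          using that by (simp add: up_kernel_def)
        have AA: "A \<inter> {0<..} \<in> sets borel" using A by simp
        show ?thesis unfolding up[OF A] up[OF AA]
          unfolding nn_integral_up_kernel[OF W_cont t borel_measurable_indicator[OF A]] nn_integral_up_kernel[OF W_cont t borel_measurable_indicator[OF AA]]
        proof (intro nn_integral_cong)
          fix \<omega>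
          show "indicator (alive t x) \<omega> * (ennreal (W (x + V t \<omega>) / W x) * indicator (A \<inter> {0<..}) (x + V t \<omega>))
            = indicator (alive t x) \<omega> * (ennreal (W (x + V t \<omega>) / W x) * indicator A (x + V t \<omega>))"
            using alive_pos[of \<omega> t x t] t by (cases "\<omega> \<in> alive t x") (auto simp: indicator_def)
        qed
      qed
      finally show "emeasure (distr (Q t x) borel (\<lambda>y. y)) A = emeasure (up_kernel M V W t x) A" .
    qed
    have "(\<integral>\<^sup>+y. \<phi> y \<partial>Q t x) = (\<integral>\<^sup>+y. \<phi> y \<partial>distr (Q t x) borel (\<lambda>y. y))"
      by (rule nn_integral_distr[OF idm, symmetric]) simp
    then show ?thesis unfolding dist using nn_integral_up_kernel[OF W_cont t \<phi>] by simp
  qed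
  \<comment> \<open>Undoes the h-transform. It is applied with \<phi> equal to \<open>gg\<close> and
    \<open>fb.om\<close>, for which the killed functions are \<open>ww\<close> and
    \<open>fr\<close>.\<close>
  have conv: "killed t (\<lambda>y. ennreal (a * \<phi> y * w y)) x = ennreal (a * W x * (\<integral>y. \<phi> y \<partial>Q t x))"
    if t: "t \<ge> 0" and x: "x > 0" and a: "a \<ge> 0" and [measurable]: "\<phi> \<in> borel_measurable borel" and pos: "\<And>y. y \<ge> 0 \<Longrightarrow> 0 \<le> \<phi> y"
      and i: "integrable (Q t x) \<phi>" for t x a and \<phi> :: "real \<Rightarrow> real"
  proof -
    note V_meas[OF t, measurable] alive_sets[OF t, measurable]
    have x0: "x \<ge> 0" using x by simp
    have mult3: "ennreal (p * (q * r)) = ennreal p * (ennreal q * ennreal r)" if "p \<ge> 0" "q \<ge> 0" "r \<ge> 0" for p q r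
      using that by (simp add: ennreal_mult)
    have "ennreal (a * W x * (\<integral>y. \<phi> y \<partial>Q t x)) = ennreal (a * W x) * ennreal (\<integral>y. \<phi> y \<partial>Q t x)"
      using a W_pos[OF x] by (intro ennreal_mult') simp
    also have "ennreal (\<integral>y. \<phi> y \<partial>Q t x) = (\<integral>\<^sup>+y. ennreal (\<phi> y) \<partial>Q t x)"
      by (rule nn_integral_eq_integral[OF i, symmetric], rule AE_I2) (use pos fb.Q_prob(3)[OF t x0] in auto)
    also have "\<dots> = (\<integral>\<^sup>+\<omega>. indicator (alive t x) \<omega> * (ennreal (W (x + V t \<omega>) / W x) * ennreal (\<phi> (x + V t \<omega>))) \<partial>M)"
      by (rule Qnn[OF t x]) measurable
    also have "\<dots> = (\<integral>\<^sup>+\<omega>. indicator (alive t x) \<omega> * (ennreal (w (x + V t \<omega>) / W x) * ennreal (\<phi> (x + V t \<omega>))) \<partial>M)"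
    proof (intro nn_integral_cong)
      fix \<omega>
      show "indicator (alive t x) \<omega> * (ennreal (W (x + V t \<omega>) / W x) * ennreal (\<phi> (x + V t \<omega>)))
        = indicator (alive t x) \<omega> * (ennreal (w (x + V t \<omega>) / W x) * ennreal (\<phi> (x + V t \<omega>)))"
        using alive_pos[of \<omega> t x t] t by (cases "\<omega> \<in> alive t x") (auto simp: w_def)
    qed
    also have "ennreal (a * W x) * \<dots> = (\<integral>\<^sup>+\<omega>. ennreal (a * W x) * (indicator (alive t x) \<omega> * (ennreal (w (x + V t \<omega>) / W x) * ennreal (\<phi> (x + V t \<omega>)))) \<partial>M)"
      by (rule nn_integral_cmult[symmetric]) measurable
    also have "\<dots> = killed t (\<lambda>y. ennreal (a * \<phi> y * w y)) x"
      unfolding killed_def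
    proof (intro nn_integral_cong)
      fix \<omega>
      show "ennreal (a * W x) * (indicator (alive t x) \<omega> * (ennreal (w (x + V t \<omega>) / W x) * ennreal (\<phi> (x + V t \<omega>))))
        = indicator (alive t x) \<omega> * ennreal (a * \<phi> (x + V t \<omega>) * w (x + V t \<omega>))"
      proof (cases "\<omega> \<in> alive t x")
        case True
        then have y: "x + V t \<omega> > 0" using alive_pos[of \<omega> t x t] t by auto
        have "ennreal (a * W x) * (ennreal (w (x + V t \<omega>) / W x) * ennreal (\<phi> (x + V t \<omega>)))
          = ennreal (a * W x * (w (x + V t \<omega>) / W x * \<phi> (x + V t \<omega>)))"
          using a W_pos[OF x] w_nonneg[of "x + V t \<omega>"] pos[of "x + V t \<omega>"] y
          by (intro mult3[symmetric]) auto
        also have "a * W x * (w (x + V t \<omega>) / W x * \<phi> (x + V t \<omega>)) = a * \<phi> (x + V t \<omega>) * w (x + V t \<omega>)"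
          using W_pos[OF x] by simp
        finally show ?thesis using True by simp
      qed simp
    qed
    finally show ?thesis by simp
  qed
  have om_meas [measurable]: "fb.om \<in> borel_measurable borel" unfolding fb.om_def[abs_def] by measurable
  \<comment> \<open>By Dynkin's formula the increment of \<open>gg\<close> under \<open>Q h\<close>
    is \<open>lam\<close> times the time integral of \<open>Q s\<close> applied to
    \<open>fb.om\<close>, and this integrand stays within \<open>d\<close> of
    \<open>fb.om x\<close>, uniformly in \<open>x\<close>, for short times.\<close>
  have gen: "\<exists>h0>0. \<forall>h. 0 < h \<and> h < h0 \<longrightarrow> (\<forall>x>0. \<bar>(\<integral>y. gg y \<partial>Q h x) - gg x - lam * h * fb.om x\<bar> \<le> \<epsilon> * h)"
    if e: "\<epsilon> > 0" for \<epsilon>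
  proof -
    define d where "d = \<epsilon> / lam"
    have d: "d > 0" using e lam by (simp add: d_def)
    obtain h0 where h0: "h0 > 0" "\<And>h x. 0 < h \<Longrightarrow> h < h0 \<Longrightarrow> x \<ge> 0 \<Longrightarrow> \<bar>(\<integral>y. fb.om y \<partial>Q h x) - fb.om x\<bar> < d"
      using fb.om_uniform[OF d] by blast
    have "\<bar>(\<integral>y. gg y \<partial>Q h x) - gg x - lam * h * fb.om x\<bar> \<le> \<epsilon> * h" if h: "0 < h" "h < h0" and x: "x > 0" for h x
    proof -
      have x0: "x \<ge> 0" and hh: "h \<ge> 0" using x h by auto
      define A where "A = (\<integral>y. gg y \<partial>Q h x)"
      define B where "B s = (\<integral>y. fb.om y \<partial>Q s x)" for s
      have wx: "w x = W x" "W x > 0" using x W_pos by (auto simp: w_def)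
      have gw: "1 * gg y * w y = ww y" for y
        using w_pos[of y] by (auto simp: gg_def g_def w_zero ww_neg)
      have ow: "lam * fb.om y * w y = fr y" for y
        using gw[of y] by (simp add: fb.om_def fr_def)
      have KA: "killed h wwe x = ennreal (W x * A)"
        using conv[OF hh x, of 1 gg] gg_bounds fb.gg_integrable[OF hh x0]
        unfolding gw A_def by (simp add: order_trans[OF zero_le_one])
      have KB: "killed s f x = ennreal (lam * W x * B s)" if "s \<ge> 0" for s
        using conv[OF that x, of lam fb.om] lam fb.om_bounds fb.om_integrable[OF that x0]
        unfolding ow B_def f_fr[abs_def] by simp
      have id: "ennreal (W x * A) = wwe x + (\<integral>\<^sup>+s. indicator {0..<h} s * ennreal (lam * W x * B s) \<partial>lborel)"
      proof -
        have "(\<integral>\<^sup>+s. indicator {0..<h} s * killed s f x \<partial>lborel) = (\<integral>\<^sup>+s. indicator {0..<h} s * ennreal (lam * W x * B s) \<partial>lborel)"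
          by (intro nn_integral_cong) (auto simp: indicator_def KB)
        then show ?thesis using killed_identity[OF h(1) x] KA by simp
      qed
      have Bs: "fb.om x - d \<le> B s" "B s \<le> fb.om x + d" if "0 < s" "s < h" for s
        using h0(2)[of s x] that h x0 unfolding B_def by (simp_all add: abs_less_iff)
      have const: "(\<integral>\<^sup>+s. indicator {0..<h} s * ennreal r \<partial>lborel) = ennreal (h * r)" for r
        using h by (subst nn_integral_multc) (auto simp: ennreal_mult')
      have up: "(\<integral>\<^sup>+s. indicator {0..<h} s * ennreal (lam * W x * B s) \<partial>lborel) \<le> ennreal (h * (lam * W x * (fb.om x + d)))"
        unfolding const[symmetric]
      proof (rule nn_integral_mono_AE)
        \<comment> \<open>The uniform estimate concerns positive times; time 0 is discarded as a
          null set.\<close>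
        show "AE s in lborel. indicator {0..<h} s * ennreal (lam * W x * B s) \<le> indicator {0..<h} s * ennreal (lam * W x * (fb.om x + d))"
          using AE_lborel_singleton[of 0]
        proof eventually_elim
          case (elim s)
          show ?case
          proof (cases "s \<in> {0..<h}")
            case True
            then have "B s \<le> fb.om x + d" using Bs(2)[of s] elim by auto
            then show ?thesis using True lam wx by (auto intro!: ennreal_leI mult_left_mono)
          qed simp
        qed
      qed
      have low: "ennreal (h * (lam * W x * (fb.om x - d))) \<le> (\<integral>\<^sup>+s. indicator {0..<h} s * ennreal (lam * W x * B s) \<partial>lborel)"
        unfolding const[symmetric]
      proof (rule nn_integral_mono_AE)
        show "AE s in lborel. indicator {0..<h} s * ennreal (lam * W x * (fb.om x - d)) \<le> indicator {0..<h} s * ennreal (lam * W x * B s)"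
          using AE_lborel_singleton[of 0]
        proof eventually_elim
          case (elim s)
          show ?case
          proof (cases "s \<in> {0..<h}")
            case True
            then have "fb.om x - d \<le> B s" using Bs(1)[of s] elim by auto
            then show ?thesis using True lam wx by (auto intro!: ennreal_leI mult_left_mono)
          qed simp
        qed
      qed
      have A0: "A \<ge> 0" unfolding A_def using gg_bounds(1) by (intro Bochner_Integration.integral_nonneg) (auto intro: order_trans[OF zero_le_one])
      have ox: "fb.om x + d \<ge> 0" using fb.om_bounds(1)[OF x0] d by simp
      have gx: "ww x = W x * gg x" using gw[of x] wx by (simp add: mult.commute)
      have "ennreal (W x * A) \<le> ennreal (ww x) + ennreal (h * (lam * W x * (fb.om x + d)))"
        unfolding id by (intro add_left_mono up)
      also have "\<dots> = ennreal (ww x + h * (lam * W x * (fb.om x + d)))"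
        using ww_nonneg lam wx hh ox by (simp add: ennreal_plus)
      finally have "W x * A \<le> ww x + h * (lam * W x * (fb.om x + d))"
        using ww_nonneg[of x] lam wx hh ox by (subst (asm) ennreal_le_iff) auto
      also have "\<dots> = W x * (gg x + h * lam * (fb.om x + d))" by (simp add: gx algebra_simps)
      finally have 1: "A \<le> gg x + h * lam * (fb.om x + d)" using wx by simp
      have 2: "gg x + h * lam * (fb.om x - d) \<le> A"
      \<comment> \<open>For a negative difference \<open>ennreal\<close> would truncate the lower
        bound to 0; in that case positivity of the integral alone suffices.\<close>
      proof (cases "fb.om x - d \<ge> 0")
        case True
        have "ennreal (ww x + h * (lam * W x * (fb.om x - d))) = ennreal (ww x) + ennreal (h * (lam * W x * (fb.om x - d)))"
          using ww_nonneg lam wx hh True by (simp add: ennreal_plus)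
        also have "\<dots> \<le> ennreal (W x * A)" unfolding id by (intro add_left_mono low)
        finally have "ww x + h * (lam * W x * (fb.om x - d)) \<le> W x * A" using A0 wx by simp
        then have "W x * (gg x + h * lam * (fb.om x - d)) \<le> W x * A" by (simp add: gx algebra_simps)
        then show ?thesis using wx by simp
      next
        case False
        have "ennreal (ww x) \<le> ennreal (W x * A)" unfolding id by simp
        then have "W x * gg x \<le> W x * A" using A0 wx by (simp add: gx)
        then have "gg x \<le> A" using wx by simp
        moreover have "h * lam * (fb.om x - d) \<le> 0" using False lam hh by (intro mult_nonneg_nonpos) auto
        ultimately show ?thesis by linarith
      qed
      have e': "\<epsilon> * h = d * (h * lam)" using lam by (simp add: d_def)
      show ?thesis using 1 2 unfolding A_def[symmetric] e' by (simp add: algebra_simps abs_le_iff)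
    qed
    then show ?thesis using h0(1) by blast
  qed
  interpret fk: feller_fk N0 Q U lam G gg
    by (intro feller_fk.intro feller_fk_axioms.intro fb.feller_bounded_axioms gen)
  show "1 / G \<le> laplace_transform_at N0 (exp_functional U) lam" by (rule fk.laplace_lower)
  define L where "L = laplace_transform_at N0 (exp_functional U) lam"
  have K0: "K \<ge> 0" using growth_const by simp
  have S1: "S K \<ge> 1" by (rule S_ge_1[OF K0 K])
  have step: "\<theta> * L \<le> 1" if \<theta>: "0 < \<theta>" "\<theta> < 1 + (S K - 1) / C" for \<theta>
  proof -
    obtain R where R: "\<And>x. x \<ge> R \<Longrightarrow> g x \<ge> \<theta>"
      using g_eventually_ge[OF K \<theta>(2)] by (auto simp: eventually_at_top_linorder)
    show ?thesis unfolding L_def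
    proof (rule fk.laplace_upper[OF \<theta>(1), of "max R 1"])
      show "\<theta> \<le> gg y" if "max R 1 \<le> y" "0 \<le> y" for y using that R[of y] by (auto simp: gg_def)
    qed
  qed
  \<comment> \<open>For \<open>C > 1\<close> the value \<open>S K / C\<close> is an admissible
    \<theta>. For \<open>C = 1\<close> it equals the excluded bound \<open>1 + (S K - 1) / C\<close>
    and is approached from below.\<close>
  have "S K / C * L \<le> 1"
  proof (cases "C = 1")
    case False
    have "1 / C < 1" using growth_const False by simp
    then have "S K / C < 1 + (S K - 1) / C" by (simp add: diff_divide_distrib)
    then show ?thesis using S1 growth_const by (intro step) auto
  next
    case True
    have "(\<lambda>n. (S K * (1 - 1 / real (Suc (Suc n)))) * L) \<longlonglongrightarrow> S K * (1 - 0) * L"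
      by (intro tendsto_intros LIMSEQ_Suc[OF LIMSEQ_inverse_real_of_nat[unfolded inverse_eq_divide]])
    moreover have "\<exists>N. \<forall>n\<ge>N. (S K * (1 - 1 / real (Suc (Suc n)))) * L \<le> 1"
    proof (intro exI allI impI step)
      fix n :: nat
      have "1 / real (Suc (Suc n)) < 1" by simp
      then show "0 < S K * (1 - 1 / real (Suc (Suc n)))" using S1 by (intro mult_pos_pos) auto
      have "S K * (1 / real (Suc (Suc n))) > 0" using S1 by (intro mult_pos_pos) auto
      then show "S K * (1 - 1 / real (Suc (Suc n))) < 1 + (S K - 1) / C" using True by (simp add: right_diff_distrib)
    qed
    ultimately have "S K * (1 - 0) * L \<le> 1" by (rule LIMSEQ_le_const2)
    then show ?thesis using True by simp
  qed
  then show "laplace_transform_at N0 (exp_functional U) lam \<le> C / S K"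
    using S1 growth_const unfolding L_def by (simp add: field_simps)
qed

end

theorem corollary1p6:
  fixes M :: "'a measure" and V :: "real \<Rightarrow> 'a \<Rightarrow> real"
    and \<Psi> W :: "real \<Rightarrow> real"
    and N :: "real \<Rightarrow> 'b measure" and X :: "real \<Rightarrow> real \<Rightarrow> 'b \<Rightarrow> real"
    and N0 :: "'c measure" and U :: "real \<Rightarrow> 'c \<Rightarrow> real"
    and C \<alpha> :: real
  assumes "spectrally_negative_levy M V"
    and "\<not> subordinator M (\<lambda>t \<omega>. - V t \<omega>)"
    and "laplace_exponent M V \<Psi>"
    and "scale_function M V \<Psi> W"
    and "conditioned_positive M V W N X N0 U"
    and "C > 0" and "1 < \<alpha>" and "\<alpha> \<le> 2"
    and "\<Psi> \<sim>[at_top] (\<lambda>l. C * l powr \<alpha>)"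
  shows "(\<lambda>x. ln (measure N0 {\<omega> \<in> space N0. exp_functional U \<omega> \<le> ennreal x}))
           \<sim>[at_right 0] (\<lambda>x. - ((\<alpha> - 1) / (C * x) powr (1 / (\<alpha> - 1))))"
proof -
  note C = assms(6) and al = assms(7)
  have levy: "levy_process M V" using assms(1) by (simp add: spectrally_negative_levy_def)
  interpret levy M V \<Psi>
    by (intro levy.intro levy_axioms.intro levy assms(3)) (use levy in \<open>simp add: levy_process_def\<close>)
  have ratio: "((\<lambda>l. \<Psi> l / (C * l powr \<alpha>)) \<longlongrightarrow> 1) at_top"
  proof -
    have "((\<lambda>l. if \<Psi> l = 0 \<and> C * l powr \<alpha> = 0 then 1 else \<Psi> l / (C * l powr \<alpha>)) \<longlongrightarrow> 1) at_top"
      using assms(9) by (simp add: asymp_equiv_def)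
    moreover have "eventually (\<lambda>l. (if \<Psi> l = 0 \<and> C * l powr \<alpha> = 0 then 1 else \<Psi> l / (C * l powr \<alpha>)) = \<Psi> l / (C * l powr \<alpha>)) at_top"
      using eventually_gt_at_top[of 0] by eventually_elim (use C in auto)
    ultimately show ?thesis by (rule Lim_transform_eventually)
  qed
  have Psi_pos: "eventually (\<lambda>l. \<Psi> l > 0) at_top"
    using order_tendstoD(1)[OF ratio zero_less_one] eventually_gt_at_top[of 0]
  proof eventually_elim
    case (elim l)
    have "C * l powr \<alpha> > 0" using C elim by simp
    then show ?case using elim by (simp add: zero_less_divide_iff)
  qed
  have sup: "((\<lambda>l. l / \<Psi> l) \<longlongrightarrow> 0) at_top"
  proof -
    have "((\<lambda>l. (l powr (1 - \<alpha>) / C) / (\<Psi> l / (C * l powr \<alpha>))) \<longlongrightarrow> (0 / C) / 1) at_top"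
      using al C by (intro tendsto_divide ratio tendsto_const tendsto_neg_powr filterlim_ident) auto
    moreover have "eventually (\<lambda>l. (l powr (1 - \<alpha>) / C) / (\<Psi> l / (C * l powr \<alpha>)) = l / \<Psi> l) at_top"
      using eventually_gt_at_top[of 0]
    proof eventually_elim
      case (elim l)
      have "l powr (1 - \<alpha>) * l powr \<alpha> = l" using elim by (simp add: powr_add[symmetric])
      then show ?case using C elim by (simp add: field_simps)
    qed
    ultimately show ?thesis by (simp add: Lim_transform_eventually)
  qed
  have W: "continuous_on {0..} W" "\<And>x. x \<ge> 0 \<Longrightarrow> W x \<ge> 0"
    using assms(4) by (auto simp: scale_function_def)
  have Xc: "conditioned_positive_from M V W x (N x) (X x)" if "x > 0" for x
    using assms(5) that by (auto simp: conditioned_positive_def)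
  interpret scale_levy M V \<Psi> W
    by unfold_locales (use assms(4) conditioned_positive_W[OF W Xc] Psi_pos sup in auto)
  obtain k c where kc: "k \<ge> 0" "k + 1 > \<kappa>" "c \<ge> 1" "\<And>x y. y \<ge> 0 \<Longrightarrow> w (x - y) \<le> c * exp (- k * y) * w x"
    using w_ratio_bound by blast
  obtain x0 C1 K1 where gr: "x0 > 0" "C1 \<ge> 1" "K1 \<ge> 0" "\<And>x y. x \<ge> x0 \<Longrightarrow> y \<ge> 0 \<Longrightarrow> W (x + y) \<le> C1 * exp (K1 * y) * W x"
    using W_growth_upper by blast
  \<comment> \<open>Enlarging the rate only weakens the growth bound, and taking it at least
    \<open>k\<close> ensures \<open>K + 1 > \<kappa>\<close>, so that the series at \<open>K\<close>
    has positive factors.\<close>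
  define K where "K = max K1 k"
  have K: "K \<ge> 0" "K + 1 > \<kappa>" using kc by (auto simp: K_def)
  have gr': "W (x + y) \<le> C1 * exp (K * y) * W x" if "x \<ge> x0" "y \<ge> 0" for x y
  proof -
    have "exp (K1 * y) \<le> exp (K * y)" using that by (simp add: K_def mult_right_mono)
    then have "C1 * exp (K1 * y) * W x \<le> C1 * exp (K * y) * W x"
      using gr that W(2)[of x] by (intro mult_right_mono mult_left_mono) auto
    then show ?thesis using gr(4)[OF that] by linarith
  qed
  define a where "a l j = \<Psi> (l + 1 + real j)" for l and j :: nat
  have a_pos: "a l j > 0" if "l + 1 > \<kappa>" for l j
    unfolding a_def using that by (intro Psi_pos) auto
  \<comment> \<open>The shift by \<open>l\<close> changes the argument \<open>j + 1\<close> by a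
    factor tending to 1, so it leaves no trace in the limit. This is why the rates \<open>k\<close>
    and \<open>K\<close> give the same asymptotics.\<close>
  have a_lim: "(\<lambda>j. a l j / real (Suc j) powr \<alpha>) \<longlonglongrightarrow> C" if "l \<ge> 0" for l
  proof -
    have top: "filterlim (\<lambda>j. l + 1 + real j) at_top sequentially"
      by (rule filterlim_tendsto_add_at_top[OF tendsto_const filterlim_real_sequentially])
    have "(\<lambda>j. l * (1 / real (Suc j)) + 1) \<longlonglongrightarrow> l * 0 + 1"
      by (intro tendsto_intros LIMSEQ_inverse_real_of_nat[unfolded inverse_eq_divide])
    moreover have "l * (1 / real (Suc j)) + 1 = (l + 1 + real j) / real (Suc j)" for j
      by (simp add: field_simps)
    ultimately have "(\<lambda>j. (l + 1 + real j) / real (Suc j)) \<longlonglongrightarrow> 1" by simp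
    then have "(\<lambda>j. \<Psi> (l + 1 + real j) / (C * (l + 1 + real j) powr \<alpha>) * (C * ((l + 1 + real j) / real (Suc j)) powr \<alpha>)) \<longlonglongrightarrow> 1 * (C * 1 powr \<alpha>)"
      by (intro tendsto_intros filterlim_compose[OF ratio top]) auto
    moreover have "\<Psi> (l + 1 + real j) / (C * (l + 1 + real j) powr \<alpha>) * (C * ((l + 1 + real j) / real (Suc j)) powr \<alpha>) = a l j / real (Suc j) powr \<alpha>" for j
      using that C by (subst powr_divide) (auto simp: a_def field_simps)
    ultimately show ?thesis by simp
  qed
  have summ: "summable (\<lambda>n. lam ^ n / (\<Prod>j<n. \<Psi> (l + 1 + real j)))" if "lam > 0" "l \<ge> 0" "l + 1 > \<kappa>" for lam l
    using summable_fseries[OF a_pos[OF that(3)] C less_imp_le[OF al] a_lim[OF that(2)] that(1)] by (simp add: a_def)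
  obtain Q where Q: "feller_process N0 Q U" "AE \<omega> in N0. U 0 \<omega> = 0"
    "\<forall>t\<ge>0. \<forall>x>0. \<forall>A\<in>sets borel. A \<subseteq> {0<..} \<longrightarrow> emeasure (Q t x) A = emeasure (up_kernel M V W t x) A"
    using assms(5) unfolding conditioned_positive_def by blast
  let ?I = "exp_functional U"
  \<comment> \<open>The \<omega>-scale function is built anew for each \<open>lam\<close>, but
    \<open>k\<close>, \<open>c\<close>, \<open>K\<close> and \<open>C1\<close> are the same for all
    of them; hence \<open>c\<close> and \<open>C1\<close> disappear on the logarithmic
    scale.\<close>
  have bounds: "1 / (c * fseries (a k) lam) \<le> laplace_transform_at N0 ?I lam" "laplace_transform_at N0 ?I lam \<le> C1 / fseries (a K) lam"
    "fseries (a k) lam \<ge> 1" "fseries (a K) lam \<ge> 1" "?I \<in> borel_measurable N0"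
    if lam: "lam > 0" for lam
  proof -
    interpret os: omega_scale M V \<Psi> W lam k c x0 C1 K
      by unfold_locales (use lam kc gr K gr' summ in auto)
    have S: "os.S l = fseries (a l) lam" for l by (simp add: os.S_def a_def[abs_def])
    show "1 / (c * fseries (a k) lam) \<le> laplace_transform_at N0 ?I lam" "laplace_transform_at N0 ?I lam \<le> C1 / fseries (a K) lam"
      using os.exp_functional_laplace_bounds(2,3)[OF Q K(2)] unfolding os.G_def S by this+
    show "fseries (a k) lam \<ge> 1" "fseries (a K) lam \<ge> 1"
      using os.S_ge_1[of k] os.S_ge_1[of K] kc K by (simp_all add: S)
    show "?I \<in> borel_measurable N0" by (rule os.exp_functional_laplace_bounds(1)[OF Q K(2)])
  qed
  have tz: "filterlim (\<lambda>x. (x / C) powr (1 / \<alpha>)) at_top at_top"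
    using powr_dilate_at_top[of C \<alpha>] C al by simp
  have N0: "prob_space N0" using Q(1) by (simp add: feller_process_def markov_process_def)
  have Im: "?I \<in> borel_measurable N0" using bounds(5)[OF zero_less_one] .
  interpret sb: small_ball N0 ?I C \<alpha>
  proof (intro small_ball.intro small_ball_axioms.intro N0 Im C al)
    fix \<epsilon> :: real assume e: "\<epsilon> > 0"
    have e2: "\<epsilon> / 2 > 0" using e by simp
    show "eventually (\<lambda>l. laplace_transform_at N0 ?I l \<le> exp (- (\<alpha> * (1 - \<epsilon>) * (l / C) powr (1 / \<alpha>)))) at_top"
      using fseries_lower[OF a_pos[OF K(2)] C less_imp_le[OF al] a_lim[OF K(1)] e2]
        eventually_gt_at_top[of 0] filterlim_at_top[THEN iffD1, rule_format, OF tz, of "ln C1 / (\<alpha> * (\<epsilon> / 2))"]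
    proof eventually_elim
      case (elim l)
      define y where "y = (l / C) powr (1 / \<alpha>)"
      have "laplace_transform_at N0 ?I l \<le> C1 / fseries (a K) l" using elim by (intro bounds) auto
      also have "\<dots> \<le> C1 / exp (\<alpha> * (1 - \<epsilon> / 2) * y)"
        using elim(1) gr bounds(4)[OF elim(2)] by (intro divide_left_mono) (auto simp: y_def intro!: mult_pos_pos)
      also have "\<dots> = exp (ln C1 - \<alpha> * (1 - \<epsilon> / 2) * y)" using gr by (simp add: exp_diff)
      also have "\<dots> \<le> exp (- (\<alpha> * (1 - \<epsilon>) * y))"
      proof -
        have "ln C1 \<le> \<alpha> * (\<epsilon> / 2) * y" using elim(3) al e by (simp add: y_def field_simps)
        then show ?thesis by (simp add: algebra_simps)
      qed
      finally show ?case by (simp add: y_def)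
    qed
    show "eventually (\<lambda>l. laplace_transform_at N0 ?I l \<ge> exp (- (\<alpha> * (1 + \<epsilon>) * (l / C) powr (1 / \<alpha>)))) at_top"
      using fseries_upper[OF a_pos[OF kc(2)] C less_imp_le[OF al] a_lim[OF kc(1)] e2]
        eventually_gt_at_top[of 0] filterlim_at_top[THEN iffD1, rule_format, OF tz, of "ln c / (\<alpha> * (\<epsilon> / 2))"]
    proof eventually_elim
      case (elim l)
      define y where "y = (l / C) powr (1 / \<alpha>)"
      have ex: "exp (- ln c - b) = 1 / (c * exp b)" for b
        using kc(3) by (simp add: exp_diff exp_minus divide_inverse)
      have f1: "fseries (a k) l \<ge> 1" using elim by (intro bounds) auto
      have "exp (- (\<alpha> * (1 + \<epsilon>) * y)) \<le> exp (- ln c - \<alpha> * (1 + \<epsilon> / 2) * y)"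
      proof -
        have "ln c \<le> \<alpha> * (\<epsilon> / 2) * y" using elim(3) al e by (simp add: y_def field_simps)
        then show ?thesis by (simp add: algebra_simps)
      qed
      also have "\<dots> = 1 / (c * exp (\<alpha> * (1 + \<epsilon> / 2) * y))"
        by (rule ex)
      also have "\<dots> \<le> 1 / (c * fseries (a k) l)"
        using elim(1) f1 kc by (intro divide_left_mono mult_left_mono) (auto simp: y_def)
      also have "\<dots> \<le> laplace_transform_at N0 ?I l" using elim by (intro bounds) auto
      finally show ?case by (simp add: y_def)
    qed
  qed
  show ?thesis by (rule sb.log_small_ball)
qed

end
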